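(* Let $\mathcal A$ be an abelian symmetric monoidal category with infinite direct sums and $\alpha$ a non-zero rational number. The functor $U:\mathrm{Ch}_*(gr\mathcal A)^{\alpha\text{-pure}}\to\mathrm{Ch}_*(\mathcal A)$ defined by forgetting the degree is formal as a lax symmetric monoidal functor.
   Context: $(\mathcal A,\otimes,\mathbf 1)$ is an abelian symmetric monoidal category with infinite direct sums. $gr\mathcal A$ is the category of graded objects $A=(A^p)_p$ of $\mathcal A$, with the symmetric monoidal structure $(A\otimes B)^n=\bigoplus_pA^p\otimes B^{n-p}$ and unit $\mathbf 1$ concentrated in degree $0$. The functor $U:gr\mathcal A\to\mathcal A$, $A\mapsto\bigoplus_pA^p$, obtained by forgetting the degree is strong symmetric monoidal, and induces $U:\mathrm{Ch}_*(gr\mathcal A)\to\mathrm{Ch}_*(\mathcal A)$ on chain complexes (homologically graded, unbounded), which carry the induced symmetric monoidal structures. $\mathrm{Ch}_*(gr\mathcal A)^{\alpha\text{-pure}}$ is the full subcategory of $\mathrm{Ch}_*(gr\mathcal A)$ given by those graded complexes $A=\bigoplus A_n^p$ ($n$ the homological degree, $p$ the extra degree) with $\alpha$-pure homology: $H_n(A)^p=0$ for all $p\ne\alpha n$. Formality: let $\mathcal C$ be a symmetric monoidal category. A lax symmetric monoidal functor $F:\mathcal C\to\mathrm{Ch}_*(\mathcal A)$ is a formal lax symmetric monoidal functor if $F$ and $H\circ F$ are weakly equivalent in the category of lax symmetric monoidal functors, that is, if there is a string of natural transformations of lax symmetric monoidal functors $F\xleftarrow{\Phi_1}F_1\to\cdots\leftarrow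 F_n\xrightarrow{\Phi_n}H\circ F$ such that for every object $X$ of $\mathcal C$ the morphisms $\Phi_i(X)$ are quasi-isomorphisms. Here $H:\mathrm{Ch}_*(\mathcal A)\to\prod_{n\in\mathbb Z}\mathcal A$ is homology, lax symmetric monoidal via the Künneth morphism, and $\prod_{n\in\mathbb Z}\mathcal A$ is identified with the full subcategory of $\mathrm{Ch}_*(\mathcal A)$ of complexes with zero differential.
   Formalization: Direct sums in A are also required to be exact (a direct sum of monomorphisms is a monomorphism), without which the claim is false; lax monoidal axioms on the pure subcategory, which need not be closed under tensor, are imposed whenever the tensor products involved are pure. *)

theory Defs
  imports Complex_Main "HOL-Algebra.Group"
begin

section \<open>Abelian symmetric monoidal categories\<close>

record ('o, 'm) cat =
  Obj :: "'o set"
  Arr :: "'m set"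
  Dom :: "'m \<Rightarrow> 'o"
  Cod :: "'m \<Rightarrow> 'o"
  Ident :: "'o \<Rightarrow> 'm"
  Comp :: "'m \<Rightarrow> 'm \<Rightarrow> 'm" (infixr "\<cdot>\<index>" 70)

definition Hom :: "('o, 'm, 'z) cat_scheme \<Rightarrow> 'o \<Rightarrow> 'o \<Rightarrow> 'm set" where
  "Hom C X Y = {f \<in> Arr C. Dom C f = X \<and> Cod C f = Y}"

locale category =
  fixes C :: "('o, 'm, 'z) cat_scheme" (structure)
  assumes Dom_Obj: "f \<in> Arr C \<Longrightarrow> Dom C f \<in> Obj C"
    and Cod_Obj: "f \<in> Arr C \<Longrightarrow> Cod C f \<in> Obj C"
    and Ident_Hom: "X \<in> Obj C \<Longrightarrow> Ident C X \<in> Hom C X X"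
    and Comp_Hom: "f \<in> Hom C X Y \<Longrightarrow> g \<in> Hom C Y Z \<Longrightarrow> g \<cdot> f \<in> Hom C X Z"
    and Comp_Ident_left: "f \<in> Hom C X Y \<Longrightarrow> Ident C Y \<cdot> f = f"
    and Comp_Ident_right: "f \<in> Hom C X Y \<Longrightarrow> f \<cdot> Ident C X = f"
    and Comp_assoc: "f \<in> Hom C W X \<Longrightarrow> g \<in> Hom C X Y \<Longrightarrow> h \<in> Hom C Y Z
      \<Longrightarrow> (h \<cdot> g) \<cdot> f = h \<cdot> (g \<cdot> f)"

definition iso_arr :: "('o, 'm, 'z) cat_scheme \<Rightarrow> 'm \<Rightarrow> bool" where
  "iso_arr C f \<longleftrightarrow> f \<in> Arr C \<and>
     (\<exists>g \<in> Hom C (Cod C f) (Dom C f).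
        g \<cdot>\<^bsub>C\<^esub> f = Ident C (Dom C f) \<and> f \<cdot>\<^bsub>C\<^esub> g = Ident C (Cod C f))"

definition monic :: "('o, 'm, 'z) cat_scheme \<Rightarrow> 'm \<Rightarrow> bool" where
  "monic C f \<longleftrightarrow> f \<in> Arr C \<and>
     (\<forall>W \<in> Obj C. \<forall>g \<in> Hom C W (Dom C f). \<forall>h \<in> Hom C W (Dom C f).
        f \<cdot>\<^bsub>C\<^esub> g = f \<cdot>\<^bsub>C\<^esub> h \<longrightarrow> g = h)"

definition epic :: "('o, 'm, 'z) cat_scheme \<Rightarrow> 'm \<Rightarrow> bool" where
  "epic C f \<longleftrightarrow> f \<in> Arr C \<and>
     (\<forall>W \<in> Obj C. \<forall>g \<in> Hom C (Cod C f) W. \<forall>h \<in> Hom C (Cod C f) W.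
        g \<cdot>\<^bsub>C\<^esub> f = h \<cdot>\<^bsub>C\<^esub> f \<longrightarrow> g = h)"

definition zero_object :: "('o, 'm, 'z) cat_scheme \<Rightarrow> 'o \<Rightarrow> bool" where
  "zero_object C Z \<longleftrightarrow> Z \<in> Obj C \<and>
     (\<forall>X \<in> Obj C. (\<exists>!f. f \<in> Hom C X Z) \<and> (\<exists>!f. f \<in> Hom C Z X))"

definition is_coproduct ::
  "('o, 'm, 'z) cat_scheme \<Rightarrow> 'i set \<Rightarrow> ('i \<Rightarrow> 'o) \<Rightarrow> 'o \<Rightarrow> ('i \<Rightarrow> 'm) \<Rightarrow> bool" where
  "is_coproduct C I F S inc \<longleftrightarrow>
     (\<forall>i\<in>I. F i \<in> Obj C) \<and> S \<in> Obj C \<and> (\<forall>i\<in>I. inc i \<in> Hom C (F i) S) \<and>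
     (\<forall>T \<in> Obj C. \<forall>g. (\<forall>i\<in>I. g i \<in> Hom C (F i) T) \<longrightarrow>
        (\<exists>!h. h \<in> Hom C S T \<and> (\<forall>i\<in>I. h \<cdot>\<^bsub>C\<^esub> inc i = g i)))"

definition full_subcategory :: "('o, 'm, 'z) cat_scheme \<Rightarrow> 'o set \<Rightarrow> ('o, 'm, 'z) cat_scheme" where
  "full_subcategory C P =
     C\<lparr>Obj := Obj C \<inter> P, Arr := {f \<in> Arr C. Dom C f \<in> P \<and> Cod C f \<in> P}\<rparr>"

record ('o, 'm) add_cat = "('o, 'm) cat" +
  Zero :: "'o \<Rightarrow> 'o \<Rightarrow> 'm"
  Add :: "'m \<Rightarrow> 'm \<Rightarrow> 'm" (infixl "\<ddagger>\<index>" 65)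

definition hom_group :: "('o, 'm, 'z) add_cat_scheme \<Rightarrow> 'o \<Rightarrow> 'o \<Rightarrow> 'm monoid" where
  "hom_group C X Y = \<lparr>carrier = Hom C X Y, monoid.mult = Add C, one = Zero C X Y\<rparr>"

definition neg :: "('o, 'm, 'z) add_cat_scheme \<Rightarrow> 'm \<Rightarrow> 'm" where
  "neg C f = inv\<^bsub>hom_group C (Dom C f) (Cod C f)\<^esub> f"

text \<open>\<open>(-1)\<^sup>k f\<close>\<close>
definition signed :: "('o, 'm, 'z) add_cat_scheme \<Rightarrow> int \<Rightarrow> 'm \<Rightarrow> 'm" where
  "signed C k f = (if even k then f else neg C f)"

definition is_kernel :: "('o, 'm, 'z) add_cat_scheme \<Rightarrow> 'm \<Rightarrow> 'm \<Rightarrow> bool" where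
  "is_kernel C f k \<longleftrightarrow> f \<in> Arr C \<and> k \<in> Arr C \<and> Cod C k = Dom C f \<and>
     f \<cdot>\<^bsub>C\<^esub> k = Zero C (Dom C k) (Cod C f) \<and>
     (\<forall>W \<in> Obj C. \<forall>g \<in> Hom C W (Dom C f). f \<cdot>\<^bsub>C\<^esub> g = Zero C W (Cod C f) \<longrightarrow>
        (\<exists>!h. h \<in> Hom C W (Dom C k) \<and> k \<cdot>\<^bsub>C\<^esub> h = g))"

definition is_cokernel :: "('o, 'm, 'z) add_cat_scheme \<Rightarrow> 'm \<Rightarrow> 'm \<Rightarrow> bool" where
  "is_cokernel C f q \<longleftrightarrow> f \<in> Arr C \<and> q \<in> Arr C \<and> Dom C q = Cod C f \<and>
     q \<cdot>\<^bsub>C\<^esub> f = Zero C (Dom C f) (Cod C q) \<and>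
     (\<forall>W \<in> Obj C. \<forall>g \<in> Hom C (Cod C f) W. g \<cdot>\<^bsub>C\<^esub> f = Zero C (Dom C f) W \<longrightarrow>
        (\<exists>!h. h \<in> Hom C (Cod C q) W \<and> h \<cdot>\<^bsub>C\<^esub> q = g))"

definition is_biproduct ::
  "('o, 'm, 'z) add_cat_scheme \<Rightarrow> 'o \<Rightarrow> 'o \<Rightarrow> 'o \<Rightarrow> 'm \<Rightarrow> 'm \<Rightarrow> 'm \<Rightarrow> 'm \<Rightarrow> bool" where
  "is_biproduct C X Y S i j p q \<longleftrightarrow> S \<in> Obj C \<and>
     i \<in> Hom C X S \<and> j \<in> Hom C Y S \<and> p \<in> Hom C S X \<and> q \<in> Hom C S Y \<and>
     p \<cdot>\<^bsub>C\<^esub> i = Ident C X \<and> q \<cdot>\<^bsub>C\<^esub> j = Ident C Y \<and>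
     q \<cdot>\<^bsub>C\<^esub> i = Zero C X Y \<and> p \<cdot>\<^bsub>C\<^esub> j = Zero C Y X \<and>
     (i \<cdot>\<^bsub>C\<^esub> p) \<ddagger>\<^bsub>C\<^esub> (j \<cdot>\<^bsub>C\<^esub> q) = Ident C S"

locale abelian_category = category C
  for C :: "('o, 'm, 'z) add_cat_scheme" (structure) +
  assumes hom_comm_group: "X \<in> Obj C \<Longrightarrow> Y \<in> Obj C \<Longrightarrow> comm_group (hom_group C X Y)"
    and Comp_Add_left: "f \<in> Hom C Y Z \<Longrightarrow> g \<in> Hom C Y Z \<Longrightarrow> h \<in> Hom C X Y
      \<Longrightarrow> (f \<ddagger> g) \<cdot> h = (f \<cdot> h) \<ddagger> (g \<cdot> h)"
    and Comp_Add_right: "f \<in> Hom C X Y \<Longrightarrow> g \<in> Hom C X Y \<Longrightarrow> h \<in> Hom C Y Z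
      \<Longrightarrow> h \<cdot> (f \<ddagger> g) = (h \<cdot> f) \<ddagger> (h \<cdot> g)"
    and has_zero_object: "\<exists>Z. zero_object C Z"
    and has_biproducts: "X \<in> Obj C \<Longrightarrow> Y \<in> Obj C \<Longrightarrow> \<exists>S i j p q. is_biproduct C X Y S i j p q"
    and has_kernels: "f \<in> Arr C \<Longrightarrow> \<exists>k. is_kernel C f k"
    and has_cokernels: "f \<in> Arr C \<Longrightarrow> \<exists>q. is_cokernel C f q"
    and monic_normal: "monic C k \<Longrightarrow> \<exists>f. is_kernel C f k"
    and epic_normal: "epic C q \<Longrightarrow> \<exists>f. is_cokernel C f q"

text \<open>Direct sums are indexed by arbitrary subsets of a type \<open>'i\<close>, which plays the role of the
  universe of small sets.\<close>

definition has_direct_sums :: "'i itself \<Rightarrow> ('o, 'm, 'z) cat_scheme \<Rightarrow> bool" where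
  "has_direct_sums _ C \<longleftrightarrow>
     (\<forall>(I :: 'i set) F. (\<forall>i\<in>I. F i \<in> Obj C) \<longrightarrow> (\<exists>S inc. is_coproduct C I F S inc))"

text \<open>Grothendieck's axiom AB4: a direct sum of monomorphisms is a monomorphism. It ensures that
  homology commutes with direct sums, so that forgetting the degree preserves quasi-isomorphisms.\<close>

definition exact_direct_sums :: "'i itself \<Rightarrow> ('o, 'm, 'z) cat_scheme \<Rightarrow> bool" where
  "exact_direct_sums _ C \<longleftrightarrow>
     (\<forall>(I :: 'i set) F S inc G T inc' f h.
        is_coproduct C I F S inc \<longrightarrow> is_coproduct C I G T inc' \<longrightarrow>
        (\<forall>i\<in>I. f i \<in> Hom C (F i) (G i) \<and> monic C (f i)) \<longrightarrow>
        h \<in> Hom C S T \<longrightarrow> (\<forall>i\<in>I. h \<cdot>\<^bsub>C\<^esub> inc i = inc' i \<cdot>\<^bsub>C\<^esub> f i) \<longrightarrow> monic C h)"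

record ('o, 'm) sm_cat = "('o, 'm) add_cat" +
  Tensor :: "'o \<Rightarrow> 'o \<Rightarrow> 'o" (infixr "\<boxtimes>\<index>" 75)
  TensorArr :: "'m \<Rightarrow> 'm \<Rightarrow> 'm" (infixr "\<boxdot>\<index>" 75)
  Unit :: "'o"
  Assoc :: "'o \<Rightarrow> 'o \<Rightarrow> 'o \<Rightarrow> 'm"
  LUnit :: "'o \<Rightarrow> 'm"
  RUnit :: "'o \<Rightarrow> 'm"
  Sym :: "'o \<Rightarrow> 'o \<Rightarrow> 'm"

locale symmetric_monoidal_category = category C
  for C :: "('o, 'm, 'z) sm_cat_scheme" (structure) +
  assumes Unit_Obj: "Unit C \<in> Obj C"
    and Tensor_Obj: "X \<in> Obj C \<Longrightarrow> Y \<in> Obj C \<Longrightarrow> X \<boxtimes> Y \<in> Obj C"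
    and TensorArr_Hom: "f \<in> Hom C X X' \<Longrightarrow> g \<in> Hom C Y Y' \<Longrightarrow> f \<boxdot> g \<in> Hom C (X \<boxtimes> Y) (X' \<boxtimes> Y')"
    and TensorArr_Ident: "X \<in> Obj C \<Longrightarrow> Y \<in> Obj C \<Longrightarrow> Ident C X \<boxdot> Ident C Y = Ident C (X \<boxtimes> Y)"
    and TensorArr_Comp: "f \<in> Hom C X X' \<Longrightarrow> f' \<in> Hom C X' X'' \<Longrightarrow> g \<in> Hom C Y Y' \<Longrightarrow> g' \<in> Hom C Y' Y''
      \<Longrightarrow> (f' \<cdot> f) \<boxdot> (g' \<cdot> g) = (f' \<boxdot> g') \<cdot> (f \<boxdot> g)"
    and Assoc_Hom: "X \<in> Obj C \<Longrightarrow> Y \<in> Obj C \<Longrightarrow> Z \<in> Obj C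
      \<Longrightarrow> Assoc C X Y Z \<in> Hom C ((X \<boxtimes> Y) \<boxtimes> Z) (X \<boxtimes> (Y \<boxtimes> Z))"
    and Assoc_iso: "X \<in> Obj C \<Longrightarrow> Y \<in> Obj C \<Longrightarrow> Z \<in> Obj C \<Longrightarrow> iso_arr C (Assoc C X Y Z)"
    and Assoc_natural: "f \<in> Hom C X X' \<Longrightarrow> g \<in> Hom C Y Y' \<Longrightarrow> h \<in> Hom C Z Z'
      \<Longrightarrow> Assoc C X' Y' Z' \<cdot> ((f \<boxdot> g) \<boxdot> h) = (f \<boxdot> (g \<boxdot> h)) \<cdot> Assoc C X Y Z"
    and LUnit_Hom: "X \<in> Obj C \<Longrightarrow> LUnit C X \<in> Hom C (Unit C \<boxtimes> X) X"
    and LUnit_iso: "X \<in> Obj C \<Longrightarrow> iso_arr C (LUnit C X)"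
    and LUnit_natural: "f \<in> Hom C X Y \<Longrightarrow> LUnit C Y \<cdot> (Ident C (Unit C) \<boxdot> f) = f \<cdot> LUnit C X"
    and RUnit_Hom: "X \<in> Obj C \<Longrightarrow> RUnit C X \<in> Hom C (X \<boxtimes> Unit C) X"
    and RUnit_iso: "X \<in> Obj C \<Longrightarrow> iso_arr C (RUnit C X)"
    and RUnit_natural: "f \<in> Hom C X Y \<Longrightarrow> RUnit C Y \<cdot> (f \<boxdot> Ident C (Unit C)) = f \<cdot> RUnit C X"
    and Sym_Hom: "X \<in> Obj C \<Longrightarrow> Y \<in> Obj C \<Longrightarrow> Sym C X Y \<in> Hom C (X \<boxtimes> Y) (Y \<boxtimes> X)"
    and Sym_natural: "f \<in> Hom C X X' \<Longrightarrow> g \<in> Hom C Y Y'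
      \<Longrightarrow> Sym C X' Y' \<cdot> (f \<boxdot> g) = (g \<boxdot> f) \<cdot> Sym C X Y"
    and Sym_Sym: "X \<in> Obj C \<Longrightarrow> Y \<in> Obj C \<Longrightarrow> Sym C Y X \<cdot> Sym C X Y = Ident C (X \<boxtimes> Y)"
    and pentagon: "W \<in> Obj C \<Longrightarrow> X \<in> Obj C \<Longrightarrow> Y \<in> Obj C \<Longrightarrow> Z \<in> Obj C \<Longrightarrow>
      (Ident C W \<boxdot> Assoc C X Y Z) \<cdot> Assoc C W (X \<boxtimes> Y) Z \<cdot> (Assoc C W X Y \<boxdot> Ident C Z) =
      Assoc C W X (Y \<boxtimes> Z) \<cdot> Assoc C (W \<boxtimes> X) Y Z"
    and triangle: "X \<in> Obj C \<Longrightarrow> Y \<in> Obj C \<Longrightarrow>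
      (Ident C X \<boxdot> LUnit C Y) \<cdot> Assoc C X (Unit C) Y = RUnit C X \<boxdot> Ident C Y"
    and hexagon: "X \<in> Obj C \<Longrightarrow> Y \<in> Obj C \<Longrightarrow> Z \<in> Obj C \<Longrightarrow>
      Assoc C Y Z X \<cdot> Sym C X (Y \<boxtimes> Z) \<cdot> Assoc C X Y Z =
      (Ident C Y \<boxdot> Sym C X Z) \<cdot> Assoc C Y X Z \<cdot> (Sym C X Y \<boxdot> Ident C Z)"

text \<open>As usual for abelian symmetric monoidal categories, the tensor product is additive and right
  exact in each variable; this is what makes the tensor product of complexes and the Kuenneth
  morphism well defined.\<close>

locale abelian_symmetric_monoidal_category =
  abelian_category C + symmetric_monoidal_category C
  for C :: "('o, 'm, 'z) sm_cat_scheme" (structure) +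
  assumes TensorArr_Add_left: "f \<in> Hom C X Y \<Longrightarrow> g \<in> Hom C X Y \<Longrightarrow> h \<in> Hom C Z W
      \<Longrightarrow> (f \<ddagger> g) \<boxdot> h = (f \<boxdot> h) \<ddagger> (g \<boxdot> h)"
    and TensorArr_Add_right: "f \<in> Hom C X Y \<Longrightarrow> g \<in> Hom C X Y \<Longrightarrow> h \<in> Hom C Z W
      \<Longrightarrow> h \<boxdot> (f \<ddagger> g) = (h \<boxdot> f) \<ddagger> (h \<boxdot> g)"
    and Tensor_right_exact_left: "is_cokernel C f q \<Longrightarrow> X \<in> Obj C
      \<Longrightarrow> is_cokernel C (f \<boxdot> Ident C X) (q \<boxdot> Ident C X)"
    and Tensor_right_exact_right: "is_cokernel C f q \<Longrightarrow> X \<in> Obj C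
      \<Longrightarrow> is_cokernel C (Ident C X \<boxdot> f) (Ident C X \<boxdot> q)"

definition tensor_preserves_direct_sums :: "'i itself \<Rightarrow> ('o, 'm, 'z) sm_cat_scheme \<Rightarrow> bool" where
  "tensor_preserves_direct_sums _ C \<longleftrightarrow>
     (\<forall>(I :: 'i set) F S inc. \<forall>X \<in> Obj C. is_coproduct C I F S inc \<longrightarrow>
        is_coproduct C I (\<lambda>i. F i \<boxtimes>\<^bsub>C\<^esub> X) (S \<boxtimes>\<^bsub>C\<^esub> X) (\<lambda>i. inc i \<boxdot>\<^bsub>C\<^esub> Ident C X) \<and>
        is_coproduct C I (\<lambda>i. X \<boxtimes>\<^bsub>C\<^esub> F i) (X \<boxtimes>\<^bsub>C\<^esub> S) (\<lambda>i. Ident C X \<boxdot>\<^bsub>C\<^esub> inc i))"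

section \<open>Chosen (co)limits\<close>

definition zero_ob :: "('o, 'm, 'z) cat_scheme \<Rightarrow> 'o" where
  "zero_ob C = (SOME Z. zero_object C Z)"

definition coprod :: "('o, 'm, 'z) cat_scheme \<Rightarrow> (int \<Rightarrow> 'o) \<Rightarrow> 'o \<times> (int \<Rightarrow> 'm)" where
  "coprod C F = (SOME (S, inc). is_coproduct C UNIV F S inc)"

definition dsum :: "('o, 'm, 'z) cat_scheme \<Rightarrow> (int \<Rightarrow> 'o) \<Rightarrow> 'o" where
  "dsum C F = fst (coprod C F)"

definition dinj :: "('o, 'm, 'z) cat_scheme \<Rightarrow> (int \<Rightarrow> 'o) \<Rightarrow> int \<Rightarrow> 'm" where
  "dinj C F = snd (coprod C F)"

definition copair :: "('o, 'm, 'z) cat_scheme \<Rightarrow> (int \<Rightarrow> 'o) \<Rightarrow> 'o \<Rightarrow> (int \<Rightarrow> 'm) \<Rightarrow> 'm" where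
  "copair C F T g = (THE h. h \<in> Hom C (dsum C F) T \<and> (\<forall>i. h \<cdot>\<^bsub>C\<^esub> dinj C F i = g i))"

definition ker_arr :: "('o, 'm, 'z) add_cat_scheme \<Rightarrow> 'm \<Rightarrow> 'm" where
  "ker_arr C f = (SOME k. is_kernel C f k)"

definition coker_arr :: "('o, 'm, 'z) add_cat_scheme \<Rightarrow> 'm \<Rightarrow> 'm" where
  "coker_arr C f = (SOME q. is_cokernel C f q)"

text \<open>The unique factorisation of \<open>f\<close> through \<open>k\<close> (on the left) or \<open>q\<close> (on the right);
  used for \<open>k\<close> monic and \<open>q\<close> epic.\<close>

definition lift_through :: "('o, 'm, 'z) cat_scheme \<Rightarrow> 'm \<Rightarrow> 'm \<Rightarrow> 'm" where
  "lift_through C k f = (THE h. h \<in> Hom C (Dom C f) (Dom C k) \<and> k \<cdot>\<^bsub>C\<^esub> h = f)"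

definition descend_through :: "('o, 'm, 'z) cat_scheme \<Rightarrow> 'm \<Rightarrow> 'm \<Rightarrow> 'm" where
  "descend_through C q f = (THE h. h \<in> Hom C (Cod C q) (Cod C f) \<and> h \<cdot>\<^bsub>C\<^esub> q = f)"

section \<open>Graded objects\<close>

definition gr_summand :: "('o, 'm) sm_cat \<Rightarrow> (int \<Rightarrow> 'o) \<Rightarrow> (int \<Rightarrow> 'o) \<Rightarrow> int \<Rightarrow> int \<Rightarrow> 'o" where
  "gr_summand A X Y n = (\<lambda>p. X p \<boxtimes>\<^bsub>A\<^esub> Y (n - p))"

definition gr_tensor :: "('o, 'm) sm_cat \<Rightarrow> (int \<Rightarrow> 'o) \<Rightarrow> (int \<Rightarrow> 'o) \<Rightarrow> int \<Rightarrow> 'o" where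
  "gr_tensor A X Y = (\<lambda>n. dsum A (gr_summand A X Y n))"

definition gr_inj :: "('o, 'm) sm_cat \<Rightarrow> (int \<Rightarrow> 'o) \<Rightarrow> (int \<Rightarrow> 'o) \<Rightarrow> int \<Rightarrow> int \<Rightarrow> 'm" where
  "gr_inj A X Y n p = dinj A (gr_summand A X Y n) p"

definition gr_tensor_arr :: "('o, 'm) sm_cat \<Rightarrow> (int \<Rightarrow> 'm) \<Rightarrow> (int \<Rightarrow> 'm) \<Rightarrow> int \<Rightarrow> 'm" where
  "gr_tensor_arr A f g = (\<lambda>n.
     let X = (\<lambda>p. Dom A (f p)); X' = (\<lambda>p. Cod A (f p));
         Y = (\<lambda>p. Dom A (g p)); Y' = (\<lambda>p. Cod A (g p))
     in copair A (gr_summand A X Y n) (gr_tensor A X' Y' n)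
          (\<lambda>p. gr_inj A X' Y' n p \<cdot>\<^bsub>A\<^esub> (f p \<boxdot>\<^bsub>A\<^esub> g (n - p))))"

definition gr_unit :: "('o, 'm) sm_cat \<Rightarrow> int \<Rightarrow> 'o" where
  "gr_unit A = (\<lambda>p. if p = 0 then Unit A else zero_ob A)"

text \<open>On the summand \<open>(X p \<otimes> Y (k - p)) \<otimes> Z (n - k)\<close> the associator is that of the base category.\<close>

definition gr_assoc ::
  "('o, 'm) sm_cat \<Rightarrow> (int \<Rightarrow> 'o) \<Rightarrow> (int \<Rightarrow> 'o) \<Rightarrow> (int \<Rightarrow> 'o) \<Rightarrow> int \<Rightarrow> 'm" where
  "gr_assoc A X Y Z = (\<lambda>n. THE h.
     h \<in> Hom A (gr_tensor A (gr_tensor A X Y) Z n) (gr_tensor A X (gr_tensor A Y Z) n) \<and>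
     (\<forall>k p. h \<cdot>\<^bsub>A\<^esub> gr_inj A (gr_tensor A X Y) Z n k \<cdot>\<^bsub>A\<^esub> (gr_inj A X Y k p \<boxdot>\<^bsub>A\<^esub> Ident A (Z (n - k))) =
        gr_inj A X (gr_tensor A Y Z) n p \<cdot>\<^bsub>A\<^esub> (Ident A (X p) \<boxdot>\<^bsub>A\<^esub> gr_inj A Y Z (n - p) (k - p)) \<cdot>\<^bsub>A\<^esub>
          Assoc A (X p) (Y (k - p)) (Z (n - k))))"

definition gr_lunit :: "('o, 'm) sm_cat \<Rightarrow> (int \<Rightarrow> 'o) \<Rightarrow> int \<Rightarrow> 'm" where
  "gr_lunit A X = (\<lambda>n. copair A (gr_summand A (gr_unit A) X n) (X n)
     (\<lambda>p. if p = 0 then LUnit A (X n) else Zero A (gr_summand A (gr_unit A) X n p) (X n)))"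

definition gr_runit :: "('o, 'm) sm_cat \<Rightarrow> (int \<Rightarrow> 'o) \<Rightarrow> int \<Rightarrow> 'm" where
  "gr_runit A X = (\<lambda>n. copair A (gr_summand A X (gr_unit A) n) (X n)
     (\<lambda>p. if p = n then RUnit A (X n) else Zero A (gr_summand A X (gr_unit A) n p) (X n)))"

text \<open>The symmetry, with sign \<open>(-1) ^ \<sigma> p q\<close> on the summand \<open>X p \<otimes> Y q\<close>.\<close>

definition gr_sym ::
  "('o, 'm) sm_cat \<Rightarrow> (int \<Rightarrow> int \<Rightarrow> int) \<Rightarrow> (int \<Rightarrow> 'o) \<Rightarrow> (int \<Rightarrow> 'o) \<Rightarrow> int \<Rightarrow> 'm" where
  "gr_sym A \<sigma> X Y = (\<lambda>n. copair A (gr_summand A X Y n) (gr_tensor A Y X n)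
     (\<lambda>p. signed A (\<sigma> p (n - p)) (gr_inj A Y X n (n - p) \<cdot>\<^bsub>A\<^esub> Sym A (X p) (Y (n - p)))))"

text \<open>There is no Koszul sign for the extra degree: otherwise forgetting it would not be symmetric.\<close>

definition gr :: "('o, 'm) sm_cat \<Rightarrow> (int \<Rightarrow> 'o, int \<Rightarrow> 'm) sm_cat" where
  "gr A = \<lparr>
     Obj = {X. \<forall>p. X p \<in> Obj A},
     Arr = {f. \<forall>p. f p \<in> Arr A},
     Dom = (\<lambda>f p. Dom A (f p)),
     Cod = (\<lambda>f p. Cod A (f p)),
     Ident = (\<lambda>X p. Ident A (X p)),
     Comp = (\<lambda>g f p. g p \<cdot>\<^bsub>A\<^esub> f p),
     Zero = (\<lambda>X Y p. Zero A (X p) (Y p)),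
     Add = (\<lambda>f g p. f p \<ddagger>\<^bsub>A\<^esub> g p),
     Tensor = gr_tensor A,
     TensorArr = gr_tensor_arr A,
     Unit = gr_unit A,
     Assoc = gr_assoc A,
     LUnit = gr_lunit A,
     RUnit = gr_runit A,
     Sym = gr_sym A (\<lambda>_ _. 0)\<rparr>"

section \<open>Chain complexes\<close>

record ('o, 'm) chain_complex =
  cob :: "int \<Rightarrow> 'o"
  cdiff :: "int \<Rightarrow> 'm"

record ('o, 'm) chain_map =
  cdom :: "('o, 'm) chain_complex"
  ccod :: "('o, 'm) chain_complex"
  carr :: "int \<Rightarrow> 'm"

definition is_complex :: "('o, 'm, 'z) add_cat_scheme \<Rightarrow> ('o, 'm) chain_complex \<Rightarrow> bool" where
  "is_complex A X \<longleftrightarrow> (\<forall>n. cob X n \<in> Obj A \<and> cdiff X n \<in> Hom A (cob X n) (cob X (n - 1)) \<and>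
     cdiff X (n - 1) \<cdot>\<^bsub>A\<^esub> cdiff X n = Zero A (cob X n) (cob X (n - 2)))"

definition is_chain_map :: "('o, 'm, 'z) add_cat_scheme \<Rightarrow> ('o, 'm) chain_map \<Rightarrow> bool" where
  "is_chain_map A f \<longleftrightarrow> is_complex A (cdom f) \<and> is_complex A (ccod f) \<and>
     (\<forall>n. carr f n \<in> Hom A (cob (cdom f) n) (cob (ccod f) n) \<and>
        cdiff (ccod f) n \<cdot>\<^bsub>A\<^esub> carr f n = carr f (n - 1) \<cdot>\<^bsub>A\<^esub> cdiff (cdom f) n)"

definition cmap ::
  "('o, 'm) chain_complex \<Rightarrow> ('o, 'm) chain_complex \<Rightarrow> (int \<Rightarrow> 'm) \<Rightarrow> ('o, 'm) chain_map" where
  "cmap X Y f = \<lparr>cdom = X, ccod = Y, carr = f\<rparr>"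

text \<open>A graded object with zero differential.\<close>

definition zero_diff_complex ::
  "('o, 'm, 'z) add_cat_scheme \<Rightarrow> (int \<Rightarrow> 'o) \<Rightarrow> ('o, 'm) chain_complex" where
  "zero_diff_complex A X = \<lparr>cob = X, cdiff = (\<lambda>n. Zero A (X n) (X (n - 1)))\<rparr>"

text \<open>On the summand \<open>X p \<otimes> Y (n - p)\<close> the differential is \<open>d \<otimes> 1 + (-1)\<^sup>p (1 \<otimes> d)\<close>.\<close>

definition ch_tensor ::
  "('o, 'm) sm_cat \<Rightarrow> ('o, 'm) chain_complex \<Rightarrow> ('o, 'm) chain_complex \<Rightarrow> ('o, 'm) chain_complex" where
  "ch_tensor A X Y = \<lparr>
     cob = gr_tensor A (cob X) (cob Y),
     cdiff = (\<lambda>n. copair A (gr_summand A (cob X) (cob Y) n) (gr_tensor A (cob X) (cob Y) (n - 1))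
       (\<lambda>p. (gr_inj A (cob X) (cob Y) (n - 1) (p - 1) \<cdot>\<^bsub>A\<^esub>
               (cdiff X p \<boxdot>\<^bsub>A\<^esub> Ident A (cob Y (n - p)))) \<ddagger>\<^bsub>A\<^esub>
             signed A p (gr_inj A (cob X) (cob Y) (n - 1) p \<cdot>\<^bsub>A\<^esub>
               (Ident A (cob X p) \<boxdot>\<^bsub>A\<^esub> cdiff Y (n - p)))))\<rparr>"

definition Ch :: "('o, 'm) sm_cat \<Rightarrow> (('o, 'm) chain_complex, ('o, 'm) chain_map) sm_cat" where
  "Ch A = \<lparr>
     Obj = {X. is_complex A X},
     Arr = {f. is_chain_map A f},
     Dom = cdom,
     Cod = ccod,
     Ident = (\<lambda>X. cmap X X (\<lambda>n. Ident A (cob X n))),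
     Comp = (\<lambda>g f. cmap (cdom f) (ccod g) (\<lambda>n. carr g n \<cdot>\<^bsub>A\<^esub> carr f n)),
     Zero = (\<lambda>X Y. cmap X Y (\<lambda>n. Zero A (cob X n) (cob Y n))),
     Add = (\<lambda>f g. cmap (cdom f) (ccod f) (\<lambda>n. carr f n \<ddagger>\<^bsub>A\<^esub> carr g n)),
     Tensor = ch_tensor A,
     TensorArr = (\<lambda>f g. cmap (ch_tensor A (cdom f) (cdom g)) (ch_tensor A (ccod f) (ccod g))
       (gr_tensor_arr A (carr f) (carr g))),
     Unit = zero_diff_complex A (gr_unit A),
     Assoc = (\<lambda>X Y Z. cmap (ch_tensor A (ch_tensor A X Y) Z) (ch_tensor A X (ch_tensor A Y Z))
       (gr_assoc A (cob X) (cob Y) (cob Z))),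
     LUnit = (\<lambda>X. cmap (ch_tensor A (zero_diff_complex A (gr_unit A)) X) X (gr_lunit A (cob X))),
     RUnit = (\<lambda>X. cmap (ch_tensor A X (zero_diff_complex A (gr_unit A))) X (gr_runit A (cob X))),
     Sym = (\<lambda>X Y. cmap (ch_tensor A X Y) (ch_tensor A Y X) (gr_sym A (\<lambda>p q. p * q) (cob X) (cob Y)))\<rparr>"

section \<open>Homology\<close>

definition cycles :: "('o, 'm, 'z) add_cat_scheme \<Rightarrow> ('o, 'm) chain_complex \<Rightarrow> int \<Rightarrow> 'm" where
  "cycles A X n = ker_arr A (cdiff X n)"

text \<open>The quotient map from cycles to homology: the cokernel of the map from \<open>X (n + 1)\<close> to the
  cycles in degree \<open>n\<close> induced by the differential.\<close>

definition hproj :: "('o, 'm, 'z) add_cat_scheme \<Rightarrow> ('o, 'm) chain_complex \<Rightarrow> int \<Rightarrow> 'm" where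
  "hproj A X n = coker_arr A (lift_through A (cycles A X n) (cdiff X (n + 1)))"

definition homology :: "('o, 'm, 'z) add_cat_scheme \<Rightarrow> ('o, 'm) chain_complex \<Rightarrow> int \<Rightarrow> 'o" where
  "homology A X n = Cod A (hproj A X n)"

definition homology_map :: "('o, 'm, 'z) add_cat_scheme \<Rightarrow> ('o, 'm) chain_map \<Rightarrow> int \<Rightarrow> 'm" where
  "homology_map A f n = descend_through A (hproj A (cdom f) n)
     (hproj A (ccod f) n \<cdot>\<^bsub>A\<^esub>
       lift_through A (cycles A (ccod f) n) (carr f n \<cdot>\<^bsub>A\<^esub> cycles A (cdom f) n))"

definition quasi_iso :: "('o, 'm, 'z) add_cat_scheme \<Rightarrow> ('o, 'm) chain_map \<Rightarrow> bool" where
  "quasi_iso A f \<longleftrightarrow> is_chain_map A f \<and> (\<forall>n. iso_arr A (homology_map A f n))"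

text \<open>The Kuenneth morphism from \<open>H\<^sub>p(X) \<otimes> H\<^sub>q(Y)\<close> to \<open>H\<^sub>p\<^sub>+\<^sub>q(X \<otimes> Y)\<close>, sending \<open>[x] \<otimes> [y]\<close> to \<open>[x \<otimes> y]\<close>.\<close>

definition kuenneth ::
  "('o, 'm) sm_cat \<Rightarrow> ('o, 'm) chain_complex \<Rightarrow> ('o, 'm) chain_complex \<Rightarrow> int \<Rightarrow> int \<Rightarrow> 'm" where
  "kuenneth A X Y p q = descend_through A (hproj A X p \<boxdot>\<^bsub>A\<^esub> hproj A Y q)
     (hproj A (ch_tensor A X Y) (p + q) \<cdot>\<^bsub>A\<^esub>
       lift_through A (cycles A (ch_tensor A X Y) (p + q))
         (gr_inj A (cob X) (cob Y) (p + q) p \<cdot>\<^bsub>A\<^esub> (cycles A X p \<boxdot>\<^bsub>A\<^esub> cycles A Y q)))"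

section \<open>Lax symmetric monoidal functors\<close>

record ('o, 'm, 'p, 'n) lax_functor =
  FObj :: "'o \<Rightarrow> 'p"
  FArr :: "'m \<Rightarrow> 'n"
  FMult :: "'o \<Rightarrow> 'o \<Rightarrow> 'n"
  FUnit :: "'n"

text \<open>The source \<open>C\<close> is a full subcategory of a symmetric monoidal category, containing the unit but
  not assumed to be closed under tensor products; each axiom is imposed whenever all the tensor
  products it involves lie in \<open>C\<close>. If \<open>C\<close> is closed under tensor products these guards are vacuous
  and this is the usual notion.\<close>

locale lax_symmetric_monoidal_functor =
  fixes C :: "('o, 'm) sm_cat" and D :: "('p, 'n) sm_cat"
    and F :: "('o, 'm, 'p, 'n) lax_functor"
  assumes source_Unit: "Unit C \<in> Obj C"
    and FObj: "X \<in> Obj C \<Longrightarrow> FObj F X \<in> Obj D"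
    and FArr: "f \<in> Hom C X Y \<Longrightarrow> FArr F f \<in> Hom D (FObj F X) (FObj F Y)"
    and FArr_Ident: "X \<in> Obj C \<Longrightarrow> FArr F (Ident C X) = Ident D (FObj F X)"
    and FArr_Comp: "f \<in> Hom C X Y \<Longrightarrow> g \<in> Hom C Y Z
      \<Longrightarrow> FArr F (g \<cdot>\<^bsub>C\<^esub> f) = FArr F g \<cdot>\<^bsub>D\<^esub> FArr F f"
    and FUnit: "FUnit F \<in> Hom D (Unit D) (FObj F (Unit C))"
    and FMult: "\<lbrakk>X \<in> Obj C; Y \<in> Obj C; X \<boxtimes>\<^bsub>C\<^esub> Y \<in> Obj C\<rbrakk>
      \<Longrightarrow> FMult F X Y \<in> Hom D (FObj F X \<boxtimes>\<^bsub>D\<^esub> FObj F Y) (FObj F (X \<boxtimes>\<^bsub>C\<^esub> Y))"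
    and FMult_natural: "\<lbrakk>f \<in> Hom C X X'; g \<in> Hom C Y Y'; X \<boxtimes>\<^bsub>C\<^esub> Y \<in> Obj C; X' \<boxtimes>\<^bsub>C\<^esub> Y' \<in> Obj C\<rbrakk>
      \<Longrightarrow> FArr F (f \<boxdot>\<^bsub>C\<^esub> g) \<cdot>\<^bsub>D\<^esub> FMult F X Y = FMult F X' Y' \<cdot>\<^bsub>D\<^esub> (FArr F f \<boxdot>\<^bsub>D\<^esub> FArr F g)"
    and FMult_Assoc: "\<lbrakk>X \<in> Obj C; Y \<in> Obj C; Z \<in> Obj C; X \<boxtimes>\<^bsub>C\<^esub> Y \<in> Obj C; Y \<boxtimes>\<^bsub>C\<^esub> Z \<in> Obj C;
        (X \<boxtimes>\<^bsub>C\<^esub> Y) \<boxtimes>\<^bsub>C\<^esub> Z \<in> Obj C; X \<boxtimes>\<^bsub>C\<^esub> (Y \<boxtimes>\<^bsub>C\<^esub> Z) \<in> Obj C\<rbrakk>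
      \<Longrightarrow> FArr F (Assoc C X Y Z) \<cdot>\<^bsub>D\<^esub> FMult F (X \<boxtimes>\<^bsub>C\<^esub> Y) Z \<cdot>\<^bsub>D\<^esub> (FMult F X Y \<boxdot>\<^bsub>D\<^esub> Ident D (FObj F Z)) =
          FMult F X (Y \<boxtimes>\<^bsub>C\<^esub> Z) \<cdot>\<^bsub>D\<^esub> (Ident D (FObj F X) \<boxdot>\<^bsub>D\<^esub> FMult F Y Z) \<cdot>\<^bsub>D\<^esub>
            Assoc D (FObj F X) (FObj F Y) (FObj F Z)"
    and FMult_LUnit: "\<lbrakk>X \<in> Obj C; Unit C \<boxtimes>\<^bsub>C\<^esub> X \<in> Obj C\<rbrakk>
      \<Longrightarrow> FArr F (LUnit C X) \<cdot>\<^bsub>D\<^esub> FMult F (Unit C) X \<cdot>\<^bsub>D\<^esub> (FUnit F \<boxdot>\<^bsub>D\<^esub> Ident D (FObj F X)) =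
          LUnit D (FObj F X)"
    and FMult_RUnit: "\<lbrakk>X \<in> Obj C; X \<boxtimes>\<^bsub>C\<^esub> Unit C \<in> Obj C\<rbrakk>
      \<Longrightarrow> FArr F (RUnit C X) \<cdot>\<^bsub>D\<^esub> FMult F X (Unit C) \<cdot>\<^bsub>D\<^esub> (Ident D (FObj F X) \<boxdot>\<^bsub>D\<^esub> FUnit F) =
          RUnit D (FObj F X)"
    and FMult_Sym: "\<lbrakk>X \<in> Obj C; Y \<in> Obj C; X \<boxtimes>\<^bsub>C\<^esub> Y \<in> Obj C; Y \<boxtimes>\<^bsub>C\<^esub> X \<in> Obj C\<rbrakk>
      \<Longrightarrow> FArr F (Sym C X Y) \<cdot>\<^bsub>D\<^esub> FMult F X Y = FMult F Y X \<cdot>\<^bsub>D\<^esub> Sym D (FObj F X) (FObj F Y)"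

locale monoidal_transformation =
  F: lax_symmetric_monoidal_functor C D F + G: lax_symmetric_monoidal_functor C D G
  for C :: "('o, 'm) sm_cat" and D :: "('p, 'n) sm_cat"
    and F :: "('o, 'm, 'p, 'n) lax_functor" and G :: "('o, 'm, 'p, 'n) lax_functor" +
  fixes \<eta> :: "'o \<Rightarrow> 'n"
  assumes component: "X \<in> Obj C \<Longrightarrow> \<eta> X \<in> Hom D (FObj F X) (FObj G X)"
    and natural: "f \<in> Hom C X Y \<Longrightarrow> FArr G f \<cdot>\<^bsub>D\<^esub> \<eta> X = \<eta> Y \<cdot>\<^bsub>D\<^esub> FArr F f"
    and monoidal: "\<lbrakk>X \<in> Obj C; Y \<in> Obj C; X \<boxtimes>\<^bsub>C\<^esub> Y \<in> Obj C\<rbrakk>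
      \<Longrightarrow> \<eta> (X \<boxtimes>\<^bsub>C\<^esub> Y) \<cdot>\<^bsub>D\<^esub> FMult F X Y = FMult G X Y \<cdot>\<^bsub>D\<^esub> (\<eta> X \<boxdot>\<^bsub>D\<^esub> \<eta> Y)"
    and unital: "\<eta> (Unit C) \<cdot>\<^bsub>D\<^esub> FUnit F = FUnit G"

definition lax_comp ::
  "('q, 'r) sm_cat \<Rightarrow> ('p, 'n, 'q, 'r) lax_functor \<Rightarrow> ('o, 'm, 'p, 'n) lax_functor
    \<Rightarrow> ('o, 'm, 'q, 'r) lax_functor" where
  "lax_comp E G F = \<lparr>
     FObj = (\<lambda>X. FObj G (FObj F X)),
     FArr = (\<lambda>f. FArr G (FArr F f)),
     FMult = (\<lambda>X Y. FArr G (FMult F X Y) \<cdot>\<^bsub>E\<^esub> FMult G (FObj F X) (FObj F Y)),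
     FUnit = FArr G (FUnit F) \<cdot>\<^bsub>E\<^esub> FUnit G\<rparr>"

text \<open>The functor on complexes induced by an additive lax symmetric monoidal functor \<open>G\<close> from \<open>A\<close> to \<open>B\<close>.\<close>

definition ch_functor ::
  "('o, 'm) sm_cat \<Rightarrow> ('p, 'n) sm_cat \<Rightarrow> ('o, 'm, 'p, 'n) lax_functor \<Rightarrow>
    (('o, 'm) chain_complex, ('o, 'm) chain_map, ('p, 'n) chain_complex, ('p, 'n) chain_map) lax_functor"
where
  "ch_functor A B G =
    (let T = (\<lambda>X. \<lparr>cob = (\<lambda>n. FObj G (cob X n)), cdiff = (\<lambda>n. FArr G (cdiff X n))\<rparr>) in \<lparr>
     FObj = T,
     FArr = (\<lambda>f. cmap (T (cdom f)) (T (ccod f)) (\<lambda>n. FArr G (carr f n))),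
     FMult = (\<lambda>X Y. cmap (ch_tensor B (T X) (T Y)) (T (ch_tensor A X Y))
       (\<lambda>n. copair B (gr_summand B (cob (T X)) (cob (T Y)) n) (cob (T (ch_tensor A X Y)) n)
         (\<lambda>p. FArr G (gr_inj A (cob X) (cob Y) n p) \<cdot>\<^bsub>B\<^esub> FMult G (cob X p) (cob Y (n - p))))),
     FUnit = cmap (Unit (Ch B)) (T (Unit (Ch A)))
       (\<lambda>n. if n = 0 then FUnit G else Zero B (gr_unit B n) (FObj G (gr_unit A n)))\<rparr>)"

text \<open>Homology, with values in the complexes with zero differential.\<close>

definition H_functor ::
  "('o, 'm) sm_cat \<Rightarrow>
    (('o, 'm) chain_complex, ('o, 'm) chain_map, ('o, 'm) chain_complex, ('o, 'm) chain_map) lax_functor"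
where
  "H_functor A =
    (let T = (\<lambda>X. zero_diff_complex A (homology A X)); I = Unit (Ch A) in \<lparr>
     FObj = T,
     FArr = (\<lambda>f. cmap (T (cdom f)) (T (ccod f)) (homology_map A f)),
     FMult = (\<lambda>X Y. cmap (ch_tensor A (T X) (T Y)) (T (ch_tensor A X Y))
       (\<lambda>n. copair A (gr_summand A (homology A X) (homology A Y) n) (homology A (ch_tensor A X Y) n)
         (\<lambda>p. kuenneth A X Y p (n - p)))),
     FUnit = cmap I (T I)
       (\<lambda>n. hproj A I n \<cdot>\<^bsub>A\<^esub> lift_through A (cycles A I n) (Ident A (cob I n)))\<rparr>)"

section \<open>Formality\<close>

definition monoidal_quasi_iso ::
  "('c, 'f) sm_cat \<Rightarrow> ('o, 'm) sm_cat
    \<Rightarrow> ('c, 'f, ('o, 'm) chain_complex, ('o, 'm) chain_map) lax_functor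
    \<Rightarrow> ('c, 'f, ('o, 'm) chain_complex, ('o, 'm) chain_map) lax_functor \<Rightarrow> bool" where
  "monoidal_quasi_iso C A F G \<longleftrightarrow>
     (\<exists>\<Phi>. monoidal_transformation C (Ch A) F G \<Phi> \<and> (\<forall>X \<in> Obj C. quasi_iso A (\<Phi> X)))"

text \<open>\<open>equivclp\<close> (reflexive, symmetric, transitive closure) yields exactly the finite strings of
  transformations pointing in either direction.\<close>

definition formal_lax_symmetric_monoidal_functor ::
  "('c, 'f) sm_cat \<Rightarrow> ('o, 'm) sm_cat
    \<Rightarrow> ('c, 'f, ('o, 'm) chain_complex, ('o, 'm) chain_map) lax_functor \<Rightarrow> bool" where
  "formal_lax_symmetric_monoidal_functor C A F \<longleftrightarrow>
     lax_symmetric_monoidal_functor C (Ch A) F \<and>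
     lax_symmetric_monoidal_functor C (Ch A) (lax_comp (Ch A) (H_functor A) F) \<and>
     equivclp (monoidal_quasi_iso C A) F (lax_comp (Ch A) (H_functor A) F)"

section \<open>Purity and the forgetful functor\<close>

definition alpha_pure ::
  "('o, 'm) sm_cat \<Rightarrow> rat \<Rightarrow> (int \<Rightarrow> 'o, int \<Rightarrow> 'm) chain_complex set" where
  "alpha_pure A \<alpha> =
     {X. \<forall>n p. of_int p \<noteq> \<alpha> * of_int n \<longrightarrow> zero_object A (homology (gr A) X n p)}"

definition Ch_gr_pure ::
  "('o, 'm) sm_cat \<Rightarrow> rat
    \<Rightarrow> ((int \<Rightarrow> 'o, int \<Rightarrow> 'm) chain_complex, (int \<Rightarrow> 'o, int \<Rightarrow> 'm) chain_map) sm_cat" where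
  "Ch_gr_pure A \<alpha> = full_subcategory (Ch (gr A)) (alpha_pure A \<alpha>)"

text \<open>The functor taking a graded object to the direct sum of its components; its structure map
  takes the summand \<open>X p \<otimes> Y q\<close> to the corresponding summand of \<open>(X \<otimes> Y) (p + q)\<close>.\<close>

definition forget_degree :: "('o, 'm) sm_cat \<Rightarrow> (int \<Rightarrow> 'o, int \<Rightarrow> 'm, 'o, 'm) lax_functor" where
  "forget_degree A = \<lparr>
     FObj = dsum A,
     FArr = (\<lambda>f. copair A (\<lambda>p. Dom A (f p)) (dsum A (\<lambda>p. Cod A (f p)))
       (\<lambda>p. dinj A (\<lambda>p. Cod A (f p)) p \<cdot>\<^bsub>A\<^esub> f p)),
     FMult = (\<lambda>X Y. THE h. h \<in> Hom A (dsum A X \<boxtimes>\<^bsub>A\<^esub> dsum A Y) (dsum A (gr_tensor A X Y)) \<and>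
       (\<forall>p q. h \<cdot>\<^bsub>A\<^esub> (dinj A X p \<boxdot>\<^bsub>A\<^esub> dinj A Y q) =
          dinj A (gr_tensor A X Y) (p + q) \<cdot>\<^bsub>A\<^esub> gr_inj A X Y (p + q) p)),
     FUnit = dinj A (gr_unit A) 0\<rparr>"

definition Ch_forget ::
  "('o, 'm) sm_cat \<Rightarrow>
    ((int \<Rightarrow> 'o, int \<Rightarrow> 'm) chain_complex, (int \<Rightarrow> 'o, int \<Rightarrow> 'm) chain_map,
     ('o, 'm) chain_complex, ('o, 'm) chain_map) lax_functor" where
  "Ch_forget A = ch_functor (gr A) A (forget_degree A)"

end

theory Submission
  imports Defs "HOL-Library.Product_Plus" "HOL-Library.Nat_Bijection"
begin

text \<open>In weight \<open>p\<close> of a pure complex of graded objects only the homology in degree \<open>p / \<alpha>\<close> survives.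
  Truncating weight \<open>p\<close> at that degree gives a subcomplex \<open>T X\<close> of \<open>X\<close> whose inclusion is a
  quasi-isomorphism, and which projects onto the homology of \<open>X\<close>, again by a quasi-isomorphism.
  If \<open>k \<ge> p / \<alpha>\<close> and \<open>l \<ge> q / \<alpha>\<close> then \<open>k + l \<ge> (p + q) / \<alpha>\<close>, and products of
  cycles are cycles; so the truncation is closed under the products and both maps are
  monoidal. Applying the exact functor that forgets the degree gives the zigzag
  \<open>U \<leftarrow> U \<circ> T \<rightarrow> H \<circ> U\<close>.

  The laxness of the functors is obtained by restriction to subfunctors and descent to quotients:
  \<open>U \<circ> T\<close> and the cycles of \<open>U\<close> are subfunctors of \<open>U\<close>, and \<open>H \<circ> U\<close> is a quotient of the cycles.\<close>

section \<open>Calculus in a category\<close>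

text \<open>The height \<open>p / \<alpha>\<close> of the cut may be fractional, and \<alpha> may be
  negative. Neither matters: multiplicativity only uses that \<open>p / \<alpha>\<close> is additive
  in \<open>p\<close>, and a weight with fractional \<open>p / \<alpha>\<close> has no homology at
  all. Projecting \<open>X\<close> itself onto the line \<open>p = \<alpha> * n\<close> would not
  respect products, since two points on opposite sides of the line can have their sum on it. Cutting
  off one side removes exactly this case. The projection of the truncation is first taken with
  values in the cycles of \<open>U X\<close>, where it is already multiplicative; it becomes
  compatible with differentials only after passing to classes. Sums, kernels and cokernels are
  chosen, independently in \<open>A\<close> and in \<open>gr A\<close>, so no two constructions
  agree on the nose. Structure maps are therefore compared on summands, and homology is compared
  through arbitrary kernels and cokernels. That summation over weights keeps quasi-isomorphisms
  rests on AB4, through the fact that direct sums then preserve kernels.\<close>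

lemma HomD:
  assumes "f \<in> Hom C X Y"
  shows "f \<in> Arr C" "Dom C f = X" "Cod C f = Y"
  using assms by (auto simp: Hom_def)

lemma Hom_iff: "f \<in> Hom C X Y \<longleftrightarrow> f \<in> Arr C \<and> Dom C f = X \<and> Cod C f = Y"
  by (auto simp: Hom_def)

lemma Arr_Hom: "f \<in> Arr C \<Longrightarrow> f \<in> Hom C (Dom C f) (Cod C f)"
  by (auto simp: Hom_def)

context category
begin

declare Dom_Obj [simp] Cod_Obj [simp]

lemma Hom_Obj: "f \<in> Hom C X Y \<Longrightarrow> X \<in> Obj C" "f \<in> Hom C X Y \<Longrightarrow> Y \<in> Obj C"
  using Dom_Obj Cod_Obj by (auto simp: Hom_def)

lemma Comp_Arr [simp]:
  assumes "f \<in> Arr C" "g \<in> Arr C" "Dom C g = Cod C f"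
  shows "g \<cdot> f \<in> Arr C" "Dom C (g \<cdot> f) = Dom C f" "Cod C (g \<cdot> f) = Cod C g"
  using Comp_Hom[of f "Dom C f" "Cod C f" g "Cod C g"] assms by (auto simp: Hom_def)

lemma Ident_Arr [simp]:
  assumes "X \<in> Obj C"
  shows "Ident C X \<in> Arr C" "Dom C (Ident C X) = X" "Cod C (Ident C X) = X"
  using Ident_Hom[OF assms] by (auto simp: Hom_def)

lemma Ident_left [simp]: "f \<in> Arr C \<Longrightarrow> Cod C f = Y \<Longrightarrow> Ident C Y \<cdot> f = f"
  using Comp_Ident_left[of f "Dom C f" Y] by (auto simp: Hom_def)

lemma Ident_right [simp]: "f \<in> Arr C \<Longrightarrow> Dom C f = X \<Longrightarrow> f \<cdot> Ident C X = f"
  using Comp_Ident_right[of f X "Cod C f"] by (auto simp: Hom_def)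

lemma assoc [simp]:
  assumes "f \<in> Arr C" "g \<in> Arr C" "h \<in> Arr C" "Dom C g = Cod C f" "Dom C h = Cod C g"
  shows "(h \<cdot> g) \<cdot> f = h \<cdot> (g \<cdot> f)"
  using Comp_assoc[of f "Dom C f" "Cod C f" g "Cod C g" h "Cod C h"] assms by (auto simp: Hom_def)

text \<open>Composites are kept associated to the right, so an equation for
  \<open>a \<cdot> b\<close> does not apply inside \<open>a \<cdot> b \<cdot> r\<close>. Instances
  of this rule supply the missing form.\<close>

lemma reassoc:
  assumes "a \<cdot> b = c" "a \<in> Arr C" "b \<in> Arr C" "Dom C a = Cod C b" "r \<in> Arr C" "Cod C r = Dom C b"
  shows "a \<cdot> b \<cdot> r = c \<cdot> r"
  using assms by (metis assoc)

lemma monicD: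
  assumes "monic C f" "f \<cdot> g = f \<cdot> h" "g \<in> Hom C W (Dom C f)" "h \<in> Hom C W (Dom C f)"
  shows "g = h"
  using assms Hom_Obj(1)[OF assms(3)] unfolding monic_def by blast

lemma epicD:
  assumes "epic C f" "g \<cdot> f = h \<cdot> f" "g \<in> Hom C (Cod C f) W" "h \<in> Hom C (Cod C f) W"
  shows "g = h"
  using assms Hom_Obj(2)[OF assms(3)] unfolding epic_def by blast

lemma epic_Arr: "epic C f \<Longrightarrow> f \<in> Arr C"
  by (simp add: epic_def)

lemma monic_Arr: "monic C f \<Longrightarrow> f \<in> Arr C"
  by (simp add: monic_def)

lemma epic_Comp:
  assumes "epic C f" "epic C g" "Dom C g = Cod C f"
  shows "epic C (g \<cdot> f)"
  unfolding epic_def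
proof (intro conjI ballI impI)
  have fg[simp]: "f \<in> Arr C" "g \<in> Arr C" using assms epic_Arr by auto
  show "g \<cdot> f \<in> Arr C" using assms by simp
  fix W a b
  assume W: "W \<in> Obj C" "a \<in> Hom C (Cod C (g \<cdot> f)) W" "b \<in> Hom C (Cod C (g \<cdot> f)) W"
    and e: "a \<cdot> g \<cdot> f = b \<cdot> g \<cdot> f"
  then have [simp]: "a \<in> Arr C" "b \<in> Arr C" "Dom C a = Cod C g" "Dom C b = Cod C g" "Cod C a = W" "Cod C b = W"
    using assms by (auto simp: Hom_iff)
  have "(a \<cdot> g) \<cdot> f = (b \<cdot> g) \<cdot> f" using e assms by simp
  then have "a \<cdot> g = b \<cdot> g"
    by (rule epicD[OF assms(1), where W=W]) (use assms in \<open>auto simp: Hom_iff\<close>)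
  then show "a = b"
    by (rule epicD[OF assms(2), where W=W]) (auto simp: Hom_iff)
qed

section \<open>Universal properties: coproducts, lifts and descents\<close>

lemma is_coproductD:
  assumes "is_coproduct C I F S inc"
  shows "S \<in> Obj C" "i \<in> I \<Longrightarrow> F i \<in> Obj C" "i \<in> I \<Longrightarrow> inc i \<in> Hom C (F i) S"
  using assms by (auto simp: is_coproduct_def)

lemma is_coproduct_ex:
  assumes "is_coproduct C I F S inc" "T \<in> Obj C" "\<And>i. i \<in> I \<Longrightarrow> g i \<in> Hom C (F i) T"
  obtains h where "h \<in> Hom C S T" "\<And>i. i \<in> I \<Longrightarrow> h \<cdot> inc i = g i"
proof -
  have "\<exists>!h. h \<in> Hom C S T \<and> (\<forall>i\<in>I. h \<cdot> inc i = g i)"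
    using assms unfolding is_coproduct_def by blast
  then show thesis using that by blast
qed

lemma is_coproduct_ext:
  assumes "is_coproduct C I F S inc" "h \<in> Hom C S T" "h' \<in> Hom C S T"
    "\<And>i. i \<in> I \<Longrightarrow> h \<cdot> inc i = h' \<cdot> inc i"
  shows "h = h'"
proof -
  have T: "T \<in> Obj C" using Hom_Obj assms by blast
  have "h \<cdot> inc i \<in> Hom C (F i) T" if "i \<in> I" for i
    using assms(2) is_coproductD(3)[OF assms(1) that] Comp_Hom by blast
  then have "\<exists>!k. k \<in> Hom C S T \<and> (\<forall>i\<in>I. k \<cdot> inc i = h \<cdot> inc i)"
    using assms(1) T unfolding is_coproduct_def
    by (elim conjE) (drule (1) bspec, drule spec[of _ "\<lambda>i. h \<cdot> inc i"], blast)
  then show ?thesis using assms by metis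
qed

lemma is_coproductI:
  assumes "S \<in> Obj C" "\<And>i. i \<in> I \<Longrightarrow> F i \<in> Obj C" "\<And>i. i \<in> I \<Longrightarrow> inc i \<in> Hom C (F i) S"
    and "\<And>T g. T \<in> Obj C \<Longrightarrow> (\<And>i. i \<in> I \<Longrightarrow> g i \<in> Hom C (F i) T)
      \<Longrightarrow> \<exists>h \<in> Hom C S T. \<forall>i\<in>I. h \<cdot> inc i = g i"
    and "\<And>T h h'. h \<in> Hom C S T \<Longrightarrow> h' \<in> Hom C S T \<Longrightarrow> (\<And>i. i \<in> I \<Longrightarrow> h \<cdot> inc i = h' \<cdot> inc i)
      \<Longrightarrow> h = h'"
  shows "is_coproduct C I F S inc"
  unfolding is_coproduct_def
proof (intro conjI ballI allI impI)
  fix T g assume T: "T \<in> Obj C" and g: "\<forall>i\<in>I. g i \<in> Hom C (F i) T"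
  obtain h where h: "h \<in> Hom C S T" "\<forall>i\<in>I. h \<cdot> inc i = g i"
    using assms(4)[OF T, of g] g by blast
  moreover have "h' = h" if "h' \<in> Hom C S T \<and> (\<forall>i\<in>I. h' \<cdot> inc i = g i)" for h'
    by (rule assms(5)) (use that h in auto)
  ultimately show "\<exists>!h. h \<in> Hom C S T \<and> (\<forall>i\<in>I. h \<cdot> inc i = g i)" by blast
qed (use assms in auto)

text \<open>\<open>lift_through\<close> is a definite description, meaningful only once uniqueness
  is known; a monic \<open>k\<close> provides it. Dually, an epic \<open>q\<close> serves
  \<open>descend_through\<close>.\<close>

lemma lift_through_eqI:
  assumes "monic C k" "h \<in> Hom C W (Dom C k)" "k \<cdot> h = f" "f \<in> Arr C"
  shows "lift_through C k f = h"
  unfolding lift_through_def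
proof (rule the_equality)
  have "k \<in> Arr C" using assms by (simp add: monic_def)
  then have "Dom C f = W" using assms by (auto simp: Hom_iff)
  then show hh: "h \<in> Hom C (Dom C f) (Dom C k) \<and> k \<cdot> h = f" using assms by auto
  fix h' assume h': "h' \<in> Hom C (Dom C f) (Dom C k) \<and> k \<cdot> h' = f"
  show "h' = h"
    by (rule monicD[OF assms(1)]) (use hh h' in auto)
qed

lemma descend_through_eqI:
  assumes "epic C q" "h \<in> Hom C (Cod C q) W" "h \<cdot> q = f" "f \<in> Arr C"
  shows "descend_through C q f = h"
  unfolding descend_through_def
proof (rule the_equality)
  have "q \<in> Arr C" using assms by (simp add: epic_def)
  then have "Cod C f = W" using assms by (auto simp: Hom_iff)
  then show hh: "h \<in> Hom C (Cod C q) (Cod C f) \<and> h \<cdot> q = f" using assms by auto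
  fix h' assume h': "h' \<in> Hom C (Cod C q) (Cod C f) \<and> h' \<cdot> q = f"
  show "h' = h"
    by (rule epicD[OF assms(1)]) (use hh h' in auto)
qed

end

section \<open>Additive structure\<close>

text \<open>The part of the abelian structure that is needed on both levels: it is verified for
  \<open>gr C\<close> as well, so signs, zero arrows, kernels and cokernels obey the same calculus
  in \<open>A\<close> and in graded objects.\<close>

locale preadditive_category = category C
  for C :: "('o, 'm, 'z) add_cat_scheme" (structure) +
  assumes comm_group_Hom: "X \<in> Obj C \<Longrightarrow> Y \<in> Obj C \<Longrightarrow> comm_group (hom_group C X Y)"
    and distrib_left: "f \<in> Hom C Y Z \<Longrightarrow> g \<in> Hom C Y Z \<Longrightarrow> h \<in> Hom C X Y
      \<Longrightarrow> (f \<ddagger> g) \<cdot> h = (f \<cdot> h) \<ddagger> (g \<cdot> h)"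
    and distrib_right: "f \<in> Hom C X Y \<Longrightarrow> g \<in> Hom C X Y \<Longrightarrow> h \<in> Hom C Y Z
      \<Longrightarrow> h \<cdot> (f \<ddagger> g) = (h \<cdot> f) \<ddagger> (h \<cdot> g)"
    and ex_zero_object: "\<exists>Z. zero_object C Z"

sublocale abelian_category \<subseteq> preadditive_category
  by (rule preadditive_category.intro[OF category_axioms], rule preadditive_category_axioms.intro)
    (use hom_comm_group Comp_Add_left Comp_Add_right has_zero_object in auto)

context preadditive_category
begin

section \<open>Arithmetic of arrows: zeros, negatives and signs\<close>

lemma Zero_Arr [simp]:
  assumes "X \<in> Obj C" "Y \<in> Obj C"
  shows "Zero C X Y \<in> Arr C" (is ?A) "Dom C (Zero C X Y) = X" (is ?B) "Cod C (Zero C X Y) = Y" (is ?C)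
proof -
  interpret comm_group "hom_group C X Y" using comm_group_Hom assms .
  have "Zero C X Y \<in> Hom C X Y" using one_closed by (simp add: hom_group_def)
  then show ?A ?B ?C
    by (auto simp: Hom_iff)
qed

lemma Add_Arr [simp]:
  assumes "f \<in> Arr C" "g \<in> Arr C" "Dom C g = Dom C f" "Cod C g = Cod C f"
  shows "f \<ddagger> g \<in> Arr C" (is ?A) "Dom C (f \<ddagger> g) = Dom C f" (is ?B) "Cod C (f \<ddagger> g) = Cod C f" (is ?C)
proof -
  interpret comm_group "hom_group C (Dom C f) (Cod C f)" using comm_group_Hom assms Dom_Obj Cod_Obj by blast
  have "f \<ddagger> g \<in> Hom C (Dom C f) (Cod C f)" using m_closed[of f g] assms
    by (simp add: hom_group_def Hom_iff)
  then show ?A ?B ?C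
    by (auto simp: Hom_iff)
qed

lemma neg_Arr [simp]:
  assumes "f \<in> Arr C"
  shows "neg C f \<in> Arr C" (is ?A) "Dom C (neg C f) = Dom C f" (is ?B) "Cod C (neg C f) = Cod C f" (is ?C)
proof -
  interpret comm_group "hom_group C (Dom C f) (Cod C f)" using comm_group_Hom assms Dom_Obj Cod_Obj by blast
  have "neg C f \<in> Hom C (Dom C f) (Cod C f)" using inv_closed[of f] assms
    by (simp add: hom_group_def Hom_iff neg_def)
  then show ?A ?B ?C
    by (auto simp: Hom_iff)
qed

lemma Add_assoc [simp]:
  assumes "f \<in> Arr C" "g \<in> Arr C" "h \<in> Arr C" "Dom C g = Dom C f" "Cod C g = Cod C f"
    "Dom C h = Dom C f" "Cod C h = Cod C f"
  shows "f \<ddagger> g \<ddagger> h = f \<ddagger> (g \<ddagger> h)"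
proof -
  interpret comm_group "hom_group C (Dom C f) (Cod C f)" using comm_group_Hom assms Dom_Obj Cod_Obj by blast
  show ?thesis using m_assoc[of f g h] assms by (simp add: hom_group_def Hom_iff)
qed

lemma Add_commute:
  assumes "f \<in> Arr C" "g \<in> Arr C" "Dom C g = Dom C f" "Cod C g = Cod C f"
  shows "f \<ddagger> g = g \<ddagger> f"
proof -
  interpret comm_group "hom_group C (Dom C f) (Cod C f)" using comm_group_Hom assms Dom_Obj Cod_Obj by blast
  show ?thesis using m_comm[of f g] assms by (simp add: hom_group_def Hom_iff)
qed

lemma Add_left_commute:
  assumes "f \<in> Arr C" "g \<in> Arr C" "h \<in> Arr C" "Dom C g = Dom C f" "Cod C g = Cod C f"
    "Dom C h = Dom C f" "Cod C h = Cod C f"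
  shows "f \<ddagger> (g \<ddagger> h) = g \<ddagger> (f \<ddagger> h)"
  using assms by (metis Add_assoc Add_commute)

lemma Add_Zero [simp]:
  assumes "f \<in> Arr C" "Dom C f = X" "Cod C f = Y"
  shows "f \<ddagger> Zero C X Y = f" (is ?A) "Zero C X Y \<ddagger> f = f" (is ?B)
proof -
  interpret comm_group "hom_group C X Y" using comm_group_Hom assms Dom_Obj Cod_Obj by blast
  show ?A ?B
    using r_one[of f] l_one[of f] assms by (simp_all add: hom_group_def Hom_iff)
qed

lemma Add_neg [simp]:
  assumes "f \<in> Arr C"
  shows "f \<ddagger> neg C f = Zero C (Dom C f) (Cod C f)" (is ?A) "neg C f \<ddagger> f = Zero C (Dom C f) (Cod C f)" (is ?B)
proof -
  interpret comm_group "hom_group C (Dom C f) (Cod C f)" using comm_group_Hom assms Dom_Obj Cod_Obj by blast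
  show ?A ?B
    using r_inv[of f] l_inv[of f] assms by (simp_all add: hom_group_def Hom_iff neg_def)
qed

lemma neg_unique:
  assumes "f \<in> Arr C" "g \<in> Arr C" "Dom C g = Dom C f" "Cod C g = Cod C f"
    "f \<ddagger> g = Zero C (Dom C f) (Cod C f)"
  shows "neg C f = g"
proof -
  have "neg C f = neg C f \<ddagger> (f \<ddagger> g)" using assms Dom_Obj Cod_Obj by simp
  also have "\<dots> = (neg C f \<ddagger> f) \<ddagger> g" using assms by (simp del: Add_neg)
  also have "\<dots> = g" using assms by simp
  finally show ?thesis .
qed

text \<open>The only idempotent of a group is its unit; applied to \<open>h \<cdot> 0\<close> and
  \<open>h \<boxdot> 0\<close>, this derives the rules for zero arrows from additivity.\<close>

lemma Add_cancel_Zero: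
  assumes "f \<in> Arr C" "Dom C f = X" "Cod C f = Y" "f \<ddagger> f = f"
  shows "f = Zero C X Y"
proof -
  have "f = f \<ddagger> (f \<ddagger> neg C f)" using assms by simp
  also have "\<dots> = (f \<ddagger> f) \<ddagger> neg C f" by (rule Add_assoc[symmetric]) (use assms in simp_all)
  also have "\<dots> = Zero C X Y" unfolding assms(4) using assms by simp
  finally show ?thesis .
qed

lemma Comp_Add [simp]:
  assumes "f \<in> Arr C" "g \<in> Arr C" "Dom C g = Dom C f" "Cod C g = Cod C f" "h \<in> Arr C"
  shows "Dom C h = Cod C f \<Longrightarrow> h \<cdot> (f \<ddagger> g) = (h \<cdot> f) \<ddagger> (h \<cdot> g)"
    "Cod C h = Dom C f \<Longrightarrow> (f \<ddagger> g) \<cdot> h = (f \<cdot> h) \<ddagger> (g \<cdot> h)"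
  using distrib_right[of f "Dom C f" "Cod C f" g h "Cod C h"]
    distrib_left[of f "Dom C f" "Cod C f" g h "Dom C h"] assms by (auto simp: Hom_iff)

lemma Comp_Zero [simp]:
  assumes "f \<in> Arr C" "X \<in> Obj C"
  shows "Dom C f = Y \<Longrightarrow> f \<cdot> Zero C X Y = Zero C X (Cod C f)"
    "Cod C f = Y \<Longrightarrow> Zero C Y X \<cdot> f = Zero C (Dom C f) X"
proof -
  assume [simp]: "Dom C f = Y"
  have Y[simp]: "Y \<in> Obj C" using Dom_Obj[OF assms(1)] by simp
  have "f \<cdot> (Zero C X Y \<ddagger> Zero C X Y) = f \<cdot> Zero C X Y \<ddagger> f \<cdot> Zero C X Y"
    by (rule Comp_Add) (use assms in auto)
  then show "f \<cdot> Zero C X Y = Zero C X (Cod C f)"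
    by (intro Add_cancel_Zero) (use assms in auto)
next
  assume [simp]: "Cod C f = Y"
  have Y[simp]: "Y \<in> Obj C" using Cod_Obj[OF assms(1)] by simp
  have "(Zero C Y X \<ddagger> Zero C Y X) \<cdot> f = Zero C Y X \<cdot> f \<ddagger> Zero C Y X \<cdot> f"
    by (rule Comp_Add) (use assms in auto)
  then show "Zero C Y X \<cdot> f = Zero C (Dom C f) X"
    by (intro Add_cancel_Zero) (use assms in auto)
qed

lemma Comp_neg [simp]:
  assumes [simp]: "f \<in> Arr C" "g \<in> Arr C" "Dom C g = Cod C f"
  shows "g \<cdot> neg C f = neg C (g \<cdot> f)" (is ?A) "neg C g \<cdot> f = neg C (g \<cdot> f)" (is ?B)
proof -
  have "g \<cdot> f \<ddagger> g \<cdot> neg C f = g \<cdot> (f \<ddagger> neg C f)"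
    by (rule Comp_Add(1)[symmetric]) auto
  then have "neg C (g \<cdot> f) = g \<cdot> neg C f"
    by (intro neg_unique) (auto simp: Dom_Obj Cod_Obj)
  then show ?A by simp
  have "g \<cdot> f \<ddagger> neg C g \<cdot> f = (g \<ddagger> neg C g) \<cdot> f"
    by (rule Comp_Add(2)[symmetric]) auto
  then have "neg C (g \<cdot> f) = neg C g \<cdot> f"
    by (intro neg_unique) (auto simp: Dom_Obj Cod_Obj)
  then show ?B by simp
qed

lemma neg_neg [simp]: "f \<in> Arr C \<Longrightarrow> neg C (neg C f) = f"
  by (rule neg_unique) auto

lemma neg_Zero [simp]: "X \<in> Obj C \<Longrightarrow> Y \<in> Obj C \<Longrightarrow> neg C (Zero C X Y) = Zero C X Y"
  by (rule neg_unique) auto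

lemma neg_Add [simp]:
  assumes "f \<in> Arr C" "g \<in> Arr C" "Dom C g = Dom C f" "Cod C g = Cod C f"
  shows "neg C (f \<ddagger> g) = neg C f \<ddagger> neg C g"
proof (rule neg_unique)
  have "f \<ddagger> g \<ddagger> (neg C f \<ddagger> neg C g) = f \<ddagger> (neg C f \<ddagger> (g \<ddagger> neg C g))"
    using assms by (simp add: Add_left_commute[of g] del: Add_neg)
  also have "\<dots> = Zero C (Dom C f) (Cod C f)"
    using assms by simp
  finally show "f \<ddagger> g \<ddagger> (neg C f \<ddagger> neg C g) = Zero C (Dom C (f \<ddagger> g)) (Cod C (f \<ddagger> g))"
    using assms by simp
qed (use assms in auto)

lemma signed_Arr [simp]:
  assumes "f \<in> Arr C"
  shows "signed C k f \<in> Arr C" "Dom C (signed C k f) = Dom C f" "Cod C (signed C k f) = Cod C f"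
  using assms by (auto simp: signed_def)

lemma signed_Comp [simp]:
  assumes "f \<in> Arr C" "g \<in> Arr C" "Dom C g = Cod C f"
  shows "g \<cdot> signed C k f = signed C k (g \<cdot> f)" "signed C k g \<cdot> f = signed C k (g \<cdot> f)"
  using assms by (auto simp: signed_def)

lemma signed_signed [simp]: "f \<in> Arr C \<Longrightarrow> signed C j (signed C k f) = signed C (j + k) f"
  by (auto simp: signed_def)

lemma signed_Zero [simp]: "X \<in> Obj C \<Longrightarrow> Y \<in> Obj C \<Longrightarrow> signed C k (Zero C X Y) = Zero C X Y"
  by (auto simp: signed_def)

lemma signed_zero [simp]: "signed C 0 f = f"
  by (simp add: signed_def)

lemma signed_Add [simp]:
  assumes "f \<in> Arr C" "g \<in> Arr C" "Dom C g = Dom C f" "Cod C g = Cod C f"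
  shows "signed C k (f \<ddagger> g) = signed C k f \<ddagger> signed C k g"
  using assms by (auto simp: signed_def)

lemma signed_parity: "even j \<longleftrightarrow> even k \<Longrightarrow> signed C j f = signed C k f"
  by (auto simp: signed_def)

lemma signed_Add_opposite:
  assumes "f \<in> Arr C" "odd (j + k)"
  shows "signed C j f \<ddagger> signed C k f = Zero C (Dom C f) (Cod C f)"
  using assms by (auto simp: signed_def)

section \<open>Monomorphisms, zero objects, kernels and cokernels\<close>

lemma monicI_Zero:
  assumes "f \<in> Arr C"
    and "\<And>W g. W \<in> Obj C \<Longrightarrow> g \<in> Hom C W (Dom C f) \<Longrightarrow> f \<cdot> g = Zero C W (Cod C f) \<Longrightarrow> g = Zero C W (Dom C f)"
  shows "monic C f"
  unfolding monic_def
proof (intro conjI ballI impI)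
  fix W g h assume W: "W \<in> Obj C" "g \<in> Hom C W (Dom C f)" "h \<in> Hom C W (Dom C f)" and e: "f \<cdot> g = f \<cdot> h"
  then have [simp]: "g \<in> Arr C" "h \<in> Arr C" "Dom C g = W" "Dom C h = W" "Cod C g = Dom C f" "Cod C h = Dom C f"
    by (auto simp: Hom_iff)
  have "f \<cdot> (g \<ddagger> neg C h) = Zero C W (Cod C f)" using e assms(1) by simp
  then have "g \<ddagger> neg C h = Zero C W (Dom C f)"
    using assms W by (intro assms(2)) (auto simp: Hom_iff)
  then have "neg C g = neg C h"
    by (intro neg_unique) auto
  then have "neg C (neg C g) = neg C (neg C h)" by simp
  then show "g = h" by (simp only: neg_neg \<open>g \<in> Arr C\<close> \<open>h \<in> Arr C\<close>)
qed (use assms in simp)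

lemma is_kernelD:
  assumes "is_kernel C f k"
  shows "f \<in> Arr C" "k \<in> Arr C" "Cod C k = Dom C f" "f \<cdot> k = Zero C (Dom C k) (Cod C f)"
  using assms by (auto simp: is_kernel_def)

lemma is_kernel_lift:
  assumes "is_kernel C f k" "g \<in> Hom C W (Dom C f)" "f \<cdot> g = Zero C W (Cod C f)"
  obtains h where "h \<in> Hom C W (Dom C k)" "k \<cdot> h = g"
  using assms Hom_Obj(1)[OF assms(2)] unfolding is_kernel_def by blast

lemma is_kernel_monic:
  assumes "is_kernel C f k"
  shows "monic C k"
  unfolding monic_def
proof (intro conjI ballI impI)
  note k[simp] = is_kernelD[OF assms]
  fix W g h assume W: "W \<in> Obj C" "g \<in> Hom C W (Dom C k)" "h \<in> Hom C W (Dom C k)" and e: "k \<cdot> g = k \<cdot> h"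
  have kg: "k \<cdot> g \<in> Hom C W (Dom C f)" using W by (auto simp: Hom_iff)
  have "f \<cdot> k \<cdot> g = Zero C W (Cod C f)"
    using reassoc[OF k(4), of g] W Cod_Obj by (auto simp: Hom_iff)
  then have "\<exists>!h. h \<in> Hom C W (Dom C k) \<and> k \<cdot> h = k \<cdot> g"
    using assms W kg unfolding is_kernel_def by blast
  then show "g = h" using e W by metis
qed (use is_kernelD[OF assms] in simp)

lemma is_kernelI:
  assumes "f \<in> Arr C" "monic C k" "Cod C k = Dom C f" "f \<cdot> k = Zero C (Dom C k) (Cod C f)"
    and "\<And>W g. g \<in> Hom C W (Dom C f) \<Longrightarrow> f \<cdot> g = Zero C W (Cod C f) \<Longrightarrow> \<exists>h \<in> Hom C W (Dom C k). k \<cdot> h = g"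
  shows "is_kernel C f k"
  unfolding is_kernel_def
proof (intro conjI ballI impI)
  show "k \<in> Arr C" using assms(2) by (simp add: monic_def)
  fix W g assume W: "W \<in> Obj C" and g: "g \<in> Hom C W (Dom C f)" "f \<cdot> g = Zero C W (Cod C f)"
  from assms(5)[OF g] obtain h where h: "h \<in> Hom C W (Dom C k)" "k \<cdot> h = g" by blast
  then show "\<exists>!h. h \<in> Hom C W (Dom C k) \<and> k \<cdot> h = g"
    by (intro ex1I[of _ h]) (auto intro: monicD[OF assms(2)])
qed (use assms in auto)

lemma is_cokernelD:
  assumes "is_cokernel C f q"
  shows "f \<in> Arr C" "q \<in> Arr C" "Dom C q = Cod C f" "q \<cdot> f = Zero C (Dom C f) (Cod C q)"
  using assms by (auto simp: is_cokernel_def)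

lemma is_cokernel_descend:
  assumes "is_cokernel C f q" "g \<in> Hom C (Cod C f) W" "g \<cdot> f = Zero C (Dom C f) W"
  obtains h where "h \<in> Hom C (Cod C q) W" "h \<cdot> q = g"
  using assms Hom_Obj(2)[OF assms(2)] unfolding is_cokernel_def by blast

lemma is_cokernel_epic:
  assumes "is_cokernel C f q"
  shows "epic C q"
  unfolding epic_def
proof (intro conjI ballI impI)
  note k[simp] = is_cokernelD[OF assms]
  fix W g h assume W: "W \<in> Obj C" "g \<in> Hom C (Cod C q) W" "h \<in> Hom C (Cod C q) W" and e: "g \<cdot> q = h \<cdot> q"
  have kg: "g \<cdot> q \<in> Hom C (Cod C f) W" using W by (auto simp: Hom_iff)
  have "(g \<cdot> q) \<cdot> f = Zero C (Dom C f) W"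
    using W Dom_Obj by (auto simp: Hom_iff)
  then have "\<exists>!h. h \<in> Hom C (Cod C q) W \<and> h \<cdot> q = g \<cdot> q"
    using assms W kg unfolding is_cokernel_def by blast
  then show "g = h" using e W by metis
qed (use is_cokernelD[OF assms] in simp)

lemma is_cokernelI:
  assumes "f \<in> Arr C" "epic C q" "Dom C q = Cod C f" "q \<cdot> f = Zero C (Dom C f) (Cod C q)"
    and "\<And>W g. g \<in> Hom C (Cod C f) W \<Longrightarrow> g \<cdot> f = Zero C (Dom C f) W \<Longrightarrow> \<exists>h \<in> Hom C (Cod C q) W. h \<cdot> q = g"
  shows "is_cokernel C f q"
  unfolding is_cokernel_def
proof (intro conjI ballI impI)
  show "q \<in> Arr C" using assms(2) by (simp add: epic_def)
  fix W g assume W: "W \<in> Obj C" and g: "g \<in> Hom C (Cod C f) W" "g \<cdot> f = Zero C (Dom C f) W"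
  from assms(5)[OF g] obtain h where h: "h \<in> Hom C (Cod C q) W" "h \<cdot> q = g" by blast
  then show "\<exists>!h. h \<in> Hom C (Cod C q) W \<and> h \<cdot> q = g"
    by (intro ex1I[of _ h]) (auto intro: epicD[OF assms(2)])
qed (use assms in auto)

text \<open>An equation in place of a universal property: in this form being zero passes to tensor
  products and to components of graded objects by computation.\<close>

lemma zero_object_iff:
  "zero_object C Z \<longleftrightarrow> Z \<in> Obj C \<and> Ident C Z = Zero C Z Z"
proof
  assume Z: "zero_object C Z"
  then have "Z \<in> Obj C" by (simp add: zero_object_def)
  moreover have "Ident C Z \<in> Hom C Z Z" "Zero C Z Z \<in> Hom C Z Z" using calculation by (auto simp: Hom_iff)
  ultimately show "Z \<in> Obj C \<and> Ident C Z = Zero C Z Z" using Z unfolding zero_object_def by blast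
next
  assume Z: "Z \<in> Obj C \<and> Ident C Z = Zero C Z Z"
  have "f = Zero C X Z" if "f \<in> Hom C X Z" for X f
    using that Z Comp_Zero(2)[of f Z Z] Ident_left[of f Z] by (auto simp: Hom_iff)
  moreover have "f = Zero C Z X" if "f \<in> Hom C Z X" for X f
    using that Z Comp_Zero(1)[of f Z Z] Ident_right[of f Z] by (auto simp: Hom_iff)
  moreover have "Zero C X Z \<in> Hom C X Z" "Zero C Z X \<in> Hom C Z X" if "X \<in> Obj C" for X
    using Z that by (auto simp: Hom_iff)
  ultimately show "zero_object C Z" using Z unfolding zero_object_def by metis
qed

lemma zero_object_Arr:
  assumes "zero_object C Z" "f \<in> Arr C"
  shows "Dom C f = Z \<Longrightarrow> f = Zero C Z (Cod C f)" "Cod C f = Z \<Longrightarrow> f = Zero C (Dom C f) Z"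
proof -
  have Z: "Z \<in> Obj C" "Ident C Z = Zero C Z Z" using assms by (auto simp: zero_object_iff)
  show "f = Zero C Z (Cod C f)" if "Dom C f = Z"
    using Comp_Zero(1)[of f Z Z] Ident_right[of f Z] Z assms that by auto
  show "f = Zero C (Dom C f) Z" if "Cod C f = Z"
    using Comp_Zero(2)[of f Z Z] Ident_left[of f Z] Z assms that by auto
qed

lemma zero_object_zero_ob: "zero_object C (zero_ob C)"
  unfolding zero_ob_def using ex_zero_object by (rule someI_ex)

lemma zero_ob_Obj [simp]: "zero_ob C \<in> Obj C"
  using zero_object_zero_ob by (simp add: zero_object_def)

lemma is_kernel_lift_through:
  assumes "is_kernel C f k" "g \<in> Hom C W (Dom C f)" "f \<cdot> g = Zero C W (Cod C f)"
  shows "lift_through C k g \<in> Hom C W (Dom C k)" (is ?A) "k \<cdot> lift_through C k g = g" (is ?B)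
proof -
  obtain h where h: "h \<in> Hom C W (Dom C k)" "k \<cdot> h = g" using is_kernel_lift assms by metis
  have "lift_through C k g = h"
    by (rule lift_through_eqI) (use h assms is_kernel_monic in \<open>auto simp: Hom_iff\<close>)
  then show ?A ?B using h by auto
qed

lemma is_cokernel_descend_through:
  assumes "is_cokernel C f q" "g \<in> Hom C (Cod C f) W" "g \<cdot> f = Zero C (Dom C f) W"
  shows "descend_through C q g \<in> Hom C (Cod C q) W" (is ?A) "descend_through C q g \<cdot> q = g" (is ?B)
proof -
  obtain h where h: "h \<in> Hom C (Cod C q) W" "h \<cdot> q = g" using is_cokernel_descend assms by metis
  have "descend_through C q g = h"
    by (rule descend_through_eqI) (use h assms is_cokernel_epic in \<open>auto simp: Hom_iff\<close>)
  then show ?A ?B using h by auto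
qed

end

section \<open>Tensor categories with countable direct sums\<close>

text \<open>No coherence axioms: the laxness of functors only involves functoriality and naturality.\<close>

locale tensor_sum_category = preadditive_category C
  for C :: "('o, 'm) sm_cat" (structure) +
  assumes Unit_in [simp]: "Unit C \<in> Obj C"
    and Tensor_in [simp]: "X \<in> Obj C \<Longrightarrow> Y \<in> Obj C \<Longrightarrow> X \<boxtimes> Y \<in> Obj C"
    and tensor_Hom: "f \<in> Hom C X X' \<Longrightarrow> g \<in> Hom C Y Y' \<Longrightarrow> f \<boxdot> g \<in> Hom C (X \<boxtimes> Y) (X' \<boxtimes> Y')"
    and tensor_Ident [simp]: "X \<in> Obj C \<Longrightarrow> Y \<in> Obj C \<Longrightarrow> Ident C X \<boxdot> Ident C Y = Ident C (X \<boxtimes> Y)"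
    and tensor_Comp_Hom: "f \<in> Hom C X X' \<Longrightarrow> f' \<in> Hom C X' X'' \<Longrightarrow> g \<in> Hom C Y Y' \<Longrightarrow> g' \<in> Hom C Y' Y''
      \<Longrightarrow> (f' \<cdot> f) \<boxdot> (g' \<cdot> g) = (f' \<boxdot> g') \<cdot> (f \<boxdot> g)"
    and tensor_Add_left_Hom: "f \<in> Hom C X Y \<Longrightarrow> g \<in> Hom C X Y \<Longrightarrow> h \<in> Hom C Z W
      \<Longrightarrow> (f \<ddagger> g) \<boxdot> h = (f \<boxdot> h) \<ddagger> (g \<boxdot> h)"
    and tensor_Add_right_Hom: "f \<in> Hom C X Y \<Longrightarrow> g \<in> Hom C X Y \<Longrightarrow> h \<in> Hom C Z W
      \<Longrightarrow> h \<boxdot> (f \<ddagger> g) = (h \<boxdot> f) \<ddagger> (h \<boxdot> g)"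
    and assoc_Hom: "X \<in> Obj C \<Longrightarrow> Y \<in> Obj C \<Longrightarrow> Z \<in> Obj C
      \<Longrightarrow> Assoc C X Y Z \<in> Hom C ((X \<boxtimes> Y) \<boxtimes> Z) (X \<boxtimes> (Y \<boxtimes> Z))"
    and assoc_natural: "f \<in> Hom C X X' \<Longrightarrow> g \<in> Hom C Y Y' \<Longrightarrow> h \<in> Hom C Z Z'
      \<Longrightarrow> Assoc C X' Y' Z' \<cdot> ((f \<boxdot> g) \<boxdot> h) = (f \<boxdot> (g \<boxdot> h)) \<cdot> Assoc C X Y Z"
    and lunit_Hom: "X \<in> Obj C \<Longrightarrow> LUnit C X \<in> Hom C (Unit C \<boxtimes> X) X"
    and lunit_natural: "f \<in> Hom C X Y \<Longrightarrow> LUnit C Y \<cdot> (Ident C (Unit C) \<boxdot> f) = f \<cdot> LUnit C X"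
    and runit_Hom: "X \<in> Obj C \<Longrightarrow> RUnit C X \<in> Hom C (X \<boxtimes> Unit C) X"
    and runit_natural: "f \<in> Hom C X Y \<Longrightarrow> RUnit C Y \<cdot> (f \<boxdot> Ident C (Unit C)) = f \<cdot> RUnit C X"
    and sym_Hom: "X \<in> Obj C \<Longrightarrow> Y \<in> Obj C \<Longrightarrow> Sym C X Y \<in> Hom C (X \<boxtimes> Y) (Y \<boxtimes> X)"
    and sym_natural: "f \<in> Hom C X X' \<Longrightarrow> g \<in> Hom C Y Y'
      \<Longrightarrow> Sym C X' Y' \<cdot> (f \<boxdot> g) = (g \<boxdot> f) \<cdot> Sym C X Y"
    and int_coproducts: "(\<And>i. F i \<in> Obj C) \<Longrightarrow> \<exists>S inc. is_coproduct C (UNIV :: int set) F S inc"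
    and tensor_coproduct_left: "is_coproduct C (UNIV :: int set) F S inc \<Longrightarrow> X \<in> Obj C
      \<Longrightarrow> is_coproduct C UNIV (\<lambda>i. F i \<boxtimes> X) (S \<boxtimes> X) (\<lambda>i. inc i \<boxdot> Ident C X)"
    and tensor_coproduct_right: "is_coproduct C (UNIV :: int set) F S inc \<Longrightarrow> X \<in> Obj C
      \<Longrightarrow> is_coproduct C UNIV (\<lambda>i. X \<boxtimes> F i) (X \<boxtimes> S) (\<lambda>i. Ident C X \<boxdot> inc i)"
begin

lemma tensor_Arr [simp]:
  assumes "f \<in> Arr C" "g \<in> Arr C"
  shows "f \<boxdot> g \<in> Arr C" "Dom C (f \<boxdot> g) = Dom C f \<boxtimes> Dom C g" "Cod C (f \<boxdot> g) = Cod C f \<boxtimes> Cod C g"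
  using tensor_Hom[OF Arr_Hom Arr_Hom, OF assms] by (auto simp: Hom_iff)

text \<open>Fixes the normal form: composites of tensors are merged into one tensor of composites.
  Later rules about inclusions of summands are stated for the merged shapes.\<close>

lemma tensor_Comp [simp]:
  assumes "f \<in> Arr C" "f' \<in> Arr C" "g \<in> Arr C" "g' \<in> Arr C" "Dom C f' = Cod C f" "Dom C g' = Cod C g"
  shows "(f' \<boxdot> g') \<cdot> (f \<boxdot> g) = (f' \<cdot> f) \<boxdot> (g' \<cdot> g)"
  by (rule sym, rule tensor_Comp_Hom) (use assms in \<open>auto simp: Hom_iff\<close>)

lemma tensor_Comp_reassoc [simp]:
  assumes "f \<in> Arr C" "f' \<in> Arr C" "g \<in> Arr C" "g' \<in> Arr C" "Dom C f' = Cod C f" "Dom C g' = Cod C g"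
    "r \<in> Arr C" "Cod C r = Dom C f \<boxtimes> Dom C g"
  shows "(f' \<boxdot> g') \<cdot> (f \<boxdot> g) \<cdot> r = ((f' \<cdot> f) \<boxdot> (g' \<cdot> g)) \<cdot> r"
  by (rule reassoc[OF tensor_Comp]) (use assms in auto)

lemma tensor_Add [simp]:
  assumes "f \<in> Arr C" "g \<in> Arr C" "Dom C g = Dom C f" "Cod C g = Cod C f" "h \<in> Arr C"
  shows "(f \<ddagger> g) \<boxdot> h = (f \<boxdot> h) \<ddagger> (g \<boxdot> h)" "h \<boxdot> (f \<ddagger> g) = (h \<boxdot> f) \<ddagger> (h \<boxdot> g)"
  by (rule tensor_Add_left_Hom tensor_Add_right_Hom; use assms in \<open>auto simp: Hom_iff\<close>)+

lemma tensor_Zero [simp]: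
  assumes [simp]: "f \<in> Arr C" "X \<in> Obj C" "Y \<in> Obj C"
  shows "f \<boxdot> Zero C X Y = Zero C (Dom C f \<boxtimes> X) (Cod C f \<boxtimes> Y)" (is ?A)
    "Zero C X Y \<boxdot> f = Zero C (X \<boxtimes> Dom C f) (Y \<boxtimes> Cod C f)" (is ?B)
proof -
  have "f \<boxdot> (Zero C X Y \<ddagger> Zero C X Y) = f \<boxdot> Zero C X Y \<ddagger> f \<boxdot> Zero C X Y"
    "(Zero C X Y \<ddagger> Zero C X Y) \<boxdot> f = Zero C X Y \<boxdot> f \<ddagger> Zero C X Y \<boxdot> f"
    by (rule tensor_Add; simp)+
  then show ?A ?B
    by (intro Add_cancel_Zero; simp)+
qed

lemma tensor_neg [simp]:
  assumes [simp]: "f \<in> Arr C" "g \<in> Arr C"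
  shows "f \<boxdot> neg C g = neg C (f \<boxdot> g)" (is ?A) "neg C f \<boxdot> g = neg C (f \<boxdot> g)" (is ?B)
proof -
  have "f \<boxdot> (g \<ddagger> neg C g) = f \<boxdot> g \<ddagger> f \<boxdot> neg C g" "(f \<ddagger> neg C f) \<boxdot> g = f \<boxdot> g \<ddagger> neg C f \<boxdot> g"
    by (rule tensor_Add; simp)+
  then have "neg C (f \<boxdot> g) = f \<boxdot> neg C g" "neg C (f \<boxdot> g) = neg C f \<boxdot> g"
    by (intro neg_unique; simp add: Dom_Obj Cod_Obj)+
  then show ?A ?B by simp_all
qed

lemma tensor_signed [simp]:
  assumes [simp]: "f \<in> Arr C" "g \<in> Arr C"
  shows "f \<boxdot> signed C k g = signed C k (f \<boxdot> g)" "signed C k f \<boxdot> g = signed C k (f \<boxdot> g)"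
  by (auto simp: signed_def)

lemma Assoc_Arr [simp]:
  assumes "X \<in> Obj C" "Y \<in> Obj C" "Z \<in> Obj C"
  shows "Assoc C X Y Z \<in> Arr C" "Dom C (Assoc C X Y Z) = (X \<boxtimes> Y) \<boxtimes> Z"
    "Cod C (Assoc C X Y Z) = X \<boxtimes> (Y \<boxtimes> Z)"
  using assoc_Hom[OF assms] by (auto simp: Hom_iff)

lemma Assoc_tensor:
  assumes "f \<in> Arr C" "g \<in> Arr C" "h \<in> Arr C" "Cod C f = X" "Cod C g = Y" "Cod C h = Z"
  shows "Assoc C X Y Z \<cdot> ((f \<boxdot> g) \<boxdot> h) = (f \<boxdot> (g \<boxdot> h)) \<cdot> Assoc C (Dom C f) (Dom C g) (Dom C h)"
  by (rule assoc_natural) (use assms in \<open>auto simp: Hom_iff\<close>)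

lemma LUnit_Arr [simp]:
  assumes "X \<in> Obj C"
  shows "LUnit C X \<in> Arr C" "Dom C (LUnit C X) = Unit C \<boxtimes> X" "Cod C (LUnit C X) = X"
    "RUnit C X \<in> Arr C" "Dom C (RUnit C X) = X \<boxtimes> Unit C" "Cod C (RUnit C X) = X"
  using lunit_Hom[OF assms] runit_Hom[OF assms] by (auto simp: Hom_iff)

lemma LUnit_tensor:
  "f \<in> Arr C \<Longrightarrow> Cod C f = Y \<Longrightarrow> LUnit C Y \<cdot> (Ident C (Unit C) \<boxdot> f) = f \<cdot> LUnit C (Dom C f)"
  by (rule lunit_natural) (auto simp: Hom_iff)

lemma RUnit_tensor:
  "f \<in> Arr C \<Longrightarrow> Cod C f = Y \<Longrightarrow> RUnit C Y \<cdot> (f \<boxdot> Ident C (Unit C)) = f \<cdot> RUnit C (Dom C f)"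
  by (rule runit_natural) (auto simp: Hom_iff)

lemma Sym_Arr [simp]:
  assumes "X \<in> Obj C" "Y \<in> Obj C"
  shows "Sym C X Y \<in> Arr C" "Dom C (Sym C X Y) = X \<boxtimes> Y" "Cod C (Sym C X Y) = Y \<boxtimes> X"
  using sym_Hom[OF assms] by (auto simp: Hom_iff)

lemma Sym_tensor:
  assumes "f \<in> Arr C" "g \<in> Arr C" "Cod C f = X" "Cod C g = Y"
  shows "Sym C X Y \<cdot> (f \<boxdot> g) = (g \<boxdot> f) \<cdot> Sym C (Dom C f) (Dom C g)"
  by (rule sym_natural) (use assms in \<open>auto simp: Hom_iff\<close>)

lemma zero_object_tensor:
  assumes "zero_object C Z" "X \<in> Obj C"
  shows "zero_object C (Z \<boxtimes> X)" (is ?A) "zero_object C (X \<boxtimes> Z)" (is ?B)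
proof -
  have [simp]: "Z \<in> Obj C" and z: "Ident C Z = Zero C Z Z" using assms by (auto simp: zero_object_iff)
  have "Ident C (Z \<boxtimes> X) = Zero C Z Z \<boxdot> Ident C X" "Ident C (X \<boxtimes> Z) = Ident C X \<boxdot> Zero C Z Z"
    using assms z by (metis \<open>Z \<in> Obj C\<close> tensor_Ident)+
  then show ?A ?B
    using assms by (auto simp: zero_object_iff)
qed

section \<open>Chosen direct sums and maps out of their tensor products\<close>

lemma is_coproduct_dsum:
  assumes "\<And>i. F i \<in> Obj C"
  shows "is_coproduct C UNIV F (dsum C F) (dinj C F)"
proof -
  have "\<exists>x. case x of (S, inc) \<Rightarrow> is_coproduct C (UNIV :: int set) F S inc"
    using int_coproducts[of F] assms by auto
  then have "case coprod C F of (S, inc) \<Rightarrow> is_coproduct C UNIV F S inc"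
    unfolding coprod_def by (rule someI_ex)
  then show ?thesis by (simp add: dsum_def dinj_def case_prod_unfold)
qed

lemma dsum_in [simp]: "(\<And>i. F i \<in> Obj C) \<Longrightarrow> dsum C F \<in> Obj C"
  using is_coproductD(1)[OF is_coproduct_dsum] .

lemma dinj_Arr [simp]:
  assumes "\<And>i. F i \<in> Obj C"
  shows "dinj C F i \<in> Arr C" "Dom C (dinj C F i) = F i" "Cod C (dinj C F i) = dsum C F"
  using is_coproductD(3)[OF is_coproduct_dsum[of F], of i] assms by (auto simp: Hom_iff)

lemma dsum_ext:
  assumes "h \<in> Arr C" "h' \<in> Arr C" "Dom C h = dsum C F" "Dom C h' = dsum C F" "Cod C h' = Cod C h"
    "\<And>i. F i \<in> Obj C" "\<And>i. h \<cdot> dinj C F i = h' \<cdot> dinj C F i"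
  shows "h = h'"
  by (rule is_coproduct_ext[OF is_coproduct_dsum[of F]]) (use assms in \<open>auto simp: Hom_iff\<close>)

lemma copair_eqI:
  assumes "\<And>i. F i \<in> Obj C" "h \<in> Hom C (dsum C F) T" "\<And>i. h \<cdot> dinj C F i = g i"
  shows "copair C F T g = h"
  unfolding copair_def
proof (rule the_equality)
  fix h' assume h': "h' \<in> Hom C (dsum C F) T \<and> (\<forall>i. h' \<cdot> dinj C F i = g i)"
  show "h' = h"
    by (rule is_coproduct_ext[OF is_coproduct_dsum[of F]]) (use assms h' in auto)
qed (use assms in auto)

lemma copair [simp]:
  assumes "\<And>i. F i \<in> Obj C" "T \<in> Obj C" "\<And>i. g i \<in> Arr C" "\<And>i. Dom C (g i) = F i" "\<And>i. Cod C (g i) = T"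
  shows "copair C F T g \<in> Arr C" (is ?A) "Dom C (copair C F T g) = dsum C F" (is ?B) "Cod C (copair C F T g) = T" (is ?C)
    "copair C F T g \<cdot> dinj C F i = g i" (is ?D)
proof -
  obtain h where h: "h \<in> Hom C (dsum C F) T" "\<And>i. h \<cdot> dinj C F i = g i"
    using is_coproduct_ex[OF is_coproduct_dsum[of F], of T g] assms by (auto simp: Hom_iff)
  have "copair C F T g = h" by (rule copair_eqI) (use h assms in auto)
  then show ?A ?B ?C ?D
    using h by (auto simp: Hom_iff)
qed

lemma copair_reassoc [simp]:
  assumes "\<And>i. F i \<in> Obj C" "T \<in> Obj C" "\<And>i. g i \<in> Arr C" "\<And>i. Dom C (g i) = F i" "\<And>i. Cod C (g i) = T"
    "r \<in> Arr C" "Cod C r = F i"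
  shows "copair C F T g \<cdot> dinj C F i \<cdot> r = g i \<cdot> r"
  by (rule reassoc[OF copair(4)]) (use assms in auto)

lemma dsum_tensor_ext:
  assumes "h \<in> Arr C" "h' \<in> Arr C" "Cod C h' = Cod C h" "\<And>i. F i \<in> Obj C" "X \<in> Obj C"
  shows "Dom C h = dsum C F \<boxtimes> X \<Longrightarrow> Dom C h' = dsum C F \<boxtimes> X \<Longrightarrow>
      (\<And>i. h \<cdot> (dinj C F i \<boxdot> Ident C X) = h' \<cdot> (dinj C F i \<boxdot> Ident C X)) \<Longrightarrow> h = h'"
    and "Dom C h = X \<boxtimes> dsum C F \<Longrightarrow> Dom C h' = X \<boxtimes> dsum C F \<Longrightarrow>
      (\<And>i. h \<cdot> (Ident C X \<boxdot> dinj C F i) = h' \<cdot> (Ident C X \<boxdot> dinj C F i)) \<Longrightarrow> h = h'"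
  by (rule is_coproduct_ext[OF tensor_coproduct_left[OF is_coproduct_dsum[of F]]];
      use assms in \<open>auto simp: Hom_iff\<close>)
    (rule is_coproduct_ext[OF tensor_coproduct_right[OF is_coproduct_dsum[of F]]];
      use assms in \<open>auto simp: Hom_iff\<close>)

lemma dsum_tensor_dsum_ext:
  assumes "h \<in> Arr C" "h' \<in> Arr C" "Cod C h' = Cod C h" and F: "\<And>i. F i \<in> Obj C" "\<And>i. G i \<in> Obj C"
    "Dom C h = dsum C F \<boxtimes> dsum C G" "Dom C h' = dsum C F \<boxtimes> dsum C G"
    and e: "\<And>i j. h \<cdot> (dinj C F i \<boxdot> dinj C G j) = h' \<cdot> (dinj C F i \<boxdot> dinj C G j)"
  shows "h = h'"
proof (rule dsum_tensor_ext(1)[of h h' F "dsum C G"])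
  fix i
  show "h \<cdot> (dinj C F i \<boxdot> Ident C (dsum C G)) = h' \<cdot> (dinj C F i \<boxdot> Ident C (dsum C G))"
    by (rule dsum_tensor_ext(2)[of _ _ G "F i"]) (use assms in auto)
qed (use assms in auto)

lemma dsum_tensor_ex:
  assumes "\<And>i. F i \<in> Obj C" "X \<in> Obj C" "T \<in> Obj C"
    "\<And>i. g i \<in> Arr C" "\<And>i. Dom C (g i) = F i \<boxtimes> X" "\<And>i. Cod C (g i) = T"
  obtains h where "h \<in> Hom C (dsum C F \<boxtimes> X) T" "\<And>i. h \<cdot> (dinj C F i \<boxdot> Ident C X) = g i"
  using is_coproduct_ex[OF tensor_coproduct_left[OF is_coproduct_dsum[of F]], of X T g] assms
  by (auto simp: Hom_iff)

text \<open>Tensoring preserves sums in each variable, so the \<open>g i j\<close> are first glued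
  over \<open>j\<close> for each fixed \<open>i\<close>, and the results over \<open>i\<close>. This
  gives existence for the structure map of \<open>forget_degree\<close>, which is a definite
  description.\<close>

lemma dsum_tensor_dsum_ex:
  assumes F[simp]: "\<And>i. F i \<in> Obj C" "\<And>i. G i \<in> Obj C" "T \<in> Obj C"
    and g[simp]: "\<And>i j. g i j \<in> Arr C" "\<And>i j. Dom C (g i j) = F i \<boxtimes> G j" "\<And>i j. Cod C (g i j) = T"
  obtains h where "h \<in> Hom C (dsum C F \<boxtimes> dsum C G) T" "\<And>i j. h \<cdot> (dinj C F i \<boxdot> dinj C G j) = g i j"
proof -
  have "\<exists>h. h \<in> Hom C (F i \<boxtimes> dsum C G) T \<and> (\<forall>j. h \<cdot> (Ident C (F i) \<boxdot> dinj C G j) = g i j)" for i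
    using is_coproduct_ex[OF tensor_coproduct_right[OF is_coproduct_dsum[of G]], of "F i" T "g i"] g F
    by (metis Hom_iff UNIV_I)
  then obtain k where "\<And>i. k i \<in> Hom C (F i \<boxtimes> dsum C G) T"
    and k: "\<And>i j. k i \<cdot> (Ident C (F i) \<boxdot> dinj C G j) = g i j" by metis
  then have [simp]: "k i \<in> Arr C" "Dom C (k i) = F i \<boxtimes> dsum C G" "Cod C (k i) = T" for i
    by (auto simp: Hom_iff)
  obtain h where h: "h \<in> Hom C (dsum C F \<boxtimes> dsum C G) T" "\<And>i. h \<cdot> (dinj C F i \<boxdot> Ident C (dsum C G)) = k i"
    using dsum_tensor_ex[of F "dsum C G" T k] by auto
  have [simp]: "h \<in> Arr C" "Dom C h = dsum C F \<boxtimes> dsum C G" using h by (auto simp: Hom_iff)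
  have "h \<cdot> (dinj C F i \<boxdot> dinj C G j) = g i j" for i j
    using k[of i j] by (simp add: h(2)[symmetric])
  then show thesis using that h by blast
qed

section \<open>Graded objects\<close>

lemma gr_summand_in: "(\<And>p. X p \<in> Obj C) \<Longrightarrow> (\<And>p. Y p \<in> Obj C) \<Longrightarrow> gr_summand C X Y n p \<in> Obj C"
  by (simp add: gr_summand_def)

lemma gr_tensor_in [simp]: "(\<And>p. X p \<in> Obj C) \<Longrightarrow> (\<And>p. Y p \<in> Obj C) \<Longrightarrow> gr_tensor C X Y n \<in> Obj C"
  by (simp add: gr_tensor_def gr_summand_in)

lemma gr_inj_Arr [simp]:
  assumes "\<And>p. X p \<in> Obj C" "\<And>p. Y p \<in> Obj C"
  shows "gr_inj C X Y n p \<in> Arr C" "Dom C (gr_inj C X Y n p) = X p \<boxtimes> Y (n - p)"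
    "Cod C (gr_inj C X Y n p) = gr_tensor C X Y n"
  \<comment> \<open>\<open>gr_summand\<close> stays folded until the facts about \<open>dinj\<close>
    have been applied, because they speak of the family as a whole.\<close>
  using assms by (simp_all add: gr_inj_def gr_tensor_def gr_summand_in) (simp add: gr_summand_def)

lemma gr_ext:
  assumes "h \<in> Arr C" "h' \<in> Arr C" "Dom C h = gr_tensor C X Y n" "Dom C h' = gr_tensor C X Y n" "Cod C h' = Cod C h"
    "\<And>p. X p \<in> Obj C" "\<And>p. Y p \<in> Obj C" "\<And>p. h \<cdot> gr_inj C X Y n p = h' \<cdot> gr_inj C X Y n p"
  shows "h = h'"
  by (rule dsum_ext[of h h' "gr_summand C X Y n"])
    (use assms in \<open>auto simp: gr_summand_in gr_tensor_def gr_inj_def\<close>)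

lemma gr_copair [simp]:
  assumes "\<And>p. X p \<in> Obj C" "\<And>p. Y p \<in> Obj C" "T \<in> Obj C"
    "\<And>p. g p \<in> Arr C" "\<And>p. Dom C (g p) = X p \<boxtimes> Y (n - p)" "\<And>p. Cod C (g p) = T"
  shows "copair C (gr_summand C X Y n) T g \<in> Arr C"
    "Dom C (copair C (gr_summand C X Y n) T g) = gr_tensor C X Y n"
    "Cod C (copair C (gr_summand C X Y n) T g) = T"
    "copair C (gr_summand C X Y n) T g \<cdot> gr_inj C X Y n p = g p"
  using assms copair[of "gr_summand C X Y n" T g]
  by (simp_all add: gr_summand_in gr_inj_def gr_tensor_def) (simp_all add: gr_summand_def)

lemma gr_copair_reassoc [simp]:
  assumes "\<And>p. X p \<in> Obj C" "\<And>p. Y p \<in> Obj C" "T \<in> Obj C"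
    "\<And>p. g p \<in> Arr C" "\<And>p. Dom C (g p) = X p \<boxtimes> Y (n - p)" "\<And>p. Cod C (g p) = T"
    "r \<in> Arr C" "Cod C r = X p \<boxtimes> Y (n - p)"
  shows "copair C (gr_summand C X Y n) T g \<cdot> gr_inj C X Y n p \<cdot> r = g p \<cdot> r"
  by (rule reassoc[OF gr_copair(4)]) (use assms in auto)

lemma gr_tensor_arr_Arr [simp]:
  assumes "\<And>p. f p \<in> Arr C" "\<And>p. g p \<in> Arr C"
  shows "gr_tensor_arr C f g n \<in> Arr C"
    "Dom C (gr_tensor_arr C f g n) = gr_tensor C (\<lambda>p. Dom C (f p)) (\<lambda>p. Dom C (g p)) n"
    "Cod C (gr_tensor_arr C f g n) = gr_tensor C (\<lambda>p. Cod C (f p)) (\<lambda>p. Cod C (g p)) n"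
  using assms by (simp_all add: gr_tensor_arr_def Let_def Dom_Obj Cod_Obj)

lemma gr_tensor_arr_inj [simp]:
  assumes "\<And>p. f p \<in> Arr C" "\<And>p. g p \<in> Arr C" "\<And>p. Dom C (f p) = X p" "\<And>p. Dom C (g p) = Y p"
  shows "gr_tensor_arr C f g n \<cdot> gr_inj C X Y n p =
    gr_inj C (\<lambda>p. Cod C (f p)) (\<lambda>p. Cod C (g p)) n p \<cdot> (f p \<boxdot> g (n - p))"
proof -
  have [simp]: "X p \<in> Obj C" "Y p \<in> Obj C" for p
    using Dom_Obj[OF assms(1), of p] Dom_Obj[OF assms(2), of p] assms(3,4) by auto
  show ?thesis unfolding gr_tensor_arr_def Let_def assms(3,4)
    by (subst gr_copair) (use assms in simp_all)
qed

lemma gr_tensor_arr_inj_reassoc [simp]: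
  assumes "\<And>p. f p \<in> Arr C" "\<And>p. g p \<in> Arr C" "\<And>p. Dom C (f p) = X p" "\<And>p. Dom C (g p) = Y p"
    "r \<in> Arr C" "Cod C r = X p \<boxtimes> Y (n - p)"
  shows "gr_tensor_arr C f g n \<cdot> gr_inj C X Y n p \<cdot> r =
    gr_inj C (\<lambda>p. Cod C (f p)) (\<lambda>p. Cod C (g p)) n p \<cdot> (f p \<boxdot> g (n - p)) \<cdot> r"
proof -
  have [simp]: "X p \<in> Obj C" "Y p \<in> Obj C" for p
    using Dom_Obj[OF assms(1), of p] Dom_Obj[OF assms(2), of p] assms(3,4) by auto
  show ?thesis
    by (subst reassoc[OF gr_tensor_arr_inj[where n=n and p=p]]) (use assms in \<open>simp_all\<close>)
qed

lemma gr_inj_tensor_ext: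
  assumes "h \<in> Arr C" "h' \<in> Arr C" "Cod C h' = Cod C h" "\<And>p. X p \<in> Obj C" "\<And>p. Y p \<in> Obj C" "Z \<in> Obj C"
  shows "Dom C h = gr_tensor C X Y n \<boxtimes> Z \<Longrightarrow> Dom C h' = gr_tensor C X Y n \<boxtimes> Z \<Longrightarrow>
    (\<And>p. h \<cdot> (gr_inj C X Y n p \<boxdot> Ident C Z) = h' \<cdot> (gr_inj C X Y n p \<boxdot> Ident C Z)) \<Longrightarrow> h = h'"
  by (rule dsum_tensor_ext(1)[of h h' "gr_summand C X Y n" Z])
    (use assms in \<open>auto simp: gr_summand_in gr_tensor_def gr_inj_def\<close>)

text \<open>The triple tensor product is an iterated sum, and tensoring with
  \<open>Z (n - k)\<close> preserves the inner one; so its pieces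
  \<open>(X p \<otimes> Y (k - p)) \<otimes> Z (n - k)\<close> detect equality of maps.\<close>

lemma gr_ext3:
  assumes h: "h \<in> Arr C" "h' \<in> Arr C" "Cod C h' = Cod C h"
    and X[simp]: "\<And>p. X p \<in> Obj C" "\<And>p. Y p \<in> Obj C" "\<And>p. Z p \<in> Obj C"
    and d: "Dom C h = gr_tensor C (gr_tensor C X Y) Z n" "Dom C h' = gr_tensor C (gr_tensor C X Y) Z n"
    and e: "\<And>k p. h \<cdot> gr_inj C (gr_tensor C X Y) Z n k \<cdot> (gr_inj C X Y k p \<boxdot> Ident C (Z (n - k))) =
      h' \<cdot> gr_inj C (gr_tensor C X Y) Z n k \<cdot> (gr_inj C X Y k p \<boxdot> Ident C (Z (n - k)))"
  shows "h = h'"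
proof (rule gr_ext[OF h(1,2) d h(3)])
  fix k
  show "h \<cdot> gr_inj C (gr_tensor C X Y) Z n k = h' \<cdot> gr_inj C (gr_tensor C X Y) Z n k"
    by (rule gr_inj_tensor_ext[of _ _ X Y "Z (n - k)" k]) (use h d e in auto)
qed auto

text \<open>\<open>gr_assoc\<close> is a definite description. For existence, the prescribed maps
  are glued over \<open>p\<close> inside the first factor for each \<open>k\<close>, then over
  \<open>k\<close>; uniqueness is detection on triple summands.\<close>

lemma gr_assoc_Hom:
  assumes [simp]: "\<And>p. X p \<in> Obj C" "\<And>p. Y p \<in> Obj C" "\<And>p. Z p \<in> Obj C"
  shows gr_assoc_Arr [simp]: "gr_assoc C X Y Z n \<in> Arr C"
    "Dom C (gr_assoc C X Y Z n) = gr_tensor C (gr_tensor C X Y) Z n"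
    "Cod C (gr_assoc C X Y Z n) = gr_tensor C X (gr_tensor C Y Z) n"
    and gr_assoc_inj: "gr_assoc C X Y Z n \<cdot> gr_inj C (gr_tensor C X Y) Z n k \<cdot> (gr_inj C X Y k p \<boxdot> Ident C (Z (n - k))) =
        gr_inj C X (gr_tensor C Y Z) n p \<cdot> (Ident C (X p) \<boxdot> gr_inj C Y Z (n - p) (k - p)) \<cdot>
          Assoc C (X p) (Y (k - p)) (Z (n - k))"
proof -
  let ?T = "gr_tensor C X (gr_tensor C Y Z) n"
  let ?g = "\<lambda>k p. gr_inj C X (gr_tensor C Y Z) n p \<cdot> (Ident C (X p) \<boxdot> gr_inj C Y Z (n - p) (k - p)) \<cdot>
          Assoc C (X p) (Y (k - p)) (Z (n - k))"
  have "\<exists>h. h \<in> Hom C (gr_tensor C X Y k \<boxtimes> Z (n - k)) ?T \<and>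
     (\<forall>p. h \<cdot> (gr_inj C X Y k p \<boxdot> Ident C (Z (n - k))) = ?g k p)" for k
  proof -
    obtain h where "h \<in> Hom C (dsum C (gr_summand C X Y k) \<boxtimes> Z (n - k)) ?T"
      "\<And>p. h \<cdot> (dinj C (gr_summand C X Y k) p \<boxdot> Ident C (Z (n - k))) = ?g k p"
      by (rule dsum_tensor_ex[of "gr_summand C X Y k" "Z (n - k)" ?T "?g k"])
        (simp_all add: gr_summand_def)
    then show ?thesis by (auto simp: gr_inj_def gr_tensor_def)
  qed
  then obtain m where m: "\<And>k. m k \<in> Hom C (gr_tensor C X Y k \<boxtimes> Z (n - k)) ?T"
     "\<And>k p. m k \<cdot> (gr_inj C X Y k p \<boxdot> Ident C (Z (n - k))) = ?g k p" by metis
  have [simp]: "m k \<in> Arr C" "Dom C (m k) = gr_tensor C X Y k \<boxtimes> Z (n - k)" "Cod C (m k) = ?T" for k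
    using m by (auto simp: Hom_iff)
  let ?h = "copair C (gr_summand C (gr_tensor C X Y) Z n) ?T m"
  have h: "?h \<in> Hom C (gr_tensor C (gr_tensor C X Y) Z n) ?T \<and>
    (\<forall>k p. ?h \<cdot> gr_inj C (gr_tensor C X Y) Z n k \<cdot> (gr_inj C X Y k p \<boxdot> Ident C (Z (n - k))) = ?g k p)"
    by (simp add: Hom_iff m(2))
  have "gr_assoc C X Y Z n = ?h"
    unfolding gr_assoc_def
  proof (rule the_equality, rule h)
    fix h' assume h': "h' \<in> Hom C (gr_tensor C (gr_tensor C X Y) Z n) ?T \<and>
      (\<forall>k p. h' \<cdot> gr_inj C (gr_tensor C X Y) Z n k \<cdot> (gr_inj C X Y k p \<boxdot> Ident C (Z (n - k))) = ?g k p)"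
    then show "h' = ?h"
      by (intro gr_ext3[of h' ?h X Y Z n]) (use h in \<open>auto simp: Hom_iff\<close>)
  qed
  then show "gr_assoc C X Y Z n \<in> Arr C"
    "Dom C (gr_assoc C X Y Z n) = gr_tensor C (gr_tensor C X Y) Z n"
    "Cod C (gr_assoc C X Y Z n) = gr_tensor C X (gr_tensor C Y Z) n"
    "gr_assoc C X Y Z n \<cdot> gr_inj C (gr_tensor C X Y) Z n k \<cdot> (gr_inj C X Y k p \<boxdot> Ident C (Z (n - k))) = ?g k p"
    using h by (auto simp: Hom_iff)
qed

lemma gr_unit_in [simp]: "gr_unit C p \<in> Obj C"
  by (simp add: gr_unit_def)

lemma gr_unit_0 [simp]: "gr_unit C 0 = Unit C"
  by (simp add: gr_unit_def)

lemma zero_object_gr_unit: "p \<noteq> 0 \<Longrightarrow> zero_object C (gr_unit C p)"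
  by (simp add: gr_unit_def zero_object_zero_ob)

text \<open>Away from \<open>p = 0\<close> the unit contributes a zero object, so the summand is
  zero and any two maps out of it agree. Only one summand has to be inspected.\<close>

lemma gr_lunit_ext:
  assumes "h \<in> Arr C" "h' \<in> Arr C" "Dom C h = gr_tensor C (gr_unit C) X n" "Dom C h' = gr_tensor C (gr_unit C) X n"
    "Cod C h' = Cod C h" "\<And>p. X p \<in> Obj C"
    and e: "h \<cdot> gr_inj C (gr_unit C) X n 0 = h' \<cdot> gr_inj C (gr_unit C) X n 0"
  shows "h = h'"
proof (rule gr_ext[OF assms(1-5)])
  fix p
  show "h \<cdot> gr_inj C (gr_unit C) X n p = h' \<cdot> gr_inj C (gr_unit C) X n p"
  proof (cases "p = 0")
    case False
    then have z: "zero_object C (gr_unit C p \<boxtimes> X (n - p))" by (simp add: zero_object_gr_unit zero_object_tensor assms)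
    show ?thesis using zero_object_Arr(1)[OF z, of "h \<cdot> gr_inj C (gr_unit C) X n p"]
      zero_object_Arr(1)[OF z, of "h' \<cdot> gr_inj C (gr_unit C) X n p"] assms by simp
  qed (use e in simp)
qed (use assms in auto)

lemma gr_runit_ext:
  assumes "h \<in> Arr C" "h' \<in> Arr C" "Dom C h = gr_tensor C X (gr_unit C) n" "Dom C h' = gr_tensor C X (gr_unit C) n"
    "Cod C h' = Cod C h" "\<And>p. X p \<in> Obj C"
    and e: "h \<cdot> gr_inj C X (gr_unit C) n n = h' \<cdot> gr_inj C X (gr_unit C) n n"
  shows "h = h'"
proof (rule gr_ext[OF assms(1-5)])
  fix p
  show "h \<cdot> gr_inj C X (gr_unit C) n p = h' \<cdot> gr_inj C X (gr_unit C) n p"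
  proof (cases "p = n")
    case False
    then have z: "zero_object C (X p \<boxtimes> gr_unit C (n - p))" by (simp add: zero_object_gr_unit zero_object_tensor assms)
    show ?thesis using zero_object_Arr(1)[OF z, of "h \<cdot> gr_inj C X (gr_unit C) n p"]
      zero_object_Arr(1)[OF z, of "h' \<cdot> gr_inj C X (gr_unit C) n p"] assms by simp
  qed (use e in simp)
qed (use assms in auto)

lemma gr_lunit_Hom:
  assumes [simp]: "\<And>p. X p \<in> Obj C"
  shows gr_lunit_Arr [simp]: "gr_lunit C X n \<in> Arr C" (is ?A) "Dom C (gr_lunit C X n) = gr_tensor C (gr_unit C) X n" (is ?B)
    "Cod C (gr_lunit C X n) = X n" (is ?C)
    and gr_lunit_inj [simp]: "gr_lunit C X n \<cdot> gr_inj C (gr_unit C) X n 0 = LUnit C (X n)" (is ?D)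
proof -
  let ?g = "\<lambda>p. if p = 0 then LUnit C (X n) else Zero C (gr_summand C (gr_unit C) X n p) (X n)"
  have "?g p \<in> Arr C" "Dom C (?g p) = gr_unit C p \<boxtimes> X (n - p)" "Cod C (?g p) = X n" for p
    by (auto simp: gr_summand_def)
  then show ?A ?B ?C ?D
    unfolding gr_lunit_def by (subst gr_copair; simp)+
qed

lemma gr_runit_Hom:
  assumes [simp]: "\<And>p. X p \<in> Obj C"
  shows gr_runit_Arr [simp]: "gr_runit C X n \<in> Arr C" (is ?A) "Dom C (gr_runit C X n) = gr_tensor C X (gr_unit C) n" (is ?B)
    "Cod C (gr_runit C X n) = X n" (is ?C)
    and gr_runit_inj [simp]: "gr_runit C X n \<cdot> gr_inj C X (gr_unit C) n n = RUnit C (X n)" (is ?D)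
proof -
  let ?g = "\<lambda>p. if p = n then RUnit C (X n) else Zero C (gr_summand C X (gr_unit C) n p) (X n)"
  have "?g p \<in> Arr C" "Dom C (?g p) = X p \<boxtimes> gr_unit C (n - p)" "Cod C (?g p) = X n" for p
    by (auto simp: gr_summand_def)
  then show ?A ?B ?C ?D
    unfolding gr_runit_def by (subst gr_copair; simp)+
qed

lemma gr_sym_Hom:
  assumes [simp]: "\<And>p. X p \<in> Obj C" "\<And>p. Y p \<in> Obj C"
  shows gr_sym_Arr [simp]: "gr_sym C \<sigma> X Y n \<in> Arr C" "Dom C (gr_sym C \<sigma> X Y n) = gr_tensor C X Y n"
    "Cod C (gr_sym C \<sigma> X Y n) = gr_tensor C Y X n"
    and gr_sym_inj: "gr_sym C \<sigma> X Y n \<cdot> gr_inj C X Y n p =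
      signed C (\<sigma> p (n - p)) (gr_inj C Y X n (n - p) \<cdot> Sym C (X p) (Y (n - p)))"
  unfolding gr_sym_def by simp_all

end

section \<open>Graded objects again form an additive tensor category with direct sums\<close>

lemma gr_sel:
  "X \<in> Obj (gr C) \<longleftrightarrow> (\<forall>p. X p \<in> Obj C)" "f \<in> Arr (gr C) \<longleftrightarrow> (\<forall>p. f p \<in> Arr C)"
  "Dom (gr C) f = (\<lambda>p. Dom C (f p))" "Cod (gr C) f = (\<lambda>p. Cod C (f p))"
  "Ident (gr C) X = (\<lambda>p. Ident C (X p))" "g \<cdot>\<^bsub>gr C\<^esub> f = (\<lambda>p. g p \<cdot>\<^bsub>C\<^esub> f p)"
  "Zero (gr C) X Y = (\<lambda>p. Zero C (X p) (Y p))" "f \<ddagger>\<^bsub>gr C\<^esub> g = (\<lambda>p. f p \<ddagger>\<^bsub>C\<^esub> g p)"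
  "X \<boxtimes>\<^bsub>gr C\<^esub> Y = gr_tensor C X Y" "f \<boxdot>\<^bsub>gr C\<^esub> g = gr_tensor_arr C f g"
  "Unit (gr C) = gr_unit C" "Assoc (gr C) = gr_assoc C" "LUnit (gr C) = gr_lunit C"
  "RUnit (gr C) = gr_runit C" "Sym (gr C) = gr_sym C (\<lambda>_ _. 0)"
  by (auto simp: gr_def)

lemma gr_Hom_iff: "f \<in> Hom (gr C) X Y \<longleftrightarrow> (\<forall>p. f p \<in> Hom C (X p) (Y p))"
  by (auto simp: Hom_iff gr_sel fun_eq_iff)

context tensor_sum_category
begin

lemma category_gr: "category (gr C)"
  by unfold_locales (auto simp: gr_sel gr_Hom_iff fun_eq_iff Hom_iff)

lemma preadditive_gr: "preadditive_category (gr C)"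
proof -
  interpret G: category "gr C" by (rule category_gr)
  show ?thesis
  proof (rule preadditive_category.intro[OF category_gr], rule preadditive_category_axioms.intro)
    fix X Y assume XY: "X \<in> Obj (gr C)" "Y \<in> Obj (gr C)"
    have "comm_group (hom_group (gr C) X Y)"
    proof (rule comm_groupI)
      fix f assume f: "f \<in> carrier (hom_group (gr C) X Y)"
      show "\<exists>g\<in>carrier (hom_group (gr C) X Y). g \<otimes>\<^bsub>hom_group (gr C) X Y\<^esub> f = \<one>\<^bsub>hom_group (gr C) X Y\<^esub>"
        by (rule bexI[of _ "\<lambda>p. neg C (f p)"])
          (use f XY in \<open>auto simp: hom_group_def gr_Hom_iff Hom_iff gr_sel fun_eq_iff\<close>)
    qed (use XY in \<open>auto simp: hom_group_def gr_Hom_iff Hom_iff gr_sel fun_eq_iff intro: Add_commute\<close>)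
    then show "comm_group (hom_group (gr C) X Y)" .
  next
    have "\<exists>!f. f \<in> Hom (gr C) X (\<lambda>_. zero_ob C)" "\<exists>!f. f \<in> Hom (gr C) (\<lambda>_. zero_ob C) X"
      if "X \<in> Obj (gr C)" for X
    proof -
      note z = zero_object_Arr[OF zero_object_zero_ob]
      show "\<exists>!f. f \<in> Hom (gr C) X (\<lambda>_. zero_ob C)"
      proof (rule ex1I[of _ "\<lambda>p. Zero C (X p) (zero_ob C)"])
        fix f assume "f \<in> Hom (gr C) X (\<lambda>_. zero_ob C)"
        then show "f = (\<lambda>p. Zero C (X p) (zero_ob C))"
          using z(2)[of "f _"] by (intro ext) (metis gr_Hom_iff HomD)
      qed (use that in \<open>auto simp: gr_Hom_iff gr_sel Hom_iff\<close>)
      show "\<exists>!f. f \<in> Hom (gr C) (\<lambda>_. zero_ob C) X"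
      proof (rule ex1I[of _ "\<lambda>p. Zero C (zero_ob C) (X p)"])
        fix f assume "f \<in> Hom (gr C) (\<lambda>_. zero_ob C) X"
        then show "f = (\<lambda>p. Zero C (zero_ob C) (X p))"
          using z(1)[of "f _"] by (intro ext) (metis gr_Hom_iff HomD)
      qed (use that in \<open>auto simp: gr_Hom_iff gr_sel Hom_iff\<close>)
    qed
    then have "zero_object (gr C) (\<lambda>_. zero_ob C)"
      unfolding zero_object_def by (auto simp: gr_sel)
    then show "\<exists>Z. zero_object (gr C) Z" by blast
  qed (auto simp: gr_Hom_iff gr_sel Hom_iff fun_eq_iff)
qed

lemma neg_gr:
  assumes "f \<in> Arr (gr C)"
  shows "neg (gr C) f = (\<lambda>p. neg C (f p))"
proof -
  interpret G: preadditive_category "gr C" by (rule preadditive_gr)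
  show ?thesis
    by (rule G.neg_unique) (use assms in \<open>auto simp: gr_sel fun_eq_iff\<close>)
qed

lemma signed_gr: "f \<in> Arr (gr C) \<Longrightarrow> signed (gr C) k f = (\<lambda>p. signed C k (f p))"
  by (auto simp: signed_def neg_gr)

lemma zero_object_gr_iff: "zero_object (gr C) Z \<longleftrightarrow> (\<forall>p. zero_object C (Z p))"
proof -
  interpret G: preadditive_category "gr C" by (rule preadditive_gr)
  show ?thesis unfolding G.zero_object_iff zero_object_iff by (auto simp: gr_sel fun_eq_iff)
qed

text \<open>The universal property of a component is tested against graded objects that agree with the
  coproduct in all other degrees.\<close>

lemma is_coproduct_gr_iff:
  "is_coproduct (gr C) I F S inc \<longleftrightarrow> (\<forall>p. is_coproduct C I (\<lambda>i. F i p) (S p) (\<lambda>i. inc i p))"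
proof
  interpret G: category "gr C" by (rule category_gr)
  assume c: "is_coproduct (gr C) I F S inc"
  have S[simp]: "S p \<in> Obj C" for p using G.is_coproductD(1)[OF c] by (auto simp: gr_sel)
  have inc: "i \<in> I \<Longrightarrow> inc i p \<in> Hom C (F i p) (S p)" for i p
    using G.is_coproductD(3)[OF c] by (auto simp: gr_Hom_iff)
  show "\<forall>p. is_coproduct C I (\<lambda>i. F i p) (S p) (\<lambda>i. inc i p)"
  proof (intro allI is_coproductI)
    fix p T g assume T: "T \<in> Obj C" and g: "\<And>i. i \<in> I \<Longrightarrow> g i \<in> Hom C (F i p) T"
    obtain h where "h \<in> Hom (gr C) S (S(p := T))"
      and h: "\<And>i. i \<in> I \<Longrightarrow> h \<cdot>\<^bsub>gr C\<^esub> inc i = (inc i)(p := g i)"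
      by (rule G.is_coproduct_ex[OF c, of "S(p := T)" "\<lambda>i. (inc i)(p := g i)"])
        (use T g inc in \<open>auto simp: gr_Hom_iff gr_sel\<close>)
    then have "h p \<in> Hom C (S p) T" "\<And>i. i \<in> I \<Longrightarrow> h p \<cdot> inc i p = g i"
      by (auto simp: gr_Hom_iff gr_sel fun_eq_iff split: if_splits)
    then show "\<exists>h\<in>Hom C (S p) T. \<forall>i\<in>I. h \<cdot> inc i p = g i" by blast
  next
    fix p T h h' assume h: "h \<in> Hom C (S p) T" "h' \<in> Hom C (S p) T" "\<And>i. i \<in> I \<Longrightarrow> h \<cdot> inc i p = h' \<cdot> inc i p"
    have "(\<lambda>q. Ident C (S q))(p := h) = (\<lambda>q. Ident C (S q))(p := h')"
      by (rule G.is_coproduct_ext[OF c, where T="S(p := T)"])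
        (use h Ident_Hom in \<open>auto simp: gr_Hom_iff gr_sel\<close>)
    then show "h = h'" by (metis fun_upd_same)
  qed (use inc G.is_coproductD(2)[OF c] in \<open>auto simp: gr_sel\<close>)
next
  interpret G: category "gr C" by (rule category_gr)
  assume "\<forall>p. is_coproduct C I (\<lambda>i. F i p) (S p) (\<lambda>i. inc i p)"
  then have c: "is_coproduct C I (\<lambda>i. F i p) (S p) (\<lambda>i. inc i p)" for p by blast
  show "is_coproduct (gr C) I F S inc"
  proof (rule G.is_coproductI)
    fix T g assume T: "T \<in> Obj (gr C)" and g: "\<And>i. i \<in> I \<Longrightarrow> g i \<in> Hom (gr C) (F i) T"
    have "\<exists>h. h \<in> Hom C (S p) (T p) \<and> (\<forall>i\<in>I. h \<cdot> inc i p = g i p)" for p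
      by (rule is_coproduct_ex[OF c, of "T p" "\<lambda>i. g i p"]) (use T g in \<open>auto simp: gr_Hom_iff gr_sel\<close>)
    then obtain h where "\<And>p. h p \<in> Hom C (S p) (T p) \<and> (\<forall>i\<in>I. h p \<cdot> inc i p = g i p)" by metis
    then show "\<exists>h\<in>Hom (gr C) S T. \<forall>i\<in>I. h \<cdot>\<^bsub>gr C\<^esub> inc i = g i"
      by (intro bexI[of _ h]) (auto simp: gr_Hom_iff gr_sel)
  next
    fix T h h' assume h: "h \<in> Hom (gr C) S T" "h' \<in> Hom (gr C) S T"
      "\<And>i. i \<in> I \<Longrightarrow> h \<cdot>\<^bsub>gr C\<^esub> inc i = h' \<cdot>\<^bsub>gr C\<^esub> inc i"
    show "h = h'"
    proof
      fix p show "h p = h' p"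
        by (rule is_coproduct_ext[OF c[of p], where T="T p"])
          (use h in \<open>auto simp: gr_Hom_iff gr_sel fun_eq_iff\<close>)
    qed
  qed (use is_coproductD[OF c] in \<open>auto simp: gr_Hom_iff gr_sel\<close>)
qed

text \<open>Interchange of two sums. A map out of \<open>gr_tensor C S X n\<close> is a family of
  maps out of \<open>S p \<otimes> X (n - p)\<close>, and each of these objects is itself a
  coproduct over \<open>i\<close>.\<close>

lemma gr_tensor_coproduct_left:
  assumes c: "\<And>p. is_coproduct C (UNIV :: int set) (\<lambda>i. F i p) (S p) (\<lambda>i. inc i p)" and X[simp]: "\<And>p. X p \<in> Obj C"
  shows "is_coproduct C UNIV (\<lambda>i. gr_tensor C (F i) X n) (gr_tensor C S X n)
    (\<lambda>i. gr_tensor_arr C (inc i) (\<lambda>p. Ident C (X p)) n)"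
proof -
  have [simp]: "S p \<in> Obj C" "F i p \<in> Obj C" "inc i p \<in> Arr C" "Dom C (inc i p) = F i p" "Cod C (inc i p) = S p" for p i
    using is_coproductD[OF c] by (auto simp: Hom_iff)
  show ?thesis
  proof (rule is_coproductI)
    fix T g assume T[simp]: "T \<in> Obj C" and "\<And>i. i \<in> UNIV \<Longrightarrow> g i \<in> Hom C (gr_tensor C (F i) X n) T"
    then have [simp]: "g i \<in> Arr C" "Dom C (g i) = gr_tensor C (F i) X n" "Cod C (g i) = T" for i
      by (auto simp: Hom_iff)
    have "\<exists>h. h \<in> Hom C (S p \<boxtimes> X (n - p)) T \<and>
      (\<forall>i. h \<cdot> (inc i p \<boxdot> Ident C (X (n - p))) = g i \<cdot> gr_inj C (F i) X n p)" for p
      by (rule is_coproduct_ex[OF tensor_coproduct_left[OF c[of p]], of "X (n - p)" T "\<lambda>i. g i \<cdot> gr_inj C (F i) X n p"])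
        (auto simp: Hom_iff)
    then obtain h where h: "\<And>p. h p \<in> Hom C (S p \<boxtimes> X (n - p)) T"
      "\<And>p i. h p \<cdot> (inc i p \<boxdot> Ident C (X (n - p))) = g i \<cdot> gr_inj C (F i) X n p" by metis
    have [simp]: "h p \<in> Arr C" "Dom C (h p) = S p \<boxtimes> X (n - p)" "Cod C (h p) = T" for p
      using h(1) by (auto simp: Hom_iff)
    let ?h = "copair C (gr_summand C S X n) T h"
    have "?h \<cdot> gr_tensor_arr C (inc i) (\<lambda>p. Ident C (X p)) n = g i" for i
      by (rule gr_ext[where X="F i" and Y=X]) (auto simp: h(2))
    then show "\<exists>h\<in>Hom C (gr_tensor C S X n) T. \<forall>i\<in>UNIV. h \<cdot> gr_tensor_arr C (inc i) (\<lambda>p. Ident C (X p)) n = g i"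
      by (intro bexI[of _ ?h]) (auto simp: Hom_iff)
  next
    fix T h h' assume "h \<in> Hom C (gr_tensor C S X n) T" "h' \<in> Hom C (gr_tensor C S X n) T"
      and e: "\<And>i. i \<in> UNIV \<Longrightarrow> h \<cdot> gr_tensor_arr C (inc i) (\<lambda>p. Ident C (X p)) n =
        h' \<cdot> gr_tensor_arr C (inc i) (\<lambda>p. Ident C (X p)) n"
    then have [simp]: "h \<in> Arr C" "Dom C h = gr_tensor C S X n" "Cod C h = T"
      "h' \<in> Arr C" "Dom C h' = gr_tensor C S X n" "Cod C h' = T" by (auto simp: Hom_iff)
    show "h = h'"
    proof (rule gr_ext[where X=S and Y=X])
      fix p
      show "h \<cdot> gr_inj C S X n p = h' \<cdot> gr_inj C S X n p"
      proof (rule is_coproduct_ext[OF tensor_coproduct_left[OF c[of p]]])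
        fix i
        have "(h \<cdot> gr_tensor_arr C (inc i) (\<lambda>p. Ident C (X p)) n) \<cdot> gr_inj C (F i) X n p =
          (h' \<cdot> gr_tensor_arr C (inc i) (\<lambda>p. Ident C (X p)) n) \<cdot> gr_inj C (F i) X n p"
          using e[of i] by (simp only: UNIV_I)
        then show "(h \<cdot> gr_inj C S X n p) \<cdot> (inc i p \<boxdot> Ident C (X (n - p))) =
          (h' \<cdot> gr_inj C S X n p) \<cdot> (inc i p \<boxdot> Ident C (X (n - p)))" by simp
      qed (auto simp: Hom_iff)
    qed auto
  qed (auto simp: Hom_iff)
qed

lemma gr_tensor_coproduct_right:
  assumes c: "\<And>p. is_coproduct C (UNIV :: int set) (\<lambda>i. F i p) (S p) (\<lambda>i. inc i p)" and X[simp]: "\<And>p. X p \<in> Obj C"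
  shows "is_coproduct C UNIV (\<lambda>i. gr_tensor C X (F i) n) (gr_tensor C X S n)
    (\<lambda>i. gr_tensor_arr C (\<lambda>p. Ident C (X p)) (inc i) n)"
proof -
  have [simp]: "S p \<in> Obj C" "F i p \<in> Obj C" "inc i p \<in> Arr C" "Dom C (inc i p) = F i p" "Cod C (inc i p) = S p" for p i
    using is_coproductD[OF c] by (auto simp: Hom_iff)
  show ?thesis
  proof (rule is_coproductI)
    fix T g assume T[simp]: "T \<in> Obj C" and "\<And>i. i \<in> UNIV \<Longrightarrow> g i \<in> Hom C (gr_tensor C X (F i) n) T"
    then have [simp]: "g i \<in> Arr C" "Dom C (g i) = gr_tensor C X (F i) n" "Cod C (g i) = T" for i
      by (auto simp: Hom_iff)
    have "\<exists>h. h \<in> Hom C (X p \<boxtimes> S (n - p)) T \<and>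
      (\<forall>i. h \<cdot> (Ident C (X p) \<boxdot> inc i (n - p)) = g i \<cdot> gr_inj C X (F i) n p)" for p
      by (rule is_coproduct_ex[OF tensor_coproduct_right[OF c[of "n - p"]], of "X p" T "\<lambda>i. g i \<cdot> gr_inj C X (F i) n p"])
        (auto simp: Hom_iff)
    then obtain h where h: "\<And>p. h p \<in> Hom C (X p \<boxtimes> S (n - p)) T"
      "\<And>p i. h p \<cdot> (Ident C (X p) \<boxdot> inc i (n - p)) = g i \<cdot> gr_inj C X (F i) n p" by metis
    have [simp]: "h p \<in> Arr C" "Dom C (h p) = X p \<boxtimes> S (n - p)" "Cod C (h p) = T" for p
      using h(1) by (auto simp: Hom_iff)
    let ?h = "copair C (gr_summand C X S n) T h"
    have "?h \<cdot> gr_tensor_arr C (\<lambda>p. Ident C (X p)) (inc i) n = g i" for i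
      by (rule gr_ext[where Y="F i" and X=X]) (auto simp: h(2))
    then show "\<exists>h\<in>Hom C (gr_tensor C X S n) T. \<forall>i\<in>UNIV. h \<cdot> gr_tensor_arr C (\<lambda>p. Ident C (X p)) (inc i) n = g i"
      by (intro bexI[of _ ?h]) (auto simp: Hom_iff)
  next
    fix T h h' assume "h \<in> Hom C (gr_tensor C X S n) T" "h' \<in> Hom C (gr_tensor C X S n) T"
      and e: "\<And>i. i \<in> UNIV \<Longrightarrow> h \<cdot> gr_tensor_arr C (\<lambda>p. Ident C (X p)) (inc i) n =
        h' \<cdot> gr_tensor_arr C (\<lambda>p. Ident C (X p)) (inc i) n"
    then have [simp]: "h \<in> Arr C" "Dom C h = gr_tensor C X S n" "Cod C h = T"
      "h' \<in> Arr C" "Dom C h' = gr_tensor C X S n" "Cod C h' = T" by (auto simp: Hom_iff)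
    show "h = h'"
    proof (rule gr_ext[where X=X and Y=S])
      fix p
      show "h \<cdot> gr_inj C X S n p = h' \<cdot> gr_inj C X S n p"
      proof (rule is_coproduct_ext[OF tensor_coproduct_right[OF c[of "n - p"]]])
        fix i
        have "(h \<cdot> gr_tensor_arr C (\<lambda>p. Ident C (X p)) (inc i) n) \<cdot> gr_inj C X (F i) n p =
          (h' \<cdot> gr_tensor_arr C (\<lambda>p. Ident C (X p)) (inc i) n) \<cdot> gr_inj C X (F i) n p"
          using e[of i] by (simp only: UNIV_I)
        then show "(h \<cdot> gr_inj C X S n p) \<cdot> (Ident C (X p) \<boxdot> inc i (n - p)) =
          (h' \<cdot> gr_inj C X S n p) \<cdot> (Ident C (X p) \<boxdot> inc i (n - p))" by simp
      qed (auto simp: Hom_iff)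
    qed auto
  qed (auto simp: Hom_iff)
qed

lemma gr_assoc_natural:
  assumes "\<And>p. f p \<in> Hom C (X p) (X' p)" "\<And>p. g p \<in> Hom C (Y p) (Y' p)" "\<And>p. h p \<in> Hom C (Z p) (Z' p)"
  shows "gr_assoc C X' Y' Z' n \<cdot> gr_tensor_arr C (gr_tensor_arr C f g) h n =
    gr_tensor_arr C f (gr_tensor_arr C g h) n \<cdot> gr_assoc C X Y Z n"
proof -
  note [simp] = HomD[OF assms(1)] HomD[OF assms(2)] HomD[OF assms(3)]
  have [simp]: "X p \<in> Obj C" "Y p \<in> Obj C" "Z p \<in> Obj C" "X' p \<in> Obj C" "Y' p \<in> Obj C" "Z' p \<in> Obj C" for p
    using assms Hom_Obj by blast+
  show ?thesis
  proof (rule gr_ext3[where X=X and Y=Y and Z=Z and n=n])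
    fix k p
    let ?r = "(f p \<boxdot> g (k - p)) \<boxdot> h (n - k)"
    have "(gr_assoc C X' Y' Z' n \<cdot> gr_tensor_arr C (gr_tensor_arr C f g) h n) \<cdot>
          gr_inj C (gr_tensor C X Y) Z n k \<cdot> (gr_inj C X Y k p \<boxdot> Ident C (Z (n - k))) =
       (gr_assoc C X' Y' Z' n \<cdot> gr_inj C (gr_tensor C X' Y') Z' n k \<cdot> (gr_inj C X' Y' k p \<boxdot> Ident C (Z' (n - k)))) \<cdot> ?r"
      by simp
    also have "\<dots> = (gr_inj C X' (gr_tensor C Y' Z') n p \<cdot> (Ident C (X' p) \<boxdot> gr_inj C Y' Z' (n - p) (k - p)) \<cdot>
          Assoc C (X' p) (Y' (k - p)) (Z' (n - k))) \<cdot> ?r"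
      by (subst gr_assoc_inj) simp_all
    also have "\<dots> = (gr_tensor_arr C f (gr_tensor_arr C g h) n \<cdot> gr_inj C X (gr_tensor C Y Z) n p \<cdot>
       (Ident C (X p) \<boxdot> gr_inj C Y Z (n - p) (k - p))) \<cdot> Assoc C (X p) (Y (k - p)) (Z (n - k))"
      by (simp add: Assoc_tensor)
    also have "\<dots> = (gr_tensor_arr C f (gr_tensor_arr C g h) n \<cdot> gr_assoc C X Y Z n) \<cdot>
          gr_inj C (gr_tensor C X Y) Z n k \<cdot> (gr_inj C X Y k p \<boxdot> Ident C (Z (n - k)))"
      by (simp del: gr_tensor_arr_inj_reassoc add: gr_assoc_inj)
    finally show "(gr_assoc C X' Y' Z' n \<cdot> gr_tensor_arr C (gr_tensor_arr C f g) h n) \<cdot>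
          gr_inj C (gr_tensor C X Y) Z n k \<cdot> (gr_inj C X Y k p \<boxdot> Ident C (Z (n - k))) =
       (gr_tensor_arr C f (gr_tensor_arr C g h) n \<cdot> gr_assoc C X Y Z n) \<cdot>
          gr_inj C (gr_tensor C X Y) Z n k \<cdot> (gr_inj C X Y k p \<boxdot> Ident C (Z (n - k)))" .
  qed auto
qed

lemma gr_lunit_natural:
  assumes "\<And>p. f p \<in> Hom C (X p) (Y p)"
  shows "gr_lunit C Y n \<cdot> gr_tensor_arr C (\<lambda>p. Ident C (gr_unit C p)) f n = f n \<cdot> gr_lunit C X n"
proof -
  note [simp] = HomD[OF assms(1)]
  have [simp]: "X p \<in> Obj C" "Y p \<in> Obj C" for p using assms Hom_Obj by blast+
  show ?thesis
    by (rule gr_lunit_ext[where X=X and n=n]) (auto simp: LUnit_tensor reassoc[OF gr_lunit_inj])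
qed

lemma gr_runit_natural:
  assumes "\<And>p. f p \<in> Hom C (X p) (Y p)"
  shows "gr_runit C Y n \<cdot> gr_tensor_arr C f (\<lambda>p. Ident C (gr_unit C p)) n = f n \<cdot> gr_runit C X n"
proof -
  note [simp] = HomD[OF assms(1)]
  have [simp]: "X p \<in> Obj C" "Y p \<in> Obj C" for p using assms Hom_Obj by blast+
  show ?thesis
    by (rule gr_runit_ext[where X=X and n=n]) (auto simp: RUnit_tensor reassoc[OF gr_runit_inj])
qed

lemma gr_sym_natural:
  assumes "\<And>p. f p \<in> Hom C (X p) (X' p)" "\<And>p. g p \<in> Hom C (Y p) (Y' p)"
  shows "gr_sym C \<sigma> X' Y' n \<cdot> gr_tensor_arr C f g n = gr_tensor_arr C g f n \<cdot> gr_sym C \<sigma> X Y n"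
proof -
  note [simp] = HomD[OF assms(1)] HomD[OF assms(2)]
  have [simp]: "X p \<in> Obj C" "Y p \<in> Obj C" "X' p \<in> Obj C" "Y' p \<in> Obj C" for p using assms Hom_Obj by blast+
  show ?thesis
    by (rule gr_ext[where X=X and Y=Y and n=n]) (auto simp: gr_sym_inj reassoc[OF gr_sym_inj] Sym_tensor)
qed

text \<open>Permits the whole calculus of tensor products of complexes to be instantiated a second
  time, at \<open>gr C\<close>.\<close>

theorem tensor_sum_category_gr: "tensor_sum_category (gr C)"
proof (rule tensor_sum_category.intro[OF preadditive_gr], rule tensor_sum_category_axioms.intro)
  fix X Y assume "X \<in> Obj (gr C)" "Y \<in> Obj (gr C)"
  then show "Ident (gr C) X \<boxdot>\<^bsub>gr C\<^esub> Ident (gr C) Y = Ident (gr C) (X \<boxtimes>\<^bsub>gr C\<^esub> Y)"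
    unfolding gr_sel by - (intro ext, rule gr_ext[where X=X and Y=Y], auto)
next
  fix f X X' f' X'' g Y Y' g' Y''
  assume a: "f \<in> Hom (gr C) X X'" "f' \<in> Hom (gr C) X' X''" "g \<in> Hom (gr C) Y Y'" "g' \<in> Hom (gr C) Y' Y''"
  then have [simp]: "X p \<in> Obj C" "Y p \<in> Obj C" "X' p \<in> Obj C" "Y' p \<in> Obj C" "X'' p \<in> Obj C" "Y'' p \<in> Obj C" for p
    using Hom_Obj unfolding gr_Hom_iff by blast+
  note b = a[unfolded gr_Hom_iff, rule_format]
  show "(f' \<cdot>\<^bsub>gr C\<^esub> f) \<boxdot>\<^bsub>gr C\<^esub> (g' \<cdot>\<^bsub>gr C\<^esub> g) = (f' \<boxdot>\<^bsub>gr C\<^esub> g') \<cdot>\<^bsub>gr C\<^esub> (f \<boxdot>\<^bsub>gr C\<^esub> g)"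
    unfolding gr_sel by (intro ext, rule gr_ext[where X=X and Y=Y]) (use b in \<open>auto simp: Hom_iff\<close>)
next
  fix f X Y g h Z W
  assume a: "f \<in> Hom (gr C) X Y" "g \<in> Hom (gr C) X Y" "h \<in> Hom (gr C) Z W"
  then have [simp]: "X p \<in> Obj C" "Y p \<in> Obj C" "Z p \<in> Obj C" "W p \<in> Obj C" for p
    using Hom_Obj unfolding gr_Hom_iff by blast+
  note b = a[unfolded gr_Hom_iff, rule_format]
  show "(f \<ddagger>\<^bsub>gr C\<^esub> g) \<boxdot>\<^bsub>gr C\<^esub> h = (f \<boxdot>\<^bsub>gr C\<^esub> h) \<ddagger>\<^bsub>gr C\<^esub> (g \<boxdot>\<^bsub>gr C\<^esub> h)"
    unfolding gr_sel by (intro ext, rule gr_ext[where X=X and Y=Z]) (use b in \<open>auto simp: Hom_iff\<close>)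
  show "h \<boxdot>\<^bsub>gr C\<^esub> (f \<ddagger>\<^bsub>gr C\<^esub> g) = (h \<boxdot>\<^bsub>gr C\<^esub> f) \<ddagger>\<^bsub>gr C\<^esub> (h \<boxdot>\<^bsub>gr C\<^esub> g)"
    unfolding gr_sel by (intro ext, rule gr_ext[where X=Z and Y=X]) (use b in \<open>auto simp: Hom_iff\<close>)
next
  fix f X X' g Y Y' h Z Z'
  assume "f \<in> Hom (gr C) X X'" "g \<in> Hom (gr C) Y Y'" "h \<in> Hom (gr C) Z Z'"
  then show "Assoc (gr C) X' Y' Z' \<cdot>\<^bsub>gr C\<^esub> ((f \<boxdot>\<^bsub>gr C\<^esub> g) \<boxdot>\<^bsub>gr C\<^esub> h) =
    (f \<boxdot>\<^bsub>gr C\<^esub> (g \<boxdot>\<^bsub>gr C\<^esub> h)) \<cdot>\<^bsub>gr C\<^esub> Assoc (gr C) X Y Z"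
    unfolding gr_sel gr_Hom_iff by (intro ext gr_assoc_natural) auto
next
  fix f X Y assume "f \<in> Hom (gr C) X Y"
  then show "LUnit (gr C) Y \<cdot>\<^bsub>gr C\<^esub> (Ident (gr C) (Unit (gr C)) \<boxdot>\<^bsub>gr C\<^esub> f) = f \<cdot>\<^bsub>gr C\<^esub> LUnit (gr C) X"
    "RUnit (gr C) Y \<cdot>\<^bsub>gr C\<^esub> (f \<boxdot>\<^bsub>gr C\<^esub> Ident (gr C) (Unit (gr C))) = f \<cdot>\<^bsub>gr C\<^esub> RUnit (gr C) X"
    unfolding gr_sel gr_Hom_iff by (intro ext gr_lunit_natural gr_runit_natural; auto)+
next
  fix f X X' g Y Y'
  assume "f \<in> Hom (gr C) X X'" "g \<in> Hom (gr C) Y Y'"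
  then show "Sym (gr C) X' Y' \<cdot>\<^bsub>gr C\<^esub> (f \<boxdot>\<^bsub>gr C\<^esub> g) = (g \<boxdot>\<^bsub>gr C\<^esub> f) \<cdot>\<^bsub>gr C\<^esub> Sym (gr C) X Y"
    unfolding gr_sel gr_Hom_iff by (intro ext gr_sym_natural) auto
next
  fix F :: "int \<Rightarrow> _" assume "\<And>i. F i \<in> Obj (gr C)"
  then have "\<exists>S inc. is_coproduct C (UNIV :: int set) (\<lambda>i. F i p) S inc" for p
    using int_coproducts[of "\<lambda>i. F i p"] by (auto simp: gr_sel)
  then obtain S inc where "\<And>p. is_coproduct C (UNIV :: int set) (\<lambda>i. F i p) (S p) (inc p)" by metis
  then show "\<exists>S inc. is_coproduct (gr C) (UNIV :: int set) F S inc"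
    by (intro exI[of _ S] exI[of _ "\<lambda>i p. inc p i"]) (simp add: is_coproduct_gr_iff)
next
  fix F S inc X assume "is_coproduct (gr C) (UNIV :: int set) F S inc" "X \<in> Obj (gr C)"
  then show "is_coproduct (gr C) (UNIV :: int set) (\<lambda>i. F i \<boxtimes>\<^bsub>gr C\<^esub> X) (S \<boxtimes>\<^bsub>gr C\<^esub> X) (\<lambda>i. inc i \<boxdot>\<^bsub>gr C\<^esub> Ident (gr C) X)"
    "is_coproduct (gr C) (UNIV :: int set) (\<lambda>i. X \<boxtimes>\<^bsub>gr C\<^esub> F i) (X \<boxtimes>\<^bsub>gr C\<^esub> S) (\<lambda>i. Ident (gr C) X \<boxdot>\<^bsub>gr C\<^esub> inc i)"
    unfolding is_coproduct_gr_iff gr_sel by (auto intro: gr_tensor_coproduct_left gr_tensor_coproduct_right)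
qed (auto simp: gr_sel gr_Hom_iff Hom_iff)

end

section \<open>The tensor product of complexes\<close>

lemma Ch_sel:
  "X \<in> Obj (Ch C) \<longleftrightarrow> is_complex C X" "f \<in> Arr (Ch C) \<longleftrightarrow> is_chain_map C f"
  "Dom (Ch C) f = cdom f" "Cod (Ch C) f = ccod f"
  "Ident (Ch C) X = cmap X X (\<lambda>n. Ident C (cob X n))"
  "g \<cdot>\<^bsub>Ch C\<^esub> f = cmap (cdom f) (ccod g) (\<lambda>n. carr g n \<cdot>\<^bsub>C\<^esub> carr f n)"
  "X \<boxtimes>\<^bsub>Ch C\<^esub> Y = ch_tensor C X Y"
  "f \<boxdot>\<^bsub>Ch C\<^esub> g = cmap (ch_tensor C (cdom f) (cdom g)) (ch_tensor C (ccod f) (ccod g))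
    (gr_tensor_arr C (carr f) (carr g))"
  "Unit (Ch C) = zero_diff_complex C (gr_unit C)"
  "Assoc (Ch C) X Y Z = cmap (ch_tensor C (ch_tensor C X Y) Z) (ch_tensor C X (ch_tensor C Y Z))
    (gr_assoc C (cob X) (cob Y) (cob Z))"
  "LUnit (Ch C) X = cmap (ch_tensor C (zero_diff_complex C (gr_unit C)) X) X (gr_lunit C (cob X))"
  "RUnit (Ch C) X = cmap (ch_tensor C X (zero_diff_complex C (gr_unit C))) X (gr_runit C (cob X))"
  "Sym (Ch C) X Y = cmap (ch_tensor C X Y) (ch_tensor C Y X) (gr_sym C (\<lambda>p q. p * q) (cob X) (cob Y))"
  by (auto simp: Ch_def)

lemma cmap_sel [simp]: "cdom (cmap X Y f) = X" "ccod (cmap X Y f) = Y" "carr (cmap X Y f) = f"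
  by (auto simp: cmap_def)

lemma cmap_eq_iff [simp]: "cmap X Y f = cmap X' Y' f' \<longleftrightarrow> X = X' \<and> Y = Y' \<and> f = f'"
  by (auto simp: cmap_def)

lemma cmap_collapse [simp]: "cmap (cdom f) (ccod f) (carr f) = f"
  by (simp add: cmap_def)

lemma zero_diff_sel [simp]: "cob (zero_diff_complex C X) = X"
  "cdiff (zero_diff_complex C X) n = Zero C (X n) (X (n - 1))"
  by (auto simp: zero_diff_complex_def)

lemma Ch_Hom_iff: "f \<in> Hom (Ch C) X Y \<longleftrightarrow> is_chain_map C f \<and> cdom f = X \<and> ccod f = Y"
  by (auto simp: Hom_iff Ch_sel)

lemma cob_ch_tensor [simp]: "cob (ch_tensor C X Y) = gr_tensor C (cob X) (cob Y)"
  by (simp add: ch_tensor_def)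

lemma is_complexD:
  assumes "is_complex C X"
  shows "cob X n \<in> Obj C" "cdiff X n \<in> Arr C" "Dom C (cdiff X n) = cob X n" "Cod C (cdiff X n) = cob X (n - 1)"
    "m = n - 1 \<Longrightarrow> cdiff X m \<cdot>\<^bsub>C\<^esub> cdiff X n = Zero C (cob X n) (cob X (n - 2))"
  using assms by (auto simp: is_complex_def Hom_iff)

lemma is_chain_mapD:
  assumes "is_chain_map C f"
  shows "is_complex C (cdom f)" "is_complex C (ccod f)"
    "carr f n \<in> Arr C" "Dom C (carr f n) = cob (cdom f) n" "Cod C (carr f n) = cob (ccod f) n"
    "cdiff (ccod f) n \<cdot>\<^bsub>C\<^esub> carr f n = carr f (n - 1) \<cdot>\<^bsub>C\<^esub> cdiff (cdom f) n"
  using assms by (auto simp: is_chain_map_def Hom_iff)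

lemma is_chain_map_cmapI:
  assumes "is_complex C X" "is_complex C Y" "\<And>n. f n \<in> Hom C (cob X n) (cob Y n)"
    "\<And>n. cdiff Y n \<cdot>\<^bsub>C\<^esub> f n = f (n - 1) \<cdot>\<^bsub>C\<^esub> cdiff X n"
  shows "is_chain_map C (cmap X Y f)"
  using assms by (auto simp: is_chain_map_def)

text \<open>A normal form for the degrees that occur in differentials of tensor products.\<close>

lemma int_diff_normal:
  "NO_MATCH (1 :: int) p \<Longrightarrow> (n :: int) - p - 1 = n - 1 - p"
  "NO_MATCH (1 :: int) p \<Longrightarrow> NO_MATCH (2 :: int) p \<Longrightarrow> (n :: int) - p - 2 = n - 2 - p"
  "(n :: int) + (- 1 - k) = n - 1 - k"
  by simp_all

context tensor_sum_category
begin

lemma is_complex_zero_diff: "(\<And>n. X n \<in> Obj C) \<Longrightarrow> is_complex C (zero_diff_complex C X)"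
  by (auto simp: is_complex_def Hom_iff)

lemma ch_tensor_diff:
  assumes "is_complex C X" "is_complex C Y"
  shows ch_tensor_diff_Arr: "cdiff (ch_tensor C X Y) n \<in> Arr C"
    "Dom C (cdiff (ch_tensor C X Y) n) = gr_tensor C (cob X) (cob Y) n"
    "Cod C (cdiff (ch_tensor C X Y) n) = gr_tensor C (cob X) (cob Y) (n - 1)"
    and ch_tensor_diff_inj: "cdiff (ch_tensor C X Y) n \<cdot> gr_inj C (cob X) (cob Y) n p =
      (gr_inj C (cob X) (cob Y) (n - 1) (p - 1) \<cdot> (cdiff X p \<boxdot> Ident C (cob Y (n - p)))) \<ddagger>
      signed C p (gr_inj C (cob X) (cob Y) (n - 1) p \<cdot> (Ident C (cob X p) \<boxdot> cdiff Y (n - p)))"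
    and ch_tensor_diff_inj_reassoc: "r \<in> Arr C \<Longrightarrow> Cod C r = cob X p \<boxtimes> cob Y (n - p) \<Longrightarrow>
      cdiff (ch_tensor C X Y) n \<cdot> gr_inj C (cob X) (cob Y) n p \<cdot> r =
      (gr_inj C (cob X) (cob Y) (n - 1) (p - 1) \<cdot> (cdiff X p \<boxdot> Ident C (cob Y (n - p))) \<cdot> r) \<ddagger>
      signed C p (gr_inj C (cob X) (cob Y) (n - 1) p \<cdot> (Ident C (cob X p) \<boxdot> cdiff Y (n - p)) \<cdot> r)"
proof -
  note [simp] = is_complexD[OF assms(1)] is_complexD[OF assms(2)] int_diff_normal
  show 1: "cdiff (ch_tensor C X Y) n \<in> Arr C"
    "Dom C (cdiff (ch_tensor C X Y) n) = gr_tensor C (cob X) (cob Y) n"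
    "Cod C (cdiff (ch_tensor C X Y) n) = gr_tensor C (cob X) (cob Y) (n - 1)"
    by (simp_all add: ch_tensor_def)
  show 2: "cdiff (ch_tensor C X Y) n \<cdot> gr_inj C (cob X) (cob Y) n p =
      (gr_inj C (cob X) (cob Y) (n - 1) (p - 1) \<cdot> (cdiff X p \<boxdot> Ident C (cob Y (n - p)))) \<ddagger>
      signed C p (gr_inj C (cob X) (cob Y) (n - 1) p \<cdot> (Ident C (cob X p) \<boxdot> cdiff Y (n - p)))" for p
    by (simp add: ch_tensor_def)
  show "cdiff (ch_tensor C X Y) n \<cdot> gr_inj C (cob X) (cob Y) n p \<cdot> r =
      (gr_inj C (cob X) (cob Y) (n - 1) (p - 1) \<cdot> (cdiff X p \<boxdot> Ident C (cob Y (n - p))) \<cdot> r) \<ddagger>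
      signed C p (gr_inj C (cob X) (cob Y) (n - 1) p \<cdot> (Ident C (cob X p) \<boxdot> cdiff Y (n - p)) \<cdot> r)"
    if "r \<in> Arr C" "Cod C r = cob X p \<boxtimes> cob Y (n - p)"
    using that by (subst reassoc[OF 2]) (simp_all add: 1)
qed

lemma is_complex_ch_tensor:
  assumes "is_complex C X" "is_complex C Y"
  shows "is_complex C (ch_tensor C X Y)"
proof -
  note [simp] = is_complexD[OF assms(1)] is_complexD[OF assms(2)] int_diff_normal
    ch_tensor_diff[OF assms]
  have "cdiff (ch_tensor C X Y) (n - 1) \<cdot> cdiff (ch_tensor C X Y) n =
    Zero C (cob (ch_tensor C X Y) n) (cob (ch_tensor C X Y) (n - 2))" for n
  proof (rule gr_ext[where X="cob X" and Y="cob Y" and n=n])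
    fix p
    \<comment> \<open>The squares of the two differentials vanish. The mixed term arises twice: with
      sign \<open>p\<close> when \<open>Y\<close> is differentiated first, and with sign
      \<open>p - 1\<close> when \<open>X\<close> has already lowered its degree.\<close>
    let ?e = "gr_inj C (cob X) (cob Y) (n - 2) (p - 1) \<cdot> (cdiff X p \<boxdot> cdiff Y (n - p))"
    have "(cdiff (ch_tensor C X Y) (n - 1) \<cdot> cdiff (ch_tensor C X Y) n) \<cdot> gr_inj C (cob X) (cob Y) n p
      = signed C (p - 1) ?e \<ddagger> signed C p ?e"
      by simp
    then show "(cdiff (ch_tensor C X Y) (n - 1) \<cdot> cdiff (ch_tensor C X Y) n) \<cdot> gr_inj C (cob X) (cob Y) n p
      = Zero C (cob (ch_tensor C X Y) n) (cob (ch_tensor C X Y) (n - 2)) \<cdot> gr_inj C (cob X) (cob Y) n p"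
      by (simp add: signed_Add_opposite)
  qed simp_all
  then show ?thesis by (auto simp: is_complex_def Hom_iff)
qed

lemma tensor_Ch:
  assumes f: "is_chain_map C f" and g: "is_chain_map C g"
  shows "is_chain_map C (f \<boxdot>\<^bsub>Ch C\<^esub> g)"
proof -
  note c = is_chain_mapD(1,2)[OF f] is_chain_mapD(1,2)[OF g]
  note [simp] = is_chain_mapD(3-)[OF f] is_chain_mapD(3-)[OF g] c[THEN is_complexD(1)] c[THEN is_complexD(2)]
    c[THEN is_complexD(3)] c[THEN is_complexD(4)]
    int_diff_normal ch_tensor_diff[OF c(1,3)] ch_tensor_diff[OF c(2,4)]
  show ?thesis
    unfolding Ch_sel
  proof (rule is_chain_map_cmapI)
    fix n
    show "cdiff (ch_tensor C (ccod f) (ccod g)) n \<cdot> gr_tensor_arr C (carr f) (carr g) n =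
      gr_tensor_arr C (carr f) (carr g) (n - 1) \<cdot> cdiff (ch_tensor C (cdom f) (cdom g)) n"
      by (rule gr_ext[where X="cob (cdom f)" and Y="cob (cdom g)" and n=n]) simp_all
  qed (use c is_complex_ch_tensor in \<open>auto simp: Hom_iff\<close>)
qed

section \<open>The structural arrows of complexes are chain maps\<close>

lemma gr_assoc_inj_Comp:
  assumes [simp]: "\<And>p. X p \<in> Obj C" "\<And>p. Y p \<in> Obj C" "\<And>p. Z p \<in> Obj C"
    and [simp]: "a \<in> Arr C" "Cod C a = X p \<boxtimes> Y (k - p)" "b \<in> Arr C" "Cod C b = Z (n - k)"
  shows "gr_assoc C X Y Z n \<cdot> gr_inj C (gr_tensor C X Y) Z n k \<cdot> ((gr_inj C X Y k p \<cdot> a) \<boxdot> b) =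
        gr_inj C X (gr_tensor C Y Z) n p \<cdot> (Ident C (X p) \<boxdot> gr_inj C Y Z (n - p) (k - p)) \<cdot>
          Assoc C (X p) (Y (k - p)) (Z (n - k)) \<cdot> (a \<boxdot> b)"
proof -
  have "gr_assoc C X Y Z n \<cdot> gr_inj C (gr_tensor C X Y) Z n k \<cdot> ((gr_inj C X Y k p \<cdot> a) \<boxdot> b) =
    (gr_assoc C X Y Z n \<cdot> gr_inj C (gr_tensor C X Y) Z n k \<cdot> (gr_inj C X Y k p \<boxdot> Ident C (Z (n - k)))) \<cdot> (a \<boxdot> b)"
    by simp
  also have "\<dots> = (gr_inj C X (gr_tensor C Y Z) n p \<cdot> (Ident C (X p) \<boxdot> gr_inj C Y Z (n - p) (k - p)) \<cdot>
          Assoc C (X p) (Y (k - p)) (Z (n - k))) \<cdot> (a \<boxdot> b)"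
    by (subst gr_assoc_inj) simp_all
  finally show ?thesis by simp
qed

lemma gr_assoc_inj_tensor:
  assumes [simp]: "\<And>p. X p \<in> Obj C" "\<And>p. Y p \<in> Obj C" "\<And>p. Z p \<in> Obj C"
    and [simp]: "b \<in> Arr C" "Cod C b = Z (n - k)"
  shows "gr_assoc C X Y Z n \<cdot> gr_inj C (gr_tensor C X Y) Z n k \<cdot> (gr_inj C X Y k p \<boxdot> b) =
        gr_inj C X (gr_tensor C Y Z) n p \<cdot> (Ident C (X p) \<boxdot> gr_inj C Y Z (n - p) (k - p)) \<cdot>
          Assoc C (X p) (Y (k - p)) (Z (n - k)) \<cdot> (Ident C (X p \<boxtimes> Y (k - p)) \<boxdot> b)"
  using gr_assoc_inj_Comp[of X Y Z "Ident C (X p \<boxtimes> Y (k - p))" p k b n] by simp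

lemma Assoc_Ident_tensor:
  assumes [simp]: "X \<in> Obj C" "Y \<in> Obj C" "b \<in> Arr C" "Cod C b = Z"
  shows "Assoc C X Y Z \<cdot> (Ident C (X \<boxtimes> Y) \<boxdot> b) =
    (Ident C X \<boxdot> (Ident C Y \<boxdot> b)) \<cdot> Assoc C X Y (Dom C b)"
  using Assoc_tensor[of "Ident C X" "Ident C Y" b X Y Z] by simp

text \<open>On a triple summand both composites are the sum of three terms, one for each factor that
  is differentiated. The signs agree because the third factor collects \<open>p\<close> and
  \<open>k - p\<close> on one side and \<open>k\<close> on the other.\<close>

lemma Assoc_Ch:
  assumes X: "is_complex C X" and Y: "is_complex C Y" and Z: "is_complex C Z"
  shows "is_chain_map C (Assoc (Ch C) X Y Z)"
proof -
  note XY = is_complex_ch_tensor[OF X Y] and YZ = is_complex_ch_tensor[OF Y Z]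
  note [simp] = is_complexD(1-4)[OF X] is_complexD(1-4)[OF Y] is_complexD(1-4)[OF Z] 
    int_diff_normal ch_tensor_diff[OF X Y] ch_tensor_diff[OF Y Z]
    ch_tensor_diff[OF XY Z, simplified] ch_tensor_diff[OF X YZ, simplified] 
  show ?thesis
    unfolding Ch_sel
  proof (rule is_chain_map_cmapI)
    fix n
    show "cdiff (ch_tensor C X (ch_tensor C Y Z)) n \<cdot> gr_assoc C (cob X) (cob Y) (cob Z) n =
       gr_assoc C (cob X) (cob Y) (cob Z) (n - 1) \<cdot> cdiff (ch_tensor C (ch_tensor C X Y) Z) n"
    proof (rule gr_ext3[where X="cob X" and Y="cob Y" and Z="cob Z" and n=n])
      fix k p
      show "(cdiff (ch_tensor C X (ch_tensor C Y Z)) n \<cdot> gr_assoc C (cob X) (cob Y) (cob Z) n) \<cdot>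
        gr_inj C (gr_tensor C (cob X) (cob Y)) (cob Z) n k \<cdot> (gr_inj C (cob X) (cob Y) k p \<boxdot> Ident C (cob Z (n - k))) =
        (gr_assoc C (cob X) (cob Y) (cob Z) (n - 1) \<cdot> cdiff (ch_tensor C (ch_tensor C X Y) Z) n) \<cdot>
        gr_inj C (gr_tensor C (cob X) (cob Y)) (cob Z) n k \<cdot> (gr_inj C (cob X) (cob Y) k p \<boxdot> Ident C (cob Z (n - k)))"
        by (simp add: gr_assoc_inj_Comp gr_assoc_inj_tensor gr_assoc_inj Assoc_tensor
          Assoc_Ident_tensor)
    qed simp_all
  qed (use X Y Z is_complex_ch_tensor in \<open>auto simp: Hom_iff\<close>)
qed

lemma is_complex_Unit: "is_complex C (Unit (Ch C))"
  by (simp add: Ch_sel is_complex_zero_diff)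

lemma LUnit_Ch:
  assumes X: "is_complex C X"
  shows "is_chain_map C (LUnit (Ch C) X)"
proof -
  let ?I = "zero_diff_complex C (gr_unit C)"
  have I: "is_complex C ?I" by (simp add: is_complex_zero_diff)
  note [simp] = is_complexD(1-4)[OF X] int_diff_normal ch_tensor_diff[OF I X, simplified]
  show ?thesis
    unfolding Ch_sel
  proof (rule is_chain_map_cmapI)
    fix n
    show "cdiff X n \<cdot> gr_lunit C (cob X) n = gr_lunit C (cob X) (n - 1) \<cdot> cdiff (ch_tensor C ?I X) n"
      by (rule gr_lunit_ext[where X="cob X" and n=n])
        (simp_all add: ch_tensor_diff_inj[OF I X, where p=0, simplified]
          reassoc[OF gr_lunit_inj] LUnit_tensor)
  qed (use X I is_complex_ch_tensor in \<open>auto simp: Hom_iff\<close>)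
qed

lemma RUnit_Ch:
  assumes X: "is_complex C X"
  shows "is_chain_map C (RUnit (Ch C) X)"
proof -
  let ?I = "zero_diff_complex C (gr_unit C)"
  have I: "is_complex C ?I" by (simp add: is_complex_zero_diff)
  note [simp] = is_complexD(1-4)[OF X] int_diff_normal ch_tensor_diff[OF X I, simplified]
  show ?thesis
    unfolding Ch_sel
  proof (rule is_chain_map_cmapI)
    fix n
    show "cdiff X n \<cdot> gr_runit C (cob X) n = gr_runit C (cob X) (n - 1) \<cdot> cdiff (ch_tensor C X ?I) n"
      by (rule gr_runit_ext[where X="cob X" and n=n])
        (simp_all add: ch_tensor_diff_inj[OF X I, where p=n, simplified]
          reassoc[OF gr_runit_inj] RUnit_tensor)
  qed (use X I is_complex_ch_tensor in \<open>auto simp: Hom_iff\<close>)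
qed

lemma Sym_Ch:
  assumes X: "is_complex C X" and Y: "is_complex C Y"
  shows "is_chain_map C (Sym (Ch C) X Y)"
proof -
  note [simp] = is_complexD(1-4)[OF X] is_complexD(1-4)[OF Y]
    int_diff_normal ch_tensor_diff[OF X Y] ch_tensor_diff[OF Y X]
  show ?thesis
    unfolding Ch_sel
  proof (rule is_chain_map_cmapI)
    fix n
    let ?S = "gr_sym C (\<lambda>p q. p * q) (cob X) (cob Y)"
    show "cdiff (ch_tensor C Y X) n \<cdot> ?S n = ?S (n - 1) \<cdot> cdiff (ch_tensor C X Y) n"
    proof (rule gr_ext[where X="cob X" and Y="cob Y" and n=n])
      fix p
      let ?a = "gr_inj C (cob Y) (cob X) (n - 1) (n - 1 - p) \<cdot> (cdiff Y (n - p) \<boxdot> Ident C (cob X p)) \<cdot> Sym C (cob X p) (cob Y (n - p))"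
      let ?b = "gr_inj C (cob Y) (cob X) (n - 1) (n - p) \<cdot> (Ident C (cob Y (n - p)) \<boxdot> cdiff X p) \<cdot> Sym C (cob X p) (cob Y (n - p))"
      have "(cdiff (ch_tensor C Y X) n \<cdot> ?S n) \<cdot> gr_inj C (cob X) (cob Y) n p
        = signed C (p * (n - p)) ?a \<ddagger> signed C (p * (n - p) + (n - p)) ?b"
        by (simp add: gr_sym_inj)
      \<comment> \<open>With \<open>q = n - p\<close>, the exponents of \<open>?a\<close> are equal,
        since \<open>p * q = p + p * (q - 1)\<close>, while those of \<open>?b\<close>,
        \<open>(p + 1) * q\<close> and \<open>(p - 1) * q\<close>, differ by an even number. This is
        why the symmetry carries the Koszul sign.\<close>
      also have "\<dots> = signed C (p + p * (n - 1 - p)) ?a \<ddagger> signed C ((p - 1) * (n - p)) ?b"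
        by (intro arg_cong2[where f="Add C"] signed_parity) auto
      also have "\<dots> = signed C ((p - 1) * (n - p)) ?b \<ddagger> signed C (p + p * (n - 1 - p)) ?a"
        by (rule Add_commute) simp_all
      also have "\<dots> = (?S (n - 1) \<cdot> cdiff (ch_tensor C X Y) n) \<cdot> gr_inj C (cob X) (cob Y) n p"
        by (simp add: gr_sym_inj reassoc[OF gr_sym_inj] Sym_tensor)
      finally show "(cdiff (ch_tensor C Y X) n \<cdot> ?S n) \<cdot> gr_inj C (cob X) (cob Y) n p =
        (?S (n - 1) \<cdot> cdiff (ch_tensor C X Y) n) \<cdot> gr_inj C (cob X) (cob Y) n p" .
    qed simp_all
  qed (use X Y is_complex_ch_tensor in \<open>auto simp: Hom_iff\<close>)
qed

lemma Ident_Ch: "is_complex C X \<Longrightarrow> is_chain_map C (Ident (Ch C) X)"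
  unfolding Ch_sel by (rule is_chain_map_cmapI) (auto simp: Hom_iff is_complexD)

lemma Comp_Ch:
  assumes f: "is_chain_map C f" and g: "is_chain_map C g" and e: "cdom g = ccod f"
  shows "is_chain_map C (g \<cdot>\<^bsub>Ch C\<^esub> f)"
proof -
  note c = is_chain_mapD(1,2)[OF f] is_chain_mapD(1,2)[OF g]
  note [simp] = is_chain_mapD(3-5)[OF f] is_chain_mapD(3-5)[OF g] c[THEN is_complexD(1)] c[THEN is_complexD(2)]
    c[THEN is_complexD(3)] c[THEN is_complexD(4)] is_chain_mapD(6)[OF f]
  show ?thesis unfolding Ch_sel
    by (rule is_chain_map_cmapI) (use c in \<open>auto simp: Hom_iff e reassoc[OF is_chain_mapD(6)[OF g, unfolded e]]\<close>)
qed

end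

section \<open>Families of objects with a multiplication\<close>

text \<open>A lax symmetric monoidal functor with values in complexes is described by the restriction of
  its structure maps to the summands of the tensor products. In this form all axioms are equations in
  the base category, whatever the grading group is.\<close>

record ('c, 'f, 'i, 'o, 'm) family =
  fob :: "'c \<Rightarrow> 'i \<Rightarrow> 'o"
  farr :: "'f \<Rightarrow> 'i \<Rightarrow> 'm"
  fdiff :: "'c \<Rightarrow> 'i \<Rightarrow> 'm"
  fmul :: "'c \<Rightarrow> 'c \<Rightarrow> 'i \<Rightarrow> 'i \<Rightarrow> 'm"
  funit :: 'm

text \<open>What a full subcategory retains when closure under tensor products is not assumed: a
  structural arrow is available as soon as its two ends are objects. This is the setting of the pure
  complexes.\<close>

locale guarded_source =
  fixes C :: "('c, 'f) sm_cat"
  assumes src_Obj: "f \<in> Hom C X Y \<Longrightarrow> X \<in> Obj C" "f \<in> Hom C X Y \<Longrightarrow> Y \<in> Obj C"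
    and src_Unit [simp]: "Unit C \<in> Obj C"
    and src_Ident: "X \<in> Obj C \<Longrightarrow> Ident C X \<in> Hom C X X"
    and src_Comp: "f \<in> Hom C X Y \<Longrightarrow> g \<in> Hom C Y Z \<Longrightarrow> g \<cdot>\<^bsub>C\<^esub> f \<in> Hom C X Z"
    and src_Tensor: "f \<in> Hom C X X' \<Longrightarrow> g \<in> Hom C Y Y' \<Longrightarrow> X \<boxtimes>\<^bsub>C\<^esub> Y \<in> Obj C \<Longrightarrow> X' \<boxtimes>\<^bsub>C\<^esub> Y' \<in> Obj C
      \<Longrightarrow> f \<boxdot>\<^bsub>C\<^esub> g \<in> Hom C (X \<boxtimes>\<^bsub>C\<^esub> Y) (X' \<boxtimes>\<^bsub>C\<^esub> Y')"
    and src_Assoc: "\<lbrakk>X \<in> Obj C; Y \<in> Obj C; Z \<in> Obj C; X \<boxtimes>\<^bsub>C\<^esub> Y \<in> Obj C; Y \<boxtimes>\<^bsub>C\<^esub> Z \<in> Obj C;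
        (X \<boxtimes>\<^bsub>C\<^esub> Y) \<boxtimes>\<^bsub>C\<^esub> Z \<in> Obj C; X \<boxtimes>\<^bsub>C\<^esub> (Y \<boxtimes>\<^bsub>C\<^esub> Z) \<in> Obj C\<rbrakk>
      \<Longrightarrow> Assoc C X Y Z \<in> Hom C ((X \<boxtimes>\<^bsub>C\<^esub> Y) \<boxtimes>\<^bsub>C\<^esub> Z) (X \<boxtimes>\<^bsub>C\<^esub> (Y \<boxtimes>\<^bsub>C\<^esub> Z))"
    and src_LUnit: "X \<in> Obj C \<Longrightarrow> Unit C \<boxtimes>\<^bsub>C\<^esub> X \<in> Obj C \<Longrightarrow> LUnit C X \<in> Hom C (Unit C \<boxtimes>\<^bsub>C\<^esub> X) X"
    and src_RUnit: "X \<in> Obj C \<Longrightarrow> X \<boxtimes>\<^bsub>C\<^esub> Unit C \<in> Obj C \<Longrightarrow> RUnit C X \<in> Hom C (X \<boxtimes>\<^bsub>C\<^esub> Unit C) X"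
    and src_Sym: "\<lbrakk>X \<in> Obj C; Y \<in> Obj C; X \<boxtimes>\<^bsub>C\<^esub> Y \<in> Obj C; Y \<boxtimes>\<^bsub>C\<^esub> X \<in> Obj C\<rbrakk>
      \<Longrightarrow> Sym C X Y \<in> Hom C (X \<boxtimes>\<^bsub>C\<^esub> Y) (Y \<boxtimes>\<^bsub>C\<^esub> X)"

text \<open>The index group is left open to treat two cases at once: \<open>int \<times> int\<close>
  with \<open>\<delta> = (1, 0)\<close> for complexes of graded objects, and \<open>int\<close> with
  \<open>\<delta> = 1\<close> once the degree is forgotten.\<close>

locale family_data = guarded_source C + A: tensor_sum_category A
  for C :: "('c, 'f) sm_cat" and A :: "('o, 'm) sm_cat" (structure) +
  fixes \<delta> :: "'i :: ab_group_add" and F :: "('c, 'f, 'i, 'o, 'm) family"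
  assumes fob [simp]: "X \<in> Obj C \<Longrightarrow> fob F X i \<in> Obj A"
    and farr: "f \<in> Hom C X Y \<Longrightarrow> farr F f i \<in> Hom A (fob F X i) (fob F Y i)"
    and fdiff: "X \<in> Obj C \<Longrightarrow> fdiff F X i \<in> Hom A (fob F X i) (fob F X (i - \<delta>))"
    and fmul: "\<lbrakk>X \<in> Obj C; Y \<in> Obj C; X \<boxtimes>\<^bsub>C\<^esub> Y \<in> Obj C\<rbrakk>
      \<Longrightarrow> fmul F X Y i j \<in> Hom A (fob F X i \<boxtimes> fob F Y j) (fob F (X \<boxtimes>\<^bsub>C\<^esub> Y) (i + j))"
    and funit: "funit F \<in> Hom A (Unit A) (fob F (Unit C) 0)"
begin

lemma fdiff_Arr [simp]:
  assumes "X \<in> Obj C"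
  shows "fdiff F X i \<in> Arr A" "Dom A (fdiff F X i) = fob F X i" "Cod A (fdiff F X i) = fob F X (i - \<delta>)"
  using fdiff[OF assms] by (auto simp: Hom_iff)

lemma fmul_Arr [simp]:
  assumes "X \<in> Obj C" "Y \<in> Obj C" "X \<boxtimes>\<^bsub>C\<^esub> Y \<in> Obj C"
  shows "fmul F X Y i j \<in> Arr A" "Dom A (fmul F X Y i j) = fob F X i \<boxtimes> fob F Y j"
    "Cod A (fmul F X Y i j) = fob F (X \<boxtimes>\<^bsub>C\<^esub> Y) (i + j)"
  using fmul[OF assms] by (auto simp: Hom_iff)

lemma funit_Arr [simp]:
  "funit F \<in> Arr A" "Dom A (funit F) = Unit A" "Cod A (funit F) = fob F (Unit C) 0"
  using funit by (auto simp: Hom_iff)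

end

text \<open>\<open>deg\<close> extracts the homological degree from an index, the only part that
  enters Koszul signs. The extra degree is carried along without signs.\<close>

locale lax_family = family_data C A \<delta> F
  for C :: "('c, 'f) sm_cat" and A :: "('o, 'm) sm_cat" (structure)
    and \<delta> :: "'i :: ab_group_add" and F :: "('c, 'f, 'i, 'o, 'm) family" +
  fixes deg :: "'i \<Rightarrow> int"
  assumes farr_Ident: "X \<in> Obj C \<Longrightarrow> farr F (Ident C X) i = Ident A (fob F X i)"
    and farr_Comp: "f \<in> Hom C X Y \<Longrightarrow> g \<in> Hom C Y Z
      \<Longrightarrow> farr F (g \<cdot>\<^bsub>C\<^esub> f) i = farr F g i \<cdot> farr F f i"
    and fdiff_fdiff: "X \<in> Obj C
      \<Longrightarrow> fdiff F X (i - \<delta>) \<cdot> fdiff F X i = Zero A (fob F X i) (fob F X (i - \<delta> - \<delta>))"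
    and fdiff_natural: "f \<in> Hom C X Y \<Longrightarrow> fdiff F Y i \<cdot> farr F f i = farr F f (i - \<delta>) \<cdot> fdiff F X i"
    and fdiff_funit: "fdiff F (Unit C) 0 \<cdot> funit F = Zero A (Unit A) (fob F (Unit C) (- \<delta>))"
    and leibniz: "\<lbrakk>X \<in> Obj C; Y \<in> Obj C; X \<boxtimes>\<^bsub>C\<^esub> Y \<in> Obj C\<rbrakk>
      \<Longrightarrow> fdiff F (X \<boxtimes>\<^bsub>C\<^esub> Y) (i + j) \<cdot> fmul F X Y i j =
        (fmul F X Y (i - \<delta>) j \<cdot> (fdiff F X i \<boxdot> Ident A (fob F Y j))) \<ddagger>
        signed A (deg i) (fmul F X Y i (j - \<delta>) \<cdot> (Ident A (fob F X i) \<boxdot> fdiff F Y j))"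
    and fmul_natural: "\<lbrakk>f \<in> Hom C X X'; g \<in> Hom C Y Y'; X \<boxtimes>\<^bsub>C\<^esub> Y \<in> Obj C; X' \<boxtimes>\<^bsub>C\<^esub> Y' \<in> Obj C\<rbrakk>
      \<Longrightarrow> farr F (f \<boxdot>\<^bsub>C\<^esub> g) (i + j) \<cdot> fmul F X Y i j =
        fmul F X' Y' i j \<cdot> (farr F f i \<boxdot> farr F g j)"
    and fmul_Assoc: "\<lbrakk>X \<in> Obj C; Y \<in> Obj C; Z \<in> Obj C; X \<boxtimes>\<^bsub>C\<^esub> Y \<in> Obj C; Y \<boxtimes>\<^bsub>C\<^esub> Z \<in> Obj C;
        (X \<boxtimes>\<^bsub>C\<^esub> Y) \<boxtimes>\<^bsub>C\<^esub> Z \<in> Obj C; X \<boxtimes>\<^bsub>C\<^esub> (Y \<boxtimes>\<^bsub>C\<^esub> Z) \<in> Obj C\<rbrakk>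
      \<Longrightarrow> farr F (Assoc C X Y Z) (i + j + k) \<cdot> fmul F (X \<boxtimes>\<^bsub>C\<^esub> Y) Z (i + j) k \<cdot>
            (fmul F X Y i j \<boxdot> Ident A (fob F Z k)) =
          fmul F X (Y \<boxtimes>\<^bsub>C\<^esub> Z) i (j + k) \<cdot> (Ident A (fob F X i) \<boxdot> fmul F Y Z j k) \<cdot>
            Assoc A (fob F X i) (fob F Y j) (fob F Z k)"
    and fmul_LUnit: "\<lbrakk>X \<in> Obj C; Unit C \<boxtimes>\<^bsub>C\<^esub> X \<in> Obj C\<rbrakk>
      \<Longrightarrow> farr F (LUnit C X) i \<cdot> fmul F (Unit C) X 0 i \<cdot> (funit F \<boxdot> Ident A (fob F X i)) =
          LUnit A (fob F X i)"
    and fmul_RUnit: "\<lbrakk>X \<in> Obj C; X \<boxtimes>\<^bsub>C\<^esub> Unit C \<in> Obj C\<rbrakk>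
      \<Longrightarrow> farr F (RUnit C X) i \<cdot> fmul F X (Unit C) i 0 \<cdot> (Ident A (fob F X i) \<boxdot> funit F) =
          RUnit A (fob F X i)"
    and fmul_Sym: "\<lbrakk>X \<in> Obj C; Y \<in> Obj C; X \<boxtimes>\<^bsub>C\<^esub> Y \<in> Obj C; Y \<boxtimes>\<^bsub>C\<^esub> X \<in> Obj C\<rbrakk>
      \<Longrightarrow> farr F (Sym C X Y) (i + j) \<cdot> fmul F X Y i j =
        signed A (deg i * deg j) (fmul F Y X j i \<cdot> Sym A (fob F X i) (fob F Y j))"

text \<open>Transformations need not commute with the differentials: the projection of the truncation
  to its pure part, used below, does not.\<close>

locale family_trans = F: family_data C A \<delta> F + G: family_data C A \<delta> G
  for C :: "('c, 'f) sm_cat" and A :: "('o, 'm) sm_cat" (structure)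
    and \<delta> :: "'i :: ab_group_add" and F :: "('c, 'f, 'i, 'o, 'm) family"
    and G :: "('c, 'f, 'i, 'o, 'm) family" +
  fixes \<eta> :: "'c \<Rightarrow> 'i \<Rightarrow> 'm"
  assumes comp: "X \<in> Obj C \<Longrightarrow> \<eta> X i \<in> Hom A (fob F X i) (fob G X i)"
    and nat: "f \<in> Hom C X Y \<Longrightarrow> \<eta> Y i \<cdot> farr F f i = farr G f i \<cdot> \<eta> X i"
    and mon: "\<lbrakk>X \<in> Obj C; Y \<in> Obj C; X \<boxtimes>\<^bsub>C\<^esub> Y \<in> Obj C\<rbrakk>
      \<Longrightarrow> \<eta> (X \<boxtimes>\<^bsub>C\<^esub> Y) (i + j) \<cdot> fmul F X Y i j = fmul G X Y i j \<cdot> (\<eta> X i \<boxdot> \<eta> Y j)"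
    and unital: "\<eta> (Unit C) 0 \<cdot> funit F = funit G"
begin

lemma comp_Arr [simp]:
  assumes "X \<in> Obj C"
  shows "\<eta> X i \<in> Arr A" "Dom A (\<eta> X i) = fob F X i" "Cod A (\<eta> X i) = fob G X i"
  using comp[OF assms] by (auto simp: Hom_iff)

lemma mon_reassoc:
  assumes "X \<in> Obj C" "Y \<in> Obj C" "X \<boxtimes>\<^bsub>C\<^esub> Y \<in> Obj C" "r \<in> Arr A" "Cod A r = fob F X i \<boxtimes> fob F Y j"
  shows "\<eta> (X \<boxtimes>\<^bsub>C\<^esub> Y) (i + j) \<cdot> fmul F X Y i j \<cdot> r = fmul G X Y i j \<cdot> (\<eta> X i \<boxdot> \<eta> Y j) \<cdot> r"
  by (subst F.A.reassoc[OF mon]) (use assms in auto)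

lemma nat_reassoc:
  assumes "f \<in> Hom C X Y" "r \<in> Arr A" "Cod A r = fob F X i"
  shows "\<eta> Y i \<cdot> farr F f i \<cdot> r = farr G f i \<cdot> \<eta> X i \<cdot> r"
  using HomD[OF F.farr[OF assms(1)]] HomD[OF G.farr[OF assms(1)]] F.src_Obj[OF assms(1)] assms
  by (subst F.A.reassoc[OF nat[OF assms(1)]]) auto

end

section \<open>Transfer of the axioms along monic and epic transformations\<close>

locale family_chain_trans = family_trans +
  assumes chain: "X \<in> Obj C \<Longrightarrow> \<eta> X (i - \<delta>) \<cdot> fdiff F X i = fdiff G X i \<cdot> \<eta> X i"
begin

lemma chain_reassoc:
  assumes "X \<in> Obj C" "r \<in> Arr A" "Cod A r = fob F X i"
  shows "\<eta> X (i - \<delta>) \<cdot> fdiff F X i \<cdot> r = fdiff G X i \<cdot> \<eta> X i \<cdot> r"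
  by (subst F.A.reassoc[OF chain]) (use assms in auto)

text \<open>Pattern of all the transfer facts: \<open>\<eta>\<close> after one side of an axiom for
  \<open>F\<close> equals the same side for \<open>G\<close> after \<open>\<eta>\<close> in the
  arguments. If the \<open>\<eta>\<close> are monic, the axiom for \<open>G\<close> yields that for
  \<open>F\<close> by cancelling on the left; if their tensor products are epic, the axiom for
  \<open>F\<close> yields that for \<open>G\<close> by cancelling on the right.\<close>

lemma transfer_Comp:
  assumes f: "f \<in> Hom C X Y" and g: "g \<in> Hom C Y Z"
  shows "\<eta> Z i \<cdot> farr F (g \<cdot>\<^bsub>C\<^esub> f) i = farr G (g \<cdot>\<^bsub>C\<^esub> f) i \<cdot> \<eta> X i" (is ?A)
    "\<eta> Z i \<cdot> farr F g i \<cdot> farr F f i = (farr G g i \<cdot> farr G f i) \<cdot> \<eta> X i" (is ?B)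
proof -
  note [simp] = F.src_Obj[OF f] F.src_Obj[OF g] HomD[OF F.farr[OF f]] HomD[OF F.farr[OF g]]
    HomD[OF G.farr[OF f]] HomD[OF G.farr[OF g]]
  show ?A
    by (rule nat[OF F.src_Comp[OF f g]])
  show ?B
    by (simp add: nat_reassoc[OF g] nat[OF f])
qed

lemma transfer_fdiff_fdiff:
  assumes [simp]: "X \<in> Obj C"
  shows "\<eta> X (i - \<delta> - \<delta>) \<cdot> fdiff F X (i - \<delta>) \<cdot> fdiff F X i =
    (fdiff G X (i - \<delta>) \<cdot> fdiff G X i) \<cdot> \<eta> X i"
  by (simp add: chain chain_reassoc)

lemma transfer_fdiff_natural:
  assumes f: "f \<in> Hom C X Y"
  shows "\<eta> Y (i - \<delta>) \<cdot> fdiff F Y i \<cdot> farr F f i = (fdiff G Y i \<cdot> farr G f i) \<cdot> \<eta> X i" (is ?A)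
    "\<eta> Y (i - \<delta>) \<cdot> farr F f (i - \<delta>) \<cdot> fdiff F X i = (farr G f (i - \<delta>) \<cdot> fdiff G X i) \<cdot> \<eta> X i" (is ?B)
proof -
  note [simp] = F.src_Obj[OF f] HomD[OF F.farr[OF f]] HomD[OF G.farr[OF f]]
  show ?A
    by (simp add: chain_reassoc nat[OF f])
  show ?B
    by (simp add: chain nat_reassoc[OF f])
qed

lemma transfer_leibniz:
  assumes [simp]: "X \<in> Obj C" "Y \<in> Obj C" "X \<boxtimes>\<^bsub>C\<^esub> Y \<in> Obj C"
  shows "\<eta> (X \<boxtimes>\<^bsub>C\<^esub> Y) (i + j - \<delta>) \<cdot> fdiff F (X \<boxtimes>\<^bsub>C\<^esub> Y) (i + j) \<cdot> fmul F X Y i j =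
      (fdiff G (X \<boxtimes>\<^bsub>C\<^esub> Y) (i + j) \<cdot> fmul G X Y i j) \<cdot> (\<eta> X i \<boxdot> \<eta> Y j)" (is ?A)
    "\<eta> (X \<boxtimes>\<^bsub>C\<^esub> Y) (i + j - \<delta>) \<cdot>
      ((fmul F X Y (i - \<delta>) j \<cdot> (fdiff F X i \<boxdot> Ident A (fob F Y j))) \<ddagger>
        signed A k (fmul F X Y i (j - \<delta>) \<cdot> (Ident A (fob F X i) \<boxdot> fdiff F Y j))) =
     ((fmul G X Y (i - \<delta>) j \<cdot> (fdiff G X i \<boxdot> Ident A (fob G Y j))) \<ddagger>
        signed A k (fmul G X Y i (j - \<delta>) \<cdot> (Ident A (fob G X i) \<boxdot> fdiff G Y j))) \<cdot> (\<eta> X i \<boxdot> \<eta> Y j)" (is ?B)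
proof -
  note [simp] = diff_add_eq add_diff_eq
  show ?A
    by (simp add: chain_reassoc mon)
  note m = mon_reassoc[of X Y _ "i - \<delta>" j, simplified] mon_reassoc[of X Y _ i "j - \<delta>", simplified]
  show ?B
    by (simp add: m chain)
qed

lemma transfer_natural:
  assumes f: "f \<in> Hom C X X'" and g: "g \<in> Hom C Y Y'" and [simp]: "X \<boxtimes>\<^bsub>C\<^esub> Y \<in> Obj C" "X' \<boxtimes>\<^bsub>C\<^esub> Y' \<in> Obj C"
  shows "\<eta> (X' \<boxtimes>\<^bsub>C\<^esub> Y') (i + j) \<cdot> farr F (f \<boxdot>\<^bsub>C\<^esub> g) (i + j) \<cdot> fmul F X Y i j =
      (farr G (f \<boxdot>\<^bsub>C\<^esub> g) (i + j) \<cdot> fmul G X Y i j) \<cdot> (\<eta> X i \<boxdot> \<eta> Y j)" (is ?A)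
    "\<eta> (X' \<boxtimes>\<^bsub>C\<^esub> Y') (i + j) \<cdot> fmul F X' Y' i j \<cdot> (farr F f i \<boxdot> farr F g j) =
      (fmul G X' Y' i j \<cdot> (farr G f i \<boxdot> farr G g j)) \<cdot> (\<eta> X i \<boxdot> \<eta> Y j)" (is ?B)
proof -
  note t = F.src_Tensor[OF f g assms(3,4)]
  note [simp] = F.src_Obj[OF f] F.src_Obj[OF g] HomD[OF F.farr[OF f]] HomD[OF F.farr[OF g]]
    HomD[OF G.farr[OF f]] HomD[OF G.farr[OF g]] HomD[OF F.farr[OF t]] HomD[OF G.farr[OF t]]
  show ?A
    by (simp add: nat_reassoc[OF t] mon)
  show ?B
    by (simp add: mon_reassoc nat[OF f] nat[OF g])
qed

lemma transfer_Assoc: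
  assumes o[simp]: "X \<in> Obj C" "Y \<in> Obj C" "Z \<in> Obj C" "X \<boxtimes>\<^bsub>C\<^esub> Y \<in> Obj C" "Y \<boxtimes>\<^bsub>C\<^esub> Z \<in> Obj C"
        "(X \<boxtimes>\<^bsub>C\<^esub> Y) \<boxtimes>\<^bsub>C\<^esub> Z \<in> Obj C" "X \<boxtimes>\<^bsub>C\<^esub> (Y \<boxtimes>\<^bsub>C\<^esub> Z) \<in> Obj C"
  shows "\<eta> (X \<boxtimes>\<^bsub>C\<^esub> (Y \<boxtimes>\<^bsub>C\<^esub> Z)) (i + j + k) \<cdot>
      farr F (Assoc C X Y Z) (i + j + k) \<cdot> fmul F (X \<boxtimes>\<^bsub>C\<^esub> Y) Z (i + j) k \<cdot>
            (fmul F X Y i j \<boxdot> Ident A (fob F Z k)) =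
      (farr G (Assoc C X Y Z) (i + j + k) \<cdot> fmul G (X \<boxtimes>\<^bsub>C\<^esub> Y) Z (i + j) k \<cdot>
            (fmul G X Y i j \<boxdot> Ident A (fob G Z k))) \<cdot> ((\<eta> X i \<boxdot> \<eta> Y j) \<boxdot> \<eta> Z k)" (is ?A)
    "\<eta> (X \<boxtimes>\<^bsub>C\<^esub> (Y \<boxtimes>\<^bsub>C\<^esub> Z)) (i + j + k) \<cdot>
      fmul F X (Y \<boxtimes>\<^bsub>C\<^esub> Z) i (j + k) \<cdot> (Ident A (fob F X i) \<boxdot> fmul F Y Z j k) \<cdot>
            Assoc A (fob F X i) (fob F Y j) (fob F Z k) =
     (fmul G X (Y \<boxtimes>\<^bsub>C\<^esub> Z) i (j + k) \<cdot> (Ident A (fob G X i) \<boxdot> fmul G Y Z j k) \<cdot>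
            Assoc A (fob G X i) (fob G Y j) (fob G Z k)) \<cdot> ((\<eta> X i \<boxdot> \<eta> Y j) \<boxdot> \<eta> Z k)" (is ?B)
proof -
  note t = F.src_Assoc[OF o]
  note [simp] = HomD[OF F.farr[OF t]] HomD[OF G.farr[OF t]]
  show ?A
    by (simp add: nat_reassoc[OF t] mon_reassoc mon)
  show ?B
    \<comment> \<open>Instantiated explicitly: multiplicativity produces the index
      \<open>i + (j + k)\<close>, which has to be identified with \<open>i + j + k\<close>.\<close>
    using mon_reassoc[of X "Y \<boxtimes>\<^bsub>C\<^esub> Z" "(Ident A (fob F X i) \<boxdot> fmul F Y Z j k) \<cdot>
            Assoc A (fob F X i) (fob F Y j) (fob F Z k)" i "j + k"]
    by (simp add: mon add.assoc F.A.Assoc_tensor)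
qed

lemma transfer_LUnit:
  assumes [simp]: "X \<in> Obj C" "Unit C \<boxtimes>\<^bsub>C\<^esub> X \<in> Obj C"
  shows "\<eta> X i \<cdot> farr F (LUnit C X) i \<cdot> fmul F (Unit C) X 0 i \<cdot> (funit F \<boxdot> Ident A (fob F X i)) =
    (farr G (LUnit C X) i \<cdot> fmul G (Unit C) X 0 i \<cdot> (funit G \<boxdot> Ident A (fob G X i))) \<cdot>
      (Ident A (Unit A) \<boxdot> \<eta> X i)" (is ?A)
    "\<eta> X i \<cdot> LUnit A (fob F X i) = LUnit A (fob G X i) \<cdot> (Ident A (Unit A) \<boxdot> \<eta> X i)" (is ?B)
proof -
  note t = F.src_LUnit[OF assms]
  note [simp] = HomD[OF F.farr[OF t]] HomD[OF G.farr[OF t]]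
  show ?A
    using mon_reassoc[of "Unit C" X "funit F \<boxdot> Ident A (fob F X i)" 0 i]
    by (simp add: nat_reassoc[OF t] unital)
  show ?B
    by (simp add: F.A.LUnit_tensor)
qed

lemma transfer_RUnit:
  assumes [simp]: "X \<in> Obj C" "X \<boxtimes>\<^bsub>C\<^esub> Unit C \<in> Obj C"
  shows "\<eta> X i \<cdot> farr F (RUnit C X) i \<cdot> fmul F X (Unit C) i 0 \<cdot> (Ident A (fob F X i) \<boxdot> funit F) =
    (farr G (RUnit C X) i \<cdot> fmul G X (Unit C) i 0 \<cdot> (Ident A (fob G X i) \<boxdot> funit G)) \<cdot>
      (\<eta> X i \<boxdot> Ident A (Unit A))" (is ?A)
    "\<eta> X i \<cdot> RUnit A (fob F X i) = RUnit A (fob G X i) \<cdot> (\<eta> X i \<boxdot> Ident A (Unit A))" (is ?B)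
proof -
  note t = F.src_RUnit[OF assms]
  note [simp] = HomD[OF F.farr[OF t]] HomD[OF G.farr[OF t]]
  show ?A
    using mon_reassoc[of X "Unit C" "Ident A (fob F X i) \<boxdot> funit F" i 0]
    by (simp add: nat_reassoc[OF t] unital)
  show ?B
    by (simp add: F.A.RUnit_tensor)
qed

lemma transfer_Sym:
  assumes o[simp]: "X \<in> Obj C" "Y \<in> Obj C" "X \<boxtimes>\<^bsub>C\<^esub> Y \<in> Obj C" "Y \<boxtimes>\<^bsub>C\<^esub> X \<in> Obj C"
  shows "\<eta> (Y \<boxtimes>\<^bsub>C\<^esub> X) (i + j) \<cdot> farr F (Sym C X Y) (i + j) \<cdot> fmul F X Y i j =
    (farr G (Sym C X Y) (i + j) \<cdot> fmul G X Y i j) \<cdot> (\<eta> X i \<boxdot> \<eta> Y j)" (is ?A)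
   "\<eta> (Y \<boxtimes>\<^bsub>C\<^esub> X) (i + j) \<cdot> signed A k (fmul F Y X j i \<cdot> Sym A (fob F X i) (fob F Y j)) =
    signed A k (fmul G Y X j i \<cdot> Sym A (fob G X i) (fob G Y j)) \<cdot> (\<eta> X i \<boxdot> \<eta> Y j)" (is ?B)
proof -
  note t = F.src_Sym[OF o]
  note [simp] = HomD[OF F.farr[OF t]] HomD[OF G.farr[OF t]]
  show ?A
    by (simp add: nat_reassoc[OF t] mon)
  show ?B
    using mon_reassoc[of Y X "Sym A (fob F X i) (fob F Y j)" j i]
    by (simp add: add.commute[of j i] F.A.Sym_tensor)
qed

text \<open>Applied to the truncation inside the tautological family, and to the cycles inside a
  complex-valued functor. Only closure under the structure maps then remains to be proved; every
  coherence axiom is inherited.\<close>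

lemma lax_subfamily:
  assumes G: "lax_family C A \<delta> G deg" and m: "\<And>X i. X \<in> Obj C \<Longrightarrow> monic A (\<eta> X i)"
  shows "lax_family C A \<delta> F deg"
proof -
  interpret G: lax_family C A \<delta> G deg by (rule G)
  have cancel: "u = v" if "\<eta> X i \<cdot> u = \<eta> X i \<cdot> v" "X \<in> Obj C" "u \<in> Arr A" "v \<in> Arr A"
    "Dom A u = Dom A v" "Cod A u = fob F X i" "Cod A v = fob F X i" for u v X i
    by (rule F.A.monicD[OF m[OF that(2)] that(1)]) (use that in \<open>auto simp: Hom_iff\<close>)
  show ?thesis
  proof (unfold_locales, goal_cases)
    case (1 X i)
    note [simp] = HomD[OF F.farr[OF F.src_Ident[OF 1]]]
    show ?case
      by (rule cancel[of X i]) (use 1 nat[OF F.src_Ident[OF 1], of i] G.farr_Ident[OF 1] in auto)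
  next
    case (2 f X Y g Z i)
    note [simp] = HomD[OF F.farr[OF 2(1)]] HomD[OF F.farr[OF 2(2)]] F.src_Obj[OF 2(1)] F.src_Obj[OF 2(2)]
      HomD[OF F.farr[OF F.src_Comp[OF 2]]]
    show ?case by (rule cancel[of Z i], unfold transfer_Comp[OF 2] G.farr_Comp[OF 2]) auto
  next
    case (3 X i)
    show ?case
      by (rule cancel[of X "i - \<delta> - \<delta>"], unfold transfer_fdiff_fdiff[OF 3] G.fdiff_fdiff[OF 3]) (use 3 in auto)
  next
    case (4 f X Y i)
    note [simp] = HomD[OF F.farr[OF 4]] F.src_Obj[OF 4]
    show ?case by (rule cancel[of Y "i - \<delta>"], unfold transfer_fdiff_natural[OF 4] G.fdiff_natural[OF 4]) auto
  next
    case 5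
    show ?case 
      by (rule cancel[of "Unit C" "- \<delta>"])
        (use chain_reassoc[of "Unit C" "funit F" 0] unital G.fdiff_funit in auto)
  next
    case (6 X Y i j)
    show ?case
      by (rule cancel[of "X \<boxtimes>\<^bsub>C\<^esub> Y" "i + j - \<delta>"], unfold transfer_leibniz[OF 6] G.leibniz[OF 6])
        (use 6 in \<open>auto simp: diff_add_eq add_diff_eq\<close>)
  next
    case (7 f X X' g Y Y' i j)
    note [simp] = HomD[OF F.farr[OF 7(1)]] HomD[OF F.farr[OF 7(2)]] F.src_Obj[OF 7(1)] F.src_Obj[OF 7(2)]
      HomD[OF F.farr[OF F.src_Tensor[OF 7]]]
    show ?case
      by (rule cancel[of "X' \<boxtimes>\<^bsub>C\<^esub> Y'" "i + j"], unfold transfer_natural[OF 7] G.fmul_natural[OF 7])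
        (use 7 in auto)
  next
    case (8 X Y Z i j k)
    note [simp] = HomD[OF F.farr[OF F.src_Assoc[OF 8]]]
    show ?case
      by (rule cancel[of "X \<boxtimes>\<^bsub>C\<^esub> (Y \<boxtimes>\<^bsub>C\<^esub> Z)" "i + j + k"], unfold transfer_Assoc[OF 8] G.fmul_Assoc[OF 8])
        (use 8 in \<open>auto simp: add.assoc\<close>)
  next
    case (9 X i)
    note [simp] = HomD[OF F.farr[OF F.src_LUnit[OF 9]]]
    show ?case
      by (rule cancel[of X i], unfold transfer_LUnit[OF 9] G.fmul_LUnit[OF 9]) (use 9 in auto)
  next
    case (10 X i)
    note [simp] = HomD[OF F.farr[OF F.src_RUnit[OF 10]]]
    show ?case
      by (rule cancel[of X i], unfold transfer_RUnit[OF 10] G.fmul_RUnit[OF 10]) (use 10 in auto)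
  next
    case (11 X Y i j)
    note [simp] = HomD[OF F.farr[OF F.src_Sym[OF 11]]]
    show ?case
      by (rule cancel[of "Y \<boxtimes>\<^bsub>C\<^esub> X" "i + j"], unfold transfer_Sym[OF 11] G.fmul_Sym[OF 11])
        (use 11 in \<open>auto simp: add.commute[of j i]\<close>)
  qed
qed

text \<open>Applied to the passage from cycles to homology. An axiom in several arguments is
  cancelled against a tensor product of components of \<open>\<eta>\<close>, hence the requirement
  that tensor products of epimorphisms be epic.\<close>

lemma lax_quotient_family:
  assumes F: "lax_family C A \<delta> F deg" and e: "\<And>X i. X \<in> Obj C \<Longrightarrow> epic A (\<eta> X i)"
    and tensor_epic: "\<And>f g. epic A f \<Longrightarrow> epic A g \<Longrightarrow> epic A (f \<boxdot> g)"
  shows "lax_family C A \<delta> G deg"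
proof -
  interpret F: lax_family C A \<delta> F deg by (rule F)
  have cancel: "u = v" if "u \<cdot> q = v \<cdot> q" "epic A q" "u \<in> Arr A" "v \<in> Arr A"
    "Cod A u = Cod A v" "Dom A u = Cod A q" "Dom A v = Cod A q" for u v q
    by (rule F.A.epicD[OF that(2,1)]) (use that in \<open>auto simp: Hom_iff\<close>)
  have I: "epic A (Ident A X)" if "X \<in> Obj A" for X
    using that by (auto simp: epic_def Hom_iff)
  show ?thesis
  proof (unfold_locales, goal_cases)
    case (1 X i)
    note [simp] = HomD[OF G.farr[OF F.src_Ident[OF 1]]]
    show ?case
      by (rule cancel[OF _ e[of X i]]) (use 1 nat[OF F.src_Ident[OF 1], of i] F.farr_Ident[OF 1] in auto)
  next
    case (2 f X Y g Z i)
    note [simp] = HomD[OF G.farr[OF 2(1)]] HomD[OF G.farr[OF 2(2)]] F.src_Obj[OF 2(1)] F.src_Obj[OF 2(2)]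
      HomD[OF G.farr[OF F.src_Comp[OF 2]]]
    show ?case by (rule cancel[OF _ e[of X i]], unfold transfer_Comp[OF 2, symmetric] F.farr_Comp[OF 2]) auto
  next
    case (3 X i)
    show ?case
      by (rule cancel[OF _ e[of X i]], unfold transfer_fdiff_fdiff[OF 3, symmetric] F.fdiff_fdiff[OF 3]) (use 3 in auto)
  next
    case (4 f X Y i)
    note [simp] = HomD[OF G.farr[OF 4]] F.src_Obj[OF 4]
    show ?case
      by (rule cancel[OF _ e[of X i]], unfold transfer_fdiff_natural[OF 4, symmetric] F.fdiff_natural[OF 4]) auto
  next
    case 5
    \<comment> \<open>Nothing is cancelled for the unit: \<open>funit G\<close> is by definition the
      image of \<open>funit F\<close>, so its differential is the image of zero.\<close>
    have "fdiff G (Unit C) 0 \<cdot> \<eta> (Unit C) 0 \<cdot> funit F = \<eta> (Unit C) (0 - \<delta>) \<cdot> fdiff F (Unit C) 0 \<cdot> funit F"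
      by (rule chain_reassoc[symmetric]) auto
    then show ?case by (simp add: unital F.fdiff_funit)
  next
    case (6 X Y i j)
    show ?case
      by (rule cancel[OF _ tensor_epic[OF e e], of _ X i Y j], unfold transfer_leibniz[OF 6, symmetric] F.leibniz[OF 6])
        (use 6 in \<open>auto simp: diff_add_eq add_diff_eq\<close>)
  next
    case (7 f X X' g Y Y' i j)
    note [simp] = HomD[OF G.farr[OF 7(1)]] HomD[OF G.farr[OF 7(2)]] F.src_Obj[OF 7(1)] F.src_Obj[OF 7(2)]
      HomD[OF G.farr[OF F.src_Tensor[OF 7]]]
    show ?case
      by (rule cancel[OF _ tensor_epic[OF e e], of _ X i Y j], unfold transfer_natural[OF 7, symmetric] F.fmul_natural[OF 7])
        (use 7 in auto)
  next
    case (8 X Y Z i j k)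
    note [simp] = HomD[OF G.farr[OF F.src_Assoc[OF 8]]]
    show ?case
      by (rule cancel[OF _ tensor_epic[OF tensor_epic[OF e e] e], of _ X i Y j Z k],
          unfold transfer_Assoc[OF 8, symmetric] F.fmul_Assoc[OF 8])
        (use 8 in \<open>auto simp: add.assoc\<close>)
  next
    case (9 X i)
    note [simp] = HomD[OF G.farr[OF F.src_LUnit[OF 9]]]
    show ?case
      by (rule cancel[OF _ tensor_epic[OF I e], of _ "Unit A" X i],
        unfold transfer_LUnit[OF 9, symmetric] F.fmul_LUnit[OF 9]) (use 9 in auto)
  next
    case (10 X i)
    note [simp] = HomD[OF G.farr[OF F.src_RUnit[OF 10]]]
    show ?case
      by (rule cancel[OF _ tensor_epic[OF e I], of _ X i "Unit A"],
        unfold transfer_RUnit[OF 10, symmetric] F.fmul_RUnit[OF 10]) (use 10 in auto)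
  next
    case (11 X Y i j)
    note [simp] = HomD[OF G.farr[OF F.src_Sym[OF 11]]]
    show ?case
      by (rule cancel[OF _ tensor_epic[OF e e], of _ X i Y j],
        unfold transfer_Sym[OF 11, symmetric] F.fmul_Sym[OF 11])
        (use 11 in \<open>auto simp: add.commute[of j i]\<close>)
  qed
qed

end

section \<open>Summation over the extra degree\<close>

text \<open>The arrow part of \<open>forget_degree\<close>, detached from the functor so that it
  also applies to families such as kernels and cokernels; \<open>bicopair\<close> does the same for
  its multiplication.\<close>

definition dmap :: "('o, 'm) sm_cat \<Rightarrow> (int \<Rightarrow> 'm) \<Rightarrow> 'm" where
  "dmap A f = copair A (\<lambda>p. Dom A (f p)) (dsum A (\<lambda>p. Cod A (f p)))
     (\<lambda>p. dinj A (\<lambda>p. Cod A (f p)) p \<cdot>\<^bsub>A\<^esub> f p)"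

definition bicopair ::
  "('o, 'm) sm_cat \<Rightarrow> (int \<Rightarrow> 'o) \<Rightarrow> (int \<Rightarrow> 'o) \<Rightarrow> 'o \<Rightarrow> (int \<Rightarrow> int \<Rightarrow> 'm) \<Rightarrow> 'm" where
  "bicopair A X Y T g = (THE h. h \<in> Hom A (dsum A X \<boxtimes>\<^bsub>A\<^esub> dsum A Y) T \<and>
     (\<forall>p q. h \<cdot>\<^bsub>A\<^esub> (dinj A X p \<boxdot>\<^bsub>A\<^esub> dinj A Y q) = g p q))"

definition sum_family :: "('o, 'm) sm_cat \<Rightarrow> ('c, 'f, int \<times> int, 'o, 'm) family \<Rightarrow> ('c, 'f) sm_cat
  \<Rightarrow> ('c, 'f, int, 'o, 'm) family" where
  "sum_family A F C = \<lparr>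
     fob = (\<lambda>X n. dsum A (\<lambda>p. fob F X (n, p))),
     farr = (\<lambda>f n. dmap A (\<lambda>p. farr F f (n, p))),
     fdiff = (\<lambda>X n. dmap A (\<lambda>p. fdiff F X (n, p))),
     fmul = (\<lambda>X Y k l. bicopair A (\<lambda>p. fob F X (k, p)) (\<lambda>p. fob F Y (l, p))
       (dsum A (\<lambda>p. fob F (X \<boxtimes>\<^bsub>C\<^esub> Y) (k + l, p)))
       (\<lambda>p q. dinj A (\<lambda>p. fob F (X \<boxtimes>\<^bsub>C\<^esub> Y) (k + l, p)) (p + q) \<cdot>\<^bsub>A\<^esub> fmul F X Y (k, p) (l, q))),
     funit = dinj A (\<lambda>p. fob F (Unit C) (0, p)) 0 \<cdot>\<^bsub>A\<^esub> funit F\<rparr>"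

context tensor_sum_category
begin

lemma dmap_Arr [simp]:
  assumes "\<And>p. f p \<in> Arr C"
  shows "dmap C f \<in> Arr C" "Dom C (dmap C f) = dsum C (\<lambda>p. Dom C (f p))"
    "Cod C (dmap C f) = dsum C (\<lambda>p. Cod C (f p))"
  using assms by (simp_all add: dmap_def)

lemma dmap_dinj:
  assumes "\<And>p. f p \<in> Arr C" "\<And>p. Dom C (f p) = X p"
  shows "dmap C f \<cdot> dinj C X p = dinj C (\<lambda>p. Cod C (f p)) p \<cdot> f p"
proof -
  have X: "X = (\<lambda>p. Dom C (f p))" using assms by auto
  show ?thesis unfolding X dmap_def by (subst copair(4)) (use assms(1) in simp_all)
qed

lemma dmap_dinj_reassoc:
  assumes "\<And>p. f p \<in> Arr C" "\<And>p. Dom C (f p) = X p" "r \<in> Arr C" "Cod C r = X p"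
  shows "dmap C f \<cdot> dinj C X p \<cdot> r = dinj C (\<lambda>p. Cod C (f p)) p \<cdot> f p \<cdot> r"
proof -
  have [simp]: "X p \<in> Obj C" for p using Dom_Obj[OF assms(1), of p] assms(2) by simp
  show ?thesis by (subst reassoc[OF dmap_dinj]) (use assms in simp_all)
qed

lemma bicopair [simp]:
  assumes F: "\<And>i. F i \<in> Obj C" "\<And>i. G i \<in> Obj C" "T \<in> Obj C"
    and g: "\<And>i j. g i j \<in> Arr C" "\<And>i j. Dom C (g i j) = F i \<boxtimes> G j" "\<And>i j. Cod C (g i j) = T"
  shows "bicopair C F G T g \<in> Arr C" (is ?A) "Dom C (bicopair C F G T g) = dsum C F \<boxtimes> dsum C G" (is ?B)
    "Cod C (bicopair C F G T g) = T" (is ?C) "bicopair C F G T g \<cdot> (dinj C F i \<boxdot> dinj C G j) = g i j" (is ?D)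
proof -
  obtain h where h: "h \<in> Hom C (dsum C F \<boxtimes> dsum C G) T" "\<And>i j. h \<cdot> (dinj C F i \<boxdot> dinj C G j) = g i j"
    using dsum_tensor_dsum_ex[of F G T g] assms by metis
  have "bicopair C F G T g = h"
    unfolding bicopair_def
  proof (rule the_equality)
    fix h' assume "h' \<in> Hom C (dsum C F \<boxtimes> dsum C G) T \<and> (\<forall>i j. h' \<cdot> (dinj C F i \<boxdot> dinj C G j) = g i j)"
    then show "h' = h"
      by (intro dsum_tensor_dsum_ext[of h' h F G]) (use h F in \<open>auto simp: Hom_iff\<close>)
  qed (use h in auto)
  then show ?A ?B ?C ?D
    using h by (auto simp: Hom_iff)
qed

text \<open>Since tensors of composites are kept merged, the inclusions
  \<open>dinj C F i \<boxdot> dinj C G j\<close> rarely occur bare. These are the shapes in which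
  they meet a \<open>bicopair\<close>.\<close>

lemma bicopair_Comp [simp]:
  assumes "\<And>i. F i \<in> Obj C" "\<And>i. G i \<in> Obj C" "T \<in> Obj C"
    "\<And>i j. g i j \<in> Arr C" "\<And>i j. Dom C (g i j) = F i \<boxtimes> G j" "\<And>i j. Cod C (g i j) = T"
  shows "a \<in> Arr C \<Longrightarrow> b \<in> Arr C \<Longrightarrow> Cod C a = F i \<Longrightarrow> Cod C b = G j \<Longrightarrow>
      bicopair C F G T g \<cdot> ((dinj C F i \<cdot> a) \<boxdot> (dinj C G j \<cdot> b)) = g i j \<cdot> (a \<boxdot> b)"
    "b \<in> Arr C \<Longrightarrow> Cod C b = G j \<Longrightarrow>
      bicopair C F G T g \<cdot> (dinj C F i \<boxdot> (dinj C G j \<cdot> b)) = g i j \<cdot> (Ident C (F i) \<boxdot> b)"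
    "a \<in> Arr C \<Longrightarrow> Cod C a = F i \<Longrightarrow>
      bicopair C F G T g \<cdot> ((dinj C F i \<cdot> a) \<boxdot> dinj C G j) = g i j \<cdot> (a \<boxdot> Ident C (G j))"
proof -
  have *: "bicopair C F G T g \<cdot> (dinj C F i \<boxdot> dinj C G j) \<cdot> r = g i j \<cdot> r"
    if "r \<in> Arr C" "Cod C r = F i \<boxtimes> G j" for r
    by (subst reassoc[OF bicopair(4)]) (use assms that in simp_all)
  show "a \<in> Arr C \<Longrightarrow> b \<in> Arr C \<Longrightarrow> Cod C a = F i \<Longrightarrow> Cod C b = G j \<Longrightarrow>
      bicopair C F G T g \<cdot> ((dinj C F i \<cdot> a) \<boxdot> (dinj C G j \<cdot> b)) = g i j \<cdot> (a \<boxdot> b)"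
    "b \<in> Arr C \<Longrightarrow> Cod C b = G j \<Longrightarrow>
      bicopair C F G T g \<cdot> (dinj C F i \<boxdot> (dinj C G j \<cdot> b)) = g i j \<cdot> (Ident C (F i) \<boxdot> b)"
    "a \<in> Arr C \<Longrightarrow> Cod C a = F i \<Longrightarrow>
      bicopair C F G T g \<cdot> ((dinj C F i \<cdot> a) \<boxdot> dinj C G j) = g i j \<cdot> (a \<boxdot> Ident C (G j))"
    using *[of "a \<boxdot> b"] *[of "Ident C (F i) \<boxdot> b"] *[of "a \<boxdot> Ident C (G j)"] assms by simp_all
qed

lemma bicopair_reassoc [simp]:
  assumes "\<And>i. F i \<in> Obj C" "\<And>i. G i \<in> Obj C" "T \<in> Obj C"
    "\<And>i j. g i j \<in> Arr C" "\<And>i j. Dom C (g i j) = F i \<boxtimes> G j" "\<And>i j. Cod C (g i j) = T"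
    and r: "r \<in> Arr C" 
  shows "a \<in> Arr C \<Longrightarrow> b \<in> Arr C \<Longrightarrow> Cod C a = F i \<Longrightarrow> Cod C b = G j \<Longrightarrow> Cod C r = Dom C a \<boxtimes> Dom C b \<Longrightarrow>
      bicopair C F G T g \<cdot> ((dinj C F i \<cdot> a) \<boxdot> (dinj C G j \<cdot> b)) \<cdot> r = g i j \<cdot> (a \<boxdot> b) \<cdot> r"
    "b \<in> Arr C \<Longrightarrow> Cod C b = G j \<Longrightarrow> Cod C r = F i \<boxtimes> Dom C b \<Longrightarrow>
      bicopair C F G T g \<cdot> (dinj C F i \<boxdot> (dinj C G j \<cdot> b)) \<cdot> r = g i j \<cdot> (Ident C (F i) \<boxdot> b) \<cdot> r"
    "Cod C r = F i \<boxtimes> G j \<Longrightarrow>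
      bicopair C F G T g \<cdot> (dinj C F i \<boxdot> dinj C G j) \<cdot> r = g i j \<cdot> r"
  by (subst reassoc[OF bicopair_Comp(1)] reassoc[OF bicopair_Comp(2)] reassoc[OF bicopair(4)];
      use assms in simp)+

text \<open>Sums are split off one tensor factor at a time, the other two factors being held fixed
  by identities.\<close>

lemma dsum_tensor3_ext:
  assumes "h \<in> Arr C" "h' \<in> Arr C" "Cod C h' = Cod C h"
    and [simp]: "\<And>i. F i \<in> Obj C" "\<And>i. G i \<in> Obj C" "\<And>i. H i \<in> Obj C"
    and d: "Dom C h = (dsum C F \<boxtimes> dsum C G) \<boxtimes> dsum C H" "Dom C h' = (dsum C F \<boxtimes> dsum C G) \<boxtimes> dsum C H"
    and e: "\<And>i j k. h \<cdot> ((dinj C F i \<boxdot> dinj C G j) \<boxdot> dinj C H k) = h' \<cdot> ((dinj C F i \<boxdot> dinj C G j) \<boxdot> dinj C H k)"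
  shows "h = h'"
proof -
  have 1: "u = v" if "u \<in> Arr C" "v \<in> Arr C" "Cod C v = Cod C u" "Dom C u = (dsum C F \<boxtimes> Y) \<boxtimes> Z" "Dom C v = (dsum C F \<boxtimes> Y) \<boxtimes> Z"
    "Y \<in> Obj C" "Z \<in> Obj C"
    "\<And>i. u \<cdot> ((dinj C F i \<boxdot> Ident C Y) \<boxdot> Ident C Z) = v \<cdot> ((dinj C F i \<boxdot> Ident C Y) \<boxdot> Ident C Z)" for u v Y Z
    by (rule is_coproduct_ext[OF tensor_coproduct_left[OF tensor_coproduct_left[OF is_coproduct_dsum[of F]]], of Y Z])
      (use that in \<open>auto simp: Hom_iff\<close>)
  have 2: "u = v" if "u \<in> Arr C" "v \<in> Arr C" "Cod C v = Cod C u" "Dom C u = (X \<boxtimes> dsum C G) \<boxtimes> Z" "Dom C v = (X \<boxtimes> dsum C G) \<boxtimes> Z"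
    "X \<in> Obj C" "Z \<in> Obj C"
    "\<And>i. u \<cdot> ((Ident C X \<boxdot> dinj C G i) \<boxdot> Ident C Z) = v \<cdot> ((Ident C X \<boxdot> dinj C G i) \<boxdot> Ident C Z)" for u v X Z
    by (rule is_coproduct_ext[OF tensor_coproduct_left[OF tensor_coproduct_right[OF is_coproduct_dsum[of G]]], of X Z])
      (use that in \<open>auto simp: Hom_iff\<close>)
  show ?thesis
  proof (rule 1[of _ _ "dsum C G" "dsum C H"])
    fix i
    show "h \<cdot> ((dinj C F i \<boxdot> Ident C (dsum C G)) \<boxdot> Ident C (dsum C H)) =
      h' \<cdot> ((dinj C F i \<boxdot> Ident C (dsum C G)) \<boxdot> Ident C (dsum C H))" (is "?u = ?v")
    proof (rule 2[of _ _ "F i" "dsum C H"])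
      fix j
      show "?u \<cdot> ((Ident C (F i) \<boxdot> dinj C G j) \<boxdot> Ident C (dsum C H)) = ?v \<cdot> ((Ident C (F i) \<boxdot> dinj C G j) \<boxdot> Ident C (dsum C H))"
        by (rule dsum_tensor_ext(2)[where X="F i \<boxtimes> G j" and F=H]) (use assms in simp_all)
    qed (use assms in simp_all)
  qed (use assms in simp_all)
qed

end

lemma sum_family_sel:
  "fob (sum_family A F C) X n = dsum A (\<lambda>p. fob F X (n, p))"
  "farr (sum_family A F C) f n = dmap A (\<lambda>p. farr F f (n, p))"
  "fdiff (sum_family A F C) X n = dmap A (\<lambda>p. fdiff F X (n, p))"
  "fmul (sum_family A F C) X Y k l = bicopair A (\<lambda>p. fob F X (k, p)) (\<lambda>p. fob F Y (l, p))
     (dsum A (\<lambda>p. fob F (X \<boxtimes>\<^bsub>C\<^esub> Y) (k + l, p)))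
     (\<lambda>p q. dinj A (\<lambda>p. fob F (X \<boxtimes>\<^bsub>C\<^esub> Y) (k + l, p)) (p + q) \<cdot>\<^bsub>A\<^esub> fmul F X Y (k, p) (l, q))"
  "funit (sum_family A F C) = dinj A (\<lambda>p. fob F (Unit C) (0, p)) 0 \<cdot>\<^bsub>A\<^esub> funit F"
  by (simp_all add: sum_family_def)

lemma family_data_sum:
  assumes "family_data C A (1, 0) F"
  shows "family_data C A (1 :: int) (sum_family A F C)"
proof -
  interpret F: family_data C A "(1, 0)" F by (rule assms)
  show ?thesis
  proof (rule family_data.intro[OF F.guarded_source_axioms F.A.tensor_sum_category_axioms], unfold_locales, goal_cases)
    case (2 f X Y i)
    note [simp] = HomD[OF F.farr[OF 2]] F.src_Obj[OF 2]
    show ?case by (simp add: Hom_iff sum_family_sel)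
  qed (simp_all add: Hom_iff sum_family_sel zero_prod_def[symmetric])
qed

text \<open>Each axiom is an equality of maps out of a sum, or out of a tensor product of sums, and
  on the summand of weights \<open>p\<close>, \<open>q\<close>, \<open>r\<close> it is the axiom of
  \<open>F\<close> at the indices \<open>(i, p)\<close>, \<open>(j, q)\<close>,
  \<open>(k, r)\<close>. The signs match because \<open>deg\<close> ignores the weight.\<close>

lemma lax_family_sum:
  assumes "lax_family C A (1, 0) F (\<lambda>(k, p). k)"
  shows "lax_family C A (1 :: int) (sum_family A F C) (\<lambda>k. k)"
proof -
  interpret F: lax_family C A "(1, 0)" F "\<lambda>(k, p). k" by (rule assms)
  interpret S: family_data C A 1 "sum_family A F C"
    by (rule family_data_sum[OF F.family_data_axioms])
  note s = sum_family_sel F.A.dmap_dinj F.A.dmap_dinj_reassoc diff_add_eq add_diff_eq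
  show ?thesis
  proof (rule lax_family.intro[OF S.family_data_axioms], unfold_locales, goal_cases)
    case (1 X i)
    note [simp] = 1
    note [simp] = HomD[OF F.farr[OF F.src_Ident[OF 1]]]
    show ?case unfolding sum_family_sel
      by (rule F.A.dsum_ext[of _ _ "\<lambda>p. fob F X (i, p)"]) (simp_all add: s F.farr_Ident)
  next
    case (2 f X Y g Z i)
    note [simp] = HomD[OF F.farr[OF 2(1)]] HomD[OF F.farr[OF 2(2)]] F.src_Obj[OF 2(1)] F.src_Obj[OF 2(2)]
      HomD[OF F.farr[OF F.src_Comp[OF 2]]]
    show ?case unfolding sum_family_sel
      by (rule F.A.dsum_ext[of _ _ "\<lambda>p. fob F X (i, p)"]) (simp_all add: s F.farr_Comp[OF 2])
  next
    case (3 X i)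
    note [simp] = 3
    show ?case unfolding sum_family_sel
      by (rule F.A.dsum_ext[of _ _ "\<lambda>p. fob F X (i, p)"])
        (simp_all add: s F.fdiff_fdiff[where i="(_, _)", simplified])
  next
    case (4 f X Y i)
    note [simp] = HomD[OF F.farr[OF 4]] F.src_Obj[OF 4]
    show ?case unfolding sum_family_sel
      by (rule F.A.dsum_ext[of _ _ "\<lambda>p. fob F X (i, p)"])
        (simp_all add: s F.fdiff_natural[OF 4, where i="(_, _)", simplified])
  next
    case 5
    show ?case
      using F.fdiff_funit by (simp add: s zero_prod_def)
  next
    case (6 X Y i j)
    note [simp] = 6
    show ?case
      by (rule F.A.dsum_tensor_dsum_ext[of _ _ "\<lambda>p. fob F X (i, p)" "\<lambda>p. fob F Y (j, p)"])
        (simp_all add: s F.leibniz[where i="(_, _)" and j="(_, _)", simplified])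
  next
    case (7 f X X' g Y Y' i j)
    note [simp] = HomD[OF F.farr[OF 7(1)]] HomD[OF F.farr[OF 7(2)]] F.src_Obj[OF 7(1)] F.src_Obj[OF 7(2)]
      HomD[OF F.farr[OF F.src_Tensor[OF 7]]] 7(3,4)
    show ?case
      by (rule F.A.dsum_tensor_dsum_ext[of _ _ "\<lambda>p. fob F X (i, p)" "\<lambda>p. fob F Y (j, p)"])
        (simp_all add: s F.fmul_natural[OF 7, where i="(_, _)" and j="(_, _)", simplified])
  next
    case (8 X Y Z i j k)
    note [simp] = HomD[OF F.farr[OF F.src_Assoc[OF 8]]] 8
    show ?case
    proof (rule F.A.dsum_tensor3_ext[of _ _ "\<lambda>p. fob F X (i, p)" "\<lambda>p. fob F Y (j, p)" "\<lambda>p. fob F Z (k, p)"], goal_cases)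
      case (9 p q r)
      show ?case
        using F.fmul_Assoc[OF 8, where i="(i, p)" and j="(j, q)" and k="(k, r)"]
        by (simp add: s add.assoc F.A.Assoc_tensor)
    qed (simp_all add: s add.assoc)
  next
    case (9 X i)
    note [simp] = HomD[OF F.farr[OF F.src_LUnit[OF 9]]] 9
    show ?case
    proof (rule F.A.dsum_tensor_ext(2)[where F="\<lambda>p. fob F X (i, p)" and X="Unit A"], goal_cases)
      case (8 p)
      show ?case
        using F.fmul_LUnit[OF 9, where i="(i, p)"]
        by (simp add: s F.A.LUnit_tensor zero_prod_def)
    qed (simp_all add: s zero_prod_def)
  next
    case (10 X i)
    note [simp] = HomD[OF F.farr[OF F.src_RUnit[OF 10]]] 10
    show ?case
    proof (rule F.A.dsum_tensor_ext(1)[where F="\<lambda>p. fob F X (i, p)" and X="Unit A"], goal_cases)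
      case (8 p)
      show ?case
        using F.fmul_RUnit[OF 10, where i="(i, p)"]
        by (simp add: s F.A.RUnit_tensor zero_prod_def)
    qed (simp_all add: s zero_prod_def)
  next
    case (11 X Y i j)
    note [simp] = HomD[OF F.farr[OF F.src_Sym[OF 11]]] 11
    show ?case
    proof (rule F.A.dsum_tensor_dsum_ext[of _ _ "\<lambda>p. fob F X (i, p)" "\<lambda>p. fob F Y (j, p)"], goal_cases)
      case (8 p q)
      show ?case
        using F.fmul_Sym[OF 11, where i="(i, p)" and j="(j, q)"]
        by (simp add: s F.A.Sym_tensor add.commute)
    qed (simp_all add: s add.commute)
  qed
qed

lemma family_trans_sum:
  assumes "family_trans C A (1, 0) F G \<eta>"
  shows "family_trans C A (1 :: int) (sum_family A F C) (sum_family A G C) (\<lambda>X n. dmap A (\<lambda>p. \<eta> X (n, p)))"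
proof -
  interpret T: family_trans C A "(1, 0)" F G \<eta> by (rule assms)
  note s = sum_family_sel T.F.A.dmap_dinj T.F.A.dmap_dinj_reassoc
  show ?thesis
  proof (rule family_trans.intro[OF family_data_sum[OF T.F.family_data_axioms] family_data_sum[OF T.G.family_data_axioms]],
      unfold_locales, goal_cases)
    case (1 X i)
    then show ?case by (simp add: Hom_iff s)
  next
    case (2 f X Y i)
    note [simp] = HomD[OF T.F.farr[OF 2]] HomD[OF T.G.farr[OF 2]] T.F.src_Obj[OF 2]
    show ?case unfolding sum_family_sel
      by (rule T.F.A.dsum_ext[of _ _ "\<lambda>p. fob F X (i, p)"]) (simp_all add: s T.nat[OF 2])
  next
    case (3 X Y i j)
    note [simp] = 3
    show ?case
    proof (rule T.F.A.dsum_tensor_dsum_ext[of _ _ "\<lambda>p. fob F X (i, p)" "\<lambda>p. fob F Y (j, p)"], goal_cases)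
      case (8 p q)
      show ?case
        using T.mon[OF 3, where i="(i, p)" and j="(j, q)"] by (simp add: s)
    qed (simp_all add: s)
  next
    case 4
    show ?case
      using T.unital by (simp add: s zero_prod_def)
  qed
qed

section \<open>From families to functors\<close>

text \<open>A functor may assemble its structure maps in any way, for instance as composites of
  functors; only their restrictions to summands are prescribed. Away from degree 0 the source of the
  unit map is a zero object, so a typing condition suffices there.\<close>

locale representation = lax_family C A "1 :: int" P "\<lambda>k. k"
  for C :: "('c, 'f) sm_cat" and A :: "('o, 'm) sm_cat" (structure) and P :: "('c, 'f, int, 'o, 'm) family" +
  fixes \<FF> :: "('c, 'f, ('o, 'm) chain_complex, ('o, 'm) chain_map) lax_functor"
  assumes rep_obj: "X \<in> Obj C \<Longrightarrow> FObj \<FF> X = \<lparr>cob = fob P X, cdiff = fdiff P X\<rparr>"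
    and rep_arr: "f \<in> Hom C X Y \<Longrightarrow> FArr \<FF> f = cmap (FObj \<FF> X) (FObj \<FF> Y) (farr P f)"
    and rep_mult_dom: "\<lbrakk>X \<in> Obj C; Y \<in> Obj C; X \<boxtimes>\<^bsub>C\<^esub> Y \<in> Obj C\<rbrakk>
      \<Longrightarrow> cdom (FMult \<FF> X Y) = ch_tensor A (FObj \<FF> X) (FObj \<FF> Y)"
    and rep_mult_cod: "\<lbrakk>X \<in> Obj C; Y \<in> Obj C; X \<boxtimes>\<^bsub>C\<^esub> Y \<in> Obj C\<rbrakk>
      \<Longrightarrow> ccod (FMult \<FF> X Y) = FObj \<FF> (X \<boxtimes>\<^bsub>C\<^esub> Y)"
    and rep_mult: "\<lbrakk>X \<in> Obj C; Y \<in> Obj C; X \<boxtimes>\<^bsub>C\<^esub> Y \<in> Obj C\<rbrakk>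
      \<Longrightarrow> carr (FMult \<FF> X Y) n \<in> Hom A (gr_tensor A (fob P X) (fob P Y) n) (fob P (X \<boxtimes>\<^bsub>C\<^esub> Y) n)"
    and rep_mult_inj: "\<lbrakk>X \<in> Obj C; Y \<in> Obj C; X \<boxtimes>\<^bsub>C\<^esub> Y \<in> Obj C\<rbrakk>
      \<Longrightarrow> carr (FMult \<FF> X Y) n \<cdot> gr_inj A (fob P X) (fob P Y) n p = fmul P X Y p (n - p)"
    and rep_unit_dom: "cdom (FUnit \<FF>) = zero_diff_complex A (gr_unit A)"
    and rep_unit_cod: "ccod (FUnit \<FF>) = FObj \<FF> (Unit C)"
    and rep_unit: "carr (FUnit \<FF>) n \<in> Hom A (gr_unit A n) (fob P (Unit C) n)"
    and rep_unit_0: "carr (FUnit \<FF>) 0 = funit P"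
begin

lemma rep_complex:
  assumes [simp]: "X \<in> Obj C"
  shows "is_complex A (FObj \<FF> X)"
  using fdiff_fdiff[OF assms] by (auto simp: rep_obj is_complex_def Hom_iff)

lemma rep_cob [simp]:
  assumes "X \<in> Obj C"
  shows "cob (FObj \<FF> X) = fob P X" "cdiff (FObj \<FF> X) = fdiff P X"
  using assms by (simp_all add: rep_obj)

lemma rep_mult_Arr [simp]:
  assumes "X \<in> Obj C" "Y \<in> Obj C" "X \<boxtimes>\<^bsub>C\<^esub> Y \<in> Obj C"
  shows "carr (FMult \<FF> X Y) n \<in> Arr A"
    "Dom A (carr (FMult \<FF> X Y) n) = gr_tensor A (fob P X) (fob P Y) n"
    "Cod A (carr (FMult \<FF> X Y) n) = fob P (X \<boxtimes>\<^bsub>C\<^esub> Y) n"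
  using HomD[OF rep_mult[OF assms, of n]] by auto

lemma rep_mult_inj_reassoc:
  assumes "X \<in> Obj C" "Y \<in> Obj C" "X \<boxtimes>\<^bsub>C\<^esub> Y \<in> Obj C"
    "r \<in> Arr A" "Cod A r = fob P X p \<boxtimes> fob P Y (n - p)"
  shows "carr (FMult \<FF> X Y) n \<cdot> gr_inj A (fob P X) (fob P Y) n p \<cdot> r = fmul P X Y p (n - p) \<cdot> r"
  by (subst A.reassoc[OF rep_mult_inj]) (use assms in simp_all)

lemma rep_unit_Arr [simp]:
  "carr (FUnit \<FF>) n \<in> Arr A" "Dom A (carr (FUnit \<FF>) n) = gr_unit A n"
  "Cod A (carr (FUnit \<FF>) n) = fob P (Unit C) n"
  using HomD[OF rep_unit] by auto

text \<open>Restricted to a summand, commutation with the differentials is the Leibniz rule of the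
  family.\<close>

lemma rep_mult_Hom:
  assumes o: "X \<in> Obj C" "Y \<in> Obj C" "X \<boxtimes>\<^bsub>C\<^esub> Y \<in> Obj C"
  shows "FMult \<FF> X Y \<in> Hom (Ch A) (ch_tensor A (FObj \<FF> X) (FObj \<FF> Y)) (FObj \<FF> (X \<boxtimes>\<^bsub>C\<^esub> Y))"
proof -
  note [simp] = o int_diff_normal A.ch_tensor_diff[OF rep_complex[OF o(1)] rep_complex[OF o(2)], unfolded rep_cob[OF o(1)] rep_cob[OF o(2)]]
  have "fdiff P (X \<boxtimes>\<^bsub>C\<^esub> Y) n \<cdot> carr (FMult \<FF> X Y) n =
    carr (FMult \<FF> X Y) (n - 1) \<cdot> cdiff (ch_tensor A (FObj \<FF> X) (FObj \<FF> Y)) n" for n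
  proof (rule A.gr_ext[where X="fob P X" and Y="fob P Y" and n=n], goal_cases)
    case (8 p)
    show ?case
      using leibniz[OF o, where i=p and j="n - p"] by (simp add: rep_mult_inj rep_mult_inj_reassoc)
  qed simp_all
  then show ?thesis
    by (auto simp: Hom_iff Ch_sel(2-4) is_chain_map_def rep_mult_dom rep_mult_cod rep_complex A.is_complex_ch_tensor)
qed

lemma rep_unit_Hom: "FUnit \<FF> \<in> Hom (Ch A) (Unit (Ch A)) (FObj \<FF> (Unit C))"
proof -
  have "fdiff P (Unit C) n \<cdot> carr (FUnit \<FF>) n = Zero A (gr_unit A n) (fob P (Unit C) (n - 1))" for n
  proof (cases "n = 0")
    case True
    then show ?thesis using fdiff_funit by (simp add: rep_unit_0)
  next
    case False
    then show ?thesis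
      using A.zero_object_Arr(1)[OF A.zero_object_gr_unit[OF False], of "fdiff P (Unit C) n \<cdot> carr (FUnit \<FF>) n"]
      by simp
  qed
  then show ?thesis
    by (auto simp: Ch_Hom_iff is_chain_map_def rep_unit_dom rep_unit_cod Ch_sel rep_complex Hom_iff
      A.is_complex_zero_diff)
qed

lemma rep_arr_Hom:
  assumes f: "f \<in> Hom C X Y"
  shows "FArr \<FF> f \<in> Hom (Ch A) (FObj \<FF> X) (FObj \<FF> Y)"
proof -
  note [simp] = src_Obj[OF f] HomD[OF farr[OF f]]
  show ?thesis
    unfolding rep_arr[OF f] Ch_Hom_iff cmap_sel
    by (auto intro!: is_chain_map_cmapI simp: rep_complex Hom_iff fdiff_natural[OF f])
qed

text \<open>Each coherence axiom is an equality of maps out of a graded tensor product, and its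
  restriction to a summand is the corresponding axiom of the family. The unit axioms are decided on
  the one summand where the unit object is not zero.\<close>

theorem rep_lax: "lax_symmetric_monoidal_functor C (Ch A) \<FF>"
proof (unfold_locales, goal_cases)
  case 1
  show ?case by simp
next
  case (2 X)
  then show ?case by (simp add: Ch_sel rep_complex)
next
  case (3 f X Y)
  then show ?case by (rule rep_arr_Hom)
next
  case (4 X)
  then show ?case by (simp add: rep_arr[OF src_Ident] Ch_sel farr_Ident fun_eq_iff)
next
  case (5 f X Y g Z)
  then show ?case
    by (simp add: rep_arr[OF src_Comp[OF 5]] rep_arr[OF 5(1)] rep_arr[OF 5(2)] Ch_sel fun_eq_iff farr_Comp[OF 5])
next
  case 6
  show ?case by (rule rep_unit_Hom)
next
  case (7 X Y)
  then show ?case using rep_mult_Hom by (simp add: Ch_sel)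
next
  case (8 f X X' g Y Y')
  note t = src_Tensor[OF 8]
  note [simp] = HomD[OF farr[OF 8(1)]] HomD[OF farr[OF 8(2)]] src_Obj[OF 8(1)] src_Obj[OF 8(2)]
    HomD[OF farr[OF t]] 8(3,4)
  have "farr P (f \<boxdot>\<^bsub>C\<^esub> g) n \<cdot> carr (FMult \<FF> X Y) n =
    carr (FMult \<FF> X' Y') n \<cdot> gr_tensor_arr A (farr P f) (farr P g) n" for n
  proof (rule A.gr_ext[where X="fob P X" and Y="fob P Y" and n=n], goal_cases)
    case (8 p)
    show ?case
      using fmul_natural[OF \<open>f \<in> _\<close> \<open>g \<in> _\<close>, where i=p and j="n - p"] by (simp add: rep_mult_inj rep_mult_inj_reassoc)
  qed simp_all
  then show ?case
    by (simp add: rep_arr[OF t] rep_arr[OF 8(1)] rep_arr[OF 8(2)] Ch_sel rep_mult_dom rep_mult_cod fun_eq_iff)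
next
  case (9 X Y Z)
  note t = src_Assoc[OF 9]
  note [simp] = HomD[OF farr[OF t]] 9
  have "farr P (Assoc C X Y Z) n \<cdot> carr (FMult \<FF> (X \<boxtimes>\<^bsub>C\<^esub> Y) Z) n \<cdot>
      gr_tensor_arr A (carr (FMult \<FF> X Y)) (\<lambda>n. Ident A (fob P Z n)) n =
    carr (FMult \<FF> X (Y \<boxtimes>\<^bsub>C\<^esub> Z)) n \<cdot> gr_tensor_arr A (\<lambda>n. Ident A (fob P X n)) (carr (FMult \<FF> Y Z)) n \<cdot>
      gr_assoc A (fob P X) (fob P Y) (fob P Z) n" for n
  proof (rule A.gr_ext3[where X="fob P X" and Y="fob P Y" and Z="fob P Z" and n=n], goal_cases)
    case (9 k p)
    have "carr (FMult \<FF> X (Y \<boxtimes>\<^bsub>C\<^esub> Z)) n \<cdot> gr_tensor_arr A (\<lambda>n. Ident A (fob P X n)) (carr (FMult \<FF> Y Z)) n \<cdot>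
      gr_assoc A (fob P X) (fob P Y) (fob P Z) n \<cdot> gr_inj A (gr_tensor A (fob P X) (fob P Y)) (fob P Z) n k \<cdot>
      (gr_inj A (fob P X) (fob P Y) k p \<boxdot> Ident A (fob P Z (n - k))) =
      fmul P X (Y \<boxtimes>\<^bsub>C\<^esub> Z) p (n - p) \<cdot> (Ident A (fob P X p) \<boxdot> fmul P Y Z (k - p) (n - k)) \<cdot>
        Assoc A (fob P X p) (fob P Y (k - p)) (fob P Z (n - k))"
      by (subst A.gr_assoc_inj) (simp_all add: rep_mult_inj rep_mult_inj_reassoc)
    then show ?case
      using fmul_Assoc[OF \<open>X \<in> Obj C\<close> \<open>Y \<in> Obj C\<close> \<open>Z \<in> Obj C\<close>, where i=p and j="k - p" and k="n - k"]
      by (simp add: rep_mult_inj rep_mult_inj_reassoc)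
  qed simp_all
  then show ?case
    by (simp add: rep_arr[OF t] Ch_sel rep_mult_dom rep_mult_cod fun_eq_iff)
next
  case (10 X)
  note t = src_LUnit[OF 10]
  note [simp] = HomD[OF farr[OF t]] 10
  have "farr P (LUnit C X) n \<cdot> carr (FMult \<FF> (Unit C) X) n \<cdot>
      gr_tensor_arr A (carr (FUnit \<FF>)) (\<lambda>n. Ident A (fob P X n)) n = gr_lunit A (fob P X) n" for n
    by (rule A.gr_lunit_ext[where X="fob P X" and n=n])
      (simp_all add: rep_mult_inj_reassoc rep_unit_0 fmul_LUnit)
  then show ?case
    by (simp add: rep_arr[OF t] Ch_sel rep_mult_dom rep_mult_cod rep_unit_dom rep_unit_cod fun_eq_iff)
next
  case (11 X)
  note t = src_RUnit[OF 11]
  note [simp] = HomD[OF farr[OF t]] 11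
  have "farr P (RUnit C X) n \<cdot> carr (FMult \<FF> X (Unit C)) n \<cdot>
      gr_tensor_arr A (\<lambda>n. Ident A (fob P X n)) (carr (FUnit \<FF>)) n = gr_runit A (fob P X) n" for n
    by (rule A.gr_runit_ext[where X="fob P X" and n=n])
      (simp_all add: rep_mult_inj_reassoc rep_unit_0 fmul_RUnit)
  then show ?case
    by (simp add: rep_arr[OF t] Ch_sel rep_mult_dom rep_mult_cod rep_unit_dom rep_unit_cod fun_eq_iff)
next
  case (12 X Y)
  note t = src_Sym[OF 12]
  note [simp] = HomD[OF farr[OF t]] 12
  have "farr P (Sym C X Y) n \<cdot> carr (FMult \<FF> X Y) n =
    carr (FMult \<FF> Y X) n \<cdot> gr_sym A (\<lambda>p q. p * q) (fob P X) (fob P Y) n" for n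
  proof (rule A.gr_ext[where X="fob P X" and Y="fob P Y" and n=n], goal_cases)
    case (8 p)
    show ?case
      using fmul_Sym[OF 12, where i=p and j="n - p"]
      by (simp add: rep_mult_inj rep_mult_inj_reassoc A.gr_sym_inj)
  qed simp_all
  then show ?case
    by (simp add: rep_arr[OF t] Ch_sel rep_mult_dom rep_mult_cod fun_eq_iff)
qed

end

text \<open>Compatibility with the differentials is a separate hypothesis: the projection to
  homology is assembled from a piece that is multiplicative without being compatible with
  them.\<close>

lemma rep_monoidal_transformation:
  assumes "representation C A P \<FF>" "representation C A Q \<GG>" "family_trans C A (1 :: int) P Q \<eta>"
    and c: "\<And>X. X \<in> Obj C \<Longrightarrow> is_chain_map A (cmap (FObj \<FF> X) (FObj \<GG> X) (\<eta> X))"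
  shows "monoidal_transformation C (Ch A) \<FF> \<GG> (\<lambda>X. cmap (FObj \<FF> X) (FObj \<GG> X) (\<eta> X))"
proof -
  interpret P: representation C A P \<FF> by (rule assms)
  interpret Q: representation C A Q \<GG> by (rule assms)
  interpret T: family_trans C A 1 P Q \<eta> by (rule assms)
  show ?thesis
  proof (rule monoidal_transformation.intro[OF P.rep_lax Q.rep_lax], unfold_locales, goal_cases)
    case (1 X)
    then show ?case using c by (simp add: Ch_Hom_iff)
  next
    case (2 f X Y)
    then show ?case by (simp add: P.rep_arr[OF 2] Q.rep_arr[OF 2] Ch_sel fun_eq_iff T.nat[OF 2])
  next
    case (3 X Y)
    note [simp] = 3
    have "\<eta> (X \<boxtimes>\<^bsub>C\<^esub> Y) n \<cdot>\<^bsub>A\<^esub> carr (FMult \<FF> X Y) n =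
      carr (FMult \<GG> X Y) n \<cdot>\<^bsub>A\<^esub> gr_tensor_arr A (\<eta> X) (\<eta> Y) n" for n
    proof (rule P.A.gr_ext[where X="fob P X" and Y="fob P Y" and n=n], goal_cases)
      case (8 p)
      show ?case
        using T.mon[OF 3, where i=p and j="n - p"]
        by (simp add: P.rep_mult_inj Q.rep_mult_inj_reassoc)
    qed simp_all
    then show ?case
      by (simp add: Ch_sel P.rep_mult_dom P.rep_mult_cod Q.rep_mult_dom Q.rep_mult_cod fun_eq_iff)
  next
    case 4
    have "\<eta> (Unit C) n \<cdot>\<^bsub>A\<^esub> carr (FUnit \<FF>) n = carr (FUnit \<GG>) n" for n
    proof (cases "n = 0")
      case True
      then show ?thesis using T.unital by (simp add: P.rep_unit_0 Q.rep_unit_0)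
    next
      case False
      note z = P.A.zero_object_Arr(1)[OF P.A.zero_object_gr_unit[OF False]]
      show ?thesis
        using z[of "\<eta> (Unit C) n \<cdot>\<^bsub>A\<^esub> carr (FUnit \<FF>) n"] z[of "carr (FUnit \<GG>) n"] by simp
    qed
    then have "\<eta> (Unit C) \<cdot>\<^bsub>gr A\<^esub> carr (FUnit \<FF>) = carr (FUnit \<GG>)" by (simp add: gr_sel)
    then show ?case
      using cmap_collapse[of "FUnit \<GG>"]
      by (simp add: Ch_sel gr_sel P.rep_unit_dom P.rep_unit_cod Q.rep_unit_dom Q.rep_unit_cod)
  qed
qed

text \<open>The canonical functor represented by a family. It realises the middle term of the
  zigzag, which is only given as a subfamily.\<close>

definition family_functor ::
  "('c, 'f) sm_cat \<Rightarrow> ('o, 'm) sm_cat \<Rightarrow> ('c, 'f, int, 'o, 'm) family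
    \<Rightarrow> ('c, 'f, ('o, 'm) chain_complex, ('o, 'm) chain_map) lax_functor" where
  "family_functor C A P =
    (let T = (\<lambda>X. \<lparr>cob = fob P X, cdiff = fdiff P X\<rparr>) in \<lparr>
     FObj = T,
     FArr = (\<lambda>f. cmap (T (Dom C f)) (T (Cod C f)) (farr P f)),
     FMult = (\<lambda>X Y. cmap (ch_tensor A (T X) (T Y)) (T (X \<boxtimes>\<^bsub>C\<^esub> Y))
       (\<lambda>n. copair A (gr_summand A (fob P X) (fob P Y) n) (fob P (X \<boxtimes>\<^bsub>C\<^esub> Y) n) (\<lambda>p. fmul P X Y p (n - p)))),
     FUnit = cmap (Unit (Ch A)) (T (Unit C))
       (\<lambda>n. if n = 0 then funit P else Zero A (gr_unit A n) (fob P (Unit C) n))\<rparr>)"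

lemma representation_family_functor:
  assumes "lax_family C A (1 :: int) P (\<lambda>k. k)"
  shows "representation C A P (family_functor C A P)"
proof -
  interpret P: lax_family C A 1 P "\<lambda>k. k" by (rule assms)
  show ?thesis
    by (rule representation.intro[OF assms], unfold_locales)
      (auto simp: family_functor_def Let_def Hom_iff Ch_sel P.A.gr_copair)
qed

section \<open>The tautological family of a complex of graded objects\<close>

text \<open>The multiplication is the inclusion of \<open>cob X k p \<otimes> cob Y l q\<close> into
  the tensor product of complexes of graded objects, in two stages: a summand for the weights in
  \<open>A\<close>, then a summand for the homological degrees in \<open>gr A\<close>, read in
  weight \<open>p + q\<close>.\<close>

definition tautological :: "('o, 'm) sm_cat \<Rightarrow>
  ((int \<Rightarrow> 'o, int \<Rightarrow> 'm) chain_complex, (int \<Rightarrow> 'o, int \<Rightarrow> 'm) chain_map, int \<times> int, 'o, 'm) family" where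
  "tautological A = \<lparr>
     fob = (\<lambda>X (k, p). cob X k p),
     farr = (\<lambda>f (k, p). carr f k p),
     fdiff = (\<lambda>X (k, p). cdiff X k p),
     fmul = (\<lambda>X Y (k, p) (l, q). gr_inj (gr A) (cob X) (cob Y) (k + l) k (p + q) \<cdot>\<^bsub>A\<^esub>
       gr_inj A (cob X k) (cob Y l) (p + q) p),
     funit = Ident A (Unit A)\<rparr>"

lemma full_subcategory_sel [simp]:
  "Obj (full_subcategory C S) = Obj C \<inter> S"
  "Arr (full_subcategory C S) = {f \<in> Arr C. Dom C f \<in> S \<and> Cod C f \<in> S}"
  "Dom (full_subcategory C S) = Dom C" "Cod (full_subcategory C S) = Cod C"
  "Ident (full_subcategory C S) = Ident C" "Comp (full_subcategory C S) = Comp C"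
  by (simp_all add: full_subcategory_def)

lemma full_subcategory_sm_sel [simp]:
  "Tensor (full_subcategory C S) = Tensor C" "TensorArr (full_subcategory C S) = TensorArr C"
  "Unit (full_subcategory C S) = Unit C" "Assoc (full_subcategory C S) = Assoc C"
  "LUnit (full_subcategory C S) = LUnit C" "RUnit (full_subcategory C S) = RUnit C"
  "Sym (full_subcategory C S) = Sym C"
  by (simp_all add: full_subcategory_def)

lemma full_subcategory_Hom: "f \<in> Hom (full_subcategory C S) X Y \<longleftrightarrow> f \<in> Hom C X Y \<and> X \<in> S \<and> Y \<in> S"
  by (auto simp: Hom_iff)

lemma Ch_cdom:
  "cdom (Ident (Ch C) X) = X" "ccod (Ident (Ch C) X) = X"
  "cdom (g \<cdot>\<^bsub>Ch C\<^esub> f) = cdom f" "ccod (g \<cdot>\<^bsub>Ch C\<^esub> f) = ccod g"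
  "cdom (f \<boxdot>\<^bsub>Ch C\<^esub> g) = ch_tensor C (cdom f) (cdom g)"
  "ccod (f \<boxdot>\<^bsub>Ch C\<^esub> g) = ch_tensor C (ccod f) (ccod g)"
  "cdom (Assoc (Ch C) X Y Z) = ch_tensor C (ch_tensor C X Y) Z"
  "ccod (Assoc (Ch C) X Y Z) = ch_tensor C X (ch_tensor C Y Z)"
  "cdom (LUnit (Ch C) X) = ch_tensor C (Unit (Ch C)) X" "ccod (LUnit (Ch C) X) = X"
  "cdom (RUnit (Ch C) X) = ch_tensor C X (Unit (Ch C))" "ccod (RUnit (Ch C) X) = X"
  "cdom (Sym (Ch C) X Y) = ch_tensor C X Y" "ccod (Sym (Ch C) X Y) = ch_tensor C Y X"
  by (simp_all add: Ch_sel)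

lemma (in tensor_sum_category) guarded_source_Ch:
  assumes "Unit (Ch C) \<in> S"
  shows "guarded_source (full_subcategory (Ch C) S)"
proof
  show "Unit (full_subcategory (Ch C) S) \<in> Obj (full_subcategory (Ch C) S)"
    using assms is_complex_Unit by (simp add: Ch_sel(1))
qed (auto simp: full_subcategory_Hom Ch_Hom_iff Ch_sel(1,7) Ch_cdom is_chain_mapD(1,2) Ident_Ch Comp_Ch tensor_Ch
  Assoc_Ch LUnit_Ch RUnit_Ch Sym_Ch)

lemma tautological_sel [simp]:
  "fob (tautological A) X (k, p) = cob X k p" "farr (tautological A) f (k, p) = carr f k p"
  "fdiff (tautological A) X (k, p) = cdiff X k p"
  "fmul (tautological A) X Y (k, p) (l, q) = gr_inj (gr A) (cob X) (cob Y) (k + l) k (p + q) \<cdot>\<^bsub>A\<^esub>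
       gr_inj A (cob X k) (cob Y l) (p + q) p"
  "funit (tautological A) = Ident A (Unit A)"
  by (simp_all add: tautological_def)

context tensor_sum_category
begin

lemma is_complex_grD:
  assumes "is_complex (gr C) X"
  shows "cob X n p \<in> Obj C" "cdiff X n p \<in> Arr C" "Dom C (cdiff X n p) = cob X n p"
    "Cod C (cdiff X n p) = cob X (n - 1) p"
    "m = n - 1 \<Longrightarrow> cdiff X m p \<cdot> cdiff X n p = Zero C (cob X n p) (cob X (n - 2) p)"
    "cob X n \<in> Obj (gr C)"
  using is_complexD[OF assms] by (auto simp: gr_sel fun_eq_iff)

lemma is_chain_map_grD:
  assumes "is_chain_map (gr C) f"
  shows "carr f n p \<in> Arr C" "Dom C (carr f n p) = cob (cdom f) n p" "Cod C (carr f n p) = cob (ccod f) n p"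
    "cdiff (ccod f) n p \<cdot> carr f n p = carr f (n - 1) p \<cdot> cdiff (cdom f) n p" "carr f n \<in> Arr (gr C)"
  using is_chain_mapD[OF assms] by (auto simp: gr_sel fun_eq_iff)

lemma gr_gr_inj_Arr:
  assumes "\<And>n p. X n p \<in> Obj C" "\<And>n p. Y n p \<in> Obj C"
  shows "gr_inj (gr C) X Y n k p \<in> Arr C" (is ?A) "Dom C (gr_inj (gr C) X Y n k p) = gr_tensor C (X k) (Y (n - k)) p" (is ?B)
    "Cod C (gr_inj (gr C) X Y n k p) = gr_tensor (gr C) X Y n p" (is ?C)
proof -
  interpret G: tensor_sum_category "gr C" by (rule tensor_sum_category_gr)
  show ?A ?B ?C
    using G.gr_inj_Arr[of X Y n k] assms by (simp_all add: gr_sel fun_eq_iff)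
qed

text \<open>The axioms are the defining equations of the differential, associator, unitors and
  symmetry of \<open>Ch (gr C)\<close>, restricted to the two nested inclusions. Each is read off
  twice: in \<open>gr C\<close> for the homological degrees, then in \<open>C\<close> for the
  weights.\<close>

lemma lax_family_tautological:
  assumes S: "Unit (Ch (gr C)) \<in> S"
  shows "lax_family (full_subcategory (Ch (gr C)) S) C (1, 0) (tautological C) (\<lambda>(k, p). k)"
proof -
  interpret G: tensor_sum_category "gr C" by (rule tensor_sum_category_gr)
  let ?S = "full_subcategory (Ch (gr C)) S"
  interpret src: guarded_source ?S by (rule G.guarded_source_Ch[OF S])
  have ObjD: "is_complex (gr C) X" if "X \<in> Obj ?S" for X using that by (simp add: Ch_sel(1))
  have HomD': "is_chain_map (gr C) f" "cdom f = X" "ccod f = Y" if "f \<in> Hom ?S X Y" for f X Y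
    using that by (auto simp: full_subcategory_Hom Ch_Hom_iff)
  interpret D: family_data ?S C "(1, 0)" "tautological C"
  proof (unfold_locales, goal_cases)
    case (1 X i)
    then show ?case using is_complex_grD[OF ObjD] by (cases i) simp
  next
    case (2 f X Y i)
    then show ?case
      using is_chain_map_grD[OF HomD'(1)[OF 2]] HomD'(2,3)[OF 2] by (cases i) (simp add: Hom_iff)
  next
    case (3 X i)
    then show ?case using is_complex_grD[OF ObjD[OF 3]] by (cases i) (simp add: Hom_iff)
  next
    case (4 X Y i j)
    note [simp] = is_complex_grD[OF ObjD[OF 4(1)]] is_complex_grD[OF ObjD[OF 4(2)]]
    show ?case by (cases i; cases j) (simp add: Hom_iff gr_gr_inj_Arr Ch_sel)
  next
    case 5
    show ?case by (simp add: Hom_iff Ch_sel zero_prod_def gr_sel)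
  qed
  show ?thesis
  proof (rule lax_family.intro[OF D.family_data_axioms], unfold_locales, goal_cases)
    case (1 X i)
    then show ?case by (cases i) (simp add: Ch_sel gr_sel)
  next
    case (2 f X Y g Z i)
    then show ?case by (cases i) (simp add: Ch_sel gr_sel)
  next
    case (3 X i)
    then show ?case using is_complex_grD[OF ObjD[OF 3]] by (cases i) simp
  next
    case (4 f X Y i)
    then show ?case
      using is_chain_map_grD[OF HomD'(1)[OF 4]] HomD'(2,3)[OF 4] by (cases i) simp
  next
    case 5
    have "gr_unit (gr C) n q \<in> Obj C" for n q using G.gr_unit_in[of n] by (simp add: gr_sel)
    then show ?case by (simp add: Ch_sel zero_prod_def gr_sel)
  next
    case (6 X Y i j)
    obtain k p l q where ij: "i = (k, p)" "j = (l, q)" by (cases i; cases j)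
    note X = ObjD[OF 6(1)] and Y = ObjD[OF 6(2)]
    note [simp] = is_complex_grD[OF X] is_complex_grD[OF Y] gr_gr_inj_Arr int_diff_normal
    \<comment> \<open>The differential on the outer summand of degrees \<open>k\<close>,
      \<open>l\<close>, taken in weight \<open>p + q\<close>. What is left is a graded tensor
      product of arrows, which the inner inclusion resolves.\<close>
    have e: "cdiff (ch_tensor (gr C) X Y) (k + l) (p + q) \<cdot> gr_inj (gr C) (cob X) (cob Y) (k + l) k (p + q) =
      (gr_inj (gr C) (cob X) (cob Y) (k + l - 1) (k - 1) (p + q) \<cdot> gr_tensor_arr C (cdiff X k) (\<lambda>p. Ident C (cob Y l p)) (p + q)) \<ddagger>
      signed C k (gr_inj (gr C) (cob X) (cob Y) (k + l - 1) k (p + q) \<cdot> gr_tensor_arr C (\<lambda>p. Ident C (cob X k p)) (cdiff Y l) (p + q))"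
      using G.ch_tensor_diff_inj[OF X Y, of "k + l" k, THEN fun_cong, of "p + q"]
      by (simp add: gr_sel signed_gr)
    show ?case
      using G.ch_tensor_diff_Arr[OF X Y, of "k + l"]
      by (simp add: ij Ch_sel reassoc[OF e] gr_sel fun_eq_iff diff_add_eq add_diff_eq)
  next
    case (7 f X X' g Y Y' i j)
    obtain k p l q where ij: "i = (k, p)" "j = (l, q)" by (cases i; cases j)
    note f = HomD'[OF 7(1)] and g = HomD'[OF 7(2)]
    note c = is_chain_mapD(1,2)[OF f(1), unfolded f(2,3)] is_chain_mapD(1,2)[OF g(1), unfolded g(2,3)]
    note [simp] = c[THEN is_complex_grD(1)] gr_gr_inj_Arr is_chain_map_grD(1-3)[OF f(1), unfolded f(2,3)]
      is_chain_map_grD(1-3)[OF g(1), unfolded g(2,3)]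
    note t = is_chain_map_grD(1-3)[OF HomD'(1)[OF src.src_Tensor[OF 7]]]
    have e: "gr_tensor_arr (gr C) (carr f) (carr g) (k + l) (p + q) \<cdot> gr_inj (gr C) (cob X) (cob Y) (k + l) k (p + q) =
      gr_inj (gr C) (cob X') (cob Y') (k + l) k (p + q) \<cdot> gr_tensor_arr C (carr f k) (carr g l) (p + q)"
      using G.gr_tensor_arr_inj[of "carr f" "carr g" "cob X" "cob Y" "k + l" k, THEN fun_cong, of "p + q"]
      by (simp add: gr_sel)
    show ?case
      using t[of "k + l" "p + q"] by (simp add: ij Ch_sel reassoc[OF e] f g)
  next
    case (8 X Y Z i j k)
    obtain k1 p1 k2 p2 k3 p3 where ij: "i = (k1, p1)" "j = (k2, p2)" "k = (k3, p3)" by (cases i; cases j; cases k)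
    note c = ObjD[OF 8(1)] ObjD[OF 8(2)] ObjD[OF 8(3)]
    note [simp] = c[THEN is_complex_grD(1)] gr_gr_inj_Arr
    let ?a = "gr_assoc (gr C) (cob X) (cob Y) (cob Z) (k1 + k2 + k3) (p1 + p2 + p3)"
    have t[simp]: "?a \<in> Arr C"
      "Dom C ?a = gr_tensor (gr C) (gr_tensor (gr C) (cob X) (cob Y)) (cob Z) (k1 + k2 + k3) (p1 + p2 + p3)"
      "Cod C ?a = gr_tensor (gr C) (cob X) (gr_tensor (gr C) (cob Y) (cob Z)) (k1 + k2 + k3) (p1 + p2 + p3)"
      using G.gr_assoc_Arr[of "cob X" "cob Y" "cob Z" "k1 + k2 + k3"] by (simp_all add: gr_sel fun_eq_iff)
    have [simp]: "gr_tensor (gr C) U V n p \<in> Obj C" if "\<And>n p. U n p \<in> Obj C" "\<And>n p. V n p \<in> Obj C" for U V n p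
      using G.gr_tensor_in[of U V n] that by (simp add: gr_sel)
    \<comment> \<open>On the outer summand the associator of complexes becomes the associator of
      \<open>gr C\<close> on the pieces of degrees \<open>k1\<close>, \<open>k2\<close>,
      \<open>k3\<close>. The inclusion \<open>?j\<close> of a triple of weights then reduces that
      one to the associator of \<open>C\<close>.\<close>
    have e: "?a \<cdot> gr_inj (gr C) (gr_tensor (gr C) (cob X) (cob Y)) (cob Z) (k1 + k2 + k3) (k1 + k2) (p1 + p2 + p3) \<cdot>
        gr_tensor_arr C (gr_inj (gr C) (cob X) (cob Y) (k1 + k2) k1) (\<lambda>p. Ident C (cob Z k3 p)) (p1 + p2 + p3) =
      gr_inj (gr C) (cob X) (gr_tensor (gr C) (cob Y) (cob Z)) (k1 + k2 + k3) k1 (p1 + p2 + p3) \<cdot>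
        gr_tensor_arr C (\<lambda>p. Ident C (cob X k1 p)) (gr_inj (gr C) (cob Y) (cob Z) (k2 + k3) k2) (p1 + p2 + p3) \<cdot>
        gr_assoc C (cob X k1) (cob Y k2) (cob Z k3) (p1 + p2 + p3)"
      using G.gr_assoc_inj[of "cob X" "cob Y" "cob Z" "k1 + k2 + k3" "k1 + k2" k1, THEN fun_cong, of "p1 + p2 + p3"]
      by (simp add: gr_sel add.assoc)
    let ?j = "gr_inj C (gr_tensor C (cob X k1) (cob Y k2)) (cob Z k3) (p1 + p2 + p3) (p1 + p2) \<cdot>
      (gr_inj C (cob X k1) (cob Y k2) (p1 + p2) p1 \<boxdot> Ident C (cob Z k3 p3))"
    have "?a \<cdot> gr_inj (gr C) (gr_tensor (gr C) (cob X) (cob Y)) (cob Z) (k1 + k2 + k3) (k1 + k2) (p1 + p2 + p3) \<cdot>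
      gr_inj C (gr_tensor (gr C) (cob X) (cob Y) (k1 + k2)) (cob Z k3) (p1 + p2 + p3) (p1 + p2) \<cdot>
      ((gr_inj (gr C) (cob X) (cob Y) (k1 + k2) k1 (p1 + p2) \<cdot> gr_inj C (cob X k1) (cob Y k2) (p1 + p2) p1) \<boxdot> Ident C (cob Z k3 p3))
     = (?a \<cdot> gr_inj (gr C) (gr_tensor (gr C) (cob X) (cob Y)) (cob Z) (k1 + k2 + k3) (k1 + k2) (p1 + p2 + p3) \<cdot>
        gr_tensor_arr C (gr_inj (gr C) (cob X) (cob Y) (k1 + k2) k1) (\<lambda>p. Ident C (cob Z k3 p)) (p1 + p2 + p3)) \<cdot> ?j"
      by simp
    also have "\<dots> = (gr_inj (gr C) (cob X) (gr_tensor (gr C) (cob Y) (cob Z)) (k1 + k2 + k3) k1 (p1 + p2 + p3) \<cdot>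
        gr_tensor_arr C (\<lambda>p. Ident C (cob X k1 p)) (gr_inj (gr C) (cob Y) (cob Z) (k2 + k3) k2) (p1 + p2 + p3)) \<cdot>
        (gr_assoc C (cob X k1) (cob Y k2) (cob Z k3) (p1 + p2 + p3) \<cdot> ?j)"
      unfolding e by (simp add: add.assoc)
    also have "gr_assoc C (cob X k1) (cob Y k2) (cob Z k3) (p1 + p2 + p3) \<cdot> ?j =
      gr_inj C (cob X k1) (gr_tensor C (cob Y k2) (cob Z k3)) (p1 + p2 + p3) p1 \<cdot>
      (Ident C (cob X k1 p1) \<boxdot> gr_inj C (cob Y k2) (cob Z k3) (p2 + p3) p2) \<cdot>
          Assoc C (cob X k1 p1) (cob Y k2 p2) (cob Z k3 p3)"
      using gr_assoc_inj[of "cob X k1" "cob Y k2" "cob Z k3" "p1 + p2 + p3" "p1 + p2" p1]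
      by (simp add: add.assoc)
    finally show ?case
      by (simp add: ij Ch_sel gr_sel add.assoc)
  next
    case (9 X i)
    obtain k p where i: "i = (k, p)" by (cases i)
    note c = ObjD[OF 9(1)]
    note [simp] = c[THEN is_complex_grD(1)] gr_gr_inj_Arr
    let ?l = "gr_lunit (gr C) (cob X) k p"
    have [simp]: "?l \<in> Arr C" "Dom C ?l = gr_tensor (gr C) (gr_unit (gr C)) (cob X) k p" "Cod C ?l = cob X k p"
      using G.gr_lunit_Arr[of "cob X" k] by (simp_all add: gr_sel fun_eq_iff)
    have [simp]: "gr_unit (gr C) n q \<in> Obj C" for n q using G.gr_unit_in[of n] by (simp add: gr_sel)
    have e: "?l \<cdot> gr_inj (gr C) (gr_unit (gr C)) (cob X) k 0 p = gr_lunit C (cob X k) p"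
      using G.gr_lunit_inj[of "cob X" k, THEN fun_cong, of p] by (simp add: gr_sel)
    have "gr_unit (gr C) 0 = gr_unit C" by (simp add: gr_sel)
    then show ?case by (simp add: i Ch_sel zero_prod_def reassoc[OF e])
  next
    case (10 X i)
    obtain k p where i: "i = (k, p)" by (cases i)
    note c = ObjD[OF 10(1)]
    note [simp] = c[THEN is_complex_grD(1)] gr_gr_inj_Arr
    let ?l = "gr_runit (gr C) (cob X) k p"
    have [simp]: "?l \<in> Arr C" "Dom C ?l = gr_tensor (gr C) (cob X) (gr_unit (gr C)) k p" "Cod C ?l = cob X k p"
      using G.gr_runit_Arr[of "cob X" k] by (simp_all add: gr_sel fun_eq_iff)
    have [simp]: "gr_unit (gr C) n q \<in> Obj C" for n q using G.gr_unit_in[of n] by (simp add: gr_sel)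
    have e: "?l \<cdot> gr_inj (gr C) (cob X) (gr_unit (gr C)) k k p = gr_runit C (cob X k) p"
      using G.gr_runit_inj[of "cob X" k, THEN fun_cong, of p] by (simp add: gr_sel)
    have "gr_unit (gr C) 0 = gr_unit C" by (simp add: gr_sel)
    then show ?case by (simp add: i Ch_sel zero_prod_def reassoc[OF e])
  next
    case (11 X Y i j)
    obtain k p l q where ij: "i = (k, p)" "j = (l, q)" by (cases i; cases j)
    note c = ObjD[OF 11(1)] ObjD[OF 11(2)]
    note [simp] = c[THEN is_complex_grD(1)] gr_gr_inj_Arr
    let ?s = "gr_sym (gr C) (\<lambda>p q. p * q) (cob X) (cob Y) (k + l) (p + q)"
    have [simp]: "?s \<in> Arr C" "Dom C ?s = gr_tensor (gr C) (cob X) (cob Y) (k + l) (p + q)"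
      "Cod C ?s = gr_tensor (gr C) (cob Y) (cob X) (k + l) (p + q)"
      using G.gr_sym_Arr[of "cob X" "cob Y" "\<lambda>p q. p * q" "k + l"] by (simp_all add: gr_sel fun_eq_iff)
    \<comment> \<open>The sign \<open>k * l\<close> comes from the homological degrees alone; the
      inner symmetry is the unsigned one of \<open>gr C\<close>.\<close>
    have e: "?s \<cdot> gr_inj (gr C) (cob X) (cob Y) (k + l) k (p + q) =
      signed C (k * l) (gr_inj (gr C) (cob Y) (cob X) (k + l) l (p + q) \<cdot> gr_sym C (\<lambda>_ _. 0) (cob X k) (cob Y l) (p + q))"
      using G.gr_sym_inj[of "cob X" "cob Y" "\<lambda>p q. p * q" "k + l" k, THEN fun_cong, of "p + q"]
      by (simp add: gr_sel signed_gr)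
    show ?case
      by (simp add: ij Ch_sel reassoc[OF e] gr_sym_inj add.commute)
  qed
qed

end

section \<open>Homology\<close>

lemma (in category) Ident_epic: "X \<in> Obj C \<Longrightarrow> epic C (Ident C X)"
  by (auto simp: epic_def Hom_iff)

text \<open>\<open>dmap_monic\<close> is AB4 for sums over the integers, phrased with the chosen
  sums.\<close>

locale exact_tensor_category =
  abelian_symmetric_monoidal_category A + tensor_sum_category A for A :: "('o, 'm) sm_cat" (structure) +
  assumes dmap_monic: "(\<And>p. monic A (f p)) \<Longrightarrow> monic A (dmap A f)"
begin

text \<open>In an abelian category every epimorphism is a cokernel, and cokernels survive tensoring
  by right exactness. The tensor product factors as \<open>f \<otimes> 1\<close> after
  \<open>1 \<otimes> g\<close>.\<close>

lemma epic_tensor: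
  assumes f: "epic A f" and g: "epic A g"
  shows "epic A (f \<boxdot> g)"
proof -
  note [simp] = epic_Arr[OF f] epic_Arr[OF g]
  obtain u v where "is_cokernel A u f" "is_cokernel A v g" using epic_normal f g by metis
  then have "epic A (f \<boxdot> Ident A (Cod A g))" "epic A (Ident A (Dom A f) \<boxdot> g)"
    by (auto intro!: is_cokernel_epic Tensor_right_exact_left Tensor_right_exact_right)
  then have "epic A ((f \<boxdot> Ident A (Cod A g)) \<cdot> (Ident A (Dom A f) \<boxdot> g))"
    by (intro epic_Comp) simp_all
  then show ?thesis by simp
qed

text \<open>Right exactness makes \<open>q \<otimes> q'\<close> the quotient by the images of
  \<open>b \<otimes> 1\<close> and \<open>1 \<otimes> b'\<close>. The map descends along
  \<open>q \<otimes> 1\<close>; the second vanishing condition is carried across this epimorphism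
  and allows the descent along \<open>1 \<otimes> q'\<close>. This is what makes the Kuenneth
  morphism well defined.\<close>

lemma tensor_descend:
  assumes b: "is_cokernel A b q" and b': "is_cokernel A b' q'"
    and [simp]: "\<phi> \<in> Arr A" "Dom A \<phi> = Cod A b \<boxtimes> Cod A b'"
    and z: "\<phi> \<cdot> (b \<boxdot> Ident A (Cod A b')) = Zero A (Dom A b \<boxtimes> Cod A b') (Cod A \<phi>)"
      "\<phi> \<cdot> (Ident A (Cod A b) \<boxdot> b') = Zero A (Cod A b \<boxtimes> Dom A b') (Cod A \<phi>)"
  shows "descend_through A (q \<boxdot> q') \<phi> \<in> Hom A (Cod A q \<boxtimes> Cod A q') (Cod A \<phi>)" (is ?A)
    "descend_through A (q \<boxdot> q') \<phi> \<cdot> (q \<boxdot> q') = \<phi>" (is ?B)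
proof -
  note [simp] = is_cokernelD(1-3)[OF b] is_cokernelD(1-3)[OF b']
  have q: "is_cokernel A (b \<boxdot> Ident A (Cod A b')) (q \<boxdot> Ident A (Cod A b'))"
    by (rule Tensor_right_exact_left[OF b]) simp
  obtain h where "h \<in> Hom A (Cod A q \<boxtimes> Cod A b') (Cod A \<phi>)"
    and h: "h \<cdot> (q \<boxdot> Ident A (Cod A b')) = \<phi>"
    by (rule is_cokernel_descend[OF q, of \<phi> "Cod A \<phi>"]) (use z in \<open>auto simp: Hom_iff\<close>)
  then have [simp]: "h \<in> Arr A" "Dom A h = Cod A q \<boxtimes> Cod A b'" "Cod A h = Cod A \<phi>"
    by (auto simp: Hom_iff)
  have "(h \<cdot> (Ident A (Cod A q) \<boxdot> b')) \<cdot> (q \<boxdot> Ident A (Dom A b')) =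
    (h \<cdot> (q \<boxdot> Ident A (Cod A b'))) \<cdot> (Ident A (Cod A b) \<boxdot> b')"
    by simp
  also have "\<dots> = Zero A (Cod A q \<boxtimes> Dom A b') (Cod A \<phi>) \<cdot> (q \<boxdot> Ident A (Dom A b'))"
    unfolding h z by simp
  finally have e: "(h \<cdot> (Ident A (Cod A q) \<boxdot> b')) \<cdot> (q \<boxdot> Ident A (Dom A b')) =
    Zero A (Cod A q \<boxtimes> Dom A b') (Cod A \<phi>) \<cdot> (q \<boxdot> Ident A (Dom A b'))" .
  have "h \<cdot> (Ident A (Cod A q) \<boxdot> b') = Zero A (Cod A q \<boxtimes> Dom A b') (Cod A \<phi>)"
    by (rule epicD[OF epic_tensor[OF is_cokernel_epic[OF b] Ident_epic] e]) (auto simp: Hom_iff)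
  then have hz: "h \<cdot> (Ident A (Cod A q) \<boxdot> b') = Zero A (Dom A (Ident A (Cod A q) \<boxdot> b')) (Cod A \<phi>)"
    by simp
  obtain k where "k \<in> Hom A (Cod A q \<boxtimes> Cod A q') (Cod A \<phi>)"
    and k: "k \<cdot> (Ident A (Cod A q) \<boxdot> q') = h"
    by (rule is_cokernel_descend[OF Tensor_right_exact_right[OF b'], of "Cod A q" h "Cod A \<phi>"])
      (use hz in \<open>auto simp: Hom_iff\<close>)
  then have [simp]: "k \<in> Arr A" "Dom A k = Cod A q \<boxtimes> Cod A q'" "Cod A k = Cod A \<phi>"
    by (auto simp: Hom_iff)
  have "k \<cdot> (q \<boxdot> q') = (k \<cdot> (Ident A (Cod A q) \<boxdot> q')) \<cdot> (q \<boxdot> Ident A (Cod A b'))"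
    by simp
  then have kq: "k \<cdot> (q \<boxdot> q') = \<phi>" unfolding k h .
  have "descend_through A (q \<boxdot> q') \<phi> = k"
    by (rule descend_through_eqI[OF epic_tensor[OF is_cokernel_epic[OF b] is_cokernel_epic[OF b']] _ kq])
      (auto simp: Hom_iff)
  then show ?A ?B
    using kq by (auto simp: Hom_iff)
qed

end

definition boundary :: "('o, 'm, 'z) add_cat_scheme \<Rightarrow> ('o, 'm) chain_complex \<Rightarrow> int \<Rightarrow> 'm" where
  "boundary A X n = lift_through A (cycles A X n) (cdiff X (n + 1))"

definition cycle_map :: "('o, 'm, 'z) add_cat_scheme \<Rightarrow> ('o, 'm) chain_map \<Rightarrow> int \<Rightarrow> 'm" where
  "cycle_map A f n = lift_through A (cycles A (ccod f) n) (carr f n \<cdot>\<^bsub>A\<^esub> cycles A (cdom f) n)"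

section \<open>Cycles, boundaries and induced maps on homology\<close>

context abelian_category
begin

lemma is_kernel_ker_arr: "f \<in> Arr C \<Longrightarrow> is_kernel C f (ker_arr C f)"
  unfolding ker_arr_def using has_kernels by (rule someI_ex)

lemma is_cokernel_coker_arr: "f \<in> Arr C \<Longrightarrow> is_cokernel C f (coker_arr C f)"
  unfolding coker_arr_def using has_cokernels by (rule someI_ex)

lemma is_kernel_cycles: "is_complex C X \<Longrightarrow> is_kernel C (cdiff X n) (cycles C X n)"
  unfolding cycles_def by (rule is_kernel_ker_arr) (simp add: is_complexD)

lemma cycles_Arr [simp]:
  assumes "is_complex C X"
  shows "cycles C X n \<in> Arr C" "Cod C (cycles C X n) = cob X n"
    "cdiff X n \<cdot> cycles C X n = Zero C (Dom C (cycles C X n)) (cob X (n - 1))"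
  using is_kernelD[OF is_kernel_cycles[OF assms, of n]] is_complexD[OF assms] by simp_all

lemma cycles_monic: "is_complex C X \<Longrightarrow> monic C (cycles C X n)"
  by (rule is_kernel_monic[OF is_kernel_cycles])

lemma cycles_cancel:
  assumes "is_complex C X" "u \<in> Arr C" "v \<in> Arr C" "Dom C u = Dom C v" "Cod C u = Dom C (cycles C X n)"
    "Cod C v = Dom C (cycles C X n)" "cycles C X n \<cdot> u = cycles C X n \<cdot> v"
  shows "u = v"
  by (rule monicD[OF cycles_monic[OF assms(1)] assms(7)]) (use assms in \<open>auto simp: Hom_iff\<close>)

lemma lift_cycles:
  assumes X: "is_complex C X" and g: "g \<in> Arr C" "Cod C g = cob X n" "cdiff X n \<cdot> g = Zero C (Dom C g) (cob X (n - 1))"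
  shows "lift_through C (cycles C X n) g \<in> Arr C" "Dom C (lift_through C (cycles C X n) g) = Dom C g"
    "Cod C (lift_through C (cycles C X n) g) = Dom C (cycles C X n)"
    "cycles C X n \<cdot> lift_through C (cycles C X n) g = g"
  using is_kernel_lift_through[OF is_kernel_cycles[OF X], of g "Dom C g" n] g is_complexD[OF X]
  by (auto simp: Hom_iff)

lemma boundary_Arr [simp]:
  assumes X: "is_complex C X"
  shows "boundary C X n \<in> Arr C" "Dom C (boundary C X n) = cob X (n + 1)"
    "Cod C (boundary C X n) = Dom C (cycles C X n)"
    "cycles C X n \<cdot> boundary C X n = cdiff X (n + 1)"
  unfolding boundary_def using lift_cycles[OF X, of "cdiff X (n + 1)" n] is_complexD[OF X] by simp_all

lemma is_cokernel_hproj: "is_complex C X \<Longrightarrow> is_cokernel C (boundary C X n) (hproj C X n)"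
  unfolding hproj_def boundary_def[symmetric] by (rule is_cokernel_coker_arr) simp

lemma hproj_Arr [simp]:
  assumes "is_complex C X"
  shows "hproj C X n \<in> Arr C" "Dom C (hproj C X n) = Dom C (cycles C X n)" "Cod C (hproj C X n) = homology C X n"
    "hproj C X n \<cdot> boundary C X n = Zero C (cob X (n + 1)) (homology C X n)"
  using is_cokernelD[OF is_cokernel_hproj[OF assms, of n]] assms by (simp_all add: homology_def)

lemma hproj_epic: "is_complex C X \<Longrightarrow> epic C (hproj C X n)"
  by (rule is_cokernel_epic[OF is_cokernel_hproj])

lemma homology_in [simp]: "is_complex C X \<Longrightarrow> homology C X n \<in> Obj C"
  using Cod_Obj[of "hproj C X n"] by simp

text \<open>The cycle \<open>u\<close> has underlying element \<open>d w\<close>, so it factors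
  through \<open>boundary\<close> and its class vanishes. The degree \<open>m\<close> is kept apart
  from \<open>n + 1\<close> so that instances with source degree \<open>n\<close> and target degree
  \<open>n - 1\<close> also fit.\<close>

lemma hproj_lift_boundary:
  assumes X: "is_complex C X" and w: "w \<in> Arr C" "Cod C w = cob X m" and u: "u \<in> Arr C" "cycles C X n \<cdot> u = cdiff X m \<cdot> w"
    "Dom C u = Dom C w" "Cod C u = Dom C (cycles C X n)" "m = n + 1"
  shows "hproj C X n \<cdot> u = Zero C (Dom C w) (homology C X n)"
proof -
  note [simp] = X u(1,3,4) w[unfolded u(5)]
  have "cycles C X n \<cdot> u = (cycles C X n \<cdot> boundary C X n) \<cdot> w"
    unfolding u(2) boundary_Arr(4)[OF X] u(5) ..
  also have "\<dots> = cycles C X n \<cdot> boundary C X n \<cdot> w"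
    by (rule assoc) simp_all
  finally have "u = boundary C X n \<cdot> w"
    by (rule cycles_cancel[OF X, rotated -1]) simp_all
  then show ?thesis by (simp add: reassoc[OF hproj_Arr(4)[OF X]])
qed

lemma cycle_map:
  assumes f: "is_chain_map C f"
  shows cycle_map_Arr [simp]: "cycle_map C f n \<in> Arr C" (is ?A) "Dom C (cycle_map C f n) = Dom C (cycles C (cdom f) n)" (is ?B)
    "Cod C (cycle_map C f n) = Dom C (cycles C (ccod f) n)" (is ?C)
    and cycles_cycle_map: "cycles C (ccod f) n \<cdot> cycle_map C f n = carr f n \<cdot> cycles C (cdom f) n" (is ?D)
proof -
  note c[simp] = is_chain_mapD[OF f] is_complexD(1-4)[OF is_chain_mapD(1)[OF f]] is_complexD(1-4)[OF is_chain_mapD(2)[OF f]]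
  have "cdiff (ccod f) n \<cdot> carr f n \<cdot> cycles C (cdom f) n = Zero C (Dom C (cycles C (cdom f) n)) (cob (ccod f) (n - 1))"
    by (subst reassoc[OF is_chain_mapD(6)[OF f]]) simp_all
  then show ?A ?B ?C ?D
    unfolding cycle_map_def using lift_cycles[of "ccod f" "carr f n \<cdot> cycles C (cdom f) n" n] by simp_all
qed

lemma homology_map:
  assumes f: "is_chain_map C f"
  shows homology_map_Arr [simp]: "homology_map C f n \<in> Arr C" (is ?A) "Dom C (homology_map C f n) = homology C (cdom f) n" (is ?B)
    "Cod C (homology_map C f n) = homology C (ccod f) n" (is ?C)
    and homology_map_hproj: "homology_map C f n \<cdot> hproj C (cdom f) n = hproj C (ccod f) n \<cdot> cycle_map C f n" (is ?D)
proof -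
  note c[simp] = is_chain_mapD[OF f] is_complexD(1-4)[OF is_chain_mapD(1)[OF f]] is_complexD(1-4)[OF is_chain_mapD(2)[OF f]]
    cycle_map_Arr[OF f]
  have 1: "hproj C (ccod f) n \<cdot> cycle_map C f n \<cdot> boundary C (cdom f) n = Zero C (cob (cdom f) (n + 1)) (homology C (ccod f) n)"
    using hproj_lift_boundary[of "ccod f" "carr f (n + 1)" "n + 1" "cycle_map C f n \<cdot> boundary C (cdom f) n" n]
    by (simp add: reassoc[OF cycles_cycle_map[OF f]])
  show ?A ?B ?C ?D
    unfolding homology_map_def cycle_map_def[symmetric]
    using is_cokernel_descend_through[OF is_cokernel_hproj[of "cdom f" n], of "hproj C (ccod f) n \<cdot> cycle_map C f n" "homology C (ccod f) n"] 1
    by (auto simp: Hom_iff)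
qed

end

context exact_tensor_category
begin

text \<open>By the Leibniz rule a product of cycles is a cycle, and a product of a boundary with a
  cycle is a boundary. So the class of the product depends only on the classes of the
  factors.\<close>

lemma kuenneth:
  assumes X: "is_complex A X" and Y: "is_complex A Y"
  shows kuenneth_Arr [simp]: "kuenneth A X Y p q \<in> Arr A"
    "Dom A (kuenneth A X Y p q) = homology A X p \<boxtimes> homology A Y q"
    "Cod A (kuenneth A X Y p q) = homology A (ch_tensor A X Y) (p + q)"
    and kuenneth_hproj: "kuenneth A X Y p q \<cdot> (hproj A X p \<boxdot> hproj A Y q) =
      hproj A (ch_tensor A X Y) (p + q) \<cdot> lift_through A (cycles A (ch_tensor A X Y) (p + q))
         (gr_inj A (cob X) (cob Y) (p + q) p \<cdot> (cycles A X p \<boxdot> cycles A Y q))"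
    and kuenneth_lift: 
      "lift_through A (cycles A (ch_tensor A X Y) (p + q)) (gr_inj A (cob X) (cob Y) (p + q) p \<cdot> (cycles A X p \<boxdot> cycles A Y q)) \<in> Arr A"
      "Dom A (lift_through A (cycles A (ch_tensor A X Y) (p + q)) (gr_inj A (cob X) (cob Y) (p + q) p \<cdot> (cycles A X p \<boxdot> cycles A Y q))) =
        Dom A (cycles A X p) \<boxtimes> Dom A (cycles A Y q)"
      "Cod A (lift_through A (cycles A (ch_tensor A X Y) (p + q)) (gr_inj A (cob X) (cob Y) (p + q) p \<cdot> (cycles A X p \<boxdot> cycles A Y q))) =
        Dom A (cycles A (ch_tensor A X Y) (p + q))"
      "cycles A (ch_tensor A X Y) (p + q) \<cdot> lift_through A (cycles A (ch_tensor A X Y) (p + q))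
         (gr_inj A (cob X) (cob Y) (p + q) p \<cdot> (cycles A X p \<boxdot> cycles A Y q)) =
       gr_inj A (cob X) (cob Y) (p + q) p \<cdot> (cycles A X p \<boxdot> cycles A Y q)"
proof -
  note XY = is_complex_ch_tensor[OF X Y]
  note [simp] = X Y XY is_complexD(1-4)[OF X] is_complexD(1-4)[OF Y] ch_tensor_diff[OF X Y] int_diff_normal
  let ?g = "gr_inj A (cob X) (cob Y) (p + q) p \<cdot> (cycles A X p \<boxdot> cycles A Y q)"
  let ?l = "lift_through A (cycles A (ch_tensor A X Y) (p + q)) ?g"
  have "cdiff (ch_tensor A X Y) (p + q) \<cdot> ?g =
    Zero A (Dom A (cycles A X p) \<boxtimes> Dom A (cycles A Y q)) (gr_tensor A (cob X) (cob Y) (p + q - 1))"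
    by (simp add: add.commute)
  then show l[simp]: "?l \<in> Arr A" "Dom A ?l = Dom A (cycles A X p) \<boxtimes> Dom A (cycles A Y q)"
    "Cod A ?l = Dom A (cycles A (ch_tensor A X Y) (p + q))"
    "cycles A (ch_tensor A X Y) (p + q) \<cdot> ?l = ?g"
    using lift_cycles[OF XY, of ?g "p + q"] by simp_all
  let ?\<phi> = "hproj A (ch_tensor A X Y) (p + q) \<cdot> ?l"
  have c: "cycles A (ch_tensor A X Y) (p + q) \<cdot> ?l \<cdot> r = ?g \<cdot> r"
    if "r \<in> Arr A" "Cod A r = Dom A (cycles A X p) \<boxtimes> Dom A (cycles A Y q)" for r
    by (rule reassoc[OF l(4)]) (use that in simp_all)
  have d1: "cycles A (ch_tensor A X Y) (p + q) \<cdot> ?l \<cdot> (boundary A X p \<boxdot> Ident A (Dom A (cycles A Y q)))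
    = cdiff (ch_tensor A X Y) (p + q + 1) \<cdot> gr_inj A (cob X) (cob Y) (p + q + 1) (p + 1) \<cdot> (Ident A (cob X (p + 1)) \<boxdot> cycles A Y q)"
    by (subst c) simp_all
  have z1: "?\<phi> \<cdot> (boundary A X p \<boxdot> Ident A (Dom A (cycles A Y q))) =
    Zero A (cob X (p + 1) \<boxtimes> Dom A (cycles A Y q)) (homology A (ch_tensor A X Y) (p + q))"
    using hproj_lift_boundary[OF XY, of "gr_inj A (cob X) (cob Y) (p + q + 1) (p + 1) \<cdot> (Ident A (cob X (p + 1)) \<boxdot> cycles A Y q)"
      "p + q + 1" "?l \<cdot> (boundary A X p \<boxdot> Ident A (Dom A (cycles A Y q)))" "p + q", OF _ _ _ d1] by simp
  \<comment> \<open>If \<open>x\<close> is a cycle of degree \<open>p\<close>, the differential of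
    \<open>x \<otimes> y\<close> is \<open>x \<otimes> d y\<close> with sign \<open>(-1)^p\<close>;
    the factor \<open>signed A p\<close> in the chosen preimage cancels it.\<close>
  have d2: "cycles A (ch_tensor A X Y) (p + q) \<cdot> ?l \<cdot> (Ident A (Dom A (cycles A X p)) \<boxdot> boundary A Y q)
    = cdiff (ch_tensor A X Y) (p + q + 1) \<cdot> signed A p (gr_inj A (cob X) (cob Y) (p + q + 1) p \<cdot> (cycles A X p \<boxdot> Ident A (cob Y (q + 1))))"
    by (subst c) (simp_all add: signed_parity[of "2 * p" 0])
  have z2: "?\<phi> \<cdot> (Ident A (Dom A (cycles A X p)) \<boxdot> boundary A Y q) =
    Zero A (Dom A (cycles A X p) \<boxtimes> cob Y (q + 1)) (homology A (ch_tensor A X Y) (p + q))"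
    using hproj_lift_boundary[OF XY, of "signed A p (gr_inj A (cob X) (cob Y) (p + q + 1) p \<cdot> (cycles A X p \<boxdot> Ident A (cob Y (q + 1))))"
      "p + q + 1" "?l \<cdot> (Ident A (Dom A (cycles A X p)) \<boxdot> boundary A Y q)" "p + q", OF _ _ _ d2] by simp
  show "kuenneth A X Y p q \<in> Arr A"
    "Dom A (kuenneth A X Y p q) = homology A X p \<boxtimes> homology A Y q"
    "Cod A (kuenneth A X Y p q) = homology A (ch_tensor A X Y) (p + q)"
    "kuenneth A X Y p q \<cdot> (hproj A X p \<boxdot> hproj A Y q) = ?\<phi>"
    unfolding kuenneth_def
    using tensor_descend[OF is_cokernel_hproj[OF X, of p] is_cokernel_hproj[OF Y, of q], of ?\<phi>] z1 z2
    by (auto simp: Hom_iff)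
qed

end

section \<open>Cycles and homology of a lax symmetric monoidal functor\<close>

text \<open>The intermediary between a functor and its homology, which are related by no direct map:
  a subfamily of the first, with the second as quotient. The zero differential is the restricted
  one, since cycles are killed.\<close>

definition cycle_family ::
  "('c, 'f) sm_cat \<Rightarrow> ('o, 'm) sm_cat \<Rightarrow> ('c, 'f, int, 'o, 'm) family
    \<Rightarrow> ('c, 'f, ('o, 'm) chain_complex, ('o, 'm) chain_map) lax_functor \<Rightarrow> ('c, 'f, int, 'o, 'm) family" where
  "cycle_family C A P F = \<lparr>
     fob = (\<lambda>X n. Dom A (cycles A (FObj F X) n)),
     farr = (\<lambda>f. cycle_map A (FArr F f)),
     fdiff = (\<lambda>X n. Zero A (Dom A (cycles A (FObj F X) n)) (Dom A (cycles A (FObj F X) (n - 1)))),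
     fmul = (\<lambda>X Y p q. lift_through A (cycles A (FObj F (X \<boxtimes>\<^bsub>C\<^esub> Y)) (p + q))
       (fmul P X Y p q \<cdot>\<^bsub>A\<^esub> (cycles A (FObj F X) p \<boxdot>\<^bsub>A\<^esub> cycles A (FObj F Y) q))),
     funit = lift_through A (cycles A (FObj F (Unit C)) 0) (funit P)\<rparr>"

definition homology_family ::
  "('o, 'm) sm_cat \<Rightarrow> ('c, 'f, ('o, 'm) chain_complex, ('o, 'm) chain_map) lax_functor
    \<Rightarrow> ('c, 'f, int, 'o, 'm) family" where
  "homology_family A F = \<lparr>
     fob = (\<lambda>X. homology A (FObj F X)),
     farr = (\<lambda>f. homology_map A (FArr F f)),
     fdiff = (\<lambda>X n. Zero A (homology A (FObj F X) n) (homology A (FObj F X) (n - 1))),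
     fmul = (\<lambda>X Y p q. homology_map A (FMult F X Y) (p + q) \<cdot>\<^bsub>A\<^esub> kuenneth A (FObj F X) (FObj F Y) p q),
     funit = homology_map A (FUnit F) 0 \<cdot>\<^bsub>A\<^esub> hproj A (Unit (Ch A)) 0 \<cdot>\<^bsub>A\<^esub>
       lift_through A (cycles A (Unit (Ch A)) 0) (Ident A (cob (Unit (Ch A)) 0))\<rparr>"

locale exact_representation = representation C A P \<FF> + exact_tensor_category A
  for C :: "('c, 'f) sm_cat" and A :: "('o, 'm) sm_cat" (structure) and P :: "('c, 'f, int, 'o, 'm) family"
    and \<FF> :: "('c, 'f, ('o, 'm) chain_complex, ('o, 'm) chain_map) lax_functor"
begin

abbreviation "Z \<equiv> cycle_family C A P \<FF>"
abbreviation "H \<equiv> homology_family A \<FF>"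
abbreviation "zyc X \<equiv> cycles A (FObj \<FF> X)"

lemma zyc_Arr [simp]:
  assumes "X \<in> Obj C"
  shows "zyc X n \<in> Arr A" "Cod A (zyc X n) = fob P X n"
    "fdiff P X n \<cdot> zyc X n = Zero A (Dom A (zyc X n)) (fob P X (n - 1))"
  using cycles_Arr[OF rep_complex[OF assms], of n] assms by simp_all

lemma lift_zyc:
  assumes X: "X \<in> Obj C" and g: "g \<in> Arr A" "Cod A g = fob P X n" "fdiff P X n \<cdot> g = Zero A (Dom A g) (fob P X (n - 1))"
  shows "lift_through A (zyc X n) g \<in> Arr A" "Dom A (lift_through A (zyc X n) g) = Dom A g"
    "Cod A (lift_through A (zyc X n) g) = Dom A (zyc X n)"
    "zyc X n \<cdot> lift_through A (zyc X n) g = g"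
  using lift_cycles[OF rep_complex[OF X], of g n] g X by simp_all

lemma fmul_zyc:
  assumes o: "X \<in> Obj C" "Y \<in> Obj C" "X \<boxtimes>\<^bsub>C\<^esub> Y \<in> Obj C"
  shows "fdiff P (X \<boxtimes>\<^bsub>C\<^esub> Y) (p + q) \<cdot> fmul P X Y p q \<cdot> (zyc X p \<boxdot> zyc Y q) =
    Zero A (Dom A (zyc X p) \<boxtimes> Dom A (zyc Y q)) (fob P (X \<boxtimes>\<^bsub>C\<^esub> Y) (p + q - 1))"
  using o by (subst A.reassoc[OF leibniz[OF o]]) (simp_all add: diff_add_eq add_diff_eq)

lemma fmul_Z:
  assumes o[simp]: "X \<in> Obj C" "Y \<in> Obj C" "X \<boxtimes>\<^bsub>C\<^esub> Y \<in> Obj C"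
  shows "fmul Z X Y p q \<in> Arr A" "Dom A (fmul Z X Y p q) = Dom A (zyc X p) \<boxtimes> Dom A (zyc Y q)"
    "Cod A (fmul Z X Y p q) = Dom A (zyc (X \<boxtimes>\<^bsub>C\<^esub> Y) (p + q))"
    "zyc (X \<boxtimes>\<^bsub>C\<^esub> Y) (p + q) \<cdot> fmul Z X Y p q = fmul P X Y p q \<cdot> (zyc X p \<boxdot> zyc Y q)"
  unfolding cycle_family_def family.select_convs
  using lift_zyc[of "X \<boxtimes>\<^bsub>C\<^esub> Y" "fmul P X Y p q \<cdot> (zyc X p \<boxdot> zyc Y q)" "p + q"] fmul_zyc[OF o, of p q]
  by simp_all

lemma funit_Z:
  "funit Z \<in> Arr A" "Dom A (funit Z) = Unit A" "Cod A (funit Z) = Dom A (zyc (Unit C) 0)"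
  "zyc (Unit C) 0 \<cdot> funit Z = funit P"
  unfolding cycle_family_def family.select_convs
  using lift_zyc[of "Unit C" "funit P" 0] fdiff_funit by simp_all

lemma farr_chain_map:
  assumes "f \<in> Hom C X Y"
  shows "is_chain_map A (FArr \<FF> f)" "cdom (FArr \<FF> f) = FObj \<FF> X" "ccod (FArr \<FF> f) = FObj \<FF> Y"
    "carr (FArr \<FF> f) = farr P f"
  using rep_arr_Hom[OF assms] rep_arr[OF assms] by (simp_all add: Ch_Hom_iff)

lemma Z_data: "family_data C A (1 :: int) Z"
proof (rule family_data.intro[OF guarded_source_axioms A.tensor_sum_category_axioms], unfold_locales, goal_cases)
  case (1 X i)
  then show ?case by (simp add: cycle_family_def)
next
  case (2 f X Y i)
  note f = farr_chain_map[OF 2]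
  show ?case using cycle_map[OF f(1), of i] f by (simp add: cycle_family_def Hom_iff)
next
  case (3 X i)
  then show ?case by (simp add: cycle_family_def Hom_iff)
next
  case (4 X Y i j)
  then show ?case using fmul_Z[OF 4, of i j] by (simp add: Hom_iff) (simp add: cycle_family_def)
next
  case 5
  show ?case using funit_Z by (simp add: Hom_iff) (simp add: cycle_family_def)
qed

lemma Z_trans: "family_chain_trans C A (1 :: int) Z P zyc"
proof (rule family_chain_trans.intro[OF family_trans.intro[OF Z_data family_data_axioms]], unfold_locales, goal_cases)
  case (1 X i)
  then show ?case by (simp add: cycle_family_def Hom_iff)
next
  case (2 f X Y i)
  note f = farr_chain_map[OF 2]
  show ?case using cycles_cycle_map[OF f(1), of i] f by (simp add: cycle_family_def)
next
  case (3 X Y i j)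
  then show ?case by (rule fmul_Z)
next
  case 4
  show ?case by (rule funit_Z)
next
  case (5 X i)
  then show ?case by (simp add: cycle_family_def)
qed

lemma Z_lax: "lax_family C A (1 :: int) Z (\<lambda>k. k)"
proof -
  interpret T: family_chain_trans C A 1 Z P zyc by (rule Z_trans)
  show ?thesis
    by (rule T.lax_subfamily[OF lax_family_axioms]) (simp add: cycles_monic rep_complex)
qed

lemma mult_chain_map:
  assumes o: "X \<in> Obj C" "Y \<in> Obj C" "X \<boxtimes>\<^bsub>C\<^esub> Y \<in> Obj C"
  shows "is_chain_map A (FMult \<FF> X Y)"
  using rep_mult_Hom[OF o] by (simp add: Ch_Hom_iff)

lemma unit_chain_map: "is_chain_map A (FUnit \<FF>)"
  using rep_unit_Hom by (simp add: Ch_Hom_iff)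

text \<open>The unit complex has zero differential, so its identity lifts through the inclusion of
  the cycles.\<close>

lemma unit_lift:
  fixes n :: int
  defines "l \<equiv> lift_through A (cycles A (Unit (Ch A)) n) (Ident A (cob (Unit (Ch A)) n))"
  shows "l \<in> Arr A" "Dom A l = gr_unit A n" "Cod A l = Dom A (cycles A (Unit (Ch A)) n)"
    "cycles A (Unit (Ch A)) n \<cdot> l = Ident A (gr_unit A n)"
  unfolding l_def using lift_cycles[OF A.is_complex_Unit, of "Ident A (cob (Unit (Ch A)) n)" n] by (simp_all add: Ch_sel)

lemma H_data: "family_data C A (1 :: int) H"
proof (rule family_data.intro[OF guarded_source_axioms A.tensor_sum_category_axioms], unfold_locales, goal_cases)
  case (1 X i)
  then show ?case by (simp add: homology_family_def rep_complex)
next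
  case (2 f X Y i)
  note f = farr_chain_map[OF 2]
  show ?case using homology_map[OF f(1), of i] f by (simp add: homology_family_def Hom_iff)
next
  case (3 X i)
  then show ?case by (simp add: homology_family_def Hom_iff rep_complex)
next
  case (4 X Y i j)
  then show ?case
    using homology_map[OF mult_chain_map[OF 4], of "i + j"] 
    by (simp add: homology_family_def Hom_iff rep_complex rep_mult_dom rep_mult_cod)
next
  case 5
  show ?case
    using homology_map[OF unit_chain_map, of 0] unit_lift[of 0] A.is_complex_Unit
    by (simp add: homology_family_def Hom_iff rep_unit_dom rep_unit_cod Ch_sel(9))
qed

text \<open>In homology the product of two classes is the class of the product of representing
  cycles, by the defining equations of \<open>kuenneth\<close> and
  \<open>homology_map\<close>.\<close>

lemma H_trans: "family_chain_trans C A (1 :: int) Z H (\<lambda>X. hproj A (FObj \<FF> X))"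
proof (rule family_chain_trans.intro[OF family_trans.intro[OF Z_data H_data]], unfold_locales, goal_cases)
  case (1 X i)
  then show ?case by (simp add: cycle_family_def homology_family_def Hom_iff rep_complex)
next
  case (2 f X Y i)
  note f = farr_chain_map[OF 2]
  show ?case using homology_map_hproj[OF f(1), of i] f by (simp add: cycle_family_def homology_family_def)
next
  case (3 X Y i j)
  note [simp] = 3 rep_complex
  note X = rep_complex[OF 3(1)] and Y = rep_complex[OF 3(2)] and m = mult_chain_map[OF 3]
  note [simp] = homology_map_Arr[OF m, unfolded rep_mult_dom[OF 3] rep_mult_cod[OF 3]]
    cycle_map_Arr[OF m, unfolded rep_mult_dom[OF 3] rep_mult_cod[OF 3]] kuenneth_lift[OF X Y, simplified]
    A.is_complex_ch_tensor[OF X Y] fmul_Z(1-3)[OF 3]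
  note c = cycles_cycle_map[OF m, unfolded rep_mult_dom[OF 3] rep_mult_cod[OF 3]]
  let ?l = "lift_through A (cycles A (ch_tensor A (FObj \<FF> X) (FObj \<FF> Y)) (i + j))
    (gr_inj A (cob (FObj \<FF> X)) (cob (FObj \<FF> Y)) (i + j) i \<cdot> (zyc X i \<boxdot> zyc Y j))"
  \<comment> \<open>Two lifts of one and the same product of cycles; they agree after the monic
    inclusion \<open>zyc\<close>, where both become \<open>fmul P X Y i j\<close> on cycles.\<close>
  have "cycle_map A (FMult \<FF> X Y) (i + j) \<cdot> ?l = fmul Z X Y i j"
  proof (rule cycles_cancel[OF rep_complex[OF 3(3)], where n="i + j"], goal_cases)
    case 6
    show ?case
      using rep_mult_inj_reassoc[OF 3, of "zyc X i \<boxdot> zyc Y j" i "i + j"]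
      by (simp add: A.reassoc[OF c] fmul_Z(4)[OF 3])
  qed simp_all
  then show ?case
    using kuenneth_hproj[OF X Y, of i j]
    by (simp add: homology_family_def
      A.reassoc[OF homology_map_hproj[OF m, unfolded rep_mult_dom[OF 3] rep_mult_cod[OF 3]]])
next
  case 4
  note u = unit_chain_map and I = A.is_complex_Unit
  note [simp] = rep_complex homology_map_Arr[OF u, unfolded rep_unit_dom rep_unit_cod, folded Ch_sel(9)]
    cycle_map_Arr[OF u, unfolded rep_unit_dom rep_unit_cod, folded Ch_sel(9)] unit_lift[of 0, simplified] I funit_Z
  note c = cycles_cycle_map[OF u, unfolded rep_unit_dom rep_unit_cod, folded Ch_sel(9)]
  note h = homology_map_hproj[OF u, unfolded rep_unit_dom rep_unit_cod, folded Ch_sel(9)]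
  let ?l = "lift_through A (cycles A (Unit (Ch A)) 0) (Ident A (cob (Unit (Ch A)) 0))"
  have "cycle_map A (FUnit \<FF>) 0 \<cdot> ?l = funit Z"
  proof (rule cycles_cancel[OF rep_complex[OF src_Unit], where n=0], goal_cases)
    case 6
    have cu: "cob (Unit (Ch A)) n = gr_unit A n" for n by (simp add: Ch_sel)
    show ?case
      by (simp add: A.reassoc[OF c] rep_unit_0 cu unit_lift[of 0, unfolded cu, simplified])
  qed simp_all
  then show ?case
    by (simp add: homology_family_def A.reassoc[OF h])
next
  case (5 X i)
  then show ?case by (simp add: cycle_family_def homology_family_def rep_complex)
qed

lemma H_lax: "lax_family C A (1 :: int) H (\<lambda>k. k)"
proof -
  interpret T: family_chain_trans C A 1 Z H "\<lambda>X. hproj A (FObj \<FF> X)" by (rule H_trans)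
  show ?thesis
    by (rule T.lax_quotient_family[OF Z_lax]) (simp_all add: hproj_epic rep_complex epic_tensor)
qed

lemma H_representation: "representation C A H (lax_comp (Ch A) (H_functor A) \<FF>)"
proof (rule representation.intro[OF H_lax], unfold_locales, goal_cases)
  case (1 X)
  then show ?case by (simp add: lax_comp_def H_functor_def Let_def homology_family_def zero_diff_complex_def)
next
  case (2 f X Y)
  then show ?case by (simp add: lax_comp_def H_functor_def Let_def homology_family_def farr_chain_map[OF 2])
next
  case (3 X Y)
  then show ?case by (simp add: lax_comp_def H_functor_def Let_def Ch_sel)
next
  case (4 X Y)
  then show ?case by (simp add: lax_comp_def H_functor_def Let_def Ch_sel rep_mult_cod)
next
  case (5 X Y n)
  note [simp] = 5 rep_complex
  note [simp] = homology_map_Arr[OF mult_chain_map[OF 5], unfolded rep_mult_dom[OF 5] rep_mult_cod[OF 5]]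
    A.is_complex_ch_tensor[OF rep_complex[OF 5(1)] rep_complex[OF 5(2)]]
  show ?case by (simp add: lax_comp_def H_functor_def Let_def Ch_sel homology_family_def Hom_iff)
next
  case (6 X Y n p)
  note [simp] = 6 rep_complex
  note [simp] = homology_map_Arr[OF mult_chain_map[OF 6], unfolded rep_mult_dom[OF 6] rep_mult_cod[OF 6]]
    A.is_complex_ch_tensor[OF rep_complex[OF 6(1)] rep_complex[OF 6(2)]]
  show ?case by (simp add: lax_comp_def H_functor_def Let_def Ch_sel homology_family_def)
next
  case 7
  show ?case by (simp add: lax_comp_def H_functor_def Let_def Ch_sel)
next
  case 8
  show ?case by (simp add: lax_comp_def H_functor_def Let_def Ch_sel rep_unit_cod)
next
  case (9 n)
  note [simp] = rep_complex homology_map_Arr[OF unit_chain_map, unfolded rep_unit_dom rep_unit_cod, folded Ch_sel(9)]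
    unit_lift[of n] A.is_complex_Unit
  show ?case
    by (simp add: lax_comp_def H_functor_def Let_def Ch_sel(6) homology_family_def Hom_iff)
next
  case 10
  note [simp] = rep_complex homology_map_Arr[OF unit_chain_map, unfolded rep_unit_dom rep_unit_cod, folded Ch_sel(9)]
    unit_lift[of 0] A.is_complex_Unit
  show ?case
    by (simp add: lax_comp_def H_functor_def Let_def Ch_sel(6) homology_family_def)
qed

end

section \<open>Isomorphisms and images\<close>

context category
begin

lemma iso_arrI:
  assumes "f \<in> Arr C" "g \<in> Arr C" "Dom C g = Cod C f" "Cod C g = Dom C f"
    "g \<cdot> f = Ident C (Dom C f)" "f \<cdot> g = Ident C (Cod C f)"
  shows "iso_arr C f"
  unfolding iso_arr_def using assms by (auto simp: Hom_iff)

lemma iso_arrE: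
  assumes "iso_arr C f"
  obtains g where "f \<in> Arr C" "g \<in> Arr C" "Dom C g = Cod C f" "Cod C g = Dom C f"
    "g \<cdot> f = Ident C (Dom C f)" "f \<cdot> g = Ident C (Cod C f)"
  using assms unfolding iso_arr_def by (auto simp: Hom_iff)

lemma iso_arr_Comp:
  assumes "iso_arr C f" "iso_arr C g" "Dom C g = Cod C f"
  shows "iso_arr C (g \<cdot> f)"
proof -
  obtain f' where f[simp]: "f \<in> Arr C" "f' \<in> Arr C" "Dom C f' = Cod C f" "Cod C f' = Dom C f"
    "f' \<cdot> f = Ident C (Dom C f)" "f \<cdot> f' = Ident C (Cod C f)" using iso_arrE[OF assms(1)] by metis
  obtain g' where g[simp]: "g \<in> Arr C" "g' \<in> Arr C" "Dom C g' = Cod C g" "Cod C g' = Dom C g"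
    "g' \<cdot> g = Ident C (Dom C g)" "g \<cdot> g' = Ident C (Cod C g)" using iso_arrE[OF assms(2)] by metis
  show ?thesis
    by (rule iso_arrI[of _ "f' \<cdot> g'"]) (simp_all add: assms(3) reassoc[OF g(5)] reassoc[OF f(6)])
qed

lemma iso_arr_cancel_right:
  assumes c: "iso_arr C c" and h: "iso_arr C (h \<cdot> c)" "h \<in> Arr C" "Dom C h = Cod C c"
  shows "iso_arr C h"
proof -
  obtain d where d[simp]: "c \<in> Arr C" "d \<in> Arr C" "Dom C d = Cod C c" "Cod C d = Dom C c"
    "d \<cdot> c = Ident C (Dom C c)" "c \<cdot> d = Ident C (Cod C c)" using iso_arrE[OF c] by metis
  have "iso_arr C ((h \<cdot> c) \<cdot> d)"
    by (rule iso_arr_Comp[OF _ h(1)]) (use h in \<open>auto intro!: iso_arrI[of d c]\<close>)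
  then show ?thesis using h by simp
qed

end

lemma (in preadditive_category) zero_object_iso:
  assumes "iso_arr C f" "zero_object C (Cod C f)"
  shows "zero_object C (Dom C f)"
proof -
  obtain g where [simp]: "f \<in> Arr C" "g \<in> Arr C" "Dom C g = Cod C f" "Cod C g = Dom C f"
    and e: "g \<cdot> f = Ident C (Dom C f)" using iso_arrE[OF assms(1)] by metis
  have "f = Zero C (Dom C f) (Cod C f)" using zero_object_Arr(2)[OF assms(2), of f] by simp
  then have "g \<cdot> f = Zero C (Dom C f) (Dom C f)"
    by (metis Comp_Zero(1) Dom_Obj \<open>f \<in> Arr C\<close> \<open>g \<in> Arr C\<close> \<open>Cod C g = Dom C f\<close> \<open>Dom C g = Cod C f\<close>)
  then show ?thesis using e by (simp add: zero_object_iff)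
qed

lemma (in preadditive_category) iso_arr_zero:
  assumes "f \<in> Arr C" "zero_object C (Dom C f)" "zero_object C (Cod C f)"
  shows "iso_arr C f"
proof (rule iso_arrI[of f "Zero C (Cod C f) (Dom C f)"])
  have "Ident C (Dom C f) = Zero C (Dom C f) (Dom C f)" "Ident C (Cod C f) = Zero C (Cod C f) (Cod C f)"
    using assms by (auto simp: zero_object_iff)
  then show "Zero C (Cod C f) (Dom C f) \<cdot> f = Ident C (Dom C f)"
    "f \<cdot> Zero C (Cod C f) (Dom C f) = Ident C (Cod C f)" using assms by auto
qed (use assms in auto)

context abelian_category
begin

text \<open>By normality \<open>k\<close> is the kernel of some \<open>w\<close>, and
  \<open>w\<close> factors through the cokernel \<open>q\<close>; so whatever \<open>q\<close> kills
  is killed by \<open>w\<close> and factors through \<open>k\<close>.\<close>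

lemma monic_is_kernel:
  assumes k: "monic C k" and q: "is_cokernel C k q"
  shows "is_kernel C q k"
proof -
  obtain w where w: "is_kernel C w k" using monic_normal k by blast
  note [simp] = is_kernelD(1-3)[OF w] is_cokernelD(2,3)[OF q]
  obtain w' where "w' \<in> Hom C (Cod C q) (Cod C w)" and w': "w' \<cdot> q = w"
    by (rule is_cokernel_descend[OF q, of w "Cod C w"]) (use is_kernelD[OF w] in \<open>auto simp: Hom_iff\<close>)
  then have [simp]: "w' \<in> Arr C" "Dom C w' = Cod C q" "Cod C w' = Cod C w" by (auto simp: Hom_iff)
  show ?thesis
  proof (rule is_kernelI)
    fix W g assume g: "g \<in> Hom C W (Dom C q)" "q \<cdot> g = Zero C W (Cod C q)"
    then have [simp]: "g \<in> Arr C" "Dom C g = W" "Cod C g = Dom C w" "W \<in> Obj C"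
      using Hom_Obj(1)[OF g(1)] by (auto simp: Hom_iff)
    have "w \<cdot> g = w' \<cdot> q \<cdot> g" using reassoc[OF w', of g] by simp
    then have "w \<cdot> g = Zero C W (Cod C w)" by (simp add: g(2))
    then show "\<exists>h\<in>Hom C W (Dom C k). k \<cdot> h = g"
      using is_kernel_lift_through[OF w, of g W] by (intro bexI[of _ "lift_through C k g"]) (auto simp: Hom_iff)
  qed (use k is_cokernelD[OF q] in auto)
qed

text \<open>Let \<open>e \<cdot> g = 0\<close>. Then \<open>e\<close> factors through
  \<open>c\<close>, the cokernel of \<open>g\<close>. The epimorphism \<open>c \<cdot> q\<close> is
  the cokernel of some \<open>h\<close>, and \<open>f \<cdot> h = 0\<close>, so \<open>h\<close>
  factors through \<open>k\<close> and is killed by \<open>q\<close>. Hence \<open>q\<close> factors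
  as \<open>r \<cdot> c \<cdot> q\<close>, which makes \<open>r \<cdot> c\<close> an identity, and
  \<open>g = r \<cdot> c \<cdot> g = 0\<close>.\<close>

lemma coimage_monic:
  assumes k: "is_kernel C f k" and q: "is_cokernel C k q" and e: "e \<in> Hom C (Cod C q) (Cod C f)" "e \<cdot> q = f"
  shows "monic C e"
proof (rule monicI_Zero)
  note [simp] = is_kernelD(1-3)[OF k] is_cokernelD(2,3)[OF q] HomD[OF e(1)]
  show "e \<in> Arr C" by simp
  fix W g assume W: "W \<in> Obj C" "g \<in> Hom C W (Dom C e)" "e \<cdot> g = Zero C W (Cod C e)"
  then have [simp]: "g \<in> Arr C" "Dom C g = W" "Cod C g = Cod C q" by (auto simp: Hom_iff)
  define c where "c = coker_arr C g"
  have c: "is_cokernel C g c" unfolding c_def by (rule is_cokernel_coker_arr) simp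
  note [simp] = is_cokernelD(2,3)[OF c]
  obtain e' where "e' \<in> Hom C (Cod C c) (Cod C f)" and e': "e' \<cdot> c = e"
    by (rule is_cokernel_descend[OF c, of e "Cod C f"]) (use W in \<open>auto simp: Hom_iff\<close>)
  then have [simp]: "e' \<in> Arr C" "Dom C e' = Cod C c" "Cod C e' = Cod C f" by (auto simp: Hom_iff)
  have "epic C (c \<cdot> q)" by (rule epic_Comp) (simp_all add: is_cokernel_epic[OF q] is_cokernel_epic[OF c])
  then obtain h where h: "is_cokernel C h (c \<cdot> q)" using epic_normal by blast
  note [simp] = is_cokernelD(1)[OF h]
  have ch[simp]: "Cod C h = Dom C f" using is_cokernelD(3)[OF h] by simp
  have "f \<cdot> h = e' \<cdot> (c \<cdot> q) \<cdot> h"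
    using e(2) e' by (metis assoc \<open>e' \<in> Arr C\<close> \<open>Dom C e' = Cod C c\<close> \<open>Dom C q = Cod C k\<close> ch
      \<open>Cod C g = Cod C q\<close> \<open>c \<in> Arr C\<close> \<open>q \<in> Arr C\<close> \<open>h \<in> Arr C\<close> \<open>Dom C c = Cod C g\<close> \<open>Cod C k = Dom C f\<close>
      Comp_Arr(1,2,3))
  also have "\<dots> = Zero C (Dom C h) (Cod C f)"
    unfolding is_cokernelD(4)[OF h] by simp
  finally obtain h' where "h' \<in> Hom C (Dom C h) (Dom C k)" and h': "k \<cdot> h' = h"
    using is_kernel_lift[OF k, of h "Dom C h"] by (auto simp: Hom_iff)
  then have [simp]: "h' \<in> Arr C" "Dom C h' = Dom C h" "Cod C h' = Dom C k" by (auto simp: Hom_iff)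
  have "q \<cdot> k \<cdot> h' = Zero C (Dom C h) (Cod C q)"
    by (subst reassoc[OF is_cokernelD(4)[OF q]]) simp_all
  then obtain r where "r \<in> Hom C (Cod C c) (Cod C q)" and r: "r \<cdot> c \<cdot> q = q"
    using is_cokernel_descend[OF h, of q "Cod C q"] by (auto simp: Hom_iff h')
  then have [simp]: "r \<in> Arr C" "Dom C r = Cod C c" "Cod C r = Cod C q" by (auto simp: Hom_iff)
  have "r \<cdot> c = Ident C (Cod C q)"
    by (rule epicD[OF is_cokernel_epic[OF q], where W="Cod C q"]) (use r in \<open>auto simp: Hom_iff\<close>)
  then have "g = (r \<cdot> c) \<cdot> g" by simp
  also have "\<dots> = r \<cdot> c \<cdot> g" by (rule assoc) simp_all
  also have "\<dots> = Zero C W (Cod C q)" unfolding is_cokernelD(4)[OF c] using W by simp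
  finally show "g = Zero C W (Dom C e)" by simp
qed

end

section \<open>Exactness of direct sums\<close>

text \<open>The assumptions on \<open>A\<close> concern sums over subsets of an abstract index type,
  whereas gradings require sums over \<open>int\<close>; an injection of \<open>int\<close> into
  that type mediates.\<close>

lemma (in category) is_coproduct_reindex:
  assumes "inj e"
  shows "is_coproduct C (range e) F S inc \<longleftrightarrow> is_coproduct C UNIV (F \<circ> e) S (inc \<circ> e)"
proof
  assume c: "is_coproduct C (range e) F S inc"
  show "is_coproduct C UNIV (F \<circ> e) S (inc \<circ> e)"
  proof (rule is_coproductI)
    fix T g assume T: "T \<in> Obj C" "\<And>i. i \<in> UNIV \<Longrightarrow> g i \<in> Hom C ((F \<circ> e) i) T"
    obtain h where "h \<in> Hom C S T" "\<And>i. i \<in> range e \<Longrightarrow> h \<cdot> inc i = g (inv_into UNIV e i)"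
      by (rule is_coproduct_ex[OF c, of T "g \<circ> inv_into UNIV e"]) (use T assms in auto)
    then show "\<exists>h\<in>Hom C S T. \<forall>i\<in>UNIV. h \<cdot> (inc \<circ> e) i = g i"
      using assms by (intro bexI[of _ h]) auto
  next
    fix T h h' assume "h \<in> Hom C S T" "h' \<in> Hom C S T" "\<And>i. i \<in> UNIV \<Longrightarrow> h \<cdot> (inc \<circ> e) i = h' \<cdot> (inc \<circ> e) i"
    then show "h = h'" by - (rule is_coproduct_ext[OF c], auto)
  qed (use is_coproductD[OF c] in auto)
next
  assume c: "is_coproduct C UNIV (F \<circ> e) S (inc \<circ> e)"
  show "is_coproduct C (range e) F S inc"
  proof (rule is_coproductI)
    fix T g assume T: "T \<in> Obj C" "\<And>i. i \<in> range e \<Longrightarrow> g i \<in> Hom C (F i) T"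
    obtain h where "h \<in> Hom C S T" "\<And>i. h \<cdot> (inc \<circ> e) i = (g \<circ> e) i"
      by (rule is_coproduct_ex[OF c, of T "g \<circ> e"]) (use T in auto)
    then show "\<exists>h\<in>Hom C S T. \<forall>i\<in>range e. h \<cdot> inc i = g i"
      by (intro bexI[of _ h]) auto
  next
    fix T h h' assume "h \<in> Hom C S T" "h' \<in> Hom C S T" "\<And>i. i \<in> range e \<Longrightarrow> h \<cdot> inc i = h' \<cdot> inc i"
    then show "h = h'" by - (rule is_coproduct_ext[OF c], auto)
  qed (use is_coproductD[OF c] in auto)
qed

lemma comp_inv_into: "inj e \<Longrightarrow> (F \<circ> inv_into UNIV e) \<circ> e = F"
  by (simp add: fun_eq_iff)

lemma ex_inj_int:
  assumes "infinite (UNIV :: 'i set)"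
  obtains e :: "int \<Rightarrow> 'i" where "inj e"
proof -
  obtain f :: "nat \<Rightarrow> 'i" where f: "inj f" using assms infinite_countable_subset by blast
  have "inj (f \<circ> int_encode)" using f inj_int_encode by (intro inj_compose) auto
  then show thesis using that by blast
qed

lemma exact_tensor_categoryI:
  fixes A :: "('o, 'm) sm_cat"
  assumes A: "abelian_symmetric_monoidal_category A"
    and I: "infinite (UNIV :: 'i set)"
    and sums: "has_direct_sums TYPE('i) A"
    and exact: "exact_direct_sums TYPE('i) A"
    and tensor: "tensor_preserves_direct_sums TYPE('i) A"
  shows "exact_tensor_category A"
proof -
  interpret abelian_symmetric_monoidal_category A by (rule A)
  obtain e :: "int \<Rightarrow> 'i" where e: "inj e" using ex_inj_int[OF I] .
  note E = comp_inv_into[OF e]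
  \<comment> \<open>A family over \<open>int\<close> becomes one over the index type through
    \<open>inv_into\<close>; a coproduct over \<open>range e\<close> sees only the values
    there.\<close>
  have re: "is_coproduct A (range e) (F \<circ> inv_into UNIV e) S (inc \<circ> inv_into UNIV e) \<longleftrightarrow> is_coproduct A UNIV F S inc" for F S inc
    using is_coproduct_reindex[OF e, of "F \<circ> inv_into UNIV e" S "inc \<circ> inv_into UNIV e"] unfolding E .
  interpret tensor_sum_category A
  proof (rule tensor_sum_category.intro[OF preadditive_category_axioms], rule tensor_sum_category_axioms.intro, goal_cases)
    case (16 F)
    then have "\<forall>i\<in>range e. (F \<circ> inv_into UNIV e) i \<in> Obj A" by auto
    then obtain S inc where "is_coproduct A (range e) (F \<circ> inv_into UNIV e) S inc"
      using sums unfolding has_direct_sums_def by meson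
    then show ?case using is_coproduct_reindex[OF e, of "F \<circ> inv_into UNIV e" S inc] unfolding E by blast
  next
    case (17 F S inc X)
    then have "is_coproduct A (range e) (F \<circ> inv_into UNIV e) S (inc \<circ> inv_into UNIV e)" by (simp add: re)
    then have "is_coproduct A (range e) (\<lambda>i. (F \<circ> inv_into UNIV e) i \<boxtimes>\<^bsub>A\<^esub> X) (S \<boxtimes>\<^bsub>A\<^esub> X) (\<lambda>i. (inc \<circ> inv_into UNIV e) i \<boxdot>\<^bsub>A\<^esub> Ident A X)"
      using tensor 17(2) unfolding tensor_preserves_direct_sums_def by meson
    then show ?case using re[of "\<lambda>i. F i \<boxtimes>\<^bsub>A\<^esub> X" "S \<boxtimes>\<^bsub>A\<^esub> X" "\<lambda>i. inc i \<boxdot>\<^bsub>A\<^esub> Ident A X"] by (simp add: comp_def)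
  next
    case (18 F S inc X)
    then have "is_coproduct A (range e) (F \<circ> inv_into UNIV e) S (inc \<circ> inv_into UNIV e)" by (simp add: re)
    then have "is_coproduct A (range e) (\<lambda>i. X \<boxtimes>\<^bsub>A\<^esub> (F \<circ> inv_into UNIV e) i) (X \<boxtimes>\<^bsub>A\<^esub> S) (\<lambda>i. Ident A X \<boxdot>\<^bsub>A\<^esub> (inc \<circ> inv_into UNIV e) i)"
      using tensor 18(2) unfolding tensor_preserves_direct_sums_def by meson
    then show ?case using re[of "\<lambda>i. X \<boxtimes>\<^bsub>A\<^esub> F i" "X \<boxtimes>\<^bsub>A\<^esub> S" "\<lambda>i. Ident A X \<boxdot>\<^bsub>A\<^esub> inc i"] by (simp add: comp_def)
  qed (use Unit_Obj Tensor_Obj TensorArr_Hom TensorArr_Ident TensorArr_Comp TensorArr_Add_left TensorArr_Add_right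
    Assoc_Hom Assoc_natural LUnit_Hom LUnit_natural RUnit_Hom RUnit_natural Sym_Hom Sym_natural in auto)
  show ?thesis
  proof (rule exact_tensor_category.intro[OF A tensor_sum_category_axioms], rule exact_tensor_category_axioms.intro)
    fix f :: "int \<Rightarrow> 'm" assume m: "\<And>p. monic A (f p)"
    then have [simp]: "f p \<in> Arr A" for p by (rule monic_Arr)
    let ?X = "\<lambda>p. Dom A (f p)" and ?Y = "\<lambda>p. Cod A (f p)"
    have c: "is_coproduct A (range e) (?X \<circ> inv_into UNIV e) (dsum A ?X) (dinj A ?X \<circ> inv_into UNIV e)"
      "is_coproduct A (range e) (?Y \<circ> inv_into UNIV e) (dsum A ?Y) (dinj A ?Y \<circ> inv_into UNIV e)"
      unfolding re by (rule is_coproduct_dsum; simp)+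
    show "monic A (dmap A f)"
    proof (rule exact[unfolded exact_direct_sums_def, rule_format, OF c])
      fix i assume "i \<in> range e"
      show "(f \<circ> inv_into UNIV e) i \<in> Hom A ((?X \<circ> inv_into UNIV e) i) ((?Y \<circ> inv_into UNIV e) i) \<and> monic A ((f \<circ> inv_into UNIV e) i)"
        using m by (auto simp: Hom_iff)
      show "dmap A f \<cdot>\<^bsub>A\<^esub> (dinj A ?X \<circ> inv_into UNIV e) i = (dinj A ?Y \<circ> inv_into UNIV e) i \<cdot>\<^bsub>A\<^esub> (f \<circ> inv_into UNIV e) i"
        by (simp add: dmap_dinj)
    qed (simp add: Hom_iff)
  qed
qed

section \<open>Summation over the integers preserves kernels and cokernels\<close>

context exact_tensor_category
begin

lemma dmap_Comp:
  assumes [simp]: "\<And>p. f p \<in> Arr A" "\<And>p. g p \<in> Arr A" "\<And>p. Dom A (g p) = Cod A (f p)"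
  shows "dmap A g \<cdot> dmap A f = dmap A (\<lambda>p. g p \<cdot> f p)"
  by (rule dsum_ext[where F="\<lambda>p. Dom A (f p)"]) (simp_all add: dmap_dinj dmap_dinj_reassoc)

lemma dmap_Ident: "(\<And>p. X p \<in> Obj A) \<Longrightarrow> dmap A (\<lambda>p. Ident A (X p)) = Ident A (dsum A X)"
  by (rule dsum_ext[where F=X]) (simp_all add: dmap_dinj)

lemma dmap_Zero:
  "(\<And>p. X p \<in> Obj A) \<Longrightarrow> (\<And>p. Y p \<in> Obj A) \<Longrightarrow> dmap A (\<lambda>p. Zero A (X p) (Y p)) = Zero A (dsum A X) (dsum A Y)"
  by (rule dsum_ext[where F=X]) (simp_all add: dmap_dinj)

lemma dmap_iso:
  assumes "\<And>p. iso_arr A (f p)"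
  shows "iso_arr A (dmap A f)"
proof -
  have "\<exists>g. f p \<in> Arr A \<and> g \<in> Arr A \<and> Dom A g = Cod A (f p) \<and> Cod A g = Dom A (f p) \<and>
    g \<cdot> f p = Ident A (Dom A (f p)) \<and> f p \<cdot> g = Ident A (Cod A (f p))" for p
    using iso_arrE[OF assms[of p]] by metis
  then obtain g where [simp]: "\<And>p. f p \<in> Arr A" "\<And>p. g p \<in> Arr A" "\<And>p. Dom A (g p) = Cod A (f p)"
    "\<And>p. Cod A (g p) = Dom A (f p)" "\<And>p. g p \<cdot> f p = Ident A (Dom A (f p))" "\<And>p. f p \<cdot> g p = Ident A (Cod A (f p))"
    by metis
  show ?thesis
    by (rule iso_arrI[of _ "dmap A g"]) (simp_all add: dmap_Comp dmap_Ident)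
qed

lemma dmap_epic:
  assumes "\<And>p. epic A (f p)"
  shows "epic A (dmap A f)"
  unfolding epic_def
proof (intro conjI ballI impI)
  have [simp]: "f p \<in> Arr A" for p using assms epic_Arr by auto
  show "dmap A f \<in> Arr A" by simp
  fix W g h assume W: "W \<in> Obj A" "g \<in> Hom A (Cod A (dmap A f)) W" "h \<in> Hom A (Cod A (dmap A f)) W"
    and e: "g \<cdot> dmap A f = h \<cdot> dmap A f"
  then have [simp]: "g \<in> Arr A" "h \<in> Arr A" "Dom A g = dsum A (\<lambda>p. Cod A (f p))" "Dom A h = dsum A (\<lambda>p. Cod A (f p))"
    "Cod A g = W" "Cod A h = W" by (auto simp: Hom_iff)
  show "g = h"
  proof (rule dsum_ext[where F="\<lambda>p. Cod A (f p)"], goal_cases)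
    case (7 p)
    have "(g \<cdot> dmap A f) \<cdot> dinj A (\<lambda>p. Dom A (f p)) p = (h \<cdot> dmap A f) \<cdot> dinj A (\<lambda>p. Dom A (f p)) p"
      using e by simp
    then have "(g \<cdot> dinj A (\<lambda>p. Cod A (f p)) p) \<cdot> f p = (h \<cdot> dinj A (\<lambda>p. Cod A (f p)) p) \<cdot> f p"
      by (simp add: dmap_dinj)
    then show ?case by (rule epicD[OF assms[of p]]) (auto simp: Hom_iff)
  qed simp_all
qed

text \<open>Both notions are colimits: a map vanishing on the sum of the \<open>f p\<close> descends
  summand by summand, and the descended maps are glued.\<close>

lemma dmap_cokernel:
  assumes c: "\<And>p. is_cokernel A (f p) (q p)"
  shows "is_cokernel A (dmap A f) (dmap A q)"
proof (rule is_cokernelI)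
  note [simp] = is_cokernelD[OF c]
  show "epic A (dmap A q)" by (rule dmap_epic[OF is_cokernel_epic[OF c]])
  show "dmap A q \<cdot> dmap A f = Zero A (Dom A (dmap A f)) (Cod A (dmap A q))"
    by (simp add: dmap_Comp dmap_Zero)
  fix W g assume g: "g \<in> Hom A (Cod A (dmap A f)) W" "g \<cdot> dmap A f = Zero A (Dom A (dmap A f)) W"
  then have [simp]: "g \<in> Arr A" "Dom A g = dsum A (\<lambda>p. Cod A (f p))" "Cod A g = W" "W \<in> Obj A"
    using Hom_Obj[OF g(1)] by (auto simp: Hom_iff)
  have "\<exists>h. h \<in> Hom A (Cod A (q p)) W \<and> h \<cdot> q p = g \<cdot> dinj A (\<lambda>p. Cod A (f p)) p" for p
  proof -
    have "(g \<cdot> dmap A f) \<cdot> dinj A (\<lambda>p. Dom A (f p)) p = Zero A (Dom A (f p)) W"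
      unfolding g(2) by simp
    then have "(g \<cdot> dinj A (\<lambda>p. Cod A (f p)) p) \<cdot> f p = Zero A (Dom A (f p)) W"
      by (simp add: dmap_dinj)
    then show ?thesis
      using is_cokernel_descend[OF c, of "g \<cdot> dinj A (\<lambda>p. Cod A (f p)) p" p W] by (auto simp: Hom_iff)
  qed
  then obtain h where h: "\<And>p. h p \<in> Hom A (Cod A (q p)) W" "\<And>p. h p \<cdot> q p = g \<cdot> dinj A (\<lambda>p. Cod A (f p)) p"
    by metis
  note [simp] = HomD[OF h(1)]
  have "copair A (\<lambda>p. Cod A (q p)) W h \<cdot> dmap A q = g"
    by (rule dsum_ext[where F="\<lambda>p. Cod A (f p)"]) (simp_all add: dmap_dinj h(2))
  then show "\<exists>h\<in>Hom A (Cod A (dmap A q)) W. h \<cdot> dmap A q = g"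
    by (intro bexI[of _ "copair A (\<lambda>p. Cod A (q p)) W h"]) (simp_all add: Hom_iff)
qed (use is_cokernelD[OF c] in simp_all)

text \<open>Write \<open>f p = e p \<cdot> q p\<close> with \<open>q p\<close> the cokernel of
  \<open>k p\<close>; then \<open>e p\<close> is monic. By AB4 the sum of the \<open>e p\<close> is
  monic, so the sums of the \<open>f p\<close> and of the \<open>q p\<close> have the same kernel.
  By AB4 again the sum of the \<open>k p\<close> is monic, and being monic it is the kernel of its
  cokernel, the sum of the \<open>q p\<close>.\<close>

lemma dmap_kernel:
  assumes k: "\<And>p. is_kernel A (f p) (k p)"
  shows "is_kernel A (dmap A f) (dmap A k)"
proof -
  note [simp] = is_kernelD[OF k]
  define q where "q p = coker_arr A (k p)" for p
  have q: "is_cokernel A (k p) (q p)" for p unfolding q_def by (rule is_cokernel_coker_arr) simp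
  note [simp] = is_cokernelD(2,3)[OF q]
  have "\<exists>e. e \<in> Hom A (Cod A (q p)) (Cod A (f p)) \<and> e \<cdot> q p = f p" for p
    using is_cokernel_descend[OF q, of "f p" p "Cod A (f p)"] by (auto simp: Hom_iff)
  then obtain e where e: "\<And>p. e p \<in> Hom A (Cod A (q p)) (Cod A (f p))" "\<And>p. e p \<cdot> q p = f p" by metis
  note [simp] = HomD[OF e(1)]
  have em: "monic A (dmap A e)" by (rule dmap_monic) (rule coimage_monic[OF k q e])
  have ker: "is_kernel A (dmap A q) (dmap A k)"
    by (rule monic_is_kernel[OF dmap_monic[OF is_kernel_monic[OF k]] dmap_cokernel[OF q]])
  have f: "f = (\<lambda>p. e p \<cdot> q p)" using e(2) by simp
  have fe: "dmap A e \<cdot> dmap A q = dmap A f" unfolding f by (rule dmap_Comp) simp_all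
  show ?thesis
  proof (rule is_kernelI)
    show "monic A (dmap A k)" by (rule is_kernel_monic[OF ker])
    show "dmap A f \<cdot> dmap A k = Zero A (Dom A (dmap A k)) (Cod A (dmap A f))"
      by (simp add: dmap_Comp dmap_Zero)
    fix W g assume g: "g \<in> Hom A W (Dom A (dmap A f))" "dmap A f \<cdot> g = Zero A W (Cod A (dmap A f))"
    then have [simp]: "g \<in> Arr A" "Dom A g = W" "Cod A g = dsum A (\<lambda>p. Dom A (f p))" "W \<in> Obj A"
      using Hom_Obj[OF g(1)] by (auto simp: Hom_iff)
    have "dmap A e \<cdot> dmap A q \<cdot> g = dmap A e \<cdot> Zero A W (Cod A (dmap A q))"
      using g(2) by (simp add: reassoc[OF fe])
    then have "dmap A q \<cdot> g = Zero A W (Cod A (dmap A q))"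
      by (rule monicD[OF em]) (auto simp: Hom_iff)
    then show "\<exists>h\<in>Hom A W (Dom A (dmap A k)). dmap A k \<cdot> h = g"
      using is_kernel_lift_through[OF ker, of g W]
      by (intro bexI[of _ "lift_through A (dmap A k) g"]) (auto simp: Hom_iff)
  qed simp_all
qed

end

section \<open>Comparison of homology objects\<close>

text \<open>Homology computed with an arbitrary kernel \<open>z\<close> and cokernel
  \<open>q\<close>. Sums of chosen kernels, components of kernels chosen in \<open>gr A\<close>, and
  identities for zero differentials are of this kind, but need not be the chosen ones.\<close>

definition homology_data ::
  "('o, 'm, 'z) add_cat_scheme \<Rightarrow> ('o, 'm) chain_complex \<Rightarrow> int \<Rightarrow> 'm \<Rightarrow> 'm \<Rightarrow> 'm \<Rightarrow> bool" where
  "homology_data A X n z b q \<longleftrightarrow> is_kernel A (cdiff X n) z \<and> b \<in> Hom A (cob X (n + 1)) (Dom A z) \<and>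
     z \<cdot>\<^bsub>A\<^esub> b = cdiff X (n + 1) \<and> is_cokernel A b q"

lemma (in preadditive_category) homology_dataD:
  assumes "homology_data C X n z b q" "is_complex C X"
  shows "is_kernel C (cdiff X n) z" "is_cokernel C b q" "z \<cdot> b = cdiff X (n + 1)"
    "z \<in> Arr C" (is ?A) "Cod C z = cob X n" (is ?B) "b \<in> Arr C" "Dom C b = cob X (n + 1)" "Cod C b = Dom C z"
    "q \<in> Arr C" (is ?C) "Dom C q = Dom C z" (is ?D) "q \<cdot> b = Zero C (cob X (n + 1)) (Cod C q)" (is ?P)
    "cdiff X n \<cdot> z = Zero C (Dom C z) (cob X (n - 1))" (is ?Q)
proof -
  show k: "is_kernel C (cdiff X n) z" and c: "is_cokernel C b q" and "z \<cdot> b = cdiff X (n + 1)"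
    and [simp]: "b \<in> Arr C" "Dom C b = cob X (n + 1)" "Cod C b = Dom C z"
    using assms(1) by (auto simp: homology_data_def Hom_iff)
  show ?A ?B ?C ?D ?P ?Q
    using is_kernelD[OF k] is_cokernelD[OF c] is_complexD[OF assms(2)] by auto
qed

text \<open>Homology is a subquotient: a monic into a zero object has zero source, and an
  epimorphism from a zero object has zero target.\<close>

lemma (in preadditive_category) homology_data_zero:
  assumes d: "homology_data C X n z b q" and X: "is_complex C X" and Z: "zero_object C (cob X n)"
  shows "zero_object C (Cod C q)"
proof -
  note D = homology_dataD[OF d X]
  note [simp] = D(4-11)
  have [simp]: "cob X n \<in> Obj C" using Z by (simp add: zero_object_def)
  have z: "z = Zero C (Dom C z) (cob X n)" using zero_object_Arr(2)[OF Z, of z] by simp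
  have "z \<cdot> Ident C (Dom C z) = z \<cdot> Zero C (Dom C z) (Dom C z)"
    using z by simp
  then have i: "Ident C (Dom C z) = Zero C (Dom C z) (Dom C z)"
    by (rule monicD[OF is_kernel_monic[OF D(1)]]) (auto simp: Hom_iff)
  have "q = q \<cdot> Ident C (Dom C z)" by simp
  also have "\<dots> = Zero C (Dom C z) (Cod C q)" unfolding i by simp
  finally have "Ident C (Cod C q) \<cdot> q = Zero C (Cod C q) (Cod C q) \<cdot> q" by simp
  then have "Ident C (Cod C q) = Zero C (Cod C q) (Cod C q)"
    by (rule epicD[OF is_cokernel_epic[OF D(2)]]) (auto simp: Hom_iff)
  then show ?thesis by (simp add: zero_object_iff)
qed

context abelian_category
begin

lemma homology_data_hproj:
  "is_complex C X \<Longrightarrow> homology_data C X n (cycles C X n) (boundary C X n) (hproj C X n)"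
  by (simp add: homology_data_def is_kernel_cycles is_cokernel_hproj Hom_iff)

text \<open>Uniqueness of kernels and of cokernels. The comparison \<open>a\<close> of cycles is
  delivered together with the isomorphism \<open>c\<close> of homology, because induced maps are
  computed on cycles.\<close>

lemma homology_comparison:
  assumes X: "is_complex C X" and d: "homology_data C X n z b q"
  obtains a c where "a \<in> Hom C (Dom C z) (Dom C (cycles C X n))" "cycles C X n \<cdot> a = z"
    "c \<in> Hom C (Cod C q) (homology C X n)" "iso_arr C c" "c \<cdot> q = hproj C X n \<cdot> a"
proof -
  note D = homology_dataD[OF d X]
  note [simp] = D(4-12) X is_complexD(1-4)[OF X]
  define a where "a = lift_through C (cycles C X n) z"
  have a[simp]: "a \<in> Arr C" "Dom C a = Dom C z" "Cod C a = Dom C (cycles C X n)" and ca: "cycles C X n \<cdot> a = z"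
    unfolding a_def using lift_cycles[OF X, of z n] by simp_all
  define a' where "a' = lift_through C z (cycles C X n)"
  have a'[simp]: "a' \<in> Arr C" "Dom C a' = Dom C (cycles C X n)" "Cod C a' = Dom C z" and za: "z \<cdot> a' = cycles C X n"
    unfolding a'_def using is_kernel_lift_through[OF D(1), of "cycles C X n" "Dom C (cycles C X n)"]
    by (auto simp: Hom_iff)
  have aa: "a \<cdot> a' = Ident C (Dom C (cycles C X n))"
    by (rule cycles_cancel[OF X, where n=n]) (simp_all add: reassoc[OF ca] za)
  have a'a: "a' \<cdot> a = Ident C (Dom C z)"
    by (rule monicD[OF is_kernel_monic[OF D(1)]]) (auto simp: reassoc[OF za] ca Hom_iff)
  have ab: "a \<cdot> b = boundary C X n"
    by (rule cycles_cancel[OF X, where n=n]) (simp_all add: reassoc[OF ca] D(3))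
  have a'b: "a' \<cdot> boundary C X n = b"
    by (simp add: ab[symmetric] reassoc[OF a'a])
  define c where "c = descend_through C q (hproj C X n \<cdot> a)"
  have c[simp]: "c \<in> Arr C" "Dom C c = Cod C q" "Cod C c = homology C X n" and cq: "c \<cdot> q = hproj C X n \<cdot> a"
    unfolding c_def using is_cokernel_descend_through[OF D(2), of "hproj C X n \<cdot> a" "homology C X n"]
    by (auto simp: Hom_iff ab)
  define c' where "c' = descend_through C (hproj C X n) (q \<cdot> a')"
  have c'[simp]: "c' \<in> Arr C" "Dom C c' = homology C X n" "Cod C c' = Cod C q" and c'h: "c' \<cdot> hproj C X n = q \<cdot> a'"
    unfolding c'_def using is_cokernel_descend_through[OF is_cokernel_hproj[OF X, of n], of "q \<cdot> a'" "Cod C q"]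
    by (auto simp: Hom_iff a'b)
  have "c' \<cdot> c = Ident C (Cod C q)"
    by (rule epicD[OF is_cokernel_epic[OF D(2)]]) (auto simp: Hom_iff cq reassoc[OF c'h] a'a)
  moreover have "c \<cdot> c' = Ident C (homology C X n)"
    by (rule epicD[OF hproj_epic[OF X, of n]]) (auto simp: Hom_iff c'h reassoc[OF cq] aa)
  ultimately have "iso_arr C c" by (intro iso_arrI[of c c']) auto
  then show thesis using that[of a c] ca cq by (auto simp: Hom_iff)
qed

lemma homology_data_iso:
  assumes X: "is_complex C X" and d: "homology_data C X n z b q"
  shows "zero_object C (homology C X n) \<longleftrightarrow> zero_object C (Cod C q)"
proof -
  obtain a c where c: "c \<in> Hom C (Cod C q) (homology C X n)" "iso_arr C c"
    using homology_comparison[OF X d] by metis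
  obtain c' where c': "c' \<in> Arr C" "Dom C c' = homology C X n" "Cod C c' = Cod C q" 
    "c' \<cdot> c = Ident C (Cod C q)" "c \<cdot> c' = Ident C (homology C X n)"
    using iso_arrE[OF c(2)] HomD[OF c(1)] by metis
  have "iso_arr C c'" by (rule iso_arrI[of c' c]) (use c' HomD[OF c(1)] in simp_all)
  then show ?thesis using zero_object_iso[OF c(2)] zero_object_iso[of c'] c' HomD[OF c(1)] by auto
qed

text \<open>The comparison isomorphisms turn \<phi> into the map induced on the chosen homology. So
  a quasi-isomorphism may be recognised with whatever kernels and cokernels suit the two
  complexes.\<close>

lemma homology_map_isoI:
  assumes f: "is_chain_map C f"
    and d: "homology_data C (cdom f) n z b q" "homology_data C (ccod f) n z' b' q'"
    and g: "g \<in> Hom C (Dom C z) (Dom C z')" "z' \<cdot> g = carr f n \<cdot> z"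
    and \<phi>: "iso_arr C \<phi>" "\<phi> \<in> Hom C (Cod C q) (Cod C q')" "\<phi> \<cdot> q = q' \<cdot> g"
  shows "iso_arr C (homology_map C f n)"
proof -
  note X = is_chain_mapD(1)[OF f] and Y = is_chain_mapD(2)[OF f]
  note D = homology_dataD[OF d(1) X] and D' = homology_dataD[OF d(2) Y]
  note [simp] = D(4-12) D'(4-12) X Y is_complexD(1-4)[OF X] is_complexD(1-4)[OF Y] is_chain_mapD(3-5)[OF f]
    HomD[OF g(1)] HomD[OF \<phi>(2)] homology_map_Arr[OF f] cycle_map_Arr[OF f]
  obtain a c where ac: "a \<in> Hom C (Dom C z) (Dom C (cycles C (cdom f) n))" "cycles C (cdom f) n \<cdot> a = z"
    "c \<in> Hom C (Cod C q) (homology C (cdom f) n)" "iso_arr C c" "c \<cdot> q = hproj C (cdom f) n \<cdot> a"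
    by (rule homology_comparison[OF X d(1)])
  obtain a' c' where ac': "a' \<in> Hom C (Dom C z') (Dom C (cycles C (ccod f) n))" "cycles C (ccod f) n \<cdot> a' = z'"
    "c' \<in> Hom C (Cod C q') (homology C (ccod f) n)" "iso_arr C c'" "c' \<cdot> q' = hproj C (ccod f) n \<cdot> a'"
    by (rule homology_comparison[OF Y d(2)])
  note [simp] = HomD[OF ac(1)] HomD[OF ac(3)] HomD[OF ac'(1)] HomD[OF ac'(3)]
  have e: "cycle_map C f n \<cdot> a = a' \<cdot> g"
    by (rule cycles_cancel[OF Y, where n=n])
      (simp_all add: reassoc[OF cycles_cycle_map[OF f]] ac(2) reassoc[OF ac'(2)] g(2))
  have "homology_map C f n \<cdot> c = c' \<cdot> \<phi>"
    by (rule epicD[OF is_cokernel_epic[OF D(2)], where W="homology C (ccod f) n"])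
      (auto simp: Hom_iff ac(5) \<phi>(3) reassoc[OF ac'(5)] reassoc[OF homology_map_hproj[OF f]] e)
  then have "iso_arr C (homology_map C f n \<cdot> c)"
    using iso_arr_Comp[OF \<phi>(1) ac'(4)] by simp
  then show ?thesis by (rule iso_arr_cancel_right[OF ac(4)]) simp_all
qed

lemma homology_data_zero_diff:
  assumes [simp]: "\<And>n. X n \<in> Obj C"
  shows "homology_data C (zero_diff_complex C X) n (Ident C (X n)) (Zero C (X (n + 1)) (X n)) (Ident C (X n))"
proof -
  have "monic C (Ident C (X n))" by (auto simp: monic_def Hom_iff)
  then have "is_kernel C (Zero C (X n) (X (n - 1))) (Ident C (X n))"
    by (intro is_kernelI) (auto simp: Hom_iff)
  moreover have "is_cokernel C (Zero C (X (n + 1)) (X n)) (Ident C (X n))"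
    by (intro is_cokernelI Ident_epic) (auto simp: Hom_iff)
  ultimately show ?thesis by (auto simp: homology_data_def Hom_iff)
qed

end

definition sum_complex :: "('o, 'm) sm_cat \<Rightarrow> (int \<Rightarrow> ('o, 'm) chain_complex) \<Rightarrow> ('o, 'm) chain_complex" where
  "sum_complex A X = \<lparr>cob = (\<lambda>n. dsum A (\<lambda>p. cob (X p) n)), cdiff = (\<lambda>n. dmap A (\<lambda>p. cdiff (X p) n))\<rparr>"

lemma sum_complex_sel [simp]:
  "cob (sum_complex A X) n = dsum A (\<lambda>p. cob (X p) n)" "cdiff (sum_complex A X) n = dmap A (\<lambda>p. cdiff (X p) n)"
  by (simp_all add: sum_complex_def)

context exact_tensor_category
begin

lemma is_complex_sum:
  assumes "\<And>p. is_complex A (X p)"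
  shows "is_complex A (sum_complex A X)"
proof -
  note [simp] = is_complexD[OF assms]
  show ?thesis by (simp add: is_complex_def Hom_iff dmap_Comp dmap_Zero)
qed

lemma homology_data_sum:
  assumes X: "\<And>p. is_complex A (X p)" and d: "\<And>p. homology_data A (X p) n (z p) (b p) (q p)"
  shows "homology_data A (sum_complex A X) n (dmap A z) (dmap A b) (dmap A q)"
proof -
  note D = homology_dataD[OF d X]
  note [simp] = D(3-12)
  show ?thesis
    by (simp add: homology_data_def dmap_kernel[OF D(1)] dmap_cokernel[OF D(2)] Hom_iff dmap_Comp)
qed

lemma is_chain_map_sum:
  assumes f: "\<And>p. is_chain_map A (f p)"
  shows "is_chain_map A (cmap (sum_complex A (\<lambda>p. cdom (f p))) (sum_complex A (\<lambda>p. ccod (f p)))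
    (\<lambda>n. dmap A (\<lambda>p. carr (f p) n)))"
proof -
  note [simp] = is_chain_mapD[OF f] is_complexD(1-4)[OF is_chain_mapD(1)[OF f]] is_complexD(1-4)[OF is_chain_mapD(2)[OF f]]
  show ?thesis
    by (rule is_chain_map_cmapI) (auto simp: is_complex_sum Hom_iff dmap_Comp)
qed

text \<open>The summed cycles and quotients are homology data of the summed complexes, and with
  respect to them the induced map is the sum of the given isomorphisms.\<close>

lemma quasi_iso_sum:
  assumes q: "\<And>p. quasi_iso A (f p)"
  shows "quasi_iso A (cmap (sum_complex A (\<lambda>p. cdom (f p))) (sum_complex A (\<lambda>p. ccod (f p)))
    (\<lambda>n. dmap A (\<lambda>p. carr (f p) n)))"
    (is "quasi_iso A ?f")
proof -
  have f: "is_chain_map A (f p)" and i: "iso_arr A (homology_map A (f p) n)" for p n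
    using q by (auto simp: quasi_iso_def)
  note [simp] = is_chain_mapD[OF f] is_complexD(1-4)[OF is_chain_mapD(1)[OF f]] is_complexD(1-4)[OF is_chain_mapD(2)[OF f]]
    cycle_map_Arr[OF f] homology_map_Arr[OF f]
  have c: "is_chain_map A ?f" by (rule is_chain_map_sum[OF f])
  have "iso_arr A (homology_map A ?f n)" for n
  proof (rule homology_map_isoI[OF c])
    show "homology_data A (cdom ?f) n (dmap A (\<lambda>p. cycles A (cdom (f p)) n)) (dmap A (\<lambda>p. boundary A (cdom (f p)) n))
      (dmap A (\<lambda>p. hproj A (cdom (f p)) n))"
      "homology_data A (ccod ?f) n (dmap A (\<lambda>p. cycles A (ccod (f p)) n)) (dmap A (\<lambda>p. boundary A (ccod (f p)) n))
      (dmap A (\<lambda>p. hproj A (ccod (f p)) n))"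
      by (simp_all add: homology_data_sum homology_data_hproj)
    show "iso_arr A (dmap A (\<lambda>p. homology_map A (f p) n))" by (rule dmap_iso[OF i])
    show "dmap A (\<lambda>p. cycle_map A (f p) n) \<in> Hom A (Dom A (dmap A (\<lambda>p. cycles A (cdom (f p)) n))) (Dom A (dmap A (\<lambda>p. cycles A (ccod (f p)) n)))"
      by (simp add: Hom_iff)
  qed (simp_all add: dmap_Comp cycles_cycle_map[OF f] homology_map_hproj[OF f] Hom_iff)
  then show ?thesis using c by (auto simp: quasi_iso_def)
qed

end

section \<open>Homology of complexes of graded objects\<close>

definition gr_component :: "(int \<Rightarrow> 'o, int \<Rightarrow> 'm) chain_complex \<Rightarrow> int \<Rightarrow> ('o, 'm) chain_complex" where
  "gr_component X p = \<lparr>cob = (\<lambda>n. cob X n p), cdiff = (\<lambda>n. cdiff X n p)\<rparr>"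

lemma gr_component_sel [simp]:
  "cob (gr_component X p) n = cob X n p" "cdiff (gr_component X p) n = cdiff X n p"
  by (simp_all add: gr_component_def)

lemma is_complex_component: "is_complex (gr A) X \<Longrightarrow> is_complex A (gr_component X p)"
  by (auto simp: is_complex_def gr_sel gr_Hom_iff fun_eq_iff)

context exact_tensor_category
begin

lemma is_kernel_gr:
  assumes k: "\<And>p. is_kernel A (f p) (k p)"
  shows "is_kernel (gr A) f k"
proof -
  interpret G: preadditive_category "gr A" by (rule preadditive_gr)
  note [simp] = is_kernelD[OF k]
  show ?thesis
  proof (rule G.is_kernelI)
    show "monic (gr A) k"
      unfolding monic_def
    proof (intro conjI ballI impI ext)
      fix W g h p
      assume "g \<in> Hom (gr A) W (Dom (gr A) k)" "h \<in> Hom (gr A) W (Dom (gr A) k)" "k \<cdot>\<^bsub>gr A\<^esub> g = k \<cdot>\<^bsub>gr A\<^esub> h"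
      then show "g p = h p"
        by (intro monicD[OF is_kernel_monic[OF k[of p]], of "g p" "h p" "W p"]) (auto simp: gr_Hom_iff gr_sel fun_eq_iff)
    qed (simp add: gr_sel)
    fix W g assume g: "g \<in> Hom (gr A) W (Dom (gr A) f)" "f \<cdot>\<^bsub>gr A\<^esub> g = Zero (gr A) W (Cod (gr A) f)"
    have "\<exists>h. h \<in> Hom A (W p) (Dom A (k p)) \<and> k p \<cdot> h = g p" for p
      using is_kernel_lift_through[OF k, of "g p" "W p" p] g by (auto simp: gr_Hom_iff gr_sel fun_eq_iff)
    then obtain h where "\<And>p. h p \<in> Hom A (W p) (Dom A (k p))" "\<And>p. k p \<cdot> h p = g p" by metis
    then show "\<exists>h\<in>Hom (gr A) W (Dom (gr A) k). k \<cdot>\<^bsub>gr A\<^esub> h = g"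
      by (intro bexI[of _ h]) (auto simp: gr_Hom_iff gr_sel fun_eq_iff)
  qed (auto simp: gr_sel fun_eq_iff)
qed

text \<open>The universal property in a single degree \<open>p\<close> is tested on graded objects
  that agree with the source of \<open>k\<close> in all other degrees, where \<open>k\<close> itself
  and identity arrows fill the gaps.\<close>

lemma is_kernel_gr_component:
  assumes k: "is_kernel (gr A) f k"
  shows "is_kernel A (f p) (k p)"
proof -
  interpret G: preadditive_category "gr A" by (rule preadditive_gr)
  have D: "f p \<in> Arr A" "k p \<in> Arr A" "Cod A (k p) = Dom A (f p)" "f p \<cdot> k p = Zero A (Dom A (k p)) (Cod A (f p))" for p
    using G.is_kernelD[OF k] by (auto simp: gr_sel fun_eq_iff)
  note [simp] = D
  show ?thesis
  proof (rule is_kernelI)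
    show "monic A (k p)"
      unfolding monic_def
    proof (intro conjI ballI impI)
      fix W g h
      assume g: "g \<in> Hom A W (Dom A (k p))" "h \<in> Hom A W (Dom A (k p))" "k p \<cdot> g = k p \<cdot> h"
      have "(\<lambda>r. Ident A (Dom A (k r)))(p := g) = (\<lambda>r. Ident A (Dom A (k r)))(p := h)"
        by (rule G.monicD[OF G.is_kernel_monic[OF k], where W="(\<lambda>r. Dom A (k r))(p := W)"])
          (use g in \<open>auto simp: gr_Hom_iff gr_sel fun_eq_iff Hom_iff\<close>)
      then show "g = h" by (metis fun_upd_same)
    qed simp
    fix W g assume g: "g \<in> Hom A W (Dom A (f p))" "f p \<cdot> g = Zero A W (Cod A (f p))"
    obtain h where "h \<in> Hom (gr A) ((\<lambda>r. Dom A (k r))(p := W)) (Dom (gr A) k)" "k \<cdot>\<^bsub>gr A\<^esub> h = k(p := g)"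
      by (rule G.is_kernel_lift[OF k, of "k(p := g)" "(\<lambda>r. Dom A (k r))(p := W)"])
        (use g in \<open>auto simp: gr_Hom_iff gr_sel fun_eq_iff Hom_iff\<close>)
    then have "h p \<in> Hom A W (Dom A (k p))" "k p \<cdot> h p = g"
      by (auto simp: gr_Hom_iff gr_sel fun_eq_iff split: if_splits)
    then show "\<exists>h\<in>Hom A W (Dom A (k p)). k p \<cdot> h = g" by blast
  qed simp_all
qed

lemma is_cokernel_gr:
  assumes q: "\<And>p. is_cokernel A (f p) (q p)"
  shows "is_cokernel (gr A) f q"
proof -
  interpret G: preadditive_category "gr A" by (rule preadditive_gr)
  note [simp] = is_cokernelD[OF q]
  show ?thesis
  proof (rule G.is_cokernelI)
    show "epic (gr A) q"
      unfolding epic_def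
    proof (intro conjI ballI impI ext)
      fix W g h p
      assume "g \<in> Hom (gr A) (Cod (gr A) q) W" "h \<in> Hom (gr A) (Cod (gr A) q) W" "g \<cdot>\<^bsub>gr A\<^esub> q = h \<cdot>\<^bsub>gr A\<^esub> q"
      then show "g p = h p"
        by (intro epicD[OF is_cokernel_epic[OF q[of p]], of "g p" "h p" "W p"]) (auto simp: gr_Hom_iff gr_sel fun_eq_iff)
    qed (simp add: gr_sel)
    fix W g assume g: "g \<in> Hom (gr A) (Cod (gr A) f) W" "g \<cdot>\<^bsub>gr A\<^esub> f = Zero (gr A) (Dom (gr A) f) W"
    have "\<exists>h. h \<in> Hom A (Cod A (q p)) (W p) \<and> h \<cdot> q p = g p" for p
      using is_cokernel_descend_through[OF q, of "g p" p "W p"] g by (auto simp: gr_Hom_iff gr_sel fun_eq_iff)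
    then obtain h where "\<And>p. h p \<in> Hom A (Cod A (q p)) (W p)" "\<And>p. h p \<cdot> q p = g p" by metis
    then show "\<exists>h\<in>Hom (gr A) (Cod (gr A) q) W. h \<cdot>\<^bsub>gr A\<^esub> q = g"
      by (intro bexI[of _ h]) (auto simp: gr_Hom_iff gr_sel fun_eq_iff)
  qed (auto simp: gr_sel fun_eq_iff)
qed

lemma is_cokernel_gr_component:
  assumes q: "is_cokernel (gr A) f q"
  shows "is_cokernel A (f p) (q p)"
proof -
  interpret G: preadditive_category "gr A" by (rule preadditive_gr)
  have D: "f p \<in> Arr A" "q p \<in> Arr A" "Dom A (q p) = Cod A (f p)" "q p \<cdot> f p = Zero A (Dom A (f p)) (Cod A (q p))" for p
    using G.is_cokernelD[OF q] by (auto simp: gr_sel fun_eq_iff)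
  note [simp] = D
  show ?thesis
  proof (rule is_cokernelI)
    show "epic A (q p)"
      unfolding epic_def
    proof (intro conjI ballI impI)
      fix W g h
      assume g: "g \<in> Hom A (Cod A (q p)) W" "h \<in> Hom A (Cod A (q p)) W" "g \<cdot> q p = h \<cdot> q p"
      have "(\<lambda>r. Ident A (Cod A (q r)))(p := g) = (\<lambda>r. Ident A (Cod A (q r)))(p := h)"
        by (rule G.epicD[OF G.is_cokernel_epic[OF q], where W="(\<lambda>r. Cod A (q r))(p := W)"])
          (use g in \<open>auto simp: gr_Hom_iff gr_sel fun_eq_iff Hom_iff\<close>)
      then show "g = h" by (metis fun_upd_same)
    qed simp
    fix W g assume g: "g \<in> Hom A (Cod A (f p)) W" "g \<cdot> f p = Zero A (Dom A (f p)) W"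
    obtain h where "h \<in> Hom (gr A) (Cod (gr A) q) ((\<lambda>r. Cod A (q r))(p := W))" "h \<cdot>\<^bsub>gr A\<^esub> q = q(p := g)"
      by (rule G.is_cokernel_descend[OF q, of "q(p := g)" "(\<lambda>r. Cod A (q r))(p := W)"])
        (use g in \<open>auto simp: gr_Hom_iff gr_sel fun_eq_iff Hom_iff\<close>)
    then have "h p \<in> Hom A (Cod A (q p)) W" "h p \<cdot> q p = g"
      by (auto simp: gr_Hom_iff gr_sel fun_eq_iff split: if_splits)
    then show "\<exists>h\<in>Hom A (Cod A (q p)) W. h \<cdot> q p = g" by blast
  qed simp_all
qed

text \<open>Componentwise kernels and cokernels show that some exist in \<open>gr A\<close>, so
  those selected there do have the universal property. Their components need not be the ones
  selected in \<open>A\<close>, but they compute the homology of the component.\<close>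

lemma homology_data_gr:
  assumes X: "is_complex (gr A) X"
  shows "homology_data A (gr_component X p) n (cycles (gr A) X n p) (boundary (gr A) X n p) (hproj (gr A) X n p)"
proof -
  interpret G: preadditive_category "gr A" by (rule preadditive_gr)
  note [simp] = is_complex_grD[OF X]
  have "is_kernel (gr A) (cdiff X n) (\<lambda>p. ker_arr A (cdiff X n p))"
    by (rule is_kernel_gr) (simp add: is_kernel_ker_arr)
  then have z: "is_kernel (gr A) (cdiff X n) (cycles (gr A) X n)"
    unfolding cycles_def ker_arr_def[of "gr A"] by (rule someI[of "is_kernel (gr A) (cdiff X n)"])
  have b: "boundary (gr A) X n \<in> Hom (gr A) (cob X (n + 1)) (Dom (gr A) (cycles (gr A) X n))"
    "cycles (gr A) X n \<cdot>\<^bsub>gr A\<^esub> boundary (gr A) X n = cdiff X (n + 1)"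
    unfolding boundary_def by (rule G.is_kernel_lift_through[OF z]; simp add: gr_Hom_iff gr_sel Hom_iff)+
  have "is_cokernel (gr A) (boundary (gr A) X n) (\<lambda>p. coker_arr A (boundary (gr A) X n p))"
    by (rule is_cokernel_gr) (use b(1) in \<open>simp add: is_cokernel_coker_arr Hom_iff gr_sel\<close>)
  then have q: "is_cokernel (gr A) (boundary (gr A) X n) (hproj (gr A) X n)"
    unfolding hproj_def boundary_def[symmetric] coker_arr_def[of "gr A"]
    by (rule someI[of "is_cokernel (gr A) (boundary (gr A) X n)"])
  show ?thesis
    using is_kernel_gr_component[OF z, of p] is_cokernel_gr_component[OF q, of p] b
    by (auto simp: homology_data_def gr_Hom_iff gr_sel fun_eq_iff)
qed

lemma alpha_pure_iff:
  assumes X: "is_complex (gr A) X"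
  shows "X \<in> alpha_pure A \<alpha> \<longleftrightarrow>
    (\<forall>n p. of_int p \<noteq> \<alpha> * of_int n \<longrightarrow> zero_object A (homology A (gr_component X p) n))"
  unfolding alpha_pure_def homology_def[of "gr A"]
  using homology_data_iso[OF is_complex_component[OF X] homology_data_gr[OF X]] by (simp add: gr_sel)

text \<open>The unit complex is concentrated in degree 0 and weight 0, a point on the line for every
  \<alpha>; elsewhere it is zero.\<close>

lemma Unit_alpha_pure: "Unit (Ch (gr A)) \<in> alpha_pure A \<alpha>"
proof -
  interpret G: tensor_sum_category "gr A" by (rule tensor_sum_category_gr)
  note I = G.is_complex_Unit
  have "zero_object A (gr_unit (gr A) n p)" if "of_int p \<noteq> \<alpha> * of_int n" for n p
  proof (cases "n = 0")
    case True
    then show ?thesis using that zero_object_gr_unit[of p] by (simp add: gr_sel)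
  next
    case False
    then show ?thesis using G.zero_object_gr_unit[of n] by (simp add: zero_object_gr_iff)
  qed
  then show ?thesis
    unfolding alpha_pure_iff[OF I]
    using homology_data_zero[OF homology_data_hproj[OF is_complex_component[OF I]] is_complex_component[OF I]]
    by (simp add: homology_def[of A] Ch_sel(9))
qed

end

section \<open>The truncation\<close>

text \<open>In weight \<open>p\<close> the truncation is zero below degree \<open>p / \<alpha>\<close>, consists of the cycles in the
  degree \<open>n\<close> with \<open>p / \<alpha> \<le> n < p / \<alpha> + 1\<close>, and is everything above. It is
  the kernel of a map that is accordingly an identity, a differential or zero.\<close>

definition trunc_mask :: "('o, 'm) sm_cat \<Rightarrow> rat \<Rightarrow> (int \<Rightarrow> 'o, int \<Rightarrow> 'm) chain_complex \<Rightarrow> int \<times> int \<Rightarrow> 'm" where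
  "trunc_mask A \<alpha> X = (\<lambda>(n, p). if of_int n < of_int p / \<alpha> then Ident A (cob X n p)
     else if of_int n < of_int p / \<alpha> + 1 then cdiff X n p else Zero A (cob X n p) (cob X n p))"

definition trunc_inc :: "('o, 'm) sm_cat \<Rightarrow> rat \<Rightarrow> (int \<Rightarrow> 'o, int \<Rightarrow> 'm) chain_complex \<Rightarrow> int \<times> int \<Rightarrow> 'm" where
  "trunc_inc A \<alpha> X i = ker_arr A (trunc_mask A \<alpha> X i)"

definition trunc_family :: "('o, 'm) sm_cat \<Rightarrow> rat \<Rightarrow>
  ((int \<Rightarrow> 'o, int \<Rightarrow> 'm) chain_complex, (int \<Rightarrow> 'o, int \<Rightarrow> 'm) chain_map, int \<times> int, 'o, 'm) family" where
  "trunc_family A \<alpha> = \<lparr>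
     fob = (\<lambda>X i. Dom A (trunc_inc A \<alpha> X i)),
     farr = (\<lambda>f i. lift_through A (trunc_inc A \<alpha> (ccod f) i)
       (farr (tautological A) f i \<cdot>\<^bsub>A\<^esub> trunc_inc A \<alpha> (cdom f) i)),
     fdiff = (\<lambda>X i. lift_through A (trunc_inc A \<alpha> X (i - (1, 0)))
       (fdiff (tautological A) X i \<cdot>\<^bsub>A\<^esub> trunc_inc A \<alpha> X i)),
     fmul = (\<lambda>X Y i j. lift_through A (trunc_inc A \<alpha> (ch_tensor (gr A) X Y) (i + j))
       (fmul (tautological A) X Y i j \<cdot>\<^bsub>A\<^esub> (trunc_inc A \<alpha> X i \<boxdot>\<^bsub>A\<^esub> trunc_inc A \<alpha> Y j))),
     funit = lift_through A (trunc_inc A \<alpha> (Unit (Ch (gr A))) 0) (funit (tautological A))\<rparr>"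

lemma (in preadditive_category) monic_Zero:
  assumes m: "monic C f" and f: "f = Zero C (Dom C f) (Cod C f)"
  shows "zero_object C (Dom C f)"
proof -
  have [simp]: "f \<in> Arr C" using m by (rule monic_Arr)
  have "f \<cdot> Zero C (Dom C f) (Dom C f) = Zero C (Dom C f) (Cod C f)" by simp
  then have "f \<cdot> Ident C (Dom C f) = f \<cdot> Zero C (Dom C f) (Dom C f)" using f by simp
  then have "Ident C (Dom C f) = Zero C (Dom C f) (Dom C f)"
    by (rule monicD[OF m]) (auto simp: Hom_iff)
  then show ?thesis by (simp add: zero_object_iff)
qed

locale pure_truncation = exact_tensor_category A for A :: "('o, 'm) sm_cat" (structure) +
  fixes \<alpha> :: rat
  assumes \<alpha>: "\<alpha> \<noteq> 0"
begin

abbreviation "\<C> \<equiv> Ch_gr_pure A \<alpha>"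
abbreviation "E \<equiv> tautological A"
abbreviation "T \<equiv> trunc_family A \<alpha>"
abbreviation "\<iota> \<equiv> trunc_inc A \<alpha>"

lemma E_lax: "lax_family \<C> A (1, 0) E (\<lambda>(k, p). k)"
  unfolding Ch_gr_pure_def by (rule lax_family_tautological[OF Unit_alpha_pure])

sublocale E: lax_family \<C> A "(1, 0)" E "\<lambda>(k, p). k"
  by (rule E_lax)

lemma Ch_gr_pure_sel:
  "X \<in> Obj \<C> \<longleftrightarrow> is_complex (gr A) X \<and> X \<in> alpha_pure A \<alpha>"
  "Unit \<C> = Unit (Ch (gr A))" "X \<boxtimes>\<^bsub>\<C>\<^esub> Y = ch_tensor (gr A) X Y"
  by (simp_all add: Ch_gr_pure_def Ch_sel(1,7))

lemma Ch_gr_pure_HomD: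
  assumes "f \<in> Hom \<C> X Y"
  shows "is_chain_map (gr A) f" "cdom f = X" "ccod f = Y"
  using assms unfolding Ch_gr_pure_def by (auto simp: full_subcategory_Hom Ch_Hom_iff)

lemma complexI: "X \<in> Obj \<C> \<Longrightarrow> is_complex (gr A) X"
  by (simp add: Ch_gr_pure_sel)

lemma trunc_mask_Arr:
  assumes "X \<in> Obj \<C>"
  shows "trunc_mask A \<alpha> X (n, p) \<in> Arr A" "Dom A (trunc_mask A \<alpha> X (n, p)) = cob X n p"
  using is_complex_grD[OF complexI[OF assms]] by (auto simp: trunc_mask_def)

lemma trunc_inc_kernel: "X \<in> Obj \<C> \<Longrightarrow> is_kernel A (trunc_mask A \<alpha> X i) (\<iota> X i)"
  unfolding trunc_inc_def by (cases i) (simp add: is_kernel_ker_arr trunc_mask_Arr)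

lemma trunc_inc_monic: "X \<in> Obj \<C> \<Longrightarrow> monic A (\<iota> X i)"
  by (rule is_kernel_monic[OF trunc_inc_kernel])

lemma trunc_inc_Arr [simp]:
  assumes "X \<in> Obj \<C>"
  shows "\<iota> X i \<in> Arr A" "Cod A (\<iota> X i) = fob E X i"
  using is_kernelD[OF trunc_inc_kernel[OF assms, of i]] trunc_mask_Arr[OF assms] by (cases i; simp)+

lemma trunc_inc_low:
  assumes X: "X \<in> Obj \<C>" and "of_int n < of_int p / \<alpha>"
  shows "\<iota> X (n, p) = Zero A (Dom A (\<iota> X (n, p))) (cob X n p)"
proof -
  note [simp] = is_complex_grD(1-4)[OF complexI[OF X]] X
  show ?thesis using is_kernelD(4)[OF trunc_inc_kernel[OF X, of "(n, p)"]] assms by (simp add: trunc_mask_def)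
qed

lemma trunc_inc_cycle:
  assumes X: "X \<in> Obj \<C>" and l: "of_int n < of_int p / \<alpha> + 1"
  shows "cdiff X n p \<cdot> \<iota> X (n, p) = Zero A (Dom A (\<iota> X (n, p))) (cob X (n - 1) p)"
proof -
  note [simp] = is_complex_grD(1-4)[OF complexI[OF X]] X
  show ?thesis
  proof (cases "of_int n < of_int p / \<alpha>")
    case True
    show ?thesis using trunc_inc_low[OF X True] by (metis Comp_Zero(1) is_complex_grD(2-4)[OF complexI[OF X]] Dom_Obj trunc_inc_Arr(1)[OF X])
  next
    case False
    then show ?thesis using is_kernelD(4)[OF trunc_inc_kernel[OF X, of "(n, p)"]] l by (simp add: trunc_mask_def)
  qed
qed

lemma trunc_inc_lift:
  assumes X: "X \<in> Obj \<C>" and g: "g \<in> Arr A" "Cod A g = fob E X (n, p)"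
    and low: "of_int n < of_int p / \<alpha> \<Longrightarrow> g = Zero A (Dom A g) (cob X n p)"
    and cycle: "of_int n < of_int p / \<alpha> + 1 \<Longrightarrow> cdiff X n p \<cdot> g = Zero A (Dom A g) (cob X (n - 1) p)"
  shows "lift_through A (\<iota> X (n, p)) g \<in> Arr A" (is ?A) "Dom A (lift_through A (\<iota> X (n, p)) g) = Dom A g" (is ?B)
    "Cod A (lift_through A (\<iota> X (n, p)) g) = Dom A (\<iota> X (n, p))" (is ?C)
    "\<iota> X (n, p) \<cdot> lift_through A (\<iota> X (n, p)) g = g" (is ?D)
proof -
  note [simp] = is_complex_grD(1-4)[OF complexI[OF X]] X g
  have "trunc_mask A \<alpha> X (n, p) \<cdot> g = Zero A (Dom A g) (Cod A (trunc_mask A \<alpha> X (n, p)))"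
    using low cycle by (auto simp: trunc_mask_def)
  then show ?A ?B ?C ?D
    using is_kernel_lift_through[OF trunc_inc_kernel[OF X, of "(n, p)"], of g "Dom A g"]
    by (auto simp: Hom_iff trunc_mask_Arr)
qed

section \<open>Stability of the truncation under the structure maps\<close>

lemma farr_T:
  assumes f: "f \<in> Hom \<C> X Y"
  shows "farr T f i \<in> Arr A" (is ?A) "Dom A (farr T f i) = Dom A (\<iota> X i)" (is ?B) "Cod A (farr T f i) = Dom A (\<iota> Y i)" (is ?C)
    "\<iota> Y i \<cdot> farr T f i = farr E f i \<cdot> \<iota> X i" (is ?D)
proof -
  note [simp] = E.src_Obj[OF f] HomD[OF E.farr[OF f]]
  obtain n p where i: "i = (n, p)" by (cases i)
  note [simp] = is_complex_grD(1-4)[OF complexI[OF E.src_Obj(1)[OF f]]] is_complex_grD(1-4)[OF complexI[OF E.src_Obj(2)[OF f]]]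
  have nat: "cdiff Y n p \<cdot> farr E f (n, p) = farr E f (n - 1, p) \<cdot> cdiff X n p"
    using E.fdiff_natural[OF f, of "(n, p)"] by simp
  have [simp]: "farr E f (k, q) = carr f k q" for k q by simp
  note [simp] = HomD[OF E.farr[OF f], of "(_, _)", simplified]
  note l = trunc_inc_lift[OF E.src_Obj(2)[OF f], of "farr E f (n, p) \<cdot> \<iota> X (n, p)" n p]
  have 1: "farr E f (n, p) \<cdot> \<iota> X (n, p) = Zero A (Dom A (\<iota> X (n, p))) (cob Y n p)" if "of_int n < of_int p / \<alpha>"
    by (subst trunc_inc_low[OF E.src_Obj(1)[OF f] that]) simp
  have 2: "cdiff Y n p \<cdot> farr E f (n, p) \<cdot> \<iota> X (n, p) = Zero A (Dom A (\<iota> X (n, p))) (cob Y (n - 1) p)"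
    if "of_int n < of_int p / \<alpha> + 1"
    using trunc_inc_cycle[OF E.src_Obj(1)[OF f] that] by (subst reassoc[OF nat]) simp_all
  show ?A ?B ?C ?D
    using l 1 2 by (simp_all add: trunc_family_def Ch_gr_pure_HomD[OF f] i)
qed

lemma fdiff_T:
  assumes X: "X \<in> Obj \<C>"
  shows "fdiff T X i \<in> Arr A" (is ?A) "Dom A (fdiff T X i) = Dom A (\<iota> X i)" (is ?B) "Cod A (fdiff T X i) = Dom A (\<iota> X (i - (1, 0)))" (is ?C)
    "\<iota> X (i - (1, 0)) \<cdot> fdiff T X i = fdiff E X i \<cdot> \<iota> X i" (is ?D)
proof -
  note c = is_complex_grD[OF complexI[OF X]]
  note [simp] = X c(1-4)
  obtain n p where i: "i = (n, p)" by (cases i)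
  \<comment> \<open>If the target degree \<open>n - 1\<close> lies below the cut, then
    \<open>n < p / \<alpha> + 1\<close> and the truncation in degree \<open>n\<close> consists of
    cycles. This is why cycles are taken at the cut: the differential has nowhere to go.\<close>
  have 1: "cdiff X n p \<cdot> \<iota> X (n, p) = Zero A (Dom A (\<iota> X (n, p))) (cob X (n - 1) p)"
    if "of_int (n - 1) < of_int p / \<alpha>"
    by (rule trunc_inc_cycle[OF X]) (use that in simp)
  have 2: "cdiff X (n - 1) p \<cdot> cdiff X n p \<cdot> \<iota> X (n, p) = Zero A (Dom A (\<iota> X (n, p))) (cob X (n - 1 - 1) p)"
    by (subst reassoc[OF c(5)]) simp_all
  show ?A ?B ?C ?D
    using trunc_inc_lift[OF X, of "cdiff X n p \<cdot> \<iota> X (n, p)" "n - 1" p] 1 2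
    by (simp_all add: trunc_family_def i)
qed

lemma fmul_T:
  assumes o: "X \<in> Obj \<C>" "Y \<in> Obj \<C>" "X \<boxtimes>\<^bsub>\<C>\<^esub> Y \<in> Obj \<C>"
  shows "fmul T X Y i j \<in> Arr A" (is ?A) "Dom A (fmul T X Y i j) = Dom A (\<iota> X i) \<boxtimes> Dom A (\<iota> Y j)" (is ?B)
    "Cod A (fmul T X Y i j) = Dom A (\<iota> (X \<boxtimes>\<^bsub>\<C>\<^esub> Y) (i + j))" (is ?C)
    "\<iota> (X \<boxtimes>\<^bsub>\<C>\<^esub> Y) (i + j) \<cdot> fmul T X Y i j = fmul E X Y i j \<cdot> (\<iota> X i \<boxdot> \<iota> Y j)" (is ?D)
proof -
  note [simp] = o is_complex_grD(1-4)[OF complexI[OF o(1)]] is_complex_grD(1-4)[OF complexI[OF o(2)]]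
    is_complex_grD(1-4)[OF complexI[OF o(3)]]
  obtain k p l q where i: "i = (k, p)" and j: "j = (l, q)" by (cases i; cases j)
  let ?m = "fmul E X Y (k, p) (l, q)"
  have m[simp]: "?m \<in> Arr A" "Dom A ?m = cob X k p \<boxtimes> cob Y l q" "Cod A ?m = cob (X \<boxtimes>\<^bsub>\<C>\<^esub> Y) (k + l) (p + q)"
    using E.fmul_Arr[OF o, of "(k, p)" "(l, q)"] by (simp_all del: tautological_sel(4))
  let ?g = "?m \<cdot> (\<iota> X (k, p) \<boxdot> \<iota> Y (l, q))"
  let ?Z = "Zero A (Dom A (\<iota> X (k, p)) \<boxtimes> Dom A (\<iota> Y (l, q)))"
  have low: "?g = ?Z (cob (X \<boxtimes>\<^bsub>\<C>\<^esub> Y) (k + l) (p + q))"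
    if "of_int k < of_int p / \<alpha> \<or> of_int l < of_int q / \<alpha>"
    using that
  proof
    assume "of_int k < of_int p / \<alpha>"
    then show ?thesis by (subst trunc_inc_low[OF o(1)]) (simp_all del: tautological_sel(4))
  next
    assume "of_int l < of_int q / \<alpha>"
    then show ?thesis by (subst trunc_inc_low[OF o(2), of l]) (simp_all del: tautological_sel(4))
  qed
  have cycle: "cdiff (X \<boxtimes>\<^bsub>\<C>\<^esub> Y) (k + l) (p + q) \<cdot> ?g = ?Z (cob (X \<boxtimes>\<^bsub>\<C>\<^esub> Y) (k + l - 1) (p + q))"
    if "of_int k < of_int p / \<alpha> + 1" "of_int l < of_int q / \<alpha> + 1"
  proof -
    have m': "fmul E X Y (k - 1, p) (l, q) \<in> Arr A" 
      "Dom A (fmul E X Y (k - 1, p) (l, q)) = cob X (k - 1) p \<boxtimes> cob Y l q"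
      "Cod A (fmul E X Y (k - 1, p) (l, q)) = cob (X \<boxtimes>\<^bsub>\<C>\<^esub> Y) (k + l - 1) (p + q)"
      "fmul E X Y (k, p) (l - 1, q) \<in> Arr A" 
      "Dom A (fmul E X Y (k, p) (l - 1, q)) = cob X k p \<boxtimes> cob Y (l - 1) q"
      "Cod A (fmul E X Y (k, p) (l - 1, q)) = cob (X \<boxtimes>\<^bsub>\<C>\<^esub> Y) (k + l - 1) (p + q)"
      using E.fmul_Arr[OF o, of "(k - 1, p)" "(l, q)"] E.fmul_Arr[OF o, of "(k, p)" "(l - 1, q)"]
      by (simp_all del: tautological_sel(4) add: diff_add_eq add_diff_eq)
    have L: "cdiff (X \<boxtimes>\<^bsub>\<C>\<^esub> Y) (k + l) (p + q) \<cdot> ?m =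
      fmul E X Y (k - 1, p) (l, q) \<cdot> (cdiff X k p \<boxdot> Ident A (cob Y l q)) \<ddagger>
      signed A k (fmul E X Y (k, p) (l - 1, q) \<cdot> (Ident A (cob X k p) \<boxdot> cdiff Y l q))"
      using E.leibniz[OF o, of "(k, p)" "(l, q)"] by (simp del: tautological_sel(4))
    show ?thesis
      using trunc_inc_cycle[OF o(1) that(1)] trunc_inc_cycle[OF o(2) that(2)]
      by (subst reassoc[OF L]) (simp_all del: tautological_sel(4) add: m')
  qed
  have 1: "?g = Zero A (Dom A ?g) (cob (X \<boxtimes>\<^bsub>\<C>\<^esub> Y) (k + l) (p + q))" if "of_int (k + l) < of_int (p + q) / \<alpha>"
  proof -
    \<comment> \<open>Heights add up: were both factors on or above their cuts, so would be the
      product.\<close>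
    have "of_int k < of_int p / \<alpha> \<or> of_int l < of_int q / \<alpha>"
      using that by (simp add: add_divide_distrib) linarith
    then show ?thesis using low by (simp del: tautological_sel(4))
  qed
  have 2: "cdiff (X \<boxtimes>\<^bsub>\<C>\<^esub> Y) (k + l) (p + q) \<cdot> ?g = Zero A (Dom A ?g) (cob (X \<boxtimes>\<^bsub>\<C>\<^esub> Y) (k + l - 1) (p + q))"
    if "of_int (k + l) < of_int (p + q) / \<alpha> + 1"
  proof -
    \<comment> \<open>If neither factor is below its cut and one of them is at least 1 above it, the
      product is at least 1 above its own cut. So otherwise both factors lie in the range of cycles,
      and the Leibniz rule makes the product a cycle.\<close>
    have "(of_int k < of_int p / \<alpha> \<or> of_int l < of_int q / \<alpha>) \<or>
      (of_int k < of_int p / \<alpha> + 1 \<and> of_int l < of_int q / \<alpha> + 1)"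
      using that by (simp add: add_divide_distrib) linarith
    then show ?thesis
    proof
      assume lt: "of_int k < of_int p / \<alpha> \<or> of_int l < of_int q / \<alpha>"
      show ?thesis unfolding low[OF lt] by (simp del: tautological_sel(4))
    next
      assume "of_int k < of_int p / \<alpha> + 1 \<and> of_int l < of_int q / \<alpha> + 1"
      then show ?thesis using cycle by (simp del: tautological_sel(4))
    qed
  qed
  note l = trunc_inc_lift[OF o(3), of ?g "k + l" "p + q", OF _ _ 1 2]
  show ?A ?B ?C ?D
    using l by (simp_all add: trunc_family_def i j Ch_gr_pure_sel(3)[symmetric] del: tautological_sel(4))
qed

lemma funit_T:
  "funit T \<in> Arr A" "Dom A (funit T) = Unit A" "Cod A (funit T) = Dom A (\<iota> (Unit \<C>) 0)"
  "\<iota> (Unit \<C>) 0 \<cdot> funit T = funit E"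
proof -
  have d: "cdiff (Unit \<C>) 0 0 \<cdot> funit E = Zero A (Unit A) (cob (Unit \<C>) (- 1) 0)"
    using E.fdiff_funit by (simp add: zero_prod_def del: tautological_sel(5))
  have [simp]: "funit E \<in> Arr A" "Dom A (funit E) = Unit A" "Cod A (funit E) = cob (Unit \<C>) 0 0"
    using E.funit_Arr by (simp_all add: zero_prod_def del: tautological_sel(5))
  show "funit T \<in> Arr A" "Dom A (funit T) = Unit A" "Cod A (funit T) = Dom A (\<iota> (Unit \<C>) 0)"
    "\<iota> (Unit \<C>) 0 \<cdot> funit T = funit E"
    using trunc_inc_lift[OF E.src_Unit, of "funit E" 0 0] d
    by (simp_all add: trunc_family_def zero_prod_def Ch_gr_pure_sel(2)[symmetric] del: tautological_sel(5))
qed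

lemma T_data: "family_data \<C> A (1, 0) T"
proof (rule family_data.intro[OF E.guarded_source_axioms tensor_sum_category_axioms], unfold_locales, goal_cases)
  case (1 X i)
  then show ?case by (simp add: trunc_family_def)
next
  case (2 f X Y i)
  show ?case using farr_T[OF 2] by (simp add: Hom_iff) (simp add: trunc_family_def)
next
  case (3 X i)
  show ?case using fdiff_T[OF 3] by (simp add: Hom_iff) (simp add: trunc_family_def)
next
  case (4 X Y i j)
  show ?case using fmul_T[OF 4] by (simp add: Hom_iff) (simp add: trunc_family_def)
next
  case 5
  show ?case using funit_T by (simp add: Hom_iff) (simp add: trunc_family_def)
qed

lemma fob_T [simp]: "fob T X i = Dom A (\<iota> X i)"
  by (simp add: trunc_family_def)

lemma T_trans: "family_chain_trans \<C> A (1, 0) T E \<iota>"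
proof (rule family_chain_trans.intro[OF family_trans.intro[OF T_data E.family_data_axioms]], unfold_locales, goal_cases)
  case (1 X i)
  then show ?case by (simp add: Hom_iff)
qed (fact farr_T fmul_T funit_T fdiff_T)+

lemma T_lax: "lax_family \<C> A (1, 0) T (\<lambda>(k, p). k)"
  by (rule family_chain_trans.lax_subfamily[OF T_trans E_lax trunc_inc_monic])

section \<open>The functor that forgets the degree\<close>

abbreviation "U \<equiv> sum_family A E \<C>"
abbreviation "UT \<equiv> sum_family A T \<C>"

lemma U_lax: "lax_family \<C> A (1 :: int) U (\<lambda>k. k)"
  by (rule lax_family_sum[OF E_lax])

lemma UT_lax: "lax_family \<C> A (1 :: int) UT (\<lambda>k. k)"
  by (rule lax_family_sum[OF T_lax])

lemma forget_sel:
  "FObj (forget_degree A) X = dsum A X" "FArr (forget_degree A) f = dmap A f"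
  "FMult (forget_degree A) X Y = bicopair A X Y (dsum A (gr_tensor A X Y))
     (\<lambda>p q. dinj A (gr_tensor A X Y) (p + q) \<cdot> gr_inj A X Y (p + q) p)"
  "FUnit (forget_degree A) = dinj A (gr_unit A) 0"
  by (simp_all add: forget_degree_def dmap_def bicopair_def)

lemma Ch_forget_sel:
  "FObj (Ch_forget A) X = sum_complex A (gr_component X)"
  "FArr (Ch_forget A) f = cmap (sum_complex A (gr_component (cdom f))) (sum_complex A (gr_component (ccod f)))
     (\<lambda>n. dmap A (carr f n))"
  "FMult (Ch_forget A) X Y = cmap (ch_tensor A (sum_complex A (gr_component X)) (sum_complex A (gr_component Y)))
     (sum_complex A (gr_component (ch_tensor (gr A) X Y)))
     (\<lambda>n. copair A (gr_summand A (\<lambda>n. dsum A (cob X n)) (\<lambda>n. dsum A (cob Y n)) n)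
        (dsum A (gr_tensor (gr A) (cob X) (cob Y) n))
        (\<lambda>k. dmap A (gr_inj (gr A) (cob X) (cob Y) n k) \<cdot>
          bicopair A (cob X k) (cob Y (n - k)) (dsum A (gr_tensor A (cob X k) (cob Y (n - k))))
           (\<lambda>p q. dinj A (gr_tensor A (cob X k) (cob Y (n - k))) (p + q) \<cdot>
             gr_inj A (cob X k) (cob Y (n - k)) (p + q) p)))"
  "FUnit (Ch_forget A) = cmap (Unit (Ch A)) (sum_complex A (gr_component (Unit (Ch (gr A)))))
     (\<lambda>n. if n = 0 then dinj A (gr_unit A) 0 else Zero A (gr_unit A n) (dsum A (gr_unit (gr A) n)))"
  by (simp_all add: Ch_forget_def ch_functor_def Let_def forget_sel sum_complex_def fun_eq_iff)

lemma fob_U: "fob U X = (\<lambda>n. dsum A (cob X n))"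
  by (simp add: sum_family_sel fun_eq_iff)

text \<open>\<open>ch_functor\<close> multiplies by first summing over weights and then including
  the homological degree, while \<open>sum_family\<close> prescribes the whole product on pairs of
  weights. The two are compared on those pairs.\<close>

lemma U_representation: "representation \<C> A U (Ch_forget A)"
proof (rule representation.intro[OF U_lax], unfold_locales, goal_cases)
  case (1 X)
  show ?case by (simp add: Ch_forget_sel sum_family_sel sum_complex_def fun_eq_iff)
next
  case (2 f X Y)
  show ?case by (simp add: Ch_forget_sel sum_family_sel Ch_gr_pure_HomD[OF 2] fun_eq_iff)
next
  case (3 X Y)
  show ?case by (simp add: Ch_forget_sel)
next
  case (4 X Y)
  show ?case by (simp add: Ch_forget_sel Ch_gr_pure_sel)
next
  case (5 X Y n)
  note c = is_complex_grD(1)[OF complexI[OF 5(1)]] is_complex_grD(1)[OF complexI[OF 5(2)]]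
  note [simp] = c gr_gr_inj_Arr[OF c] is_complex_grD(1)[OF complexI[OF 5(3)], unfolded Ch_gr_pure_sel, simplified]
  show ?case by (simp add: Ch_forget_sel fob_U Hom_iff Ch_gr_pure_sel)
next
  case (6 X Y n k)
  note c = is_complex_grD(1)[OF complexI[OF 6(1)]] is_complex_grD(1)[OF complexI[OF 6(2)]]
  note [simp] = c gr_gr_inj_Arr[OF c] is_complex_grD(1)[OF complexI[OF 6(3)], unfolded Ch_gr_pure_sel, simplified]
  have "dmap A (gr_inj (gr A) (cob X) (cob Y) n k) \<cdot>
     bicopair A (cob X k) (cob Y (n - k)) (dsum A (gr_tensor A (cob X k) (cob Y (n - k))))
           (\<lambda>p q. dinj A (gr_tensor A (cob X k) (cob Y (n - k))) (p + q) \<cdot>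
             gr_inj A (cob X k) (cob Y (n - k)) (p + q) p) = fmul U X Y k (n - k)"
    by (rule dsum_tensor_dsum_ext[where F="cob X k" and G="cob Y (n - k)"])
      (simp_all add: sum_family_sel Ch_gr_pure_sel dmap_dinj_reassoc)
  then show ?case by (simp add: Ch_forget_sel fob_U)
next
  case 7
  show ?case by (simp add: Ch_forget_sel Ch_sel)
next
  case 8
  show ?case by (simp add: Ch_forget_sel Ch_gr_pure_sel)
next
  case (9 n)
  have c: "cob (Unit (Ch (gr A))) = gr_unit (gr A)" by (simp add: Ch_sel)
  have "gr_unit (gr A) n p \<in> Obj A" for n p
    using is_complex_grD(1)[OF complexI[OF E.src_Unit]] by (simp add: Ch_gr_pure_sel c)
  moreover have "gr_unit (gr A) 0 = gr_unit A" by (simp add: gr_unit_def[of "gr A"] gr_sel)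
  ultimately show ?case by (simp add: Ch_forget_sel sum_family_sel Hom_iff Ch_gr_pure_sel c)
next
  case 10
  have "cob (Unit (Ch (gr A))) 0 = gr_unit A" by (simp add: Ch_sel gr_unit_def[of "gr A"] gr_sel)
  then show ?case by (simp add: Ch_forget_sel sum_family_sel Ch_gr_pure_sel)
qed

end

lemma family_trans_Comp:
  assumes "family_trans C A \<delta> F G \<eta>" "family_trans C A \<delta> G H \<theta>"
  shows "family_trans C A \<delta> F H (\<lambda>X i. \<theta> X i \<cdot>\<^bsub>A\<^esub> \<eta> X i)"
proof -
  interpret S: family_trans C A \<delta> F G \<eta> by (rule assms(1))
  interpret T: family_trans C A \<delta> G H \<theta> by (rule assms(2))
  show ?thesis
  proof (rule family_trans.intro[OF S.F.family_data_axioms T.G.family_data_axioms], unfold_locales, goal_cases)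
    case (1 X i)
    then show ?case by (simp add: Hom_iff)
  next
    case (2 f X Y i)
    note [simp] = S.F.src_Obj[OF 2] HomD[OF S.F.farr[OF 2]] HomD[OF S.G.farr[OF 2]] HomD[OF T.G.farr[OF 2]]
    show ?case by (simp add: S.nat[OF 2] T.nat_reassoc[OF 2])
  next
    case (3 X Y i j)
    note [simp] = 3
    show ?case by (simp add: S.mon[OF 3] T.mon_reassoc[OF 3])
  next
    case 4
    show ?case by (simp add: S.unital T.unital)
  qed
qed

context pure_truncation
begin

sublocale U: exact_representation \<C> A U "Ch_forget A"
  by (intro exact_representation.intro U_representation exact_tensor_category_axioms)

section \<open>The projection of the truncation to its pure part\<close>

text \<open>On the line \<open>of_int p = \<alpha> * of_int n\<close> the truncation consists of
  cycles, so the inclusion into the sum over weights lifts to the cycles of the summed complex. Off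
  the line the homology is zero, and zero is the right value.\<close>

definition pure_part :: "(int \<Rightarrow> 'o, int \<Rightarrow> 'm) chain_complex \<Rightarrow> int \<Rightarrow> int \<Rightarrow> 'm" where
  "pure_part X n p = (if of_int p = \<alpha> * of_int n
     then lift_through A (U.zyc X n) (dinj A (cob X n) p \<cdot> \<iota> X (n, p))
     else Zero A (Dom A (\<iota> X (n, p))) (Dom A (U.zyc X n)))"

definition pure_proj :: "(int \<Rightarrow> 'o, int \<Rightarrow> 'm) chain_complex \<Rightarrow> int \<Rightarrow> 'm" where
  "pure_proj X n = copair A (\<lambda>p. Dom A (\<iota> X (n, p))) (Dom A (U.zyc X n)) (pure_part X n)"

lemma pure_part:
  assumes X: "X \<in> Obj \<C>"
  shows "pure_part X n p \<in> Arr A" (is ?A) "Dom A (pure_part X n p) = Dom A (\<iota> X (n, p))" (is ?B)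
    "Cod A (pure_part X n p) = Dom A (U.zyc X n)" (is ?C)
    and zyc_pure_part: "U.zyc X n \<cdot> pure_part X n p = (if of_int p = \<alpha> * of_int n
      then dinj A (cob X n) p \<cdot> \<iota> X (n, p)
      else Zero A (Dom A (\<iota> X (n, p))) (dsum A (cob X n)))" (is ?D)
proof -
  note [simp] = X is_complex_grD(1-4)[OF complexI[OF X]]
  have d: "fdiff U X n \<cdot> dinj A (cob X n) p \<cdot> \<iota> X (n, p) =
    Zero A (Dom A (\<iota> X (n, p))) (fob U X (n - 1))" if "of_int p = \<alpha> * of_int n"
  proof -
    have "of_int n < of_int p / \<alpha> + 1" using that \<alpha> by simp
    then show ?thesis
      using trunc_inc_cycle[OF X, of n p] by (simp add: sum_family_sel dmap_dinj_reassoc)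
  qed
  show ?A ?B ?C ?D
    using U.lift_zyc[OF X, of "dinj A (cob X n) p \<cdot> \<iota> X (n, p)" n] d
    by (simp_all add: pure_part_def fob_U)
qed

lemma pure_proj [simp]:
  assumes X: "X \<in> Obj \<C>"
  shows "pure_proj X n \<in> Arr A" "Dom A (pure_proj X n) = dsum A (\<lambda>p. Dom A (\<iota> X (n, p)))"
    "Cod A (pure_proj X n) = Dom A (U.zyc X n)"
    "pure_proj X n \<cdot> dinj A (\<lambda>p. Dom A (\<iota> X (n, p))) p = pure_part X n p"
  unfolding pure_proj_def using X pure_part[OF X] by simp_all

lemma pure_proj_reassoc:
  assumes X: "X \<in> Obj \<C>" and r: "r \<in> Arr A" "Cod A r = Dom A (\<iota> X (n, p))"
  shows "pure_proj X n \<cdot> dinj A (\<lambda>p. Dom A (\<iota> X (n, p))) p \<cdot> r = pure_part X n p \<cdot> r"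
  by (subst reassoc[OF pure_proj(4)[OF X]]) (use X r in simp_all)

lemma zyc_cancel:
  assumes "X \<in> Obj \<C>" "u \<in> Arr A" "v \<in> Arr A" "Dom A u = Dom A v" "Cod A u = Dom A (U.zyc X n)"
    "Cod A v = Dom A (U.zyc X n)" "U.zyc X n \<cdot> u = U.zyc X n \<cdot> v"
  shows "u = v"
  by (rule cycles_cancel[OF U.rep_complex[OF assms(1)] assms(2-7)])

lemma pure_part_natural:
  assumes f: "f \<in> Hom \<C> X Y"
  shows "pure_part Y n p \<cdot> farr T f (n, p) = farr U.Z f n \<cdot> pure_part X n p"
proof -
  note nat = family_trans.nat_reassoc[OF family_chain_trans.axioms(1)[OF U.Z_trans] f]
  note X = E.src_Obj[OF f]
  note [simp] = X is_complex_grD(1-4)[OF complexI[OF X(1)]] is_complex_grD(1-4)[OF complexI[OF X(2)]]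
    pure_part[OF X(1)] pure_part[OF X(2)] farr_T(1-3)[OF f] HomD[OF family_data.farr[OF U.Z_data f]] Ch_gr_pure_HomD[OF f]
    HomD[OF E.farr[OF f], of "(_, _)", simplified] HomD[OF U.farr[OF f], unfolded fob_U]
  have z: "fob U.Z W m = Dom A (U.zyc W m)" for W m by (simp add: cycle_family_def)
  show ?thesis
  proof (rule zyc_cancel[OF X(2), of _ _ n], goal_cases)
    case 6
    have "farr U f n \<cdot> dinj A (cob X n) p \<cdot> \<iota> X (n, p) = dinj A (cob Y n) p \<cdot> farr E f (n, p) \<cdot> \<iota> X (n, p)"
      by (simp add: sum_family_sel dmap_dinj_reassoc)
    then show ?case
      using farr_T(4)[OF f, of "(n, p)"]
      by (simp add: reassoc[OF zyc_pure_part[OF X(2)]] nat z zyc_pure_part[OF X(1)])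
  qed (simp_all add: z)
qed

text \<open>Compared after the monic \<open>U.zyc\<close>. The left side is the product or zero
  according to whether the sum of the two points is on the line, the right side according to whether
  both points are. These differ only for two points off the line with sum on it, and then the
  truncation makes the product vanish.\<close>

lemma pure_part_mult:
  assumes o: "X \<in> Obj \<C>" "Y \<in> Obj \<C>" "X \<boxtimes>\<^bsub>\<C>\<^esub> Y \<in> Obj \<C>"
  shows "pure_part (X \<boxtimes>\<^bsub>\<C>\<^esub> Y) (k + l) (p + q) \<cdot> fmul T X Y (k, p) (l, q) =
    fmul U.Z X Y k l \<cdot> (pure_part X k p \<boxdot> pure_part Y l q)"
proof -
  note [simp] = o is_complex_grD(1-4)[OF complexI[OF o(1)]] is_complex_grD(1-4)[OF complexI[OF o(2)]]
    is_complex_grD(1-4)[OF complexI[OF o(3)]] pure_part[OF o(1)] pure_part[OF o(2)] pure_part[OF o(3)]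
    U.fmul_Z(1-3)[OF o] fmul_T(1,2)[OF o] fmul_T(3)[OF o, of "(_, _)" "(_, _)", simplified]
  let ?m = "fmul E X Y (k, p) (l, q)"
  have m[simp]: "?m \<in> Arr A" "Dom A ?m = cob X k p \<boxtimes> cob Y l q" "Cod A ?m = cob (X \<boxtimes>\<^bsub>\<C>\<^esub> Y) (k + l) (p + q)"
    using E.fmul_Arr[OF o, of "(k, p)" "(l, q)"] by (simp_all del: tautological_sel(4))
  have U[simp]: "fmul U X Y k l \<in> Arr A" "Dom A (fmul U X Y k l) = dsum A (cob X k) \<boxtimes> dsum A (cob Y l)"
    "Cod A (fmul U X Y k l) = dsum A (cob (X \<boxtimes>\<^bsub>\<C>\<^esub> Y) (k + l))"
    using U.fmul_Arr[OF o, of k l] by (simp_all add: fob_U)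
  have m': "fmul E X Y (k, p') (l, q') \<in> Arr A" "Dom A (fmul E X Y (k, p') (l, q')) = cob X k p' \<boxtimes> cob Y l q'"
    "Cod A (fmul E X Y (k, p') (l, q')) = cob (X \<boxtimes>\<^bsub>\<C>\<^esub> Y) (k + l) (p' + q')" for p' q'
    using E.fmul_Arr[OF o, of "(k, p')" "(l, q')"] by (simp_all del: tautological_sel(4))
  have Um: "fmul U X Y k l \<cdot> ((dinj A (cob X k) p \<cdot> \<iota> X (k, p)) \<boxdot> (dinj A (cob Y l) q \<cdot> \<iota> Y (l, q))) =
    dinj A (cob (X \<boxtimes>\<^bsub>\<C>\<^esub> Y) (k + l)) (p + q) \<cdot> ?m \<cdot> (\<iota> X (k, p) \<boxdot> \<iota> Y (l, q))"
    using m' by (simp add: sum_family_sel del: tautological_sel(4))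
  have L: "U.zyc (X \<boxtimes>\<^bsub>\<C>\<^esub> Y) (k + l) \<cdot> pure_part (X \<boxtimes>\<^bsub>\<C>\<^esub> Y) (k + l) (p + q) \<cdot> fmul T X Y (k, p) (l, q) =
    (if of_int (p + q) = \<alpha> * of_int (k + l) then dinj A (cob (X \<boxtimes>\<^bsub>\<C>\<^esub> Y) (k + l)) (p + q) \<cdot> ?m \<cdot> (\<iota> X (k, p) \<boxdot> \<iota> Y (l, q))
     else Zero A (Dom A (\<iota> X (k, p)) \<boxtimes> Dom A (\<iota> Y (l, q))) (dsum A (cob (X \<boxtimes>\<^bsub>\<C>\<^esub> Y) (k + l))))"
    using fmul_T(4)[OF o, of "(k, p)" "(l, q)"]
    by (subst reassoc[OF zyc_pure_part[OF o(3)]]) (simp_all del: tautological_sel(4))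
  have "U.zyc (X \<boxtimes>\<^bsub>\<C>\<^esub> Y) (k + l) \<cdot> fmul U.Z X Y k l \<cdot> (pure_part X k p \<boxdot> pure_part Y l q) =
    fmul U X Y k l \<cdot> ((U.zyc X k \<cdot> pure_part X k p) \<boxdot> (U.zyc Y l \<cdot> pure_part Y l q))"
    by (subst reassoc[OF U.fmul_Z(4)[OF o]]) (simp_all add: fob_U)
  also have "\<dots> = (if of_int p = \<alpha> * of_int k \<and> of_int q = \<alpha> * of_int l
     then dinj A (cob (X \<boxtimes>\<^bsub>\<C>\<^esub> Y) (k + l)) (p + q) \<cdot> ?m \<cdot> (\<iota> X (k, p) \<boxdot> \<iota> Y (l, q))
     else Zero A (Dom A (\<iota> X (k, p)) \<boxtimes> Dom A (\<iota> Y (l, q))) (dsum A (cob (X \<boxtimes>\<^bsub>\<C>\<^esub> Y) (k + l))))"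
    unfolding zyc_pure_part[OF o(1)] zyc_pure_part[OF o(2)] by (auto simp: Um simp del: tautological_sel(4))
  finally have R: "U.zyc (X \<boxtimes>\<^bsub>\<C>\<^esub> Y) (k + l) \<cdot> fmul U.Z X Y k l \<cdot> (pure_part X k p \<boxdot> pure_part Y l q) = \<dots>" .
  have ml: "?m \<cdot> (\<iota> X (k, p) \<boxdot> \<iota> Y (l, q)) =
      Zero A (Dom A (\<iota> X (k, p)) \<boxtimes> Dom A (\<iota> Y (l, q))) (cob (X \<boxtimes>\<^bsub>\<C>\<^esub> Y) (k + l) (p + q))"
    if "of_int k < of_int p / \<alpha> \<or> of_int l < of_int q / \<alpha>"
    using that
  proof
    assume "of_int k < of_int p / \<alpha>"
    then show ?thesis by (subst trunc_inc_low[OF o(1)]) (simp_all del: tautological_sel(4))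
  next
    assume "of_int l < of_int q / \<alpha>"
    then show ?thesis by (subst trunc_inc_low[OF o(2), of l]) (simp_all del: tautological_sel(4))
  qed
  have line: "of_int b = \<alpha> * of_int a \<longleftrightarrow> of_int b / \<alpha> = of_int a" for a b :: int
    using \<alpha> by (auto simp: field_simps)
  consider (pure) "of_int p = \<alpha> * of_int k" "of_int q = \<alpha> * of_int l"
    | (off) "of_int (p + q) \<noteq> \<alpha> * of_int (k + l)" "\<not> (of_int p = \<alpha> * of_int k \<and> of_int q = \<alpha> * of_int l)"
    | (low) "\<not> (of_int p = \<alpha> * of_int k \<and> of_int q = \<alpha> * of_int l)" "of_int k < of_int p / \<alpha> \<or> of_int l < of_int q / \<alpha>"
  proof (cases "of_int p = \<alpha> * of_int k \<and> of_int q = \<alpha> * of_int l")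
    case True
    then show ?thesis using pure by blast
  next
    case False
    show ?thesis
    proof (cases "of_int (p + q) = \<alpha> * of_int (k + l)")
      case True
      \<comment> \<open>The two differences \<open>k - p / \<alpha>\<close> and
        \<open>l - q / \<alpha>\<close> add up to zero without both being zero, so one of them is
        negative: that factor is below its cut.\<close>
      then have "of_int p / \<alpha> + of_int q / \<alpha> = of_int k + of_int l"
        unfolding line by (simp add: add_divide_distrib)
      then have "of_int k < of_int p / \<alpha> \<or> of_int l < of_int q / \<alpha>"
        using False unfolding line by linarith
      then show ?thesis using low False by blast
    qed (use off False in blast)
  qed
  note c = this
  show ?thesis
  proof (rule zyc_cancel[OF o(3), of _ _ "k + l"], goal_cases)
    case 6
    show ?case
      using c
    proof cases
      case pure
      then show ?thesis unfolding L R by (simp add: ring_distribs)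
    next
      case off
      then show ?thesis unfolding L R by auto
    next
      case low
      then show ?thesis unfolding L R ml[OF low(2)] by (auto simp del: tautological_sel(4))
    qed
  qed simp_all
qed

lemma pure_proj_trans: "family_trans \<C> A (1 :: int) UT U.Z pure_proj"
proof (rule family_trans.intro[OF family_data_sum[OF T_data] U.Z_data], unfold_locales, goal_cases)
  case (1 X i)
  then show ?case by (simp add: Hom_iff sum_family_sel cycle_family_def)
next
  case (2 f X Y i)
  interpret Z: family_data \<C> A "1 :: int" U.Z by (rule U.Z_data)
  note X = E.src_Obj[OF 2]
  note [simp] = X pure_part[OF X(1)] pure_part[OF X(2)] farr_T(1-3)[OF 2] HomD[OF Z.farr[OF 2]]
  have z: "fob U.Z W m = Dom A (U.zyc W m)" for W m by (simp add: cycle_family_def)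
  show ?case
    by (rule dsum_ext[where F="\<lambda>p. Dom A (\<iota> X (i, p))"])
      (simp_all add: sum_family_sel dmap_dinj pure_proj_reassoc pure_part_natural[OF 2] z)
next
  case (3 X Y i j)
  note [simp] = 3 pure_part[OF 3(1)] pure_part[OF 3(2)] pure_part[OF 3(3)] U.fmul_Z(1-3)[OF 3]
     fmul_T(1,2)[OF 3] fmul_T(3)[OF 3, of "(_, _)" "(_, _)", simplified]
  show ?case
    by (rule dsum_tensor_dsum_ext[where F="\<lambda>p. Dom A (\<iota> X (i, p))" and G="\<lambda>p. Dom A (\<iota> Y (j, p))"])
      (simp_all add: sum_family_sel pure_proj_reassoc pure_part_mult[OF 3])
next
  case 4
  note u[simp] = E.src_Unit pure_part[OF E.src_Unit] funit_T(1-3)[unfolded zero_prod_def] U.funit_Z(1-3)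
    is_complex_grD(1-4)[OF complexI[OF E.src_Unit]]
  have f: "funit E \<in> Arr A" "Dom A (funit E) = Unit A" "Cod A (funit E) = cob (Unit \<C>) 0 0"
    using E.funit_Arr by (simp_all add: zero_prod_def del: tautological_sel(5))
  show ?case
  proof (rule zyc_cancel[OF E.src_Unit, of _ _ 0], goal_cases)
    case 6
    show ?case
      using funit_T(4) f
      by (simp add: sum_family_sel pure_proj_reassoc reassoc[OF zyc_pure_part[OF E.src_Unit]] U.funit_Z(4) zero_prod_def
        del: tautological_sel(5))
  qed (simp_all add: sum_family_sel zero_prod_def)
qed

section \<open>The quasi-isomorphisms\<close>

definition trunc_component :: "(int \<Rightarrow> 'o, int \<Rightarrow> 'm) chain_complex \<Rightarrow> int \<Rightarrow> ('o, 'm) chain_complex" where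
  "trunc_component X p = \<lparr>cob = (\<lambda>n. Dom A (\<iota> X (n, p))), cdiff = (\<lambda>n. fdiff T X (n, p))\<rparr>"

lemma trunc_component_sel [simp]:
  "cob (trunc_component X p) n = Dom A (\<iota> X (n, p))" "cdiff (trunc_component X p) n = fdiff T X (n, p)"
  by (simp_all add: trunc_component_def)

abbreviation inc :: "(int \<Rightarrow> 'o, int \<Rightarrow> 'm) chain_complex \<Rightarrow> int \<Rightarrow> ('o, 'm) chain_map" where
  "inc X p \<equiv> cmap (trunc_component X p) (gr_component X p) (\<lambda>n. \<iota> X (n, p))"

lemma is_complex_trunc_component:
  assumes X: "X \<in> Obj \<C>"
  shows "is_complex A (trunc_component X p)"
proof -
  interpret TL: lax_family \<C> A "(1, 0)" T "\<lambda>(k, p). k" by (rule T_lax)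
  show ?thesis
    using TL.fdiff_fdiff[OF X, of "(_, p)"] fdiff_T(1-3)[OF X, of "(_, p)"] X by (simp add: is_complex_def Hom_iff)
qed

lemma inc_chain_map:
  assumes X: "X \<in> Obj \<C>"
  shows "is_chain_map A (inc X p)"
  using is_complex_trunc_component[OF X] is_complex_component[OF complexI[OF X]] fdiff_T(4)[OF X, of "(_, p)"] X
  by (intro is_chain_map_cmapI) (simp_all add: Hom_iff)

lemma pure_homology:
  assumes X: "X \<in> Obj \<C>" and "of_int p \<noteq> \<alpha> * of_int n"
  shows "zero_object A (homology A (gr_component X p) n)"
  using X assms(2) alpha_pure_iff[OF complexI[OF X], of \<alpha>] by (simp add: Ch_gr_pure_sel)

text \<open>From degree \<open>p / \<alpha>\<close> on, the cycles of \<open>X\<close> lie in the truncation, and the boundaries come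
  from degrees where the truncation is everything.\<close>

lemma inc_quasi_iso:
  assumes X: "X \<in> Obj \<C>"
  shows "quasi_iso A (inc X p)"
proof -
  let ?X = "gr_component X p" and ?T = "trunc_component X p"
  note XC = is_complex_component[OF complexI[OF X], of p] and TC = is_complex_trunc_component[OF X, of p]
  note f = inc_chain_map[OF X, of p]
  note [simp] = X XC TC is_complex_grD(1-4)[OF complexI[OF X]] fdiff_T(1,2)[OF X] fdiff_T(3)[OF X, of "(_, _)", simplified]
  have "iso_arr A (homology_map A (inc X p) n)" for n
  proof (cases "of_int n < of_int p / \<alpha>")
    case True
    \<comment> \<open>Strictly below the cut both sides are zero: the homology of \<open>X\<close>
      by purity, that of the truncation because its object is already zero.\<close>
    then have "of_int p \<noteq> \<alpha> * of_int n" using \<alpha> by auto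
    then have 1: "zero_object A (homology A ?X n)" by (rule pure_homology[OF X])
    have "zero_object A (Dom A (\<iota> X (n, p)))"
      by (rule monic_Zero[OF trunc_inc_monic[OF X]], unfold trunc_inc_Arr(2)[OF X] tautological_sel)
        (rule trunc_inc_low[OF X True])
    then have 2: "zero_object A (homology A ?T n)"
      using homology_data_zero[OF homology_data_hproj[OF TC, of n] TC] by simp
    show ?thesis by (rule iso_arr_zero) (use homology_map_Arr[OF f, of n] 1 2 in simp_all)
  next
    case False
    have c: "cdiff X n p \<cdot> cycles A ?X n = Zero A (Dom A (cycles A ?X n)) (cob X (n - 1) p)"
      using cycles_Arr(3)[OF XC, of n] by simp
    define z where "z = lift_through A (\<iota> X (n, p)) (cycles A ?X n)"
    have z[simp]: "z \<in> Arr A" "Dom A z = Dom A (cycles A ?X n)" "Cod A z = Dom A (\<iota> X (n, p))"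
      and iz: "\<iota> X (n, p) \<cdot> z = cycles A ?X n"
      unfolding z_def using trunc_inc_lift[OF X, of "cycles A ?X n" n p] False c by simp_all
    have cancel: "u = v" if "\<iota> X (k, p) \<cdot> u = \<iota> X (k, p) \<cdot> v" "u \<in> Arr A" "v \<in> Arr A"
      "Dom A u = Dom A v" "Cod A u = Dom A (\<iota> X (k, p))" "Cod A v = Dom A (\<iota> X (k, p))" for u v k
      by (rule monicD[OF trunc_inc_monic[OF X] that(1)]) (use that in \<open>auto simp: Hom_iff\<close>)
    have it: "\<iota> X (k - 1, p) \<cdot> fdiff T X (k, p) = cdiff X k p \<cdot> \<iota> X (k, p)" for k
      using fdiff_T(4)[OF X, of "(k, p)"] by simp
    have it': "\<iota> X (n, p) \<cdot> fdiff T X (n + 1, p) = cdiff X (n + 1) p \<cdot> \<iota> X (n + 1, p)"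
      using it[of "n + 1"] by simp
    have kz: "is_kernel A (fdiff T X (n, p)) z"
    proof (rule is_kernelI)
      have "monic A z"
        unfolding monic_def
      proof (intro conjI ballI impI)
        fix W g h assume g: "g \<in> Hom A W (Dom A z)" "h \<in> Hom A W (Dom A z)" "z \<cdot> g = z \<cdot> h"
        have "cycles A ?X n \<cdot> g = cycles A ?X n \<cdot> h"
          unfolding iz[symmetric] using g by (simp add: Hom_iff)
        then show "g = h" by (rule monicD[OF cycles_monic[OF XC]]) (use g in auto)
      qed simp
      then show "monic A z" .
      show "fdiff T X (n, p) \<cdot> z = Zero A (Dom A z) (Cod A (fdiff T X (n, p)))"
        by (rule cancel[of "n - 1"]) (simp_all add: reassoc[OF it] iz c)
      fix W g assume g: "g \<in> Hom A W (Dom A (fdiff T X (n, p)))"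
        "fdiff T X (n, p) \<cdot> g = Zero A W (Cod A (fdiff T X (n, p)))"
      then have [simp]: "g \<in> Arr A" "Dom A g = W" "Cod A g = Dom A (\<iota> X (n, p))" "W \<in> Obj A"
        using Hom_Obj[OF g(1)] by (auto simp: Hom_iff)
      have "cdiff X n p \<cdot> \<iota> X (n, p) \<cdot> g = \<iota> X (n - 1, p) \<cdot> fdiff T X (n, p) \<cdot> g"
        by (simp add: reassoc[OF it])
      also have "\<dots> = Zero A W (cob X (n - 1) p)" unfolding g(2) by simp
      finally obtain h where h: "h \<in> Hom A W (Dom A (cycles A ?X n))" "cycles A ?X n \<cdot> h = \<iota> X (n, p) \<cdot> g"
        using is_kernel_lift[OF is_kernel_cycles[OF XC, of n], of "\<iota> X (n, p) \<cdot> g" W] by (auto simp: Hom_iff)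
      have "z \<cdot> h = g"
        by (rule cancel[of n]) (use h in \<open>auto simp: reassoc[OF iz] Hom_iff\<close>)
      then show "\<exists>h\<in>Hom A W (Dom A z). z \<cdot> h = g" using h by auto
    qed simp_all
    let ?b = "boundary A ?X n \<cdot> \<iota> X (n + 1, p)"
    have b[simp]: "Dom A (boundary A ?X n) = cob X (n + 1) p" using boundary_Arr(2)[OF XC, of n] by simp
    have cb: "cycles A ?X n \<cdot> boundary A ?X n = cdiff X (n + 1) p" using boundary_Arr(4)[OF XC, of n] by simp
    have hb: "hproj A ?X n \<cdot> boundary A ?X n = Zero A (cob X (n + 1) p) (homology A ?X n)"
      using hproj_Arr(4)[OF XC, of n] by simp
    have zb: "z \<cdot> ?b = fdiff T X (n + 1, p)"
      by (rule cancel[of n]) (simp_all add: reassoc[OF iz] it' reassoc[OF cb])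
    \<comment> \<open>In degree \<open>n + 1\<close> the mask is a zero arrow, so the identity
      factors through its kernel. The section \<open>s\<close> turns vanishing on \<open>?b\<close>
      into vanishing on all boundaries of \<open>X\<close>.\<close>
    define s where "s = lift_through A (\<iota> X (n + 1, p)) (Ident A (cob X (n + 1) p))"
    have s[simp]: "s \<in> Arr A" "Dom A s = cob X (n + 1) p" "Cod A s = Dom A (\<iota> X (n + 1, p))"
      and inc_s: "\<iota> X (n + 1, p) \<cdot> s = Ident A (cob X (n + 1) p)"
      unfolding s_def using trunc_inc_lift[OF X, of "Ident A (cob X (n + 1) p)" "n + 1" p] False by simp_all
    have kb: "is_cokernel A ?b (hproj A ?X n)"
    proof (rule is_cokernelI)
      show "epic A (hproj A ?X n)" by (rule hproj_epic[OF XC])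
      show "hproj A ?X n \<cdot> ?b = Zero A (Dom A ?b) (Cod A (hproj A ?X n))"
        by (simp add: reassoc[OF hb])
      fix W g assume g: "g \<in> Hom A (Cod A ?b) W" "g \<cdot> ?b = Zero A (Dom A ?b) W"
      then have [simp]: "g \<in> Arr A" "Dom A g = Dom A (cycles A ?X n)" "Cod A g = W" "W \<in> Obj A"
        using Hom_Obj[OF g(1)] by (auto simp: Hom_iff)
      have "(g \<cdot> ?b) \<cdot> s = g \<cdot> boundary A ?X n"
        by (simp add: inc_s)
      then have "g \<cdot> boundary A ?X n = Zero A (cob X (n + 1) p) W"
        unfolding g(2) by simp
      then show "\<exists>h\<in>Hom A (Cod A (hproj A ?X n)) W. h \<cdot> hproj A ?X n = g"
        using is_cokernel_descend_through[OF is_cokernel_hproj[OF XC, of n], of g W]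
        by (intro bexI[of _ "descend_through A (hproj A ?X n) g"]) (auto simp: Hom_iff)
    qed simp_all
    \<comment> \<open>With \<open>z\<close> as cycles of the truncation, both complexes have the
      same cycle object and the same quotient, and the inclusion induces identities on them.\<close>
    show ?thesis
    proof (rule homology_map_isoI[OF f])
      show "homology_data A (cdom (inc X p)) n z ?b (hproj A ?X n)"
        using kz kb zb by (simp add: homology_data_def Hom_iff)
      show "homology_data A (ccod (inc X p)) n (cycles A ?X n) (boundary A ?X n) (hproj A ?X n)"
        by (simp add: homology_data_hproj)
      show "Ident A (Dom A z) \<in> Hom A (Dom A z) (Dom A (cycles A ?X n))"
        "cycles A ?X n \<cdot> Ident A (Dom A z) = carr (inc X p) n \<cdot> z"
        by (simp_all add: Hom_iff iz)
      show "iso_arr A (Ident A (homology A ?X n))"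
        by (rule iso_arrI[of _ "Ident A (homology A ?X n)"]) simp_all
    qed (simp_all add: Hom_iff)
  qed
  then show ?thesis using f by (simp add: quasi_iso_def)
qed

section \<open>The two arms of the zigzag\<close>

abbreviation "\<F> \<equiv> family_functor \<C> A UT"
abbreviation "\<H> \<equiv> lax_comp (Ch A) (H_functor A) (Ch_forget A)"

lemma F_obj: "FObj \<F> X = sum_complex A (trunc_component X)"
  by (simp add: family_functor_def Let_def sum_family_sel sum_complex_def fun_eq_iff)

lemma forget_quasi_iso:
  assumes X: "X \<in> Obj \<C>"
  shows "quasi_iso A (cmap (FObj \<F> X) (FObj (Ch_forget A) X) (\<lambda>n. dmap A (\<lambda>p. \<iota> X (n, p))))"
  using quasi_iso_sum[of "inc X", OF inc_quasi_iso[OF X]] by (simp add: F_obj Ch_forget_sel)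

lemma forget_monoidal_quasi_iso: "monoidal_quasi_iso \<C> A \<F> (Ch_forget A)"
  unfolding monoidal_quasi_iso_def
proof (intro exI conjI ballI)
  show "monoidal_transformation \<C> (Ch A) \<F> (Ch_forget A)
    (\<lambda>X. cmap (FObj \<F> X) (FObj (Ch_forget A) X) (\<lambda>n. dmap A (\<lambda>p. \<iota> X (n, p))))"
    using forget_quasi_iso
    by (intro rep_monoidal_transformation[OF representation_family_functor[OF UT_lax] U_representation
      family_trans_sum[OF family_chain_trans.axioms(1)[OF T_trans]]]) (simp add: quasi_iso_def)
qed (rule forget_quasi_iso)

abbreviation homology_proj :: "(int \<Rightarrow> 'o, int \<Rightarrow> 'm) chain_complex \<Rightarrow> ('o, 'm) chain_map" where
  "homology_proj X \<equiv> cmap (FObj \<F> X) (FObj \<H> X) (\<lambda>n. hproj A (FObj (Ch_forget A) X) n \<cdot> pure_proj X n)"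

lemma H_obj: "FObj \<H> X = zero_diff_complex A (homology A (FObj (Ch_forget A) X))"
  by (simp add: lax_comp_def H_functor_def Let_def)

text \<open>The target has zero differential, so differentials of the truncation must go to the
  class zero. On the line such an element becomes a boundary of the summed complex; off the line the
  projection is zero anyway. On the level of cycles it would not vanish.\<close>

lemma homology_proj_chain_map:
  assumes X: "X \<in> Obj \<C>"
  shows "is_chain_map A (homology_proj X)"
proof -
  let ?U = "FObj (Ch_forget A) X"
  note UC = U.rep_complex[OF X]
  note [simp] = X UC is_complex_grD(1-4)[OF complexI[OF X]] pure_part[OF X] fdiff_T(1,2)[OF X] fdiff_T(3)[OF X, of "(_, _)", simplified]
  have z: "hproj A ?U (n - 1) \<cdot> pure_part X (n - 1) p \<cdot> fdiff T X (n, p) =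
    Zero A (Dom A (\<iota> X (n, p))) (homology A ?U (n - 1))" for n p
  proof (cases "of_int p = \<alpha> * of_int (n - 1)")
    case True
    have "U.zyc X (n - 1) \<cdot> pure_part X (n - 1) p \<cdot> fdiff T X (n, p) =
      dinj A (cob X (n - 1)) p \<cdot> \<iota> X (n - 1, p) \<cdot> fdiff T X (n, p)"
      using True by (subst reassoc[OF zyc_pure_part[OF X]]) simp_all
    also have "\<dots> = dinj A (cob X (n - 1)) p \<cdot> cdiff X n p \<cdot> \<iota> X (n, p)"
      using fdiff_T(4)[OF X, of "(n, p)"] by simp
    also have "\<dots> = cdiff ?U n \<cdot> dinj A (cob X n) p \<cdot> \<iota> X (n, p)"
      by (simp add: sum_family_sel dmap_dinj_reassoc)
    finally show ?thesis
      using hproj_lift_boundary[OF UC, of "dinj A (cob X n) p \<cdot> \<iota> X (n, p)" n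
        "pure_part X (n - 1) p \<cdot> fdiff T X (n, p)" "n - 1"] by (simp add: fob_U)
  next
    case False
    then show ?thesis by (simp add: pure_part_def)
  qed
  have "(hproj A ?U (n - 1) \<cdot> pure_proj X (n - 1)) \<cdot> dmap A (\<lambda>p. fdiff T X (n, p)) =
    Zero A (dsum A (\<lambda>p. Dom A (\<iota> X (n, p)))) (homology A ?U (n - 1))" for n
    by (rule dsum_ext[where F="\<lambda>p. Dom A (\<iota> X (n, p))"]) (simp_all add: dmap_dinj pure_proj_reassoc z)
  then show ?thesis
    by (intro is_chain_map_cmapI)
      (simp_all add: F_obj H_obj is_complex_sum is_complex_trunc_component is_complex_zero_diff Hom_iff)
qed

text \<open>Its effect on homology is the sum over \<open>p\<close> of the isomorphisms induced by
  \<open>inc X p\<close>, followed by the comparison of the sum of the homologies with the homology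
  of the sum. The projection discards the weights off the line, but there purity leaves nothing to
  lose.\<close>

lemma homology_proj_quasi_iso:
  assumes X: "X \<in> Obj \<C>"
  shows "quasi_iso A (homology_proj X)"
proof -
  let ?U = "FObj (Ch_forget A) X"
  note UC = U.rep_complex[OF X] and XC = is_complex_component[OF complexI[OF X]] and TC = is_complex_trunc_component[OF X]
  note f = inc_chain_map[OF X]
  note [simp] = X UC XC TC is_complex_grD(1-4)[OF complexI[OF X]] pure_part[OF X]
    cycle_map_Arr[OF f, simplified] homology_map_Arr[OF f, simplified]
  have "iso_arr A (homology_map A (homology_proj X) n)" for n
  proof -
    let ?cX = "\<lambda>p. cycles A (gr_component X p) n" and ?cT = "\<lambda>p. cycles A (trunc_component X p) n"
    let ?hX = "\<lambda>p. hproj A (gr_component X p) n" and ?hT = "\<lambda>p. hproj A (trunc_component X p) n"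
    have [simp]: "Cod A (?cX p) = cob X n p" "Cod A (?cT p) = Dom A (\<iota> X (n, p))" for p
      using cycles_Arr(2)[OF XC] cycles_Arr(2)[OF TC] by simp_all
    have d: "homology_data A ?U n (dmap A ?cX) (dmap A (\<lambda>p. boundary A (gr_component X p) n)) (dmap A ?hX)"
      unfolding Ch_forget_sel by (rule homology_data_sum[OF XC homology_data_hproj[OF XC]])
    obtain a c where ac: "a \<in> Hom A (Dom A (dmap A ?cX)) (Dom A (cycles A ?U n))" "cycles A ?U n \<cdot> a = dmap A ?cX"
      "c \<in> Hom A (Cod A (dmap A ?hX)) (homology A ?U n)" "iso_arr A c" "c \<cdot> dmap A ?hX = hproj A ?U n \<cdot> a"
      by (rule homology_comparison[OF UC d])
    note [simp] = HomD[OF ac(1), simplified] HomD[OF ac(3), simplified]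
    let ?\<phi> = "\<lambda>p. homology_map A (inc X p) n" and ?g = "\<lambda>p. cycle_map A (inc X p) n"
    have i: "iso_arr A (?\<phi> p)" for p using inc_quasi_iso[OF X, of p] by (simp add: quasi_iso_def)
    have ch: "c \<cdot> dinj A (\<lambda>p. homology A (gr_component X p) n) p \<cdot> ?hX p =
      hproj A ?U n \<cdot> a \<cdot> dinj A (\<lambda>p. Dom A (?cX p)) p" for p
      using reassoc[OF ac(5), of "dinj A (\<lambda>p. Dom A (?cX p)) p"] by (simp add: dmap_dinj)
    \<comment> \<open>The identification weight by weight. On the line it is checked on underlying
      cycles, where both sides are the inclusion of the cycles of the truncation; off the line the
      map on homology has zero target.\<close>
    have e: "c \<cdot> dinj A (\<lambda>p. homology A (gr_component X p) n) p \<cdot> ?\<phi> p \<cdot> ?hT p =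
      hproj A ?U n \<cdot> pure_part X n p \<cdot> ?cT p" for p
    proof (cases "of_int p = \<alpha> * of_int n")
      case True
      have "U.zyc X n \<cdot> pure_part X n p \<cdot> ?cT p = dinj A (cob X n) p \<cdot> \<iota> X (n, p) \<cdot> ?cT p"
        using True by (subst reassoc[OF zyc_pure_part[OF X]]) simp_all
      also have "\<dots> = dinj A (cob X n) p \<cdot> ?cX p \<cdot> ?g p"
        using cycles_cycle_map[OF f, of p n] by simp
      also have "\<dots> = U.zyc X n \<cdot> a \<cdot> dinj A (\<lambda>p. Dom A (?cX p)) p \<cdot> ?g p"
        by (subst reassoc[OF ac(2)]) (simp_all add: dmap_dinj_reassoc)
      finally have "pure_part X n p \<cdot> ?cT p = a \<cdot> dinj A (\<lambda>p. Dom A (?cX p)) p \<cdot> ?g p"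
        by - (rule zyc_cancel[OF X, of _ _ n], simp_all)
      moreover have "c \<cdot> dinj A (\<lambda>p. homology A (gr_component X p) n) p \<cdot> ?\<phi> p \<cdot> ?hT p =
        (c \<cdot> dinj A (\<lambda>p. homology A (gr_component X p) n) p \<cdot> ?hX p) \<cdot> ?g p"
        using homology_map_hproj[OF f, of p n] by simp
      ultimately show ?thesis unfolding ch by simp
    next
      case False
      have "?\<phi> p = Zero A (homology A (trunc_component X p) n) (homology A (gr_component X p) n)"
        using zero_object_Arr(2)[OF pure_homology[OF X False], of "?\<phi> p"] by simp
      then show ?thesis using False by (simp add: pure_part_def)
    qed
    show ?thesis
    proof (rule homology_map_isoI[OF homology_proj_chain_map[OF X]])
      show "homology_data A (cdom (homology_proj X)) n (dmap A ?cT) (dmap A (\<lambda>p. boundary A (trunc_component X p) n)) (dmap A ?hT)"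
        unfolding F_obj cmap_sel by (rule homology_data_sum[OF TC homology_data_hproj[OF TC]])
      show "homology_data A (ccod (homology_proj X)) n (Ident A (homology A ?U n))
        (Zero A (homology A ?U (n + 1)) (homology A ?U n)) (Ident A (homology A ?U n))"
        unfolding H_obj cmap_sel by (rule homology_data_zero_diff) simp
      \<comment> \<open>For a zero differential the cycles and the homology are the object itself,
        so the same arrow serves as the map on cycles and as its class.\<close>
      let ?G = "hproj A ?U n \<cdot> pure_proj X n \<cdot> dmap A ?cT"
      show "?G \<in> Hom A (Dom A (dmap A ?cT)) (Dom A (Ident A (homology A ?U n)))" by (simp add: Hom_iff)
      show "Ident A (homology A ?U n) \<cdot> ?G = carr (homology_proj X) n \<cdot> dmap A ?cT" by simp
      show "iso_arr A (c \<cdot> dmap A ?\<phi>)" by (rule iso_arr_Comp[OF dmap_iso[OF i] ac(4)]) simp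
      show "c \<cdot> dmap A ?\<phi> \<in> Hom A (Cod A (dmap A ?hT)) (Cod A (Ident A (homology A ?U n)))" by (simp add: Hom_iff)
      show "(c \<cdot> dmap A ?\<phi>) \<cdot> dmap A ?hT = Ident A (homology A ?U n) \<cdot> ?G"
        by (rule dsum_ext[where F="\<lambda>p. Dom A (?cT p)"])
          (simp_all add: dmap_dinj dmap_dinj_reassoc pure_proj_reassoc e)
    qed
  qed
  then show ?thesis using homology_proj_chain_map[OF X] by (simp add: quasi_iso_def)
qed

lemma homology_monoidal_quasi_iso: "monoidal_quasi_iso \<C> A \<F> \<H>"
  unfolding monoidal_quasi_iso_def
proof (intro exI conjI ballI)
  interpret H: family_chain_trans \<C> A 1 U.Z U.H "\<lambda>X. hproj A (FObj (Ch_forget A) X)" by (rule U.H_trans)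
  show "monoidal_transformation \<C> (Ch A) \<F> \<H> homology_proj"
    by (rule rep_monoidal_transformation[OF representation_family_functor[OF UT_lax] U.H_representation
      family_trans_Comp[OF pure_proj_trans H.family_trans_axioms] homology_proj_chain_map])
qed (rule homology_proj_quasi_iso)

lemma formal_forget: "formal_lax_symmetric_monoidal_functor \<C> A (Ch_forget A)"
  unfolding formal_lax_symmetric_monoidal_functor_def
proof (intro conjI)
  show "lax_symmetric_monoidal_functor \<C> (Ch A) (Ch_forget A)" by (rule U.rep_lax)
  show "lax_symmetric_monoidal_functor \<C> (Ch A) \<H>"
    by (rule representation.rep_lax[OF U.H_representation])
  show "equivclp (monoidal_quasi_iso \<C> A) (Ch_forget A) \<H>"
    by (rule equivclp_trans[OF equivclp_sym[OF r_into_equivclp] r_into_equivclp])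
      (rule forget_monoidal_quasi_iso homology_monoidal_quasi_iso)+
qed

end

theorem proposition2p7:
  fixes A :: "('o, 'm) sm_cat" and \<alpha> :: rat
  assumes "abelian_symmetric_monoidal_category A"
    and "infinite (UNIV :: 'i set)"
    and "has_direct_sums TYPE('i) A"
    and "exact_direct_sums TYPE('i) A"
    and "tensor_preserves_direct_sums TYPE('i) A"
    and "\<alpha> \<noteq> 0"
  shows "formal_lax_symmetric_monoidal_functor (Ch_gr_pure A \<alpha>) A (Ch_forget A)"
proof -
  interpret pure_truncation A \<alpha>
    by (intro pure_truncation.intro pure_truncation_axioms.intro exact_tensor_categoryI[OF assms(1-5)] assms(6))
  show ?thesis by (rule formal_forget)
qed

end
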